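(* Let $K$ be a field, $A=KQ/I$ a finite-dimensional $K$-algebra given by a finite quiver $Q$ and an admissible ideal $I$, and let $k$ be a vertex of $Q$ without loops. Let $T^-_k$, $T^+_k$ be the complexes defined in the context. Below, "non-zero" means non-zero as an element of $A$. (a) $T^-_k$ is a tilting complex if and only if for every vertex $i\neq k$ and every non-zero linear combination $\sum_r a_r p_r$ of paths starting at $k$ and ending at $i$, there exists at least one arrow $\alpha$ ending at $k$ such that $\sum_r a_r\,\alpha p_r$ is non-zero. (b) $T^-_k$ is isomorphic in $\mathcal{D}^b(A)$ to a tilting module if and only if for every vertex $i$ (including $i=k$) and every non-zero linear combination $\sum_r a_r p_r$ of paths starting at $k$ and ending at $i$, there exists at least one arrow $\alpha$ ending at $k$ such that $\sum_r a_r\,\alpha p_r$ is non-zero. (c) $T^+_k$ is a tilting complex if and only if for every vertex $i\neq k$ and every non-zero linear combination $\sum_r a_r p_r$ of paths starting at $i$ and ending at $k$, there exists at least one arrow $\beta$ starting at $k$ such that $\sum_r a_r\, p_r\beta$ is non-zero.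
   Context: For an arrow $\alpha$ of $Q$, $s(\alpha)$ and $t(\alpha)$ denote its start and end vertices; paths compose left to right, i.e. $\alpha\beta$ is defined if $t(\alpha)=s(\beta)$. Paths include the trivial path at each vertex. Modules are finite-dimensional right $A$-modules, and $\mathcal{D}^b(A)$ is the bounded derived category of $\operatorname{mod} A$. For a vertex $i$, $P_i$ is the projective cover of the simple module at $i$, spanned by the (non-zero) paths starting at $i$. An arrow $\alpha$ induces a map $P_{t(\alpha)}\xrightarrow{\alpha}P_{s(\alpha)}$ (left multiplication by $\alpha$). Let $f=(\alpha)_\alpha\colon P_k\to\bigoplus_{\alpha:\,t(\alpha)=k}P_{s(\alpha)}$ be induced by the arrows ending at $k$, and $g=(\beta)_\beta\colon\bigoplus_{\beta:\,s(\beta)=k}P_{t(\beta)}\to P_k$ be induced by the arrows starting at $k$. Then $L_k$ is the two-term complex $P_k\xrightarrow{f}\bigoplus_{\alpha:\,t(\alpha)=k}P_{s(\alpha)}$ with $P_k$ in degree $-1$, and $R_k$ is the two-term complex $\bigoplus_{\beta:\,s(\beta)=k}P_{t(\beta)}\xrightarrow{g}P_k$ with $P_k$ in degree $1$. Set $T^-_k=L_k\oplus\bigoplus_{i\neq k}P_i$ and $T^+_k=R_k\oplus\bigoplus_{i\neq k}P_i$. A tilting complex is a bounded complex $T$ of finitely generated projective modules with $\operatorname{Hom}_{\mathcal{D}^b(A)}(T,T[r])=0$ for all $r\neq 0$ whose direct summands generate the category $\operatorname{per}A$ of perfect complexes as a triangulated category. A tilting module is a module which, viewed as a complex concentrated in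 degree $0$, is isomorphic in $\mathcal{D}^b(A)$ to a tilting complex. *)

theory Defs
  imports
    "HOL-Algebra.QuotRing"
    "HOL-Algebra.Ideal_Product"
    "HOL-Algebra.Module"
    "Graph_Theory.Arc_Walk"
begin

section \<open>Path algebras of quivers and their quotients\<close>

text \<open>
  A finite quiver is a \<^locale>\<open>fin_digraph\<close> (multiple arrows and loops allowed), with
  \<^const>\<open>tail\<close> and \<^const>\<open>head\<close> giving the start and end vertex of an arrow.
  A path is a pair of its start vertex and the list of its arrows, read from left to right;
  the trivial path at \<open>u\<close> is \<open>(u, [])\<close>.
\<close>

type_synonym ('v, 'e) path = "'v \<times> 'e list"

definition path_end :: "('v, 'e) pre_digraph \<Rightarrow> ('v, 'e) path \<Rightarrow> 'v" where
  "path_end Q p = pre_digraph.awlast Q (fst p) (snd p)"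

definition paths :: "('v, 'e) pre_digraph \<Rightarrow> ('v, 'e) path set" where
  "paths Q = {p. pre_digraph.awalk Q (fst p) (snd p) (path_end Q p)}"

text \<open>
  Elements of \<open>KQ\<close> are finitely supported coefficient functions on paths. The coefficient of
  \<open>x \<otimes> y\<close> at a path runs over all ways of cutting this path into two.
\<close>

definition path_algebra :: "('v, 'e) pre_digraph \<Rightarrow> ('k::field, ('v, 'e) path \<Rightarrow> 'k) module" where
  "path_algebra Q =
     \<lparr>carrier = {x. finite {p. x p \<noteq> 0} \<and> {p. x p \<noteq> 0} \<subseteq> paths Q},
      mult = (\<lambda>x y (u, es).
        \<Sum>j\<le>length es. x (u, take j es) * y (path_end Q (u, take j es), drop j es)),
      one = (\<lambda>(u, es). if u \<in> verts Q \<and> es = [] then 1 else 0),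
      zero = (\<lambda>p. 0),
      add = (\<lambda>x y p. x p + y p),
      smult = (\<lambda>c x p. c * x p)\<rparr>"

lemma path_end_simp: "path_end Q (u, p) = (if p = [] then u else head Q (last p))"
  by (simp add: path_end_def pre_digraph.awalk_verts_conv)

lemma path_end_drop: "path_end Q (path_end Q (u, p), q) = path_end Q (u, p @ q)"
  by (simp add: path_end_simp)

lemma paths_append:
  assumes "(u,p) \<in> paths Q" "(path_end Q (u,p), q) \<in> paths Q"
  shows "(u, p @ q) \<in> paths Q"
  using assms pre_digraph.cas_append_iff[of Q u p q "path_end Q (u,p@q)"]
  by (auto simp: paths_def pre_digraph.awalk_def path_end_drop path_end_def[of Q "(u,p)", simplified, symmetric])

lemma sum_cut_assoc:
  fixes F :: "nat \<Rightarrow> nat \<Rightarrow> 'k::comm_monoid_add"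
  shows "(\<Sum>j\<le>n. \<Sum>i\<le>j. F i j) = (\<Sum>i\<le>n. \<Sum>l\<le>n-i. F i (i+l))"
proof -
  have "(\<Sum>j\<le>n. \<Sum>i\<le>j. F i j) = (\<Sum>(j,i)\<in>(SIGMA j:{..n}. {..j}). F i j)"
    by (simp add: sum.Sigma)
  also have "\<dots> = (\<Sum>(i,l)\<in>(SIGMA i:{..n}. {..n-i}). F i (i+l))"
    by (rule sum.reindex_bij_witness[where i="\<lambda>(i,l). (i+l,i)" and j="\<lambda>(j,i). (i,j-i)"]) auto
  finally show ?thesis by (simp add: sum.Sigma)
qed

lemma path_algebra_m_assoc:
  fixes x y z :: "('v, 'e) path \<Rightarrow> 'k::field"
  shows "(x \<otimes>\<^bsub>path_algebra Q\<^esub> y) \<otimes>\<^bsub>path_algebra Q\<^esub> z = x \<otimes>\<^bsub>path_algebra Q\<^esub> (y \<otimes>\<^bsub>path_algebra Q\<^esub> z)"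
proof (rule ext, clarify)
  fix u :: 'v and es :: "'e list"
  let ?n = "length es"
  let ?F = "\<lambda>i j. x (u, take i es) * y (path_end Q (u, take i es), drop i (take j es)) * z (path_end Q (u, take j es), drop j es)"
  have 1: "((x \<otimes>\<^bsub>path_algebra Q\<^esub> y) \<otimes>\<^bsub>path_algebra Q\<^esub> z) (u,es) = (\<Sum>j\<le>?n. \<Sum>i\<le>j. ?F i j)"
    by (auto simp: path_algebra_def sum_distrib_right min_def intro!: sum.cong)
  have e: "path_end Q (path_end Q (u, take i es), take l (drop i es)) = path_end Q (u, take (i+l) es)" for i l
    by (simp add: path_end_drop take_add)
  have 2: "(x \<otimes>\<^bsub>path_algebra Q\<^esub> (y \<otimes>\<^bsub>path_algebra Q\<^esub> z)) (u,es) = (\<Sum>i\<le>?n. \<Sum>l\<le>?n-i. ?F i (i+l))"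
    by (auto simp: path_algebra_def sum_distrib_left min_def e drop_take add.commute mult.assoc intro!: sum.cong)
  show "((x \<otimes>\<^bsub>path_algebra Q\<^esub> y) \<otimes>\<^bsub>path_algebra Q\<^esub> z) (u,es) = (x \<otimes>\<^bsub>path_algebra Q\<^esub> (y \<otimes>\<^bsub>path_algebra Q\<^esub> z)) (u,es)"
    unfolding 1 2 by (rule sum_cut_assoc)
qed

lemma path_algebra_m_closed:
  assumes "x \<in> carrier (path_algebra Q)" "y \<in> carrier (path_algebra Q)"
  shows "x \<otimes>\<^bsub>path_algebra Q\<^esub> y \<in> carrier (path_algebra Q)"
proof -
  let ?X = "{p. x p \<noteq> 0}" and ?Y = "{p. y p \<noteq> 0}"
  have s: "{p. (x \<otimes>\<^bsub>path_algebra Q\<^esub> y) p \<noteq> 0} \<subseteq> (\<lambda>(p,q). (fst p, snd p @ snd q)) ` {(p,q). p \<in> ?X \<and> q \<in> ?Y \<and> fst q = path_end Q p}"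
  proof clarify
    fix u es assume "(x \<otimes>\<^bsub>path_algebra Q\<^esub> y) (u,es) \<noteq> 0"
    then obtain j where "x (u, take j es) * y (path_end Q (u, take j es), drop j es) \<noteq> 0"
      by (auto simp: path_algebra_def elim: sum.not_neutral_contains_not_neutral)
    then show "(u,es) \<in> (\<lambda>(p,q). (fst p, snd p @ snd q)) ` {(p,q). p \<in> ?X \<and> q \<in> ?Y \<and> fst q = path_end Q p}"
      by (intro image_eqI[where x="((u, take j es),(path_end Q (u, take j es), drop j es))"]) auto
  qed
  have "finite {(p,q). p \<in> ?X \<and> q \<in> ?Y \<and> fst q = path_end Q p}"
    by (rule finite_subset[where B="?X \<times> ?Y"]) (use assms in \<open>auto simp: path_algebra_def\<close>)
  then have "finite {p. (x \<otimes>\<^bsub>path_algebra Q\<^esub> y) p \<noteq> 0}" using s finite_subset by blast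
  moreover have "{p. (x \<otimes>\<^bsub>path_algebra Q\<^esub> y) p \<noteq> 0} \<subseteq> paths Q"
  proof -
    have "(u,p@q) \<in> paths Q" if "x (u,p) \<noteq> 0" "y (path_end Q (u,p), q) \<noteq> 0" for u p q
      using that assms by (intro paths_append) (auto simp: path_algebra_def)
    then show ?thesis using s by fastforce
  qed
  ultimately show ?thesis by (simp add: path_algebra_def)
qed

lemma path_end_verts: "wf_digraph Q \<Longrightarrow> p \<in> paths Q \<Longrightarrow> fst p \<in> verts Q \<and> path_end Q p \<in> verts Q"
  unfolding paths_def by (metis (mono_tags) mem_Collect_eq wf_digraph.awalk_last_in_verts pre_digraph.awalk_def)

lemma path_algebra_one:
  assumes "x \<in> carrier (path_algebra Q)" "wf_digraph Q"
  shows "\<one>\<^bsub>path_algebra Q\<^esub> \<otimes>\<^bsub>path_algebra Q\<^esub> x = x" "x \<otimes>\<^bsub>path_algebra Q\<^esub> \<one>\<^bsub>path_algebra Q\<^esub> = x"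
proof -
  have s: "u \<in> verts Q \<and> path_end Q (u,es) \<in> verts Q" if "x (u,es) \<noteq> 0" for u es
    using path_end_verts[OF assms(2), of "(u,es)"] assms(1) that by (auto simp: path_algebra_def)
  show "\<one>\<^bsub>path_algebra Q\<^esub> \<otimes>\<^bsub>path_algebra Q\<^esub> x = x"
  proof (rule ext, clarify)
    fix u es
    have "(\<one>\<^bsub>path_algebra Q\<^esub> \<otimes>\<^bsub>path_algebra Q\<^esub> x) (u,es) = (\<Sum>j\<le>length es. if j = 0 then (if u \<in> verts Q then x (u,es) else 0) else 0)"
      unfolding path_algebra_def by (auto simp: path_end_simp simp del: sum.delta sum.delta' intro!: sum.cong sum.neutral)
    then show "(\<one>\<^bsub>path_algebra Q\<^esub> \<otimes>\<^bsub>path_algebra Q\<^esub> x) (u,es) = x (u,es)" using s[of u es] by auto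
  qed
  show "x \<otimes>\<^bsub>path_algebra Q\<^esub> \<one>\<^bsub>path_algebra Q\<^esub> = x"
  proof (rule ext, clarify)
    fix u es
    have "(x \<otimes>\<^bsub>path_algebra Q\<^esub> \<one>\<^bsub>path_algebra Q\<^esub>) (u,es) = (\<Sum>j\<le>length es. if j = length es then (if path_end Q (u,es) \<in> verts Q then x (u,es) else 0) else 0)"
      unfolding path_algebra_def by (auto simp del: sum.delta sum.delta' intro!: sum.cong sum.neutral)
    then show "(x \<otimes>\<^bsub>path_algebra Q\<^esub> \<one>\<^bsub>path_algebra Q\<^esub>) (u,es) = x (u,es)" using s[of u es] by auto
  qed
qed

lemma path_algebra_one_closed: assumes "fin_digraph Q" shows "\<one>\<^bsub>path_algebra Q\<^esub> \<in> carrier (path_algebra Q)"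
proof -
  interpret fin_digraph Q by fact
  have "{p. \<one>\<^bsub>path_algebra Q\<^esub> p \<noteq> (0::'k::field)} \<subseteq> (\<lambda>v. (v,[])) ` verts Q"
    by (auto simp: path_algebra_def split: if_splits)
  moreover have "(\<lambda>v. (v,[])) ` verts Q \<subseteq> paths Q" by (auto simp: paths_def awalk_def path_end_simp)
  ultimately show ?thesis using finite_subset[OF _ finite_imageI[OF finite_verts]] by (fastforce simp: path_algebra_def)
qed

lemma path_algebra_ring: assumes "fin_digraph Q" shows "ring (path_algebra Q :: ('k::field, _) module)"
proof -
  have w: "wf_digraph Q" using assms fin_digraph.axioms(1) by blast
  have fin: "finite {p. x p + y p \<noteq> (0::'k)}" if "finite {p. x p \<noteq> 0}" "finite {p. y p \<noteq> 0}" for x y :: "'c \<Rightarrow> 'k"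
    by (rule finite_subset[OF _ finite_UnI[OF that]]) auto
  show ?thesis
  proof (rule ringI)
    show "abelian_group (path_algebra Q :: ('k::field, _) module)"
    proof (rule abelian_groupI)
      fix x :: "_ \<Rightarrow> 'k" assume x: "x \<in> carrier (path_algebra Q)"
      then show "\<exists>y\<in>carrier (path_algebra Q). y \<oplus>\<^bsub>path_algebra Q\<^esub> x = \<zero>\<^bsub>path_algebra Q\<^esub>"
        by (intro bexI[of _ "\<lambda>p. - x p"]) (auto simp: path_algebra_def)
    next
      fix x y :: "_ \<Rightarrow> 'k" assume "x \<in> carrier (path_algebra Q)" "y \<in> carrier (path_algebra Q)"
      then show "x \<oplus>\<^bsub>path_algebra Q\<^esub> y \<in> carrier (path_algebra Q)"
        by (simp add: path_algebra_def fin subset_iff) force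
    qed (auto simp: path_algebra_def algebra_simps)
    show "monoid (path_algebra Q :: ('k::field, _) module)"
      by (rule monoidI) (auto simp: path_algebra_m_closed path_algebra_one_closed[OF assms] path_algebra_m_assoc path_algebra_one[OF _ w])
  qed (auto simp: path_algebra_def fun_eq_iff algebra_simps sum.distrib)
qed

definition arrow_elt :: "('v, 'e) pre_digraph \<Rightarrow> 'e \<Rightarrow> ('v, 'e) path \<Rightarrow> 'k::field" where
  "arrow_elt Q e = (\<lambda>p. if p = (tail Q e, [e]) then 1 else 0)"

definition arrow_ideal :: "('v, 'e) pre_digraph \<Rightarrow> (('v, 'e) path \<Rightarrow> 'k::field) set" where
  "arrow_ideal Q = Idl\<^bsub>path_algebra Q\<^esub> (arrow_elt Q ` arcs Q)"

definition arrow_ideal_power ::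
    "('v, 'e) pre_digraph \<Rightarrow> nat \<Rightarrow> (('v, 'e) path \<Rightarrow> 'k::field) set" where
  "arrow_ideal_power Q m =
     (ideal_prod (path_algebra Q) (arrow_ideal Q) ^^ m) (carrier (path_algebra Q))"

definition admissible_ideal ::
    "('v, 'e) pre_digraph \<Rightarrow> (('v, 'e) path \<Rightarrow> 'k::field) set \<Rightarrow> bool" where
  "admissible_ideal Q I \<longleftrightarrow>
     ideal I (path_algebra Q) \<and>
     I \<subseteq> arrow_ideal_power Q 2 \<and>
     (\<exists>m\<ge>2. arrow_ideal_power Q m \<subseteq> I)"

text \<open>The \<open>K\<close>-algebra \<open>KQ/I\<close>: the quotient ring, with the induced scalar multiplication.\<close>

definition quiver_algebra ::
    "('v, 'e) pre_digraph \<Rightarrow> (('v, 'e) path \<Rightarrow> 'k::field) set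
      \<Rightarrow> ('k, (('v, 'e) path \<Rightarrow> 'k) set) module" where
  "quiver_algebra Q I =
     ring.extend (path_algebra Q Quot I)
       (module.fields (\<lambda>c X. \<Union>x\<in>X. I +>\<^bsub>path_algebra Q\<^esub> (c \<odot>\<^bsub>path_algebra Q\<^esub> x)))"

lemma quiver_algebra_simps: "carrier (quiver_algebra Q I) = carrier (path_algebra Q Quot I)"
  "mult (quiver_algebra Q I) = mult (path_algebra Q Quot I)"
  "one (quiver_algebra Q I) = one (path_algebra Q Quot I)"
  "add (quiver_algebra Q I) = add (path_algebra Q Quot I)"
  "zero (quiver_algebra Q I) = I"
  "smult (quiver_algebra Q I) c X = (\<Union>x\<in>X. I +>\<^bsub>path_algebra Q\<^esub> (c \<odot>\<^bsub>path_algebra Q\<^esub> x))"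
  by (simp_all add: quiver_algebra_def ring.extend_def module.fields_def FactRing_def)

definition residue_class ::
    "('v, 'e) pre_digraph \<Rightarrow> (('v, 'e) path \<Rightarrow> 'k::field) set
      \<Rightarrow> (('v, 'e) path \<Rightarrow> 'k) \<Rightarrow> (('v, 'e) path \<Rightarrow> 'k) set" where
  "residue_class Q I x = I +>\<^bsub>path_algebra Q\<^esub> x"

definition path_combs ::
    "('v, 'e) pre_digraph \<Rightarrow> 'v \<Rightarrow> 'v \<Rightarrow> (('v, 'e) path \<Rightarrow> 'k::field) set" where
  "path_combs Q i j =
     {x \<in> carrier (path_algebra Q). \<forall>p. x p \<noteq> 0 \<longrightarrow> fst p = i \<and> path_end Q p = j}"

definition nonzero_in ::
    "('v, 'e) pre_digraph \<Rightarrow> (('v, 'e) path \<Rightarrow> 'k::field) set \<Rightarrow> (('v, 'e) path \<Rightarrow> 'k) \<Rightarrow> bool" where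
  "nonzero_in Q I x \<longleftrightarrow> residue_class Q I x \<noteq> \<zero>\<^bsub>quiver_algebra Q I\<^esub>"


section \<open>Finite-dimensional right modules\<close>

text \<open>
  As for the record \<^typ>\<open>('a, 'b) module\<close>, the fields \<^const>\<open>mult\<close> and \<^const>\<open>one\<close>
  inherited from \<^typ>\<open>'b ring\<close> play no role.
\<close>

record ('a, 'b) right_mod = "'b ring" +
  ract :: "'b \<Rightarrow> 'a \<Rightarrow> 'b" (infixl \<open>\<bullet>\<index>\<close> 70)

locale right_module = A?: ring A + M?: abelian_group M
  for A :: "('a, 'm) ring_scheme" (structure) and M :: "('a, 'b) right_mod" (structure) +
  assumes ract_closed:
      "\<lbrakk>x \<in> carrier M; a \<in> carrier A\<rbrakk> \<Longrightarrow> x \<bullet>\<^bsub>M\<^esub> a \<in> carrier M"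
    and ract_add_left:
      "\<lbrakk>x \<in> carrier M; y \<in> carrier M; a \<in> carrier A\<rbrakk>
        \<Longrightarrow> (x \<oplus>\<^bsub>M\<^esub> y) \<bullet>\<^bsub>M\<^esub> a = x \<bullet>\<^bsub>M\<^esub> a \<oplus>\<^bsub>M\<^esub> y \<bullet>\<^bsub>M\<^esub> a"
    and ract_add_right:
      "\<lbrakk>x \<in> carrier M; a \<in> carrier A; b \<in> carrier A\<rbrakk>
        \<Longrightarrow> x \<bullet>\<^bsub>M\<^esub> (a \<oplus>\<^bsub>A\<^esub> b) = x \<bullet>\<^bsub>M\<^esub> a \<oplus>\<^bsub>M\<^esub> x \<bullet>\<^bsub>M\<^esub> b"
    and ract_mult:
      "\<lbrakk>x \<in> carrier M; a \<in> carrier A; b \<in> carrier A\<rbrakk>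
        \<Longrightarrow> x \<bullet>\<^bsub>M\<^esub> (a \<otimes>\<^bsub>A\<^esub> b) = (x \<bullet>\<^bsub>M\<^esub> a) \<bullet>\<^bsub>M\<^esub> b"
    and ract_one:
      "x \<in> carrier M \<Longrightarrow> x \<bullet>\<^bsub>M\<^esub> \<one>\<^bsub>A\<^esub> = x"

text \<open>
  The ground field acts on a right module through \<open>c \<mapsto> c 1\<close>; finite-dimensionality is the
  existence of a finite spanning set for this action.
\<close>

definition fd_module :: "('k::field, 'a) module \<Rightarrow> ('a, 'b) right_mod \<Rightarrow> bool" where
  "fd_module A M \<longleftrightarrow>
     right_module A M \<and>
     (\<exists>B. finite B \<and> B \<subseteq> carrier M \<and>
       (\<forall>x\<in>carrier M. \<exists>c :: 'b \<Rightarrow> 'k.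
          x = (\<Oplus>\<^bsub>M\<^esub>b\<in>B. b \<bullet>\<^bsub>M\<^esub> (c b \<odot>\<^bsub>A\<^esub> \<one>\<^bsub>A\<^esub>))))"

definition mod_hom ::
    "('k, 'a) module \<Rightarrow> ('a, 'b) right_mod \<Rightarrow> ('a, 'c) right_mod \<Rightarrow> ('b \<Rightarrow> 'c) set" where
  "mod_hom A M N =
     {f. f \<in> carrier M \<rightarrow> carrier N \<and>
         (\<forall>x\<in>carrier M. \<forall>y\<in>carrier M. f (x \<oplus>\<^bsub>M\<^esub> y) = f x \<oplus>\<^bsub>N\<^esub> f y) \<and>
         (\<forall>x\<in>carrier M. \<forall>a\<in>carrier A. f (x \<bullet>\<^bsub>M\<^esub> a) = f x \<bullet>\<^bsub>N\<^esub> a)}"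

text \<open>
  Objects may have elements of any type. Where one has to quantify over all modules (or all
  complexes), this is done over those with elements in \<^typ>\<open>nat \<Rightarrow> 'k\<close>. No
  restriction is put on the module structure, so every finite-dimensional module is isomorphic
  to one of this kind, and these modules form an essentially small model of \<open>mod A\<close>.
\<close>

definition fg_projective :: "('k::field, 'a) module \<Rightarrow> ('a, 'b) right_mod \<Rightarrow> bool" where
  "fg_projective A P \<longleftrightarrow>
     fd_module A P \<and>
     (\<forall>(M :: ('a, nat \<Rightarrow> 'k) right_mod) (N :: ('a, nat \<Rightarrow> 'k) right_mod).
        \<forall>e\<in>mod_hom A M N. \<forall>h\<in>mod_hom A P N.
          fd_module A M \<and> fd_module A N \<and> e ` carrier M = carrier N \<longrightarrow>
          (\<exists>l\<in>mod_hom A P M. \<forall>x\<in>carrier P. e (l x) = h x))"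

definition zero_mod :: "('a, 'b) right_mod" where
  "zero_mod =
     \<lparr>carrier = {undefined}, mult = undefined, one = undefined, zero = undefined,
      add = (\<lambda>x y. undefined), ract = (\<lambda>x a. undefined)\<rparr>"

definition mod_sum ::
    "('a, 'b) right_mod \<Rightarrow> ('a, 'c) right_mod \<Rightarrow> ('a, 'b \<times> 'c) right_mod" where
  "mod_sum M N =
     \<lparr>carrier = carrier M \<times> carrier N, mult = undefined, one = undefined,
      zero = (\<zero>\<^bsub>M\<^esub>, \<zero>\<^bsub>N\<^esub>),
      add = (\<lambda>(x, y) (x', y'). (x \<oplus>\<^bsub>M\<^esub> x', y \<oplus>\<^bsub>N\<^esub> y')),
      ract = (\<lambda>(x, y) a. (x \<bullet>\<^bsub>M\<^esub> a, y \<bullet>\<^bsub>N\<^esub> a))\<rparr>"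

text \<open>The direct sum of a family over a finite index set \<open>J\<close>.\<close>

definition mod_Sum :: "'j set \<Rightarrow> ('j \<Rightarrow> ('a, 'b) right_mod) \<Rightarrow> ('a, 'j \<Rightarrow> 'b) right_mod" where
  "mod_Sum J M =
     \<lparr>carrier = (\<Pi>\<^sub>E j\<in>J. carrier (M j)), mult = undefined, one = undefined,
      zero = (\<lambda>j\<in>J. \<zero>\<^bsub>M j\<^esub>),
      add = (\<lambda>x y. \<lambda>j\<in>J. x j \<oplus>\<^bsub>M j\<^esub> y j),
      ract = (\<lambda>x a. \<lambda>j\<in>J. x j \<bullet>\<^bsub>M j\<^esub> a)\<rparr>"


section \<open>Complexes\<close>

record ('a, 'b) cochain =
  obj :: "int \<Rightarrow> ('a, 'b) right_mod"
  dif :: "int \<Rightarrow> 'b \<Rightarrow> 'b"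

text \<open>
  Bounded complexes of finite-dimensional modules; these are the objects of \<open>D\<^sup>b(A)\<close>.
  The differential is \<open>dif X n : obj X n \<rightarrow> obj X (n + 1)\<close>.
\<close>

definition bounded_complex :: "('k::field, 'a) module \<Rightarrow> ('a, 'b) cochain \<Rightarrow> bool" where
  "bounded_complex A X \<longleftrightarrow>
     (\<forall>n. fd_module A (obj X n) \<and> dif X n \<in> mod_hom A (obj X n) (obj X (n + 1)) \<and>
        (\<forall>x\<in>carrier (obj X n). dif X (n + 1) (dif X n x) = \<zero>\<^bsub>obj X (n + 1 + 1)\<^esub>)) \<and>
     (\<exists>N. \<forall>n. \<bar>n\<bar> > N \<longrightarrow> carrier (obj X n) = {\<zero>\<^bsub>obj X n\<^esub>})"

definition projective_complex :: "('k::field, 'a) module \<Rightarrow> ('a, 'b) cochain \<Rightarrow> bool" where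
  "projective_complex A X \<longleftrightarrow> bounded_complex A X \<and> (\<forall>n. fg_projective A (obj X n))"

definition chain_map ::
    "('k, 'a) module \<Rightarrow> ('a, 'b) cochain \<Rightarrow> ('a, 'c) cochain \<Rightarrow> (int \<Rightarrow> 'b \<Rightarrow> 'c) set" where
  "chain_map A X Y =
     {f. \<forall>n. f n \<in> mod_hom A (obj X n) (obj Y n) \<and>
        (\<forall>x\<in>carrier (obj X n). f (n + 1) (dif X n x) = dif Y n (f n x))}"

definition homotopic ::
    "('k, 'a) module \<Rightarrow> ('a, 'b) cochain \<Rightarrow> ('a, 'c) cochain
      \<Rightarrow> (int \<Rightarrow> 'b \<Rightarrow> 'c) \<Rightarrow> (int \<Rightarrow> 'b \<Rightarrow> 'c) \<Rightarrow> bool" where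
  "homotopic A X Y f g \<longleftrightarrow>
     (\<exists>h. \<forall>n. h n \<in> mod_hom A (obj X n) (obj Y (n - 1)) \<and>
        (\<forall>x\<in>carrier (obj X n).
           f n x \<ominus>\<^bsub>obj Y n\<^esub> g n x = dif Y (n - 1) (h n x) \<oplus>\<^bsub>obj Y n\<^esub> h (n + 1) (dif X n x)))"

definition cocycles :: "('a, 'b) cochain \<Rightarrow> int \<Rightarrow> 'b set" where
  "cocycles X n = {x \<in> carrier (obj X n). dif X n x = \<zero>\<^bsub>obj X (n + 1)\<^esub>}"

definition coboundaries :: "('a, 'b) cochain \<Rightarrow> int \<Rightarrow> 'b set" where
  "coboundaries X n = dif X (n - 1) ` carrier (obj X (n - 1))"

definition cohomology :: "('a, 'b) cochain \<Rightarrow> int \<Rightarrow> 'b set set" where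
  "cohomology X n = (\<lambda>z. coboundaries X n +>\<^bsub>obj X n\<^esub> z) ` cocycles X n"

definition cohomology_map ::
    "('a, 'c) cochain \<Rightarrow> (int \<Rightarrow> 'b \<Rightarrow> 'c) \<Rightarrow> int \<Rightarrow> 'b set \<Rightarrow> 'c set" where
  "cohomology_map Y f n S = (\<Union>z\<in>S. coboundaries Y n +>\<^bsub>obj Y n\<^esub> f n z)"

definition quasi_iso ::
    "('k, 'a) module \<Rightarrow> ('a, 'b) cochain \<Rightarrow> ('a, 'c) cochain \<Rightarrow> (int \<Rightarrow> 'b \<Rightarrow> 'c) set" where
  "quasi_iso A X Y =
     {f \<in> chain_map A X Y.
        \<forall>n. bij_betw (cohomology_map Y f n) (cohomology X n) (cohomology Y n)}"

definition cochain_sum ::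
    "('a, 'b) cochain \<Rightarrow> ('a, 'c) cochain \<Rightarrow> ('a, 'b \<times> 'c) cochain" where
  "cochain_sum X Y =
     \<lparr>obj = (\<lambda>n. mod_sum (obj X n) (obj Y n)), dif = (\<lambda>n (x, y). (dif X n x, dif Y n y))\<rparr>"

definition shift :: "int \<Rightarrow> ('a, 'b) cochain \<Rightarrow> ('a, 'b) cochain" where
  "shift r X =
     \<lparr>obj = (\<lambda>n. obj X (n + r)),
      dif = (\<lambda>n x. if even r then dif X (n + r) x
                  else \<ominus>\<^bsub>obj X (n + 1 + r)\<^esub> dif X (n + r) x)\<rparr>"

definition cone ::
    "('a, 'b) cochain \<Rightarrow> ('a, 'c) cochain \<Rightarrow> (int \<Rightarrow> 'b \<Rightarrow> 'c) \<Rightarrow> ('a, 'b \<times> 'c) cochain" where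
  "cone X Y f =
     \<lparr>obj = (\<lambda>n. mod_sum (obj X (n + 1)) (obj Y n)),
      dif = (\<lambda>n (x, y). (\<ominus>\<^bsub>obj X (n + 1 + 1)\<^esub> dif X (n + 1) x,
                         f (n + 1) x \<oplus>\<^bsub>obj Y (n + 1)\<^esub> dif Y n y))\<rparr>"

definition stalk :: "('a, 'b) right_mod \<Rightarrow> ('a, 'b) cochain" where
  "stalk M =
     \<lparr>obj = (\<lambda>n. if n = 0 then M else zero_mod),
      dif = (\<lambda>n x. \<zero>\<^bsub>if n + 1 = 0 then M else zero_mod\<^esub>)\<rparr>"

text \<open>
  The complex \<open>M \<rightarrow> N\<close> with \<open>M\<close> in degree \<open>d\<close> and \<open>N\<close> in degree \<open>d + 1\<close>. Since all terms of a
  complex have elements of the same type, \<open>M\<close> and \<open>N\<close> are padded with zero modules to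
  \<open>M \<oplus> 0\<close> and \<open>0 \<oplus> N\<close>.
\<close>

definition two_term_obj ::
    "int \<Rightarrow> ('a, 'b) right_mod \<Rightarrow> ('a, 'c) right_mod \<Rightarrow> int \<Rightarrow> ('a, 'b \<times> 'c) right_mod" where
  "two_term_obj d M N n =
     mod_sum (if n = d then M else zero_mod) (if n = d + 1 then N else zero_mod)"

definition two_term ::
    "int \<Rightarrow> ('a, 'b) right_mod \<Rightarrow> ('a, 'c) right_mod \<Rightarrow> ('b \<Rightarrow> 'c) \<Rightarrow> ('a, 'b \<times> 'c) cochain" where
  "two_term d M N f =
     \<lparr>obj = two_term_obj d M N,
      dif = (\<lambda>n (x, y).
        if n = d then (\<zero>\<^bsub>zero_mod :: ('a, 'b) right_mod\<^esub>, f x)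
        else \<zero>\<^bsub>two_term_obj d M N (n + 1)\<^esub>)\<rparr>"


section \<open>The bounded derived category\<close>

text \<open>
  \<open>D\<^sup>b(A)\<close> is the localisation of the homotopy category of bounded complexes at the
  quasi-isomorphisms. A morphism from \<open>X\<close> to \<open>Y\<close> is represented by a roof
  \<open>X \<leftarrow> Z \<rightarrow> Y\<close>, with legs \<open>s\<close> (a quasi-isomorphism) and \<open>f\<close>.
\<close>

definition roof ::
    "('k::field, 'a) module \<Rightarrow> ('a, 'b) cochain \<Rightarrow> ('a, 'c) cochain
      \<Rightarrow> ('a, 'z) cochain \<Rightarrow> (int \<Rightarrow> 'z \<Rightarrow> 'b) \<Rightarrow> (int \<Rightarrow> 'z \<Rightarrow> 'c) \<Rightarrow> bool" where
  "roof A X Y Z s f \<longleftrightarrow>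
     bounded_complex A X \<and> bounded_complex A Y \<and> bounded_complex A Z \<and>
     s \<in> quasi_iso A Z X \<and> f \<in> chain_map A Z Y"

text \<open>
  Two roofs \<open>X \<leftarrow> Z \<rightarrow> Y\<close> and \<open>X \<leftarrow> Z' \<rightarrow> Y\<close> represent the same morphism if they are
  dominated, up to homotopy, by a third roof \<open>X \<leftarrow> W \<rightarrow> Y\<close>.
\<close>

definition roof_eq ::
    "('k::field, 'a) module \<Rightarrow> ('a, 'b) cochain \<Rightarrow> ('a, 'c) cochain
      \<Rightarrow> ('a, 'y) cochain \<Rightarrow> (int \<Rightarrow> 'y \<Rightarrow> 'b) \<Rightarrow> (int \<Rightarrow> 'y \<Rightarrow> 'c)
      \<Rightarrow> ('a, 'z) cochain \<Rightarrow> (int \<Rightarrow> 'z \<Rightarrow> 'b) \<Rightarrow> (int \<Rightarrow> 'z \<Rightarrow> 'c) \<Rightarrow> bool" where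
  "roof_eq A X Y Z s f Z' s' f' \<longleftrightarrow>
     (\<exists>(W :: ('a, nat \<Rightarrow> 'k) cochain) u u'.
        bounded_complex A W \<and> u \<in> chain_map A W Z \<and> u' \<in> chain_map A W Z' \<and>
        (\<lambda>n. s n \<circ> u n) \<in> quasi_iso A W X \<and>
        homotopic A W X (\<lambda>n. s n \<circ> u n) (\<lambda>n. s' n \<circ> u' n) \<and>
        homotopic A W Y (\<lambda>n. f n \<circ> u n) (\<lambda>n. f' n \<circ> u' n))"

text \<open>
  The composite of \<open>X \<leftarrow> Z \<rightarrow> Y\<close> and \<open>Y \<leftarrow> Z' \<rightarrow> V\<close> is the roof
  \<open>X \<leftarrow> Z \<leftarrow> W \<rightarrow> Z' \<rightarrow> V\<close> for any \<open>W\<close> completing the middle to a square which commutes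
  up to homotopy and in which \<open>u : W \<rightarrow> Z\<close> is a quasi-isomorphism. The following says that the
  composite of a roof from \<open>X\<close> to \<open>Y\<close> with one from \<open>Y\<close> to \<open>X\<close> is the identity of \<open>X\<close>.
\<close>

definition roof_comp_id ::
    "('k::field, 'a) module \<Rightarrow> ('a, 'b) cochain \<Rightarrow> ('a, 'c) cochain
      \<Rightarrow> ('a, 'y) cochain \<Rightarrow> (int \<Rightarrow> 'y \<Rightarrow> 'b) \<Rightarrow> (int \<Rightarrow> 'y \<Rightarrow> 'c)
      \<Rightarrow> ('a, 'z) cochain \<Rightarrow> (int \<Rightarrow> 'z \<Rightarrow> 'c) \<Rightarrow> (int \<Rightarrow> 'z \<Rightarrow> 'b) \<Rightarrow> bool" where
  "roof_comp_id A X Y Z s f Z' t g \<longleftrightarrow>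
     (\<exists>(W :: ('a, nat \<Rightarrow> 'k) cochain) u v.
        bounded_complex A W \<and> u \<in> quasi_iso A W Z \<and> v \<in> chain_map A W Z' \<and>
        homotopic A W Y (\<lambda>n. f n \<circ> u n) (\<lambda>n. t n \<circ> v n) \<and>
        roof_eq A X X W (\<lambda>n. s n \<circ> u n) (\<lambda>n. g n \<circ> v n) X (\<lambda>n. id) (\<lambda>n. id))"

definition Db_iso ::
    "('k::field, 'a) module \<Rightarrow> ('a, 'b) cochain \<Rightarrow> ('a, 'c) cochain \<Rightarrow> bool" where
  "Db_iso A X Y \<longleftrightarrow>
     (\<exists>(Z :: ('a, nat \<Rightarrow> 'k) cochain) s f (Z' :: ('a, nat \<Rightarrow> 'k) cochain) t g.
        roof A X Y Z s f \<and> roof A Y X Z' t g \<and>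
        roof_comp_id A X Y Z s f Z' t g \<and> roof_comp_id A Y X Z' t g Z s f)"

text \<open>\<open>Hom(X, Y) = 0\<close>: every morphism is the zero morphism.\<close>

definition Db_Hom_zero ::
    "('k::field, 'a) module \<Rightarrow> ('a, 'b) cochain \<Rightarrow> ('a, 'c) cochain \<Rightarrow> bool" where
  "Db_Hom_zero A X Y \<longleftrightarrow>
     (\<forall>(Z :: ('a, nat \<Rightarrow> 'k) cochain) s f.
        roof A X Y Z s f \<longrightarrow> roof_eq A X Y Z s f Z s (\<lambda>n x. \<zero>\<^bsub>obj Y n\<^esub>))"


section \<open>Tilting complexes and tilting modules\<close>

definition perfect :: "('k::field, 'a) module \<Rightarrow> ('a, 'b) cochain \<Rightarrow> bool" where
  "perfect A X \<longleftrightarrow>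
     (\<exists>P :: ('a, nat \<Rightarrow> 'k) cochain. projective_complex A P \<and> Db_iso A X P)"

text \<open>
  The smallest strictly full triangulated subcategory of \<open>per A\<close> containing all direct summands
  of \<open>T\<close> in \<open>D\<^sup>b(A)\<close>. Up to isomorphism in \<open>D\<^sup>b(A)\<close>, every morphism is a chain map and every
  distinguished triangle is the standard one on its cone.
\<close>

inductive tri_generated ::
    "('k::field, 'a) module \<Rightarrow> ('a, 'b) cochain \<Rightarrow> ('a, nat \<Rightarrow> 'k) cochain \<Rightarrow> bool"
  for A :: "('k::field, 'a) module" and T :: "('a, 'b) cochain" where
  summand: "\<lbrakk>perfect A X; bounded_complex A (Y :: ('a, nat \<Rightarrow> 'k) cochain);
      Db_iso A (cochain_sum X Y) T\<rbrakk> \<Longrightarrow> tri_generated A T X"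
| iso: "\<lbrakk>tri_generated A T X; perfect A Y; Db_iso A X Y\<rbrakk> \<Longrightarrow> tri_generated A T Y"
| shift: "tri_generated A T X \<Longrightarrow> tri_generated A T (shift r X)"
| triangle: "\<lbrakk>tri_generated A T X; tri_generated A T Y; f \<in> chain_map A X Y;
      perfect A Z; Db_iso A (cone X Y f) Z\<rbrakk> \<Longrightarrow> tri_generated A T Z"

definition generates_per :: "('k::field, 'a) module \<Rightarrow> ('a, 'b) cochain \<Rightarrow> bool" where
  "generates_per A T \<longleftrightarrow>
     (\<forall>X :: ('a, nat \<Rightarrow> 'k) cochain. perfect A X \<longrightarrow> tri_generated A T X)"

definition tilting_complex :: "('k::field, 'a) module \<Rightarrow> ('a, 'b) cochain \<Rightarrow> bool" where
  "tilting_complex A T \<longleftrightarrow>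
     projective_complex A T \<and>
     (\<forall>r. r \<noteq> 0 \<longrightarrow> Db_Hom_zero A T (shift r T)) \<and>
     generates_per A T"

definition tilting_module :: "('k::field, 'a) module \<Rightarrow> ('a, 'b) right_mod \<Rightarrow> bool" where
  "tilting_module A M \<longleftrightarrow>
     fd_module A M \<and>
     (\<exists>T :: ('a, nat \<Rightarrow> 'k) cochain. tilting_complex A T \<and> Db_iso A (stalk M) T)"

definition iso_to_tilting_module :: "('k::field, 'a) module \<Rightarrow> ('a, 'b) cochain \<Rightarrow> bool" where
  "iso_to_tilting_module A X \<longleftrightarrow>
     (\<exists>M :: ('a, nat \<Rightarrow> 'k) right_mod. tilting_module A M \<and> Db_iso A X (stalk M))"


section \<open>The complexes \<open>T\<^sup>-\<^sub>k\<close> and \<open>T\<^sup>+\<^sub>k\<close>\<close>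

type_synonym ('v, 'e, 'k) qelt = "(('v, 'e) path \<Rightarrow> 'k) set"

text \<open>The module \<open>P\<^sub>i\<close>, spanned by the residue classes of the paths starting at \<open>i\<close>.\<close>

definition proj_mod ::
    "('v, 'e) pre_digraph \<Rightarrow> (('v, 'e) path \<Rightarrow> 'k::field) set \<Rightarrow> 'v
      \<Rightarrow> (('v, 'e, 'k) qelt, ('v, 'e, 'k) qelt) right_mod" where
  "proj_mod Q I i =
     \<lparr>carrier = residue_class Q I ` {x \<in> carrier (path_algebra Q). \<forall>p. x p \<noteq> 0 \<longrightarrow> fst p = i},
      mult = undefined, one = undefined,
      zero = \<zero>\<^bsub>quiver_algebra Q I\<^esub>,
      add = add (quiver_algebra Q I),
      ract = mult (quiver_algebra Q I)\<rparr>"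

definition left_mult_arrow ::
    "('v, 'e) pre_digraph \<Rightarrow> (('v, 'e) path \<Rightarrow> 'k::field) set \<Rightarrow> 'e
      \<Rightarrow> ('v, 'e, 'k) qelt \<Rightarrow> ('v, 'e, 'k) qelt" where
  "left_mult_arrow Q I e x = residue_class Q I (arrow_elt Q e) \<otimes>\<^bsub>quiver_algebra Q I\<^esub> x"

definition in_arrows :: "('v, 'e) pre_digraph \<Rightarrow> 'v \<Rightarrow> 'e set" where
  "in_arrows Q k = {e \<in> arcs Q. head Q e = k}"

definition out_arrows :: "('v, 'e) pre_digraph \<Rightarrow> 'v \<Rightarrow> 'e set" where
  "out_arrows Q k = {e \<in> arcs Q. tail Q e = k}"

definition L_complex ::
    "('v, 'e) pre_digraph \<Rightarrow> (('v, 'e) path \<Rightarrow> 'k::field) set \<Rightarrow> 'v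
      \<Rightarrow> (('v, 'e, 'k) qelt, ('v, 'e, 'k) qelt \<times> ('e \<Rightarrow> ('v, 'e, 'k) qelt)) cochain" where
  "L_complex Q I k =
     two_term (-1) (proj_mod Q I k)
       (mod_Sum (in_arrows Q k) (\<lambda>e. proj_mod Q I (tail Q e)))
       (\<lambda>x. \<lambda>e\<in>in_arrows Q k. left_mult_arrow Q I e x)"

definition R_complex ::
    "('v, 'e) pre_digraph \<Rightarrow> (('v, 'e) path \<Rightarrow> 'k::field) set \<Rightarrow> 'v
      \<Rightarrow> (('v, 'e, 'k) qelt, ('e \<Rightarrow> ('v, 'e, 'k) qelt) \<times> ('v, 'e, 'k) qelt) cochain" where
  "R_complex Q I k =
     two_term 0 (mod_Sum (out_arrows Q k) (\<lambda>e. proj_mod Q I (head Q e)))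
       (proj_mod Q I k)
       (\<lambda>y. \<Oplus>\<^bsub>proj_mod Q I k\<^esub>e\<in>out_arrows Q k. left_mult_arrow Q I e (y e))"

definition T_minus ::
    "('v, 'e) pre_digraph \<Rightarrow> (('v, 'e) path \<Rightarrow> 'k::field) set \<Rightarrow> 'v
      \<Rightarrow> (('v, 'e, 'k) qelt, (('v, 'e, 'k) qelt \<times> ('e \<Rightarrow> ('v, 'e, 'k) qelt))
                \<times> ('v \<Rightarrow> ('v, 'e, 'k) qelt)) cochain" where
  "T_minus Q I k =
     cochain_sum (L_complex Q I k) (stalk (mod_Sum (verts Q - {k}) (proj_mod Q I)))"

definition T_plus ::
    "('v, 'e) pre_digraph \<Rightarrow> (('v, 'e) path \<Rightarrow> 'k::field) set \<Rightarrow> 'v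
      \<Rightarrow> (('v, 'e, 'k) qelt, (('e \<Rightarrow> ('v, 'e, 'k) qelt) \<times> ('v, 'e, 'k) qelt)
                \<times> ('v \<Rightarrow> ('v, 'e, 'k) qelt)) cochain" where
  "T_plus Q I k =
     cochain_sum (R_complex Q I k) (stalk (mod_Sum (verts Q - {k}) (proj_mod Q I)))"

end

theory Submission
  imports Defs
begin

text \<open>
  A complex of projectives in two consecutive degrees has self-extensions in \<open>\<D>\<^sup>b(A)\<close> at most in
  degrees \<open>1\<close> and \<open>-1\<close>. In degree \<open>1\<close> they vanish because every path between
  \<open>k\<close> and another vertex contains an arrow at \<open>k\<close>, so that (\<open>k\<close> having no loops) the maps in question
  factor through \<open>f\<close> or \<open>g\<close>. In degree \<open>-1\<close> such an extension
  is a map from the cokernel of the differential to its kernel; as the \<open>P\<^sub>i\<close> with \<open>i \<noteq> k\<close> are summands,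
  it vanishes exactly when the kernel has no element \<open>x = x e\<^sub>i\<close> (for \<open>f\<close>), respectively when no
  element of \<open>P\<^sub>i\<close> is killed by all arrows starting at \<open>k\<close> (for \<open>g\<close>). Generation of \<open>per A\<close> is
  independent of the condition: rotating the triangle of the two-term complex recovers \<open>P\<^sub>k\<close>, and
  Krull--Schmidt together with brutal truncation reduces a perfect complex to the \<open>P\<^sub>i\<close>. For (b), the
  complex is isomorphic to a module exactly when its cohomology in degree \<open>-1\<close>, the kernel of \<open>f\<close>,
  is zero.
\<close>

section \<open>Right modules\<close>

text \<open>The definitions quantify over complexes with elements in
  \<open>nat \<Rightarrow> 'k\<close>, while T, its cones and its summands have other element types.
  Hence every finite-dimensional module and every bounded complex gets an isomorphic copy of that
  type, and generation is handled through copies. Roofs are never composed: isomorphisms in the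
  derived category come from single quasi-isomorphisms, composed beforehand as chain maps, and are
  chained only by the closure of \<open>tri_generated\<close> under isomorphism. Vanishing of Hom is
  controlled from two sides. A roof starting in a bounded complex of projectives can be replaced by
  a chain map, so null-homotopy suffices; conversely a zero morphism induces zero on cohomology, and
  for a complex in two degrees cohomology sees all maps of degree -1. As (b) asks for a tilting
  complex of the fixed element type, tilting is proved there for every complex isomorphic to T. The
  computations with elements rest on two facts: the degree 0 term of T is generated by elements m =
  m e_i with i \<noteq> k, and P_i = e_i A represents M \<mapsto> M e_i.\<close>

lemma abelian_group_uminus_zero: "abelian_group G \<Longrightarrow> \<ominus>\<^bsub>G\<^esub> \<zero>\<^bsub>G\<^esub> = \<zero>\<^bsub>G\<^esub>"
  by (metis abelian_group.minus_equality abelian_groupE(2,5))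

lemma right_module_ring: "right_module A M \<Longrightarrow> ring A"
  by (rule right_module.axioms)

lemma right_module_group: "right_module A M \<Longrightarrow> abelian_group M"
  by (rule right_module.axioms)

context right_module
begin

lemma zero_ract [simp]:
  assumes "a \<in> carrier A" shows "\<zero>\<^bsub>M\<^esub> \<bullet>\<^bsub>M\<^esub> a = \<zero>\<^bsub>M\<^esub>"
proof -
  have c: "\<zero>\<^bsub>M\<^esub> \<bullet>\<^bsub>M\<^esub> a \<in> carrier M" using assms by (simp add: ract_closed)
  have "\<zero>\<^bsub>M\<^esub> \<bullet>\<^bsub>M\<^esub> a \<oplus>\<^bsub>M\<^esub> \<zero>\<^bsub>M\<^esub> \<bullet>\<^bsub>M\<^esub> a = \<zero>\<^bsub>M\<^esub> \<bullet>\<^bsub>M\<^esub> a \<oplus>\<^bsub>M\<^esub> \<zero>\<^bsub>M\<^esub>"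
    using assms c ract_add_left[of "\<zero>\<^bsub>M\<^esub>" "\<zero>\<^bsub>M\<^esub>" a] by simp
  then show ?thesis using c by (metis M.add.l_cancel_one M.r_zero)
qed

lemma ract_zero [simp]:
  assumes "x \<in> carrier M" shows "x \<bullet>\<^bsub>M\<^esub> \<zero> = \<zero>\<^bsub>M\<^esub>"
proof -
  have c: "x \<bullet>\<^bsub>M\<^esub> \<zero> \<in> carrier M" using assms by (simp add: ract_closed)
  have "x \<bullet>\<^bsub>M\<^esub> \<zero> \<oplus>\<^bsub>M\<^esub> x \<bullet>\<^bsub>M\<^esub> \<zero> = x \<bullet>\<^bsub>M\<^esub> \<zero> \<oplus>\<^bsub>M\<^esub> \<zero>\<^bsub>M\<^esub>"
    using assms c ract_add_right[of x \<zero> \<zero>] by simp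
  then show ?thesis using c by (metis M.add.l_cancel_one M.r_zero)
qed

lemma ract_minus:
  assumes "x \<in> carrier M" "a \<in> carrier A"
  shows "(\<ominus>\<^bsub>M\<^esub> x) \<bullet>\<^bsub>M\<^esub> a = \<ominus>\<^bsub>M\<^esub> (x \<bullet>\<^bsub>M\<^esub> a)"
proof (rule sym, rule M.minus_equality)
  show "(\<ominus>\<^bsub>M\<^esub> x) \<bullet>\<^bsub>M\<^esub> a \<oplus>\<^bsub>M\<^esub> x \<bullet>\<^bsub>M\<^esub> a = \<zero>\<^bsub>M\<^esub>"
    using assms by (simp add: ract_add_left[symmetric] M.l_neg)
qed (use assms in \<open>auto simp: ract_closed\<close>)

lemma ract_finsum:
  assumes "\<And>j. j \<in> J \<Longrightarrow> x j \<in> carrier M" "a \<in> carrier A"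
  shows "(\<Oplus>\<^bsub>M\<^esub>j\<in>J. x j) \<bullet>\<^bsub>M\<^esub> a = (\<Oplus>\<^bsub>M\<^esub>j\<in>J. x j \<bullet>\<^bsub>M\<^esub> a)"
proof (cases "finite J")
  case True
  then show ?thesis using assms
    by (induction J rule: finite_induct) (auto simp: ract_closed ract_add_left Pi_iff)
qed (simp add: assms M.finsum_infinite)

end

section \<open>Homomorphisms of right modules\<close>

lemma mod_homI:
  assumes "\<And>x. x \<in> carrier M \<Longrightarrow> f x \<in> carrier N"
    and "\<And>x y. x \<in> carrier M \<Longrightarrow> y \<in> carrier M \<Longrightarrow> f (x \<oplus>\<^bsub>M\<^esub> y) = f x \<oplus>\<^bsub>N\<^esub> f y"
    and "\<And>x a. x \<in> carrier M \<Longrightarrow> a \<in> carrier A \<Longrightarrow> f (x \<bullet>\<^bsub>M\<^esub> a) = f x \<bullet>\<^bsub>N\<^esub> a"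
  shows "f \<in> mod_hom A M N"
  using assms by (auto simp: mod_hom_def)

lemma mod_hom_closed: "f \<in> mod_hom A M N \<Longrightarrow> x \<in> carrier M \<Longrightarrow> f x \<in> carrier N"
  by (auto simp: mod_hom_def)

lemma mod_hom_add:
  "f \<in> mod_hom A M N \<Longrightarrow> x \<in> carrier M \<Longrightarrow> y \<in> carrier M \<Longrightarrow> f (x \<oplus>\<^bsub>M\<^esub> y) = f x \<oplus>\<^bsub>N\<^esub> f y"
  by (auto simp: mod_hom_def)

lemma mod_hom_ract:
  "f \<in> mod_hom A M N \<Longrightarrow> x \<in> carrier M \<Longrightarrow> a \<in> carrier A \<Longrightarrow> f (x \<bullet>\<^bsub>M\<^esub> a) = f x \<bullet>\<^bsub>N\<^esub> a"
  by (auto simp: mod_hom_def)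

lemma mod_hom_zero:
  assumes "f \<in> mod_hom A M N" "abelian_group M" "abelian_group N"
  shows "f \<zero>\<^bsub>M\<^esub> = \<zero>\<^bsub>N\<^esub>"
proof -
  interpret M: abelian_group M by fact
  interpret N: abelian_group N by fact
  have c: "f \<zero>\<^bsub>M\<^esub> \<in> carrier N" using mod_hom_closed[OF assms(1)] by simp
  have "f \<zero>\<^bsub>M\<^esub> \<oplus>\<^bsub>N\<^esub> f \<zero>\<^bsub>M\<^esub> = f \<zero>\<^bsub>M\<^esub> \<oplus>\<^bsub>N\<^esub> \<zero>\<^bsub>N\<^esub>"
    using mod_hom_add[OF assms(1), of "\<zero>\<^bsub>M\<^esub>" "\<zero>\<^bsub>M\<^esub>"] c by simp
  then show ?thesis using c by (metis N.add.l_cancel_one N.r_zero)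
qed

lemma mod_hom_uminus:
  assumes "f \<in> mod_hom A M N" "abelian_group M" "abelian_group N" "x \<in> carrier M"
  shows "f (\<ominus>\<^bsub>M\<^esub> x) = \<ominus>\<^bsub>N\<^esub> f x"
proof -
  interpret M: abelian_group M by fact
  interpret N: abelian_group N by fact
  have "f (\<ominus>\<^bsub>M\<^esub> x) \<oplus>\<^bsub>N\<^esub> f x = \<zero>\<^bsub>N\<^esub>"
    using assms mod_hom_add[OF assms(1), of "\<ominus>\<^bsub>M\<^esub> x" x] by (simp add: M.l_neg mod_hom_zero)
  then show ?thesis using assms mod_hom_closed[OF assms(1)] by (metis M.a_inv_closed N.minus_equality)
qed

lemma mod_hom_minus:
  assumes "f \<in> mod_hom A M N" "abelian_group M" "abelian_group N" "x \<in> carrier M" "y \<in> carrier M"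
  shows "f (x \<ominus>\<^bsub>M\<^esub> y) = f x \<ominus>\<^bsub>N\<^esub> f y"
  using assms abelian_group.a_inv_closed[OF assms(2)]
  by (simp add: a_minus_def mod_hom_add mod_hom_uminus)

lemma mod_hom_finsum:
  assumes "f \<in> mod_hom A M N" "abelian_group M" "abelian_group N" "\<And>j. j \<in> J \<Longrightarrow> x j \<in> carrier M"
  shows "f (\<Oplus>\<^bsub>M\<^esub>j\<in>J. x j) = (\<Oplus>\<^bsub>N\<^esub>j\<in>J. f (x j))"
proof -
  interpret M: abelian_group M by fact
  interpret N: abelian_group N by fact
  show ?thesis
  proof (cases "finite J")
    case True
    then show ?thesis using assms(4)
      by (induction J rule: finite_induct)
        (auto simp: mod_hom_zero[OF assms(1-3)] mod_hom_add[OF assms(1)] mod_hom_closed[OF assms(1)] Pi_iff)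
  qed (simp add: mod_hom_zero[OF assms(1-3)] M.finsum_infinite N.finsum_infinite)
qed

lemma mod_hom_comp: "f \<in> mod_hom A M N \<Longrightarrow> g \<in> mod_hom A N L \<Longrightarrow> g \<circ> f \<in> mod_hom A M L"
  by (auto simp: mod_hom_def Pi_iff)

lemma mod_hom_id: "id \<in> mod_hom A M M" "(\<lambda>x. x) \<in> mod_hom A M M"
  by (auto simp: mod_hom_def)

lemma mod_hom_zero_map:
  assumes "right_module A N" shows "(\<lambda>x. \<zero>\<^bsub>N\<^esub>) \<in> mod_hom A M N"
proof -
  interpret N: right_module A N by fact
  show ?thesis by (rule mod_homI) auto
qed

lemma mod_hom_neg_map:
  assumes "f \<in> mod_hom A M N" "right_module A M" "right_module A N"
  shows "(\<lambda>x. \<ominus>\<^bsub>N\<^esub> f x) \<in> mod_hom A M N"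
proof -
  interpret N: right_module A N by fact
  show ?thesis by (rule mod_homI)
    (use assms in \<open>auto simp: mod_hom_closed mod_hom_add mod_hom_ract N.ract_minus N.minus_add\<close>)
qed

lemma mod_hom_add_map:
  assumes "f \<in> mod_hom A M N" "g \<in> mod_hom A M N" "right_module A N"
  shows "(\<lambda>x. f x \<oplus>\<^bsub>N\<^esub> g x) \<in> mod_hom A M N"
proof -
  interpret N: right_module A N by fact
  show ?thesis by (rule mod_homI)
    (use assms in \<open>auto simp: mod_hom_closed[OF assms(1)] mod_hom_closed[OF assms(2)]
       mod_hom_add[OF assms(1)] mod_hom_add[OF assms(2)] mod_hom_ract N.ract_add_left N.a_ac\<close>)
qed

lemma mod_hom_minus_map:
  assumes "f \<in> mod_hom A M N" "g \<in> mod_hom A M N" "right_module A M" "right_module A N"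
  shows "(\<lambda>x. f x \<ominus>\<^bsub>N\<^esub> g x) \<in> mod_hom A M N"
  unfolding a_minus_def using assms by (intro mod_hom_add_map mod_hom_neg_map)

text \<open>Maps are total functions that matter only on the carrier. As the carrier is closed under
  the operations, agreement there transfers all homomorphism laws.\<close>

lemma mod_hom_cong:
  assumes "f \<in> mod_hom A M N" "right_module A M" "\<And>x. x \<in> carrier M \<Longrightarrow> g x = f x"
  shows "g \<in> mod_hom A M N"
proof -
  interpret M: right_module A M by fact
  show ?thesis by (rule mod_homI)
    (use assms in \<open>auto simp: mod_hom_closed mod_hom_add mod_hom_ract M.ract_closed\<close>)
qed

lemma mod_hom_inv_into:
  assumes "right_module A M" "f \<in> mod_hom A M N" "bij_betw f (carrier M) (carrier N)"
  shows "inv_into (carrier M) f \<in> mod_hom A N M"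
proof -
  interpret M: right_module A M by fact
  let ?g = "inv_into (carrier M) f"
  have inj: "inj_on f (carrier M)" using assms(3) by (rule bij_betw_imp_inj_on)
  have c: "?g y \<in> carrier M" "f (?g y) = y" if "y \<in> carrier N" for y
    using assms(3) that by (auto simp: bij_betw_def intro: inv_into_into f_inv_into_f)
  show ?thesis
  proof (rule mod_homI)
    fix x y assume xy: "x \<in> carrier N" "y \<in> carrier N"
    have "f (?g x \<oplus>\<^bsub>M\<^esub> ?g y) = x \<oplus>\<^bsub>N\<^esub> y" using xy c assms(2) by (simp add: mod_hom_add)
    then show "?g (x \<oplus>\<^bsub>N\<^esub> y) = ?g x \<oplus>\<^bsub>M\<^esub> ?g y"
      using xy c inj by (metis M.a_closed inv_into_f_f)
  next
    fix x a assume xa: "x \<in> carrier N" "a \<in> carrier A"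
    have "f (?g x \<bullet>\<^bsub>M\<^esub> a) = x \<bullet>\<^bsub>N\<^esub> a" using xa c assms(2) by (simp add: mod_hom_ract)
    then show "?g (x \<bullet>\<^bsub>N\<^esub> a) = ?g x \<bullet>\<^bsub>M\<^esub> a"
      using xa c inj by (metis M.ract_closed inv_into_f_f)
  qed (use c in auto)
qed

subsection \<open>Sums and quotients\<close>

lemma zero_mod_simps [simp]:
  "carrier zero_mod = {undefined}" "\<zero>\<^bsub>zero_mod\<^esub> = undefined"
  "x \<oplus>\<^bsub>zero_mod\<^esub> y = undefined" "x \<bullet>\<^bsub>zero_mod\<^esub> a = undefined"
  by (simp_all add: zero_mod_def)

text \<open>Sums and actions unfold through \<open>fst\<close> and \<open>snd\<close> instead of
  pair patterns, so that the rules apply to elements not yet split into components.\<close>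

lemma mod_sum_simps [simp]:
  "carrier (mod_sum M N) = carrier M \<times> carrier N" "\<zero>\<^bsub>mod_sum M N\<^esub> = (\<zero>\<^bsub>M\<^esub>, \<zero>\<^bsub>N\<^esub>)"
  "p \<oplus>\<^bsub>mod_sum M N\<^esub> q = (fst p \<oplus>\<^bsub>M\<^esub> fst q, snd p \<oplus>\<^bsub>N\<^esub> snd q)"
  "p \<bullet>\<^bsub>mod_sum M N\<^esub> a = (fst p \<bullet>\<^bsub>M\<^esub> a, snd p \<bullet>\<^bsub>N\<^esub> a)"
  by (simp_all add: mod_sum_def split: prod.split)

lemma mod_Sum_simps [simp]:
  "carrier (mod_Sum J M) = (\<Pi>\<^sub>E j\<in>J. carrier (M j))" "\<zero>\<^bsub>mod_Sum J M\<^esub> = (\<lambda>j\<in>J. \<zero>\<^bsub>M j\<^esub>)"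
  "p \<oplus>\<^bsub>mod_Sum J M\<^esub> q = (\<lambda>j\<in>J. p j \<oplus>\<^bsub>M j\<^esub> q j)"
  "p \<bullet>\<^bsub>mod_Sum J M\<^esub> a = (\<lambda>j\<in>J. p j \<bullet>\<^bsub>M j\<^esub> a)"
  by (simp_all add: mod_Sum_def)

lemma right_module_zero_mod: "ring A \<Longrightarrow> right_module A zero_mod"
  by (intro right_module.intro right_module_axioms.intro abelian_groupI) auto

lemma right_module_mod_sum:
  assumes "right_module A M" "right_module A N" shows "right_module A (mod_sum M N)"
proof -
  interpret M: right_module A M by fact
  interpret N: right_module A N by fact
  show ?thesis
  proof (intro right_module.intro right_module_axioms.intro abelian_groupI)
    fix p assume "p \<in> carrier (mod_sum M N)"
    then show "\<exists>q\<in>carrier (mod_sum M N). q \<oplus>\<^bsub>mod_sum M N\<^esub> p = \<zero>\<^bsub>mod_sum M N\<^esub>"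
      by (intro bexI[of _ "(\<ominus>\<^bsub>M\<^esub> fst p, \<ominus>\<^bsub>N\<^esub> snd p)"]) (auto simp: M.l_neg N.l_neg)
  qed (auto simp: M.a_ac N.a_ac M.ract_closed N.ract_closed M.ract_add_left N.ract_add_left
      M.ract_add_right N.ract_add_right M.ract_mult N.ract_mult M.ract_one N.ract_one M.ring_axioms)
qed

lemma mod_sum_uminus:
  assumes "right_module A M" "right_module A N" "x \<in> carrier M" "y \<in> carrier N"
  shows "\<ominus>\<^bsub>mod_sum M N\<^esub> (x, y) = (\<ominus>\<^bsub>M\<^esub> x, \<ominus>\<^bsub>N\<^esub> y)"
proof -
  interpret M: right_module A M by fact
  interpret N: right_module A N by fact
  interpret S: right_module A "mod_sum M N" by (rule right_module_mod_sum[OF assms(1,2)])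
  show ?thesis by (rule S.minus_equality) (use assms in \<open>auto simp: M.l_neg N.l_neg\<close>)
qed

lemma right_module_mod_Sum:
  assumes "ring A" "\<And>j. j \<in> J \<Longrightarrow> right_module A (M j)" shows "right_module A (mod_Sum J M)"
proof -
  have m: "j \<in> J \<Longrightarrow> abelian_group (M j)" for j using assms(2) right_module_group by blast
  note g = abelian_groupE[OF m]
  have ext: "x = y" if "x \<in> carrier (mod_Sum J M)" "y \<in> carrier (mod_Sum J M)" "\<And>j. j \<in> J \<Longrightarrow> x j = y j" for x y
    using that by (auto intro: PiE_ext)
  show ?thesis
  proof (intro right_module.intro right_module_axioms.intro abelian_groupI)
    fix p assume p: "p \<in> carrier (mod_Sum J M)"
    then show "\<exists>q\<in>carrier (mod_Sum J M). q \<oplus>\<^bsub>mod_Sum J M\<^esub> p = \<zero>\<^bsub>mod_Sum J M\<^esub>"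
      by (intro bexI[of _ "\<lambda>j\<in>J. \<ominus>\<^bsub>M j\<^esub> p j"])
        (auto simp: PiE_iff abelian_group.l_neg[OF m] abelian_group.a_inv_closed[OF m] intro!: restrict_ext)
  next
    fix x y z assume "x \<in> carrier (mod_Sum J M)" "y \<in> carrier (mod_Sum J M)" "z \<in> carrier (mod_Sum J M)"
    then show "(x \<oplus>\<^bsub>mod_Sum J M\<^esub> y) \<oplus>\<^bsub>mod_Sum J M\<^esub> z = x \<oplus>\<^bsub>mod_Sum J M\<^esub> (y \<oplus>\<^bsub>mod_Sum J M\<^esub> z)"
      by (auto simp: PiE_iff intro!: restrict_ext g(3))
  next
    fix x y assume "x \<in> carrier (mod_Sum J M)" "y \<in> carrier (mod_Sum J M)"
    then show "x \<oplus>\<^bsub>mod_Sum J M\<^esub> y = y \<oplus>\<^bsub>mod_Sum J M\<^esub> x"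
      by (auto simp: PiE_iff intro!: restrict_ext g(4))
  next
    fix x assume "x \<in> carrier (mod_Sum J M)"
    then show "\<zero>\<^bsub>mod_Sum J M\<^esub> \<oplus>\<^bsub>mod_Sum J M\<^esub> x = x"
      by (auto simp: fun_eq_iff PiE_iff extensional_def g(1,2,5))
  next
    fix x assume "x \<in> carrier (mod_Sum J M)"
    then show "x \<bullet>\<^bsub>mod_Sum J M\<^esub> \<one>\<^bsub>A\<^esub> = x"
      by (auto simp: fun_eq_iff PiE_iff extensional_def right_module.ract_one[OF assms(2)])
  qed (auto simp: PiE_iff assms(1) g(1,2) right_module.ract_closed[OF assms(2)] right_module.ract_mult[OF assms(2)]
      right_module.ract_add_left[OF assms(2)] right_module.ract_add_right[OF assms(2)] intro!: restrict_ext)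
qed

text \<open>Transport of structure, meaningful when \<open>\<phi>\<close> is injective on the
  carrier. It moves a module to the element type over which the definitions quantify.\<close>

definition transport :: "('b \<Rightarrow> 'c) \<Rightarrow> ('a, 'b) right_mod \<Rightarrow> ('a, 'c) right_mod" where
  "transport \<phi> M = (let \<psi> = inv_into (carrier M) \<phi> in
     \<lparr>carrier = \<phi> ` carrier M, mult = undefined, one = undefined, zero = \<phi> \<zero>\<^bsub>M\<^esub>,
      add = (\<lambda>x y. \<phi> (\<psi> x \<oplus>\<^bsub>M\<^esub> \<psi> y)), ract = (\<lambda>x a. \<phi> (\<psi> x \<bullet>\<^bsub>M\<^esub> a))\<rparr>)"

lemma transport:
  assumes "right_module A M" "inj_on \<phi> (carrier M)"
  shows "right_module A (transport \<phi> M)" "\<phi> \<in> mod_hom A M (transport \<phi> M)"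
    "bij_betw \<phi> (carrier M) (carrier (transport \<phi> M))"
proof -
  interpret M: right_module A M by fact
  have i: "inv_into (carrier M) \<phi> (\<phi> x) = x" if "x \<in> carrier M" for x using assms(2) that by simp
  show "right_module A (transport \<phi> M)"
  proof (intro right_module.intro right_module_axioms.intro abelian_groupI)
    fix p assume "p \<in> carrier (transport \<phi> M)"
    then obtain x where "x \<in> carrier M" "p = \<phi> x" by (auto simp: transport_def Let_def)
    then show "\<exists>q\<in>carrier (transport \<phi> M). q \<oplus>\<^bsub>transport \<phi> M\<^esub> p = \<zero>\<^bsub>transport \<phi> M\<^esub>"
      by (intro bexI[of _ "\<phi> (\<ominus>\<^bsub>M\<^esub> x)"]) (auto simp: transport_def Let_def i M.l_neg)
  qed (auto simp: transport_def Let_def i M.a_ac M.ract_closed M.ract_add_left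
      M.ract_add_right M.ract_mult M.ract_one M.ring_axioms)
  show "\<phi> \<in> mod_hom A M (transport \<phi> M)"
    by (rule mod_homI) (auto simp: transport_def Let_def i)
  show "bij_betw \<phi> (carrier M) (carrier (transport \<phi> M))"
    using assms(2) by (auto simp: transport_def Let_def bij_betw_def)
qed

text \<open>The quotient N/S. The action is a union over all representatives of a coset; this is a
  single coset as soon as S is a submodule.\<close>

definition mod_coker :: "('a, 'c) right_mod \<Rightarrow> 'c set \<Rightarrow> ('a, 'c set) right_mod" where
  "mod_coker N S =
     \<lparr>carrier = (\<lambda>y. S +>\<^bsub>N\<^esub> y) ` carrier N, mult = undefined, one = undefined, zero = S,
      add = set_add N, ract = (\<lambda>Y a. \<Union>y\<in>Y. S +>\<^bsub>N\<^esub> (y \<bullet>\<^bsub>N\<^esub> a))\<rparr>"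

lemma additive_subgroup_image:
  assumes "right_module A M" "right_module A N" "f \<in> mod_hom A M N"
  shows "additive_subgroup (f ` carrier M) N"
proof -
  interpret M: right_module A M by fact
  interpret N: right_module A N by fact
  note g = M.abelian_group_axioms N.abelian_group_axioms
  show ?thesis
  proof (rule additive_subgroup.intro, rule subgroup.intro)
    fix x assume "x \<in> f ` carrier M"
    then obtain m where m: "m \<in> carrier M" "x = f m" by auto
    have "inv\<^bsub>add_monoid N\<^esub> x = f (\<ominus>\<^bsub>M\<^esub> m)" using m mod_hom_uminus[OF assms(3) g m(1)] by (simp add: a_inv_def)
    then show "inv\<^bsub>add_monoid N\<^esub> x \<in> f ` carrier M" using m by auto
  next
    fix x y assume "x \<in> f ` carrier M" "y \<in> f ` carrier M"
    then obtain m m' where "m \<in> carrier M" "x = f m" "m' \<in> carrier M" "y = f m'" by auto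
    then have "x \<oplus>\<^bsub>N\<^esub> y = f (m \<oplus>\<^bsub>M\<^esub> m')" "m \<oplus>\<^bsub>M\<^esub> m' \<in> carrier M" using assms(3) by (auto simp: mod_hom_add)
    then show "x \<otimes>\<^bsub>add_monoid N\<^esub> y \<in> f ` carrier M" by auto
  next
    show "\<one>\<^bsub>add_monoid N\<^esub> \<in> f ` carrier M"
      using mod_hom_zero[OF assms(3) g] M.zero_closed by (metis image_eqI monoid.select_convs(2))
  qed (use assms mod_hom_closed in fastforce)
qed

lemma coset_eq_iff:
  assumes "abelian_group N" "additive_subgroup S N" "y \<in> carrier N" "y' \<in> carrier N"
  shows "S +>\<^bsub>N\<^esub> y = S +>\<^bsub>N\<^esub> y' \<longleftrightarrow> y \<ominus>\<^bsub>N\<^esub> y' \<in> S"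
proof -
  interpret N: abelian_group N by fact
  interpret S: abelian_subgroup S N
    by (rule abelian_subgroupI3) (use assms in auto)
  have mem: "y \<in> S +>\<^bsub>N\<^esub> y' \<longleftrightarrow> y \<ominus>\<^bsub>N\<^esub> y' \<in> S"
  proof
    assume "y \<in> S +>\<^bsub>N\<^esub> y'"
    then obtain s where s: "s \<in> S" "y = s \<oplus>\<^bsub>N\<^esub> y'" by (auto simp: a_r_coset_def r_coset_def)
    then have "y \<ominus>\<^bsub>N\<^esub> y' = s" using assms S.a_Hcarr by (simp add: N.a_assoc N.minus_eq N.r_neg)
    then show "y \<ominus>\<^bsub>N\<^esub> y' \<in> S" using s by simp
  next
    assume s: "y \<ominus>\<^bsub>N\<^esub> y' \<in> S"
    have "y = (y \<ominus>\<^bsub>N\<^esub> y') \<oplus>\<^bsub>N\<^esub> y'" using assms by (simp add: N.a_assoc N.minus_eq N.l_neg)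
    then show "y \<in> S +>\<^bsub>N\<^esub> y'" using s by (auto simp: a_r_coset_def r_coset_def)
  qed
  show ?thesis
  proof
    assume "S +>\<^bsub>N\<^esub> y = S +>\<^bsub>N\<^esub> y'"
    then show "y \<ominus>\<^bsub>N\<^esub> y' \<in> S" using S.a_rcos_self[OF assms(3)] mem by blast
  next
    assume "y \<ominus>\<^bsub>N\<^esub> y' \<in> S"
    then show "S +>\<^bsub>N\<^esub> y = S +>\<^bsub>N\<^esub> y'"
      using N.a_repr_independence[OF _ assms(4) S.a_subgroup] mem by simp
  qed
qed

lemma mod_coker:
  assumes "right_module A M" "right_module A N" "f \<in> mod_hom A M N"
  defines "S \<equiv> f ` carrier M"
  shows "right_module A (mod_coker N S)" "(\<lambda>y. S +>\<^bsub>N\<^esub> y) \<in> mod_hom A N (mod_coker N S)"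
    "(\<lambda>y. S +>\<^bsub>N\<^esub> y) ` carrier N = carrier (mod_coker N S)"
    "\<And>y. y \<in> carrier N \<Longrightarrow> S +>\<^bsub>N\<^esub> y = \<zero>\<^bsub>mod_coker N S\<^esub> \<longleftrightarrow> y \<in> S"
proof -
  interpret M: right_module A M by fact
  interpret N: right_module A N by fact
  have sub: "additive_subgroup S N" unfolding S_def by (rule additive_subgroup_image[OF assms(1-3)])
  interpret S: abelian_subgroup S N
    by (rule abelian_subgroupI3) (use sub N.abelian_group_axioms in auto)
  note eq = coset_eq_iff[OF N.abelian_group_axioms sub]
  let ?Q = "mod_coker N S"
  have add: "(S +>\<^bsub>N\<^esub> y) \<oplus>\<^bsub>?Q\<^esub> (S +>\<^bsub>N\<^esub> y') = S +>\<^bsub>N\<^esub> (y \<oplus>\<^bsub>N\<^esub> y')" if "y \<in> carrier N" "y' \<in> carrier N" for y y'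
    using S.a_rcos_sum[OF that] by (simp add: mod_coker_def)
  \<comment> \<open>The image of a homomorphism is a submodule, since (f m) a = f (m a); this makes
    the action on cosets well defined.\<close>
  have Sact: "s \<bullet>\<^bsub>N\<^esub> a \<in> S" if "s \<in> S" "a \<in> carrier A" for s a
    using that assms(3) M.ract_closed by (auto simp: S_def mod_hom_ract[symmetric])
  have act: "(S +>\<^bsub>N\<^esub> y) \<bullet>\<^bsub>?Q\<^esub> a = S +>\<^bsub>N\<^esub> (y \<bullet>\<^bsub>N\<^esub> a)" if y: "y \<in> carrier N" and a: "a \<in> carrier A" for y a
  proof -
    \<comment> \<open>Independence of the representative: z a - y a = (z - y) a lies in S.\<close>
    have "S +>\<^bsub>N\<^esub> (z \<bullet>\<^bsub>N\<^esub> a) = S +>\<^bsub>N\<^esub> (y \<bullet>\<^bsub>N\<^esub> a)" if z: "z \<in> S +>\<^bsub>N\<^esub> y" for z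
    proof -
      have zc: "z \<in> carrier N" using z y S.a_subset N.a_r_coset_subset_G by blast
      have "S +>\<^bsub>N\<^esub> z = S +>\<^bsub>N\<^esub> y" using N.a_repr_independence[OF z y S.a_subgroup] by simp
      then have "(z \<ominus>\<^bsub>N\<^esub> y) \<bullet>\<^bsub>N\<^esub> a \<in> S" using eq[OF zc y] Sact a by blast
      then have "z \<bullet>\<^bsub>N\<^esub> a \<ominus>\<^bsub>N\<^esub> y \<bullet>\<^bsub>N\<^esub> a \<in> S"
        using y zc a by (simp add: a_minus_def N.ract_add_left N.ract_minus)
      then show ?thesis using eq N.ract_closed y zc a by blast
    qed
    moreover have "y \<in> S +>\<^bsub>N\<^esub> y" using y by (rule S.a_rcos_self)
    ultimately have "(\<Union>z\<in>S +>\<^bsub>N\<^esub> y. S +>\<^bsub>N\<^esub> (z \<bullet>\<^bsub>N\<^esub> a)) = S +>\<^bsub>N\<^esub> (y \<bullet>\<^bsub>N\<^esub> a)" by blast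
    then show ?thesis by (simp add: mod_coker_def)
  qed
  have z: "\<zero>\<^bsub>?Q\<^esub> = S +>\<^bsub>N\<^esub> \<zero>\<^bsub>N\<^esub>" using S.a_subset by (simp add: mod_coker_def N.a_coset_add_zero)
  have car: "carrier ?Q = (\<lambda>y. S +>\<^bsub>N\<^esub> y) ` carrier N" by (simp add: mod_coker_def)
  show "right_module A ?Q"
  proof (intro right_module.intro right_module_axioms.intro abelian_groupI)
    fix p assume "p \<in> carrier ?Q"
    then obtain y where "y \<in> carrier N" "p = S +>\<^bsub>N\<^esub> y" by (auto simp: car)
    then show "\<exists>q\<in>carrier ?Q. q \<oplus>\<^bsub>?Q\<^esub> p = \<zero>\<^bsub>?Q\<^esub>"
      by (intro bexI[of _ "S +>\<^bsub>N\<^esub> (\<ominus>\<^bsub>N\<^esub> y)"]) (auto simp: car z add N.l_neg)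
  qed (auto simp: car z add act N.a_ac N.ract_closed N.ract_add_left
      N.ract_add_right N.ract_mult N.ract_one right_module_ring[OF assms(1)])
  show "(\<lambda>y. S +>\<^bsub>N\<^esub> y) \<in> mod_hom A N ?Q"
    by (rule mod_homI) (auto simp: car add act)
  show "(\<lambda>y. S +>\<^bsub>N\<^esub> y) ` carrier N = carrier ?Q" by (simp add: car)
  show "S +>\<^bsub>N\<^esub> y = \<zero>\<^bsub>?Q\<^esub> \<longleftrightarrow> y \<in> S" if "y \<in> carrier N" for y
    using eq[OF that N.zero_closed] that abelian_group_uminus_zero[OF N.abelian_group_axioms] by (simp add: z a_minus_def)
qed


text \<open>Makes the image of a homomorphism available as a target, so that lifting along
  surjections also serves maps that are not surjective.\<close>

lemma right_module_image:
  assumes "right_module A M" "right_module A N" "f \<in> mod_hom A M N"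
  shows "right_module A (N\<lparr>carrier := f ` carrier M\<rparr>)"
proof -
  interpret M: right_module A M by fact
  interpret N: right_module A N by fact
  note g = M.abelian_group_axioms N.abelian_group_axioms
  interpret S: additive_subgroup "f ` carrier M" N by (rule additive_subgroup_image[OF assms])
  have act: "f x \<bullet>\<^bsub>N\<^esub> a \<in> f ` carrier M" if "x \<in> carrier M" "a \<in> carrier A" for x a
    using that assms(3) M.ract_closed by (auto simp: mod_hom_ract[symmetric])
  show ?thesis
  proof (intro right_module.intro right_module_axioms.intro abelian_groupI)
    fix p assume p: "p \<in> carrier (N\<lparr>carrier := f ` carrier M\<rparr>)"
    then have "\<ominus>\<^bsub>N\<^esub> p \<in> f ` carrier M" using S.a_inv_closed by simp
    then show "\<exists>q\<in>carrier (N\<lparr>carrier := f ` carrier M\<rparr>).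
        q \<oplus>\<^bsub>N\<lparr>carrier := f ` carrier M\<rparr>\<^esub> p = \<zero>\<^bsub>N\<lparr>carrier := f ` carrier M\<rparr>\<^esub>"
      by (intro bexI[of _ "\<ominus>\<^bsub>N\<^esub> p"]) (use p S.a_Hcarr in \<open>auto simp: N.l_neg\<close>)
  next
    fix x y assume "x \<in> carrier (N\<lparr>carrier := f ` carrier M\<rparr>)" "y \<in> carrier (N\<lparr>carrier := f ` carrier M\<rparr>)"
    then show "x \<oplus>\<^bsub>N\<lparr>carrier := f ` carrier M\<rparr>\<^esub> y \<in> carrier (N\<lparr>carrier := f ` carrier M\<rparr>)"
      using S.a_closed by simp
  next
    show "\<zero>\<^bsub>N\<lparr>carrier := f ` carrier M\<rparr>\<^esub> \<in> carrier (N\<lparr>carrier := f ` carrier M\<rparr>)"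
      using S.zero_closed by simp
  qed (use assms(3) act in \<open>auto simp: mod_hom_closed N.a_ac N.ract_closed N.ract_add_left
      N.ract_add_right N.ract_mult N.ract_one right_module_ring[OF assms(1)]\<close>)
qed

text \<open>The inductive step for finite direct sums: properties of binary sums pass to families
  along this isomorphism.\<close>

lemma mod_Sum_insert:
  assumes "j \<notin> J"
  shows "(\<lambda>(x, p). p(j := x)) \<in> mod_hom A (mod_sum (M j) (mod_Sum J M)) (mod_Sum (insert j J) M)"
    "bij_betw (\<lambda>(x, p). p(j := x)) (carrier (mod_sum (M j) (mod_Sum J M))) (carrier (mod_Sum (insert j J) M))"
proof -
  show "(\<lambda>(x, p). p(j := x)) \<in> mod_hom A (mod_sum (M j) (mod_Sum J M)) (mod_Sum (insert j J) M)"
    using assms by (intro mod_homI) (auto simp: PiE_iff extensional_def fun_eq_iff)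
  show "bij_betw (\<lambda>(x, p). p(j := x)) (carrier (mod_sum (M j) (mod_Sum J M))) (carrier (mod_Sum (insert j J) M))"
    by (rule bij_betwI[where g = "\<lambda>p. (p j, p(j := undefined))"])
      (use assms in \<open>auto simp: PiE_iff extensional_def fun_eq_iff split: if_splits\<close>)
qed

subsection \<open>Finite-dimensional modules\<close>

text \<open>The ground field enters the homological part only through the elements
  \<open>c \<odot> \<one>\<close>, which lie in A and depend additively on c.\<close>

locale kalg = ring A for A :: "('k::field, 'a) module" (structure) +
  assumes smult_one_closed [simp]: "c \<odot> \<one> \<in> carrier A"
    and smult_one_add: "(c + d) \<odot> \<one> = c \<odot> \<one> \<oplus> d \<odot> \<one>"
begin

lemma smult_one_zero [simp]: "0 \<odot> \<one> = \<zero>"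
  using smult_one_add[of 0 0] add.l_cancel_one[of "0 \<odot> \<one>" "0 \<odot> \<one>"] by simp

text \<open>Spanning is phrased as an induction principle rather than by coefficients: a closed set
  S can be pulled back along homomorphisms without choosing any coefficients.\<close>

definition spanning :: "('a, 'b) right_mod \<Rightarrow> 'b set \<Rightarrow> bool" where
  "spanning M B \<longleftrightarrow> finite B \<and> B \<subseteq> carrier M \<and>
     (\<forall>S. S \<subseteq> carrier M \<and> \<zero>\<^bsub>M\<^esub> \<in> S \<and> (\<forall>x\<in>S. \<forall>y\<in>S. x \<oplus>\<^bsub>M\<^esub> y \<in> S) \<and>
        (\<forall>b\<in>B. \<forall>c. b \<bullet>\<^bsub>M\<^esub> (c \<odot> \<one>) \<in> S) \<longrightarrow> carrier M \<subseteq> S)"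

lemma spanningI:
  assumes "finite B" "B \<subseteq> carrier M"
    and "\<And>S. S \<subseteq> carrier M \<Longrightarrow> \<zero>\<^bsub>M\<^esub> \<in> S \<Longrightarrow> (\<And>x y. x \<in> S \<Longrightarrow> y \<in> S \<Longrightarrow> x \<oplus>\<^bsub>M\<^esub> y \<in> S) \<Longrightarrow>
      (\<And>b c. b \<in> B \<Longrightarrow> b \<bullet>\<^bsub>M\<^esub> (c \<odot> \<one>) \<in> S) \<Longrightarrow> carrier M \<subseteq> S"
  shows "spanning M B"
  unfolding spanning_def
proof (intro conjI allI impI)
  fix S assume "S \<subseteq> carrier M \<and> \<zero>\<^bsub>M\<^esub> \<in> S \<and> (\<forall>x\<in>S. \<forall>y\<in>S. x \<oplus>\<^bsub>M\<^esub> y \<in> S) \<and> (\<forall>b\<in>B. \<forall>c. b \<bullet>\<^bsub>M\<^esub> (c \<odot> \<one>) \<in> S)"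
  then have S: "S \<subseteq> carrier M" "\<zero>\<^bsub>M\<^esub> \<in> S" "\<forall>x\<in>S. \<forall>y\<in>S. x \<oplus>\<^bsub>M\<^esub> y \<in> S" "\<forall>b\<in>B. \<forall>c. b \<bullet>\<^bsub>M\<^esub> (c \<odot> \<one>) \<in> S"
    by - (elim conjE; assumption)+
  show "carrier M \<subseteq> S" by (rule assms(3)[OF S(1,2)]) (use S(3,4) in simp_all)
qed (rule assms)+

lemma spanningD:
  assumes "spanning M B" "S \<subseteq> carrier M" "\<zero>\<^bsub>M\<^esub> \<in> S"
    and "\<And>x y. x \<in> S \<Longrightarrow> y \<in> S \<Longrightarrow> x \<oplus>\<^bsub>M\<^esub> y \<in> S"
    and "\<And>b c. b \<in> B \<Longrightarrow> b \<in> carrier M \<Longrightarrow> b \<bullet>\<^bsub>M\<^esub> (c \<odot> \<one>) \<in> S"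
  shows "carrier M \<subseteq> S"
proof -
  have "B \<subseteq> carrier M" using assms(1) by (simp add: spanning_def)
  then have "S \<subseteq> carrier M \<and> \<zero>\<^bsub>M\<^esub> \<in> S \<and> (\<forall>x\<in>S. \<forall>y\<in>S. x \<oplus>\<^bsub>M\<^esub> y \<in> S) \<and> (\<forall>b\<in>B. \<forall>c. b \<bullet>\<^bsub>M\<^esub> (c \<odot> \<one>) \<in> S)"
    using assms(2-5) by blast
  then show ?thesis using assms(1) unfolding spanning_def by blast
qed

text \<open>The combinations over B form the least set containing 0 and all b (c 1) that is closed
  under addition.\<close>

lemma fd_module_iff: "fd_module A M \<longleftrightarrow> right_module A M \<and> (\<exists>B. spanning M B)"
proof (cases "right_module A M")
  case True
  then interpret M: right_module A M .
  have "spanning M B \<longleftrightarrow> finite B \<and> B \<subseteq> carrier M \<and>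
       (\<forall>x\<in>carrier M. \<exists>c :: 'b \<Rightarrow> 'k. x = (\<Oplus>\<^bsub>M\<^esub>b\<in>B. b \<bullet>\<^bsub>M\<^esub> (c b \<odot> \<one>)))" (is "?L \<longleftrightarrow> ?R") for B
  proof
    assume L: ?L
    then have fin: "finite B" and sub: "B \<subseteq> carrier M" by (auto simp: spanning_def)
    \<comment> \<open>The range of this map contains 0 and the generators and is closed under
      addition, so \<open>spanningD\<close> makes it the whole carrier.\<close>
    let ?f = "\<lambda>c :: 'b \<Rightarrow> 'k. \<Oplus>\<^bsub>M\<^esub>b\<in>B. b \<bullet>\<^bsub>M\<^esub> (c b \<odot> \<one>)"
    have cl: "b \<bullet>\<^bsub>M\<^esub> (c \<odot> \<one>) \<in> carrier M" if "b \<in> B" for b c using that sub by (auto intro: M.ract_closed)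
    have a: "?f c \<oplus>\<^bsub>M\<^esub> ?f c' = ?f (\<lambda>b. c b + c' b)" for c c'
    proof -
      have "?f (\<lambda>b. c b + c' b) = (\<Oplus>\<^bsub>M\<^esub>b\<in>B. b \<bullet>\<^bsub>M\<^esub> (c b \<odot> \<one>) \<oplus>\<^bsub>M\<^esub> b \<bullet>\<^bsub>M\<^esub> (c' b \<odot> \<one>))"
        by (rule M.finsum_cong') (use sub cl in \<open>auto simp: smult_one_add M.ract_add_right subset_iff\<close>)
      then show ?thesis using cl by (simp add: M.finsum_addf)
    qed
    have z: "?f (\<lambda>b. 0) = \<zero>\<^bsub>M\<^esub>"
    proof -
      have "?f (\<lambda>b. 0) = (\<Oplus>\<^bsub>M\<^esub>b\<in>B. \<zero>\<^bsub>M\<^esub>)"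
        by (rule M.finsum_cong') (use sub in \<open>auto simp: subset_iff\<close>)
      then show ?thesis by simp
    qed
    have s: "b \<bullet>\<^bsub>M\<^esub> (c \<odot> \<one>) = ?f (\<lambda>b'. if b' = b then c else 0)" if b: "b \<in> B" for b c
    proof -
      have "?f (\<lambda>b'. if b' = b then c else 0) = (\<Oplus>\<^bsub>M\<^esub>b'\<in>B. if b' = b then b \<bullet>\<^bsub>M\<^esub> (c \<odot> \<one>) else \<zero>\<^bsub>M\<^esub>)"
        by (rule M.finsum_cong') (use sub b cl in \<open>auto simp: subset_iff\<close>)
      also have "\<dots> = b \<bullet>\<^bsub>M\<^esub> (c \<odot> \<one>)"
        using M.finsum_singleton[OF b fin, of "\<lambda>_. b \<bullet>\<^bsub>M\<^esub> (c \<odot> \<one>)"] b cl by (simp add: eq_commute[of b])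
      finally show ?thesis ..
    qed
    have "carrier M \<subseteq> range ?f"
    proof (rule spanningD[OF L])
      show "range ?f \<subseteq> carrier M" using cl by (auto intro!: M.finsum_closed)
      show "x \<oplus>\<^bsub>M\<^esub> y \<in> range ?f" if "x \<in> range ?f" "y \<in> range ?f" for x y using a that by auto
      show "\<zero>\<^bsub>M\<^esub> \<in> range ?f" by (rule range_eqI[of _ _ "\<lambda>_. 0"]) (rule z[symmetric])
      show "b \<bullet>\<^bsub>M\<^esub> (c \<odot> \<one>) \<in> range ?f" if "b \<in> B" for b c
        by (rule range_eqI[of _ _ "\<lambda>b'. if b' = b then c else 0"]) (rule s[OF that])
    qed
    then show ?R using fin sub by blast
  next
    assume R: ?R
    have "carrier M \<subseteq> S" if S: "S \<subseteq> carrier M" "\<zero>\<^bsub>M\<^esub> \<in> S" "\<forall>x\<in>S. \<forall>y\<in>S. x \<oplus>\<^bsub>M\<^esub> y \<in> S"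
      "\<forall>b\<in>B. \<forall>c. b \<bullet>\<^bsub>M\<^esub> (c \<odot> \<one>) \<in> S" for S
    proof
      fix x assume "x \<in> carrier M"
      then obtain c :: "'b \<Rightarrow> 'k" where x: "x = (\<Oplus>\<^bsub>M\<^esub>b\<in>B. b \<bullet>\<^bsub>M\<^esub> (c b \<odot> \<one>))" using R by blast
      \<comment> \<open>S is closed under binary sums only, hence an induction over the subsets of
        B.\<close>
      have "(\<Oplus>\<^bsub>M\<^esub>b\<in>B'. b \<bullet>\<^bsub>M\<^esub> (c b \<odot> \<one>)) \<in> S" if "finite B'" "B' \<subseteq> B" for B'
        using that
      proof (induction B' rule: finite_induct)
        case (insert b B')
        have "b' \<bullet>\<^bsub>M\<^esub> (c b' \<odot> \<one>) \<in> carrier M" if "b' \<in> insert b B'" for b' using that S insert by blast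
        then show ?case using insert S by (auto simp: M.finsum_insert)
      qed (use S in simp)
      then show "x \<in> S" using R x by blast
    qed
    then show ?L using R by (auto simp: spanning_def)
  qed
  then show ?thesis using True by (simp add: fd_module_def)
qed (simp add: fd_module_def)

lemma fd_right: "fd_module A M \<Longrightarrow> right_module A M"
  by (simp add: fd_module_def)

text \<open>The image of a spanning set spans: a closed set in N is tested on its preimage in
  M.\<close>

lemma fd_module_image:
  assumes "fd_module A M" "right_module A N" "f \<in> mod_hom A M N" "f ` carrier M = carrier N"
  shows "fd_module A N"
proof -
  interpret M: right_module A M using assms(1) by (rule fd_right)
  interpret N: right_module A N by fact
  obtain B where B: "spanning M B" using assms(1) fd_module_iff by blast
  have "spanning N (f ` B)"
  proof (rule spanningI)
    show "finite (f ` B)" "f ` B \<subseteq> carrier N" using B assms(4) by (auto simp: spanning_def)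
    fix S assume S: "S \<subseteq> carrier N" "\<zero>\<^bsub>N\<^esub> \<in> S" "\<And>x y. x \<in> S \<Longrightarrow> y \<in> S \<Longrightarrow> x \<oplus>\<^bsub>N\<^esub> y \<in> S"
      "\<And>b c. b \<in> f ` B \<Longrightarrow> b \<bullet>\<^bsub>N\<^esub> (c \<odot> \<one>) \<in> S"
    have sub: "carrier M \<subseteq> {x \<in> carrier M. f x \<in> S}"
    proof (rule spanningD[OF B])
      show "\<zero>\<^bsub>M\<^esub> \<in> {x \<in> carrier M. f x \<in> S}"
        using S(2) by (simp add: mod_hom_zero[OF assms(3) M.abelian_group_axioms N.abelian_group_axioms])
    qed (simp_all add: S(3,4) mod_hom_add[OF assms(3)] mod_hom_ract[OF assms(3)] M.ract_closed subset_iff)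
    have "f ` carrier M \<subseteq> S" by (rule image_subsetI) (use sub in \<open>auto simp: subset_iff\<close>)
    then show "carrier N \<subseteq> S" by (simp only: assms(4))
  qed
  then show ?thesis using fd_module_iff assms(2) by blast
qed

lemma fd_module_zero_mod: "fd_module A zero_mod"
  unfolding fd_module_iff
  by (intro conjI right_module_zero_mod exI[of _ "{}"]) (auto simp: spanning_def ring_axioms)

lemma fd_module_mod_sum:
  assumes "fd_module A M" "fd_module A N" shows "fd_module A (mod_sum M N)"
proof -
  interpret M: right_module A M using assms(1) by (rule fd_right)
  interpret N: right_module A N using assms(2) by (rule fd_right)
  obtain B B' where B: "spanning M B" and B': "spanning N B'"
    using assms(1)[unfolded fd_module_iff] assms(2)[unfolded fd_module_iff] by blast
  have "spanning (mod_sum M N) (B \<times> {\<zero>\<^bsub>N\<^esub>} \<union> {\<zero>\<^bsub>M\<^esub>} \<times> B')" (is "spanning _ ?B")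
  proof (rule spanningI)
    show "finite ?B" "?B \<subseteq> carrier (mod_sum M N)" using B B' by (auto simp: spanning_def)
    fix S assume S: "S \<subseteq> carrier (mod_sum M N)" "\<zero>\<^bsub>mod_sum M N\<^esub> \<in> S"
      "\<And>x y. x \<in> S \<Longrightarrow> y \<in> S \<Longrightarrow> x \<oplus>\<^bsub>mod_sum M N\<^esub> y \<in> S"
      "\<And>b c. b \<in> ?B \<Longrightarrow> b \<bullet>\<^bsub>mod_sum M N\<^esub> (c \<odot> \<one>) \<in> S"
    have add: "(x \<oplus>\<^bsub>M\<^esub> x', y \<oplus>\<^bsub>N\<^esub> y') \<in> S" if "(x, y) \<in> S" "(x', y') \<in> S" for x x' y y'
      using S(3)[OF that] by simp
    have act: "(b \<bullet>\<^bsub>M\<^esub> (c \<odot> \<one>), \<zero>\<^bsub>N\<^esub>) \<in> S" if "b \<in> B" for b c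
      using S(4)[of "(b, \<zero>\<^bsub>N\<^esub>)" c] that by simp
    have act': "(\<zero>\<^bsub>M\<^esub>, b \<bullet>\<^bsub>N\<^esub> (c \<odot> \<one>)) \<in> S" if "b \<in> B'" for b c
      using S(4)[of "(\<zero>\<^bsub>M\<^esub>, b)" c] that by simp
    have "carrier M \<subseteq> {x \<in> carrier M. (x, \<zero>\<^bsub>N\<^esub>) \<in> S}"
    proof (rule spanningD[OF B])
      fix x y assume "x \<in> {x \<in> carrier M. (x, \<zero>\<^bsub>N\<^esub>) \<in> S}" "y \<in> {x \<in> carrier M. (x, \<zero>\<^bsub>N\<^esub>) \<in> S}"
      then show "x \<oplus>\<^bsub>M\<^esub> y \<in> {x \<in> carrier M. (x, \<zero>\<^bsub>N\<^esub>) \<in> S}" using add[of x "\<zero>\<^bsub>N\<^esub>" y "\<zero>\<^bsub>N\<^esub>"] by simp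
    qed (use S(2) act in \<open>simp_all add: M.ract_closed subset_iff\<close>)
    moreover have "carrier N \<subseteq> {y \<in> carrier N. (\<zero>\<^bsub>M\<^esub>, y) \<in> S}"
    proof (rule spanningD[OF B'])
      fix x y assume "x \<in> {x \<in> carrier N. (\<zero>\<^bsub>M\<^esub>, x) \<in> S}" "y \<in> {x \<in> carrier N. (\<zero>\<^bsub>M\<^esub>, x) \<in> S}"
      then show "x \<oplus>\<^bsub>N\<^esub> y \<in> {x \<in> carrier N. (\<zero>\<^bsub>M\<^esub>, x) \<in> S}" using add[of "\<zero>\<^bsub>M\<^esub>" x "\<zero>\<^bsub>M\<^esub>" y] by simp
    qed (use S(2) act' in \<open>simp_all add: N.ract_closed subset_iff\<close>)
    ultimately have "(x, y) \<in> S" if "x \<in> carrier M" "y \<in> carrier N" for x y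
      using add[of x "\<zero>\<^bsub>N\<^esub>" "\<zero>\<^bsub>M\<^esub>" y] that by (auto simp: subset_iff)
    then show "carrier (mod_sum M N) \<subseteq> S" by auto
  qed
  then show ?thesis using fd_module_iff right_module_mod_sum[OF M.right_module_axioms N.right_module_axioms] by blast
qed

text \<open>The binary sum of \<open>M j\<close> with a module of functions has elements of a
  product type. The step is therefore phrased for every Z of the function type that is isomorphic to
  it.\<close>

lemma mod_Sum_induct:
  assumes "finite J" "\<And>j. j \<in> J \<Longrightarrow> right_module A (M j)"
    and iso: "\<And>(X :: ('a, 'b) right_mod) (Y :: ('a, 'j \<Rightarrow> 'b) right_mod) (Z :: ('a, 'j \<Rightarrow> 'b) right_mod) f j J'. 
       j \<in> J \<Longrightarrow> J' \<subseteq> J \<Longrightarrow> X = M j \<Longrightarrow> P Y \<Longrightarrow> right_module A Y \<Longrightarrow> right_module A Z \<Longrightarrow>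
       f \<in> mod_hom A (mod_sum X Y) Z \<Longrightarrow> bij_betw f (carrier (mod_sum X Y)) (carrier Z) \<Longrightarrow> P Z"
    and empty: "\<And>Y :: ('a, 'j \<Rightarrow> 'b) right_mod. right_module A Y \<Longrightarrow> carrier Y = {\<zero>\<^bsub>Y\<^esub>} \<Longrightarrow> P Y"
  shows "P (mod_Sum J M)"
proof -
  have "P (mod_Sum J' M)" if "finite J'" "J' \<subseteq> J" for J'
    using that
  proof (induction J' rule: finite_induct)
    case empty
    show ?case by (rule assms(4)) (auto intro!: right_module_mod_Sum ring_axioms)
  next
    case (insert j J')
    show ?case
      by (rule iso[OF _ _ refl _ _ _ mod_Sum_insert(1)[OF insert.hyps(2)] mod_Sum_insert(2)[OF insert.hyps(2)]])
        (use insert assms(2) in \<open>auto intro!: right_module_mod_Sum ring_axioms\<close>)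
  qed
  then show ?thesis using assms(1) by blast
qed

lemma fd_module_trivial:
  assumes "right_module A Y" "carrier Y = {\<zero>\<^bsub>Y\<^esub>}" shows "fd_module A Y"
  unfolding fd_module_iff using assms by (intro conjI exI[of _ "{}"]) (auto simp: spanning_def)

lemma fd_module_mod_Sum:
  assumes "finite J" "\<And>j. j \<in> J \<Longrightarrow> fd_module A (M j)" shows "fd_module A (mod_Sum J M)"
  using assms(1)
proof (rule mod_Sum_induct)
  fix X :: "('a, 'c) right_mod" and Y Z :: "('a, 'b \<Rightarrow> 'c) right_mod" and f j J'
  assume "j \<in> J" "X = M j" "fd_module A Y" "right_module A Z" "f \<in> mod_hom A (mod_sum X Y) Z"
    "bij_betw f (carrier (mod_sum X Y)) (carrier Z)"
  then show "fd_module A Z" by (intro fd_module_image[OF fd_module_mod_sum[of X Y], of Z f])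
    (auto simp: assms bij_betw_def)
qed (auto intro: fd_module_trivial fd_right assms)

text \<open>Number a finite spanning set and send an element to a chosen coefficient vector;
  elements with equal coefficients coincide.\<close>

lemma fd_module_inj:
  assumes "fd_module A M"
  shows "\<exists>\<phi> :: 'b \<Rightarrow> nat \<Rightarrow> 'k. inj_on \<phi> (carrier (M :: ('a, 'b) right_mod))"
proof -
  interpret M: right_module A M using assms by (rule fd_right)
  obtain B where B: "finite B" "B \<subseteq> carrier M"
    "\<forall>x\<in>carrier M. \<exists>c :: 'b \<Rightarrow> 'k. x = (\<Oplus>\<^bsub>M\<^esub>b\<in>B. b \<bullet>\<^bsub>M\<^esub> (c b \<odot> \<one>))"
    using assms unfolding fd_module_def by blast
  obtain c :: "'b \<Rightarrow> 'b \<Rightarrow> 'k" where c: "\<forall>x\<in>carrier M. x = (\<Oplus>\<^bsub>M\<^esub>b\<in>B. b \<bullet>\<^bsub>M\<^esub> (c x b \<odot> \<one>))"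
    using B(3) by metis
  obtain f :: "'b \<Rightarrow> nat" where f: "inj_on f B" using finite_imp_inj_to_nat_seg[OF B(1)] by blast
  have "inj_on (\<lambda>x n. c x (inv_into B f n)) (carrier M)"
  proof (rule inj_onI)
    fix x y assume xy: "x \<in> carrier M" "y \<in> carrier M" "(\<lambda>n. c x (inv_into B f n)) = (\<lambda>n. c y (inv_into B f n))"
    have "c x b = c y b" if "b \<in> B" for b using fun_cong[OF xy(3), of "f b"] f that by simp
    then have "(\<Oplus>\<^bsub>M\<^esub>b\<in>B. b \<bullet>\<^bsub>M\<^esub> (c x b \<odot> \<one>)) = (\<Oplus>\<^bsub>M\<^esub>b\<in>B. b \<bullet>\<^bsub>M\<^esub> (c y b \<odot> \<one>))"
      by (intro M.finsum_cong') (use B in \<open>auto intro: M.ract_closed\<close>)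
    then show "x = y" using c xy by metis
  qed
  then show ?thesis by blast
qed

text \<open>An arbitrary choice, injective when M is finite-dimensional by
  \<open>fd_module_inj\<close>.\<close>

definition enc :: "('a, 'b) right_mod \<Rightarrow> 'b \<Rightarrow> nat \<Rightarrow> 'k" where
  "enc M = (SOME \<phi>. inj_on \<phi> (carrier M))"

definition dec :: "('a, 'b) right_mod \<Rightarrow> (nat \<Rightarrow> 'k) \<Rightarrow> 'b" where
  "dec M = inv_into (carrier M) (enc M)"

definition copy_mod :: "('a, 'b) right_mod \<Rightarrow> ('a, nat \<Rightarrow> 'k) right_mod" where
  "copy_mod M = transport (enc M) M"

lemma copy_mod:
  assumes "fd_module A M"
  shows "fd_module A (copy_mod M)" "enc M \<in> mod_hom A M (copy_mod M)"
    "bij_betw (enc M) (carrier M) (carrier (copy_mod M))"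
    "dec M \<in> mod_hom A (copy_mod M) M" "bij_betw (dec M) (carrier (copy_mod M)) (carrier M)"
    "\<And>x. x \<in> carrier M \<Longrightarrow> dec M (enc M x) = x"
    "\<And>y. y \<in> carrier (copy_mod M) \<Longrightarrow> enc M (dec M y) = y"
proof -
  have i: "inj_on (enc M) (carrier M)" unfolding enc_def by (rule someI_ex[OF fd_module_inj[OF assms]])
  note t = transport[OF fd_right[OF assms] i, folded copy_mod_def]
  show "enc M \<in> mod_hom A M (copy_mod M)" "bij_betw (enc M) (carrier M) (carrier (copy_mod M))" by (rule t)+
  then show "fd_module A (copy_mod M)" using fd_module_image[OF assms t(1,2)] by (simp add: bij_betw_def)
  show "dec M \<in> mod_hom A (copy_mod M) M" unfolding dec_def
    by (rule mod_hom_inv_into[OF fd_right[OF assms] t(2,3)])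
  show "bij_betw (dec M) (carrier (copy_mod M)) (carrier M)" unfolding dec_def by (rule bij_betw_inv_into[OF t(3)])
  show "dec M (enc M x) = x" if "x \<in> carrier M" for x using that i by (simp add: dec_def)
  show "enc M (dec M y) = y" if "y \<in> carrier (copy_mod M)" for y
    using that t(3) by (simp add: dec_def bij_betw_def f_inv_into_f)
qed

subsection \<open>Projective modules\<close>

lemma fg_projective_fd: "fg_projective A P \<Longrightarrow> fd_module A P"
  by (simp add: fg_projective_def)

text \<open>The definition of projectivity tests surjections between modules of one fixed element
  type. Cutting N down to the image of e gives a surjection, and passing to copies gives the element
  type.\<close>

lemma fg_projective_lift:
  assumes "fg_projective A P" "fd_module A M" "right_module A N"
    and e: "e \<in> mod_hom A M N" and h: "h \<in> mod_hom A P N" and sub: "h ` carrier P \<subseteq> e ` carrier M"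
  shows "\<exists>l\<in>mod_hom A P M. \<forall>x\<in>carrier P. e (l x) = h x"
proof -
  let ?I = "N\<lparr>carrier := e ` carrier M\<rparr>"
  have rI: "right_module A ?I" by (rule right_module_image[OF fd_right[OF assms(2)] assms(3) e])
  have eI: "e \<in> mod_hom A M ?I" using e by (auto simp: mod_hom_def)
  have hI: "h \<in> mod_hom A P ?I" using h sub by (auto simp: mod_hom_def)
  have fI: "fd_module A ?I" by (rule fd_module_image[OF assms(2) rI eI]) simp
  note cM = copy_mod[OF assms(2)] and cI = copy_mod[OF fI]
  have 1: "enc ?I \<circ> (e \<circ> dec M) \<in> mod_hom A (copy_mod M) (copy_mod ?I)"
    by (intro mod_hom_comp[of _ _ _ ?I] mod_hom_comp[of _ _ _ M] cM cI eI)
  have 2: "enc ?I \<circ> h \<in> mod_hom A P (copy_mod ?I)"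
    by (intro mod_hom_comp[of _ _ _ ?I] cI hI)
  have 3: "(enc ?I \<circ> (e \<circ> dec M)) ` carrier (copy_mod M) = carrier (copy_mod ?I)"
  proof -
    have "(enc ?I \<circ> (e \<circ> dec M)) ` carrier (copy_mod M) = enc ?I ` e ` dec M ` carrier (copy_mod M)"
      by (simp only: image_comp)
    then show ?thesis using bij_betw_imp_surj_on[OF cM(5)] bij_betw_imp_surj_on[OF cI(3)] by simp
  qed
  obtain l where l: "l \<in> mod_hom A P (copy_mod M)" "\<forall>x\<in>carrier P. (enc ?I \<circ> (e \<circ> dec M)) (l x) = (enc ?I \<circ> h) x"
    using assms(1) 1 2 3 cM(1) cI(1) unfolding fg_projective_def by blast
  have "e ((dec M \<circ> l) x) = h x" if x: "x \<in> carrier P" for x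
  proof -
    have "dec M (l x) \<in> carrier M" by (rule mod_hom_closed[OF cM(4) mod_hom_closed[OF l(1) x]])
    then have "e (dec M (l x)) \<in> carrier ?I" by simp
    moreover have "h x \<in> carrier ?I" by (rule mod_hom_closed[OF hI x])
    moreover have "enc ?I (e (dec M (l x))) = enc ?I (h x)" using l(2) x by simp
    ultimately have "e (dec M (l x)) = h x" using cI(6) by metis
    then show ?thesis by simp
  qed
  then show ?thesis using mod_hom_comp[OF l(1) cM(4)] by blast
qed

lemma fg_projective_iso:
  assumes "fg_projective A P" "right_module A P'" "f \<in> mod_hom A P P'" "bij_betw f (carrier P) (carrier P')"
  shows "fg_projective A P'"
  unfolding fg_projective_def
proof (intro conjI allI ballI impI)
  show "fd_module A P'" using fd_module_image[OF fg_projective_fd[OF assms(1)] assms(2,3)] assms(4) by (simp add: bij_betw_def)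
  let ?g = "inv_into (carrier P) f"
  have g: "?g \<in> mod_hom A P' P" by (rule mod_hom_inv_into[OF fd_right[OF fg_projective_fd[OF assms(1)]] assms(3,4)])
  fix M N :: "('a, nat \<Rightarrow> 'k) right_mod" and e h
  assume e: "e \<in> mod_hom A M N" and h: "h \<in> mod_hom A P' N" and *: "fd_module A M \<and> fd_module A N \<and> e ` carrier M = carrier N"
  then obtain l where l: "l \<in> mod_hom A P M" "\<forall>x\<in>carrier P. e (l x) = (h \<circ> f) x"
    using assms(1) mod_hom_comp[OF assms(3) h] unfolding fg_projective_def by blast
  have "e ((l \<circ> ?g) x) = h x" if "x \<in> carrier P'" for x
    using l(2) mod_hom_closed[OF g that] that assms(4) by (simp add: bij_betw_def f_inv_into_f)
  then show "\<exists>l\<in>mod_hom A P' M. \<forall>x\<in>carrier P'. e (l x) = h x" using mod_hom_comp[OF g l(1)] by blast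
qed

lemma fg_projective_trivial:
  assumes "right_module A Y" "carrier Y = {\<zero>\<^bsub>Y\<^esub>}" shows "fg_projective A Y"
  unfolding fg_projective_def
proof (intro conjI allI ballI impI)
  fix M N :: "('a, nat \<Rightarrow> 'k) right_mod" and e h
  assume e: "e \<in> mod_hom A M N" and h: "h \<in> mod_hom A Y N" and *: "fd_module A M \<and> fd_module A N \<and> e ` carrier M = carrier N"
  have r: "right_module A M" "right_module A N" using * by (auto intro: fd_right)
  have "e \<zero>\<^bsub>M\<^esub> = \<zero>\<^bsub>N\<^esub>" "h \<zero>\<^bsub>Y\<^esub> = \<zero>\<^bsub>N\<^esub>"
    by (rule mod_hom_zero[OF e r[THEN right_module_group]])
      (rule mod_hom_zero[OF h right_module_group[OF assms(1)] right_module_group[OF r(2)]])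
  then show "\<exists>l\<in>mod_hom A Y M. \<forall>x\<in>carrier Y. e (l x) = h x"
    using assms(2) r(1) by (intro bexI[of _ "\<lambda>_. \<zero>\<^bsub>M\<^esub>"] mod_hom_zero_map) auto
qed (rule fd_module_trivial[OF assms])

lemma fg_projective_zero_mod: "fg_projective A zero_mod"
  by (rule fg_projective_trivial) (auto intro: right_module_zero_mod ring_axioms)

lemma mod_sum_maps:
  assumes "right_module A M" "right_module A N"
  shows "(\<lambda>x. (x, \<zero>\<^bsub>N\<^esub>)) \<in> mod_hom A M (mod_sum M N)" "(\<lambda>y. (\<zero>\<^bsub>M\<^esub>, y)) \<in> mod_hom A N (mod_sum M N)"
    "fst \<in> mod_hom A (mod_sum M N) M" "snd \<in> mod_hom A (mod_sum M N) N"
proof -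
  interpret M: right_module A M by fact
  interpret N: right_module A N by fact
  show "(\<lambda>x. (x, \<zero>\<^bsub>N\<^esub>)) \<in> mod_hom A M (mod_sum M N)" "(\<lambda>y. (\<zero>\<^bsub>M\<^esub>, y)) \<in> mod_hom A N (mod_sum M N)"
    "fst \<in> mod_hom A (mod_sum M N) M" "snd \<in> mod_hom A (mod_sum M N) N"
    by (intro mod_homI; auto)+
qed

lemma fg_projective_mod_sum:
  assumes "fg_projective A P" "fg_projective A P'" shows "fg_projective A (mod_sum P P')"
proof -
  note fd = assms[THEN fg_projective_fd]
  note r = fd[THEN fd_right]
  note m = mod_sum_maps[OF r]
  interpret P: right_module A P by (rule r)
  interpret P': right_module A P' by (rule r)
  show ?thesis unfolding fg_projective_def
  proof (intro conjI allI ballI impI fd_module_mod_sum fd)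
    fix M N :: "('a, nat \<Rightarrow> 'k) right_mod" and e h
    assume e: "e \<in> mod_hom A M N" and h: "h \<in> mod_hom A (mod_sum P P') N"
      and *: "fd_module A M \<and> fd_module A N \<and> e ` carrier M = carrier N"
    then have rM: "right_module A M" using fd_right by blast
    obtain l where l: "l \<in> mod_hom A P M" "\<forall>x\<in>carrier P. e (l x) = (h \<circ> (\<lambda>x. (x, \<zero>\<^bsub>P'\<^esub>))) x"
      using assms(1) mod_hom_comp[OF m(1) h] e * unfolding fg_projective_def by blast
    obtain l' where l': "l' \<in> mod_hom A P' M" "\<forall>x\<in>carrier P'. e (l' x) = (h \<circ> (\<lambda>y. (\<zero>\<^bsub>P\<^esub>, y))) x"
      using assms(2) mod_hom_comp[OF m(2) h] e * unfolding fg_projective_def by blast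
    let ?l = "\<lambda>p. (l \<circ> fst) p \<oplus>\<^bsub>M\<^esub> (l' \<circ> snd) p"
    have "e (?l p) = h p" if "p \<in> carrier (mod_sum P P')" for p
    proof -
      have "e (?l p) = h (fst p, \<zero>\<^bsub>P'\<^esub>) \<oplus>\<^bsub>N\<^esub> h (\<zero>\<^bsub>P\<^esub>, snd p)"
        using that l l' mod_hom_closed[OF l(1)] mod_hom_closed[OF l'(1)] by (auto simp: mod_hom_add[OF e])
      also have "\<dots> = h (p)" using that by (auto simp: mod_hom_add[OF h, symmetric])
      finally show ?thesis .
    qed
    then show "\<exists>l\<in>mod_hom A (mod_sum P P') M. \<forall>x\<in>carrier (mod_sum P P'). e (l x) = h x"
      by (intro bexI[of _ ?l] mod_hom_add_map mod_hom_comp[OF m(3) l(1)] mod_hom_comp[OF m(4) l'(1)] rM) auto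
  qed
qed

lemma fg_projective_mod_Sum:
  assumes "finite J" "\<And>j. j \<in> J \<Longrightarrow> fg_projective A (M j)" shows "fg_projective A (mod_Sum J M)"
  using assms(1)
proof (rule mod_Sum_induct)
  fix X :: "('a, 'c) right_mod" and Y Z :: "('a, 'b \<Rightarrow> 'c) right_mod" and f j J'
  assume "j \<in> J" "X = M j" "fg_projective A Y" "right_module A Z" "f \<in> mod_hom A (mod_sum X Y) Z"
    "bij_betw f (carrier (mod_sum X Y)) (carrier Z)"
  then show "fg_projective A Z" using assms by (intro fg_projective_iso[of "mod_sum X Y" Z f] fg_projective_mod_sum) auto
qed (auto intro: fg_projective_trivial fd_right fg_projective_fd assms)

end

section \<open>Bounded complexes\<close>

lemma (in abelian_group) minus_eq_iff:
  "a \<in> carrier G \<Longrightarrow> b \<in> carrier G \<Longrightarrow> c \<in> carrier G \<Longrightarrow> a \<ominus> b = c \<longleftrightarrow> a = c \<oplus> b"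
  by (metis a_assoc minus_eq a_inv_closed l_neg r_neg r_zero)

lemma (in abelian_group) minus_self: "a \<in> carrier G \<Longrightarrow> a \<ominus> a = \<zero>"
  by (simp add: minus_eq r_neg)

lemma a_r_coset_mem: "x \<in> H +>\<^bsub>G\<^esub> a \<longleftrightarrow> (\<exists>h\<in>H. x = h \<oplus>\<^bsub>G\<^esub> a)"
  by (auto simp: a_r_coset_def')

context kalg
begin

lemma bounded_complexI:
  assumes "\<And>n. fd_module A (obj X n)" "\<And>n. dif X n \<in> mod_hom A (obj X n) (obj X (n + 1))"
    and "\<And>n x. x \<in> carrier (obj X n) \<Longrightarrow> dif X (n + 1) (dif X n x) = \<zero>\<^bsub>obj X (n + 1 + 1)\<^esub>"
    and "\<And>n. \<bar>n\<bar> > N \<Longrightarrow> carrier (obj X n) = {\<zero>\<^bsub>obj X n\<^esub>}"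
  shows "bounded_complex A X"
  using assms unfolding bounded_complex_def by blast

lemma bc_fd: "bounded_complex A X \<Longrightarrow> fd_module A (obj X n)"
  by (simp add: bounded_complex_def)

lemma bc_right: "bounded_complex A X \<Longrightarrow> right_module A (obj X n)"
  by (rule fd_right[OF bc_fd])

lemma bc_group: "bounded_complex A X \<Longrightarrow> abelian_group (obj X n)"
  by (rule right_module_group[OF bc_right])

text \<open>The target degree is a separate variable, so that the rule also matches degrees written
  as \<open>n - 1\<close> and \<open>n\<close>. The rules below follow the same pattern.\<close>

lemma bc_dif: "bounded_complex A X \<Longrightarrow> m = n + 1 \<Longrightarrow> dif X n \<in> mod_hom A (obj X n) (obj X m)"
  by (simp add: bounded_complex_def)

lemma bc_dd:
  "bounded_complex A X \<Longrightarrow> x \<in> carrier (obj X n) \<Longrightarrow> m = n + 1 \<Longrightarrow> l = m + 1 \<Longrightarrow> dif X m (dif X n x) = \<zero>\<^bsub>obj X l\<^esub>"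
  by (simp add: bounded_complex_def)

lemma bc_closed:
  "bounded_complex A X \<Longrightarrow> x \<in> carrier (obj X n) \<Longrightarrow> m = n + 1 \<Longrightarrow> dif X n x \<in> carrier (obj X m)"
  by (rule mod_hom_closed[OF bc_dif])

lemma bc_zero: "bounded_complex A X \<Longrightarrow> m = n + 1 \<Longrightarrow> dif X n \<zero>\<^bsub>obj X n\<^esub> = \<zero>\<^bsub>obj X m\<^esub>"
  by (rule mod_hom_zero[OF bc_dif bc_group bc_group])

lemma cm_hom: "f \<in> chain_map A X Y \<Longrightarrow> f n \<in> mod_hom A (obj X n) (obj Y n)"
  by (simp add: chain_map_def)

lemma cm_closed: "f \<in> chain_map A X Y \<Longrightarrow> x \<in> carrier (obj X n) \<Longrightarrow> f n x \<in> carrier (obj Y n)"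
  by (rule mod_hom_closed[OF cm_hom])

lemma cm_add: "f \<in> chain_map A X Y \<Longrightarrow> x \<in> carrier (obj X n) \<Longrightarrow> y \<in> carrier (obj X n) \<Longrightarrow>
    f n (x \<oplus>\<^bsub>obj X n\<^esub> y) = f n x \<oplus>\<^bsub>obj Y n\<^esub> f n y"
  by (rule mod_hom_add[OF cm_hom])

lemma cm_dif: "f \<in> chain_map A X Y \<Longrightarrow> x \<in> carrier (obj X n) \<Longrightarrow> m = n + 1 \<Longrightarrow> f m (dif X n x) = dif Y n (f n x)"
  by (simp add: chain_map_def)

lemma cm_zero: "f \<in> chain_map A X Y \<Longrightarrow> bounded_complex A X \<Longrightarrow> bounded_complex A Y \<Longrightarrow> f n \<zero>\<^bsub>obj X n\<^esub> = \<zero>\<^bsub>obj Y n\<^esub>"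
  by (rule mod_hom_zero[OF cm_hom bc_group bc_group])

lemma cmI:
  assumes "\<And>n. f n \<in> mod_hom A (obj X n) (obj Y n)"
    and "\<And>n x. x \<in> carrier (obj X n) \<Longrightarrow> f (n + 1) (dif X n x) = dif Y n (f n x)"
  shows "f \<in> chain_map A X Y"
  using assms by (simp add: chain_map_def)

lemma cm_comp: "f \<in> chain_map A X Y \<Longrightarrow> g \<in> chain_map A Y Z \<Longrightarrow> (\<lambda>n. g n \<circ> f n) \<in> chain_map A X Z"
  by (rule cmI) (auto intro: mod_hom_comp cm_hom simp: cm_dif cm_closed)

lemma cm_id: "(\<lambda>n. id) \<in> chain_map A X X" "(\<lambda>n x. x) \<in> chain_map A X X"
  by (auto intro!: cmI mod_hom_id)

lemma cm_zero_map:
  assumes "bounded_complex A X" "bounded_complex A Y"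
  shows "(\<lambda>n x. \<zero>\<^bsub>obj Y n\<^esub>) \<in> chain_map A X Y"
  by (rule cmI) (auto intro: mod_hom_zero_map bc_right assms simp: bc_zero[OF assms(2)])

text \<open>The additive form f = d h + h d + g avoids the subtraction in the definition, which
  interacts badly with rewriting.\<close>

lemma homotopicI:
  assumes "bounded_complex A X" "bounded_complex A Y"
    and "\<And>n. f n \<in> mod_hom A (obj X n) (obj Y n)" "\<And>n. g n \<in> mod_hom A (obj X n) (obj Y n)"
    and "\<And>n. h n \<in> mod_hom A (obj X n) (obj Y (n - 1))"
    and "\<And>n x. x \<in> carrier (obj X n) \<Longrightarrow>
      f n x = (dif Y (n - 1) (h n x) \<oplus>\<^bsub>obj Y n\<^esub> h (n + 1) (dif X n x)) \<oplus>\<^bsub>obj Y n\<^esub> g n x"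
  shows "homotopic A X Y f g"
  unfolding homotopic_def
proof (intro exI[of _ h] allI conjI ballI)
  fix n x assume x: "x \<in> carrier (obj X n)"
  interpret Y: abelian_group "obj Y n" by (rule bc_group[OF assms(2)])
  have "h (n + 1) (dif X n x) \<in> carrier (obj Y n)"
    using mod_hom_closed[OF assms(5)[of "n + 1"] bc_closed[OF assms(1) x refl]] by simp
  moreover have "dif Y (n - 1) (h n x) \<in> carrier (obj Y n)"
    by (rule bc_closed[OF assms(2) mod_hom_closed[OF assms(5) x]]) simp
  ultimately show "f n x \<ominus>\<^bsub>obj Y n\<^esub> g n x = dif Y (n - 1) (h n x) \<oplus>\<^bsub>obj Y n\<^esub> h (n + 1) (dif X n x)"
    using assms(6)[OF x] mod_hom_closed[OF assms(4) x] mod_hom_closed[OF assms(3) x]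
    by (simp add: Y.minus_eq_iff)
qed (rule assms)

lemma homotopicD:
  assumes "homotopic A X Y f g" "bounded_complex A X" "bounded_complex A Y"
    and "\<And>n. f n \<in> mod_hom A (obj X n) (obj Y n)" "\<And>n. g n \<in> mod_hom A (obj X n) (obj Y n)"
  shows "\<exists>h. (\<forall>n. h n \<in> mod_hom A (obj X n) (obj Y (n - 1))) \<and> (\<forall>n. \<forall>x\<in>carrier (obj X n).
      f n x = (dif Y (n - 1) (h n x) \<oplus>\<^bsub>obj Y n\<^esub> h (n + 1) (dif X n x)) \<oplus>\<^bsub>obj Y n\<^esub> g n x)"
proof -
  obtain h where h: "\<And>n. h n \<in> mod_hom A (obj X n) (obj Y (n - 1))"
    "\<And>n x. x \<in> carrier (obj X n) \<Longrightarrow>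
      f n x \<ominus>\<^bsub>obj Y n\<^esub> g n x = dif Y (n - 1) (h n x) \<oplus>\<^bsub>obj Y n\<^esub> h (n + 1) (dif X n x)"
    using assms(1) unfolding homotopic_def by blast
  have "f n x = (dif Y (n - 1) (h n x) \<oplus>\<^bsub>obj Y n\<^esub> h (n + 1) (dif X n x)) \<oplus>\<^bsub>obj Y n\<^esub> g n x"
    if x: "x \<in> carrier (obj X n)" for n x
  proof -
    interpret Y: abelian_group "obj Y n" by (rule bc_group[OF assms(3)])
    have "h (n + 1) (dif X n x) \<in> carrier (obj Y n)"
      using mod_hom_closed[OF h(1)[of "n + 1"] bc_closed[OF assms(2) x refl]] by simp
    moreover have "dif Y (n - 1) (h n x) \<in> carrier (obj Y n)"
      by (rule bc_closed[OF assms(3) mod_hom_closed[OF h(1) x]]) simp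
    ultimately show ?thesis
      using h(2)[OF x] mod_hom_closed[OF assms(5) x] mod_hom_closed[OF assms(4) x]
      by (simp add: Y.minus_eq_iff)
  qed
  with h(1) show ?thesis by blast
qed

text \<open>Chain maps may differ outside the carriers; such maps are homotopic by the zero
  homotopy.\<close>

lemma homotopic_cong:
  assumes "bounded_complex A X" "bounded_complex A Y"
    and "\<And>n. f n \<in> mod_hom A (obj X n) (obj Y n)"
    and "\<And>n x. x \<in> carrier (obj X n) \<Longrightarrow> g n x = f n x"
  shows "homotopic A X Y f g" "homotopic A X Y g f"
proof -
  have g: "g n \<in> mod_hom A (obj X n) (obj Y n)" for n by (rule mod_hom_cong[OF assms(3) bc_right[OF assms(1)] assms(4)])
  have r: "(dif Y (n - 1) \<zero>\<^bsub>obj Y (n - 1)\<^esub> \<oplus>\<^bsub>obj Y n\<^esub> \<zero>\<^bsub>obj Y n\<^esub>) \<oplus>\<^bsub>obj Y n\<^esub> y = y"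
    if "y \<in> carrier (obj Y n)" for n y
  proof -
    interpret Y: abelian_group "obj Y n" by (rule bc_group[OF assms(2)])
    show ?thesis using that by (simp add: bc_zero[OF assms(2), of n])
  qed
  show "homotopic A X Y f g"
    by (rule homotopicI[OF assms(1-3) g, where h = "\<lambda>n x. \<zero>\<^bsub>obj Y (n - 1)\<^esub>"])
      (auto intro: mod_hom_zero_map bc_right[OF assms(2)] simp: r mod_hom_closed[OF assms(3)] assms(4))
  show "homotopic A X Y g f"
    by (rule homotopicI[OF assms(1,2) g assms(3), where h = "\<lambda>n x. \<zero>\<^bsub>obj Y (n - 1)\<^esub>"])
      (auto intro: mod_hom_zero_map bc_right[OF assms(2)] simp: r mod_hom_closed[OF assms(3)] assms(4))
qed

lemma homotopic_pre:
  assumes "homotopic A X Y f g" "bounded_complex A X" "bounded_complex A Y" "bounded_complex A W"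
    and "\<And>n. f n \<in> mod_hom A (obj X n) (obj Y n)" "\<And>n. g n \<in> mod_hom A (obj X n) (obj Y n)"
    and u: "u \<in> chain_map A W X"
  shows "homotopic A W Y (\<lambda>n. f n \<circ> u n) (\<lambda>n. g n \<circ> u n)"
proof -
  obtain h where h: "\<And>n. h n \<in> mod_hom A (obj X n) (obj Y (n - 1))"
    "\<And>n x. x \<in> carrier (obj X n) \<Longrightarrow>
      f n x = (dif Y (n - 1) (h n x) \<oplus>\<^bsub>obj Y n\<^esub> h (n + 1) (dif X n x)) \<oplus>\<^bsub>obj Y n\<^esub> g n x"
    using homotopicD[OF assms(1-3,5,6)] by blast
  show ?thesis
    by (rule homotopicI[OF assms(4,3), where h = "\<lambda>n. h n \<circ> u n"])
      (auto intro!: mod_hom_comp cm_hom[OF u] assms(5,6) h(1) simp: h(2) cm_closed[OF u] cm_dif[OF u])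
qed

lemma homotopic_post:
  assumes "homotopic A X Y f g" "bounded_complex A X" "bounded_complex A Y" "bounded_complex A V"
    and "\<And>n. f n \<in> mod_hom A (obj X n) (obj Y n)" "\<And>n. g n \<in> mod_hom A (obj X n) (obj Y n)"
    and v: "v \<in> chain_map A Y V"
  shows "homotopic A X V (\<lambda>n. v n \<circ> f n) (\<lambda>n. v n \<circ> g n)"
proof -
  obtain h where h: "\<And>n. h n \<in> mod_hom A (obj X n) (obj Y (n - 1))"
    "\<And>n x. x \<in> carrier (obj X n) \<Longrightarrow>
      f n x = (dif Y (n - 1) (h n x) \<oplus>\<^bsub>obj Y n\<^esub> h (n + 1) (dif X n x)) \<oplus>\<^bsub>obj Y n\<^esub> g n x"
    using homotopicD[OF assms(1-3,5,6)] by blast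
  show ?thesis
  proof (rule homotopicI[OF assms(2,4), where h = "\<lambda>n. v (n - 1) \<circ> h n"])
    fix n x assume x: "x \<in> carrier (obj X n)"
    interpret Y: abelian_group "obj Y n" by (rule bc_group[OF assms(3)])
    have c: "h (n + 1) (dif X n x) \<in> carrier (obj Y n)"
      using mod_hom_closed[OF h(1)[of "n + 1"] bc_closed[OF assms(2) x refl]] by simp
    have c': "h n x \<in> carrier (obj Y (n - 1))" "dif Y (n - 1) (h n x) \<in> carrier (obj Y n)"
      by (rule mod_hom_closed[OF h(1) x], rule bc_closed[OF assms(3) mod_hom_closed[OF h(1) x]]) simp
    show "(v n \<circ> f n) x = (dif V (n - 1) ((v (n - 1) \<circ> h n) x) \<oplus>\<^bsub>obj V n\<^esub> (v (n + 1 - 1) \<circ> h (n + 1)) (dif X n x))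
        \<oplus>\<^bsub>obj V n\<^esub> (v n \<circ> g n) x"
      using c c' x by (simp add: h(2) cm_add[OF v] mod_hom_closed[OF assms(6)] cm_dif[OF v c'(1), of n])
  qed (auto intro!: mod_hom_comp cm_hom[OF v] assms(5,6) h(1))
qed

subsection \<open>Quasi-isomorphisms\<close>

lemma coboundaries_subgroup:
  assumes "bounded_complex A X" shows "additive_subgroup (coboundaries X n) (obj X n)"
  unfolding coboundaries_def
  by (rule additive_subgroup_image[OF bc_right[OF assms] bc_right[OF assms] bc_dif[OF assms]]) simp

lemma coboundariesD: "x \<in> coboundaries X n \<longleftrightarrow> (\<exists>v\<in>carrier (obj X (n - 1)). x = dif X (n - 1) v)"
  by (auto simp: coboundaries_def)

text \<open>The union over representatives in the definition collapses, because f sends boundaries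
  to boundaries.\<close>

lemma cohomology_map_coset:
  assumes X: "bounded_complex A X" and Y: "bounded_complex A Y" and f: "f \<in> chain_map A X Y" and z: "z \<in> carrier (obj X n)"
  shows "cohomology_map Y f n (coboundaries X n +>\<^bsub>obj X n\<^esub> z) = coboundaries Y n +>\<^bsub>obj Y n\<^esub> f n z"
proof -
  interpret XG: abelian_group "obj X n" by (rule bc_group[OF X])
  interpret YG: abelian_group "obj Y n" by (rule bc_group[OF Y])
  interpret S: abelian_subgroup "coboundaries X n" "obj X n"
    by (rule abelian_subgroupI3[OF coboundaries_subgroup[OF X] bc_group[OF X]])
  have "coboundaries Y n +>\<^bsub>obj Y n\<^esub> f n z' = coboundaries Y n +>\<^bsub>obj Y n\<^esub> f n z"
    if zz: "z' \<in> coboundaries X n +>\<^bsub>obj X n\<^esub> z" for z'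
  proof -
    obtain v where v: "v \<in> carrier (obj X (n - 1))" "z' = dif X (n - 1) v \<oplus>\<^bsub>obj X n\<^esub> z"
      using zz unfolding a_r_coset_mem by (auto simp: coboundaries_def)
    have dv: "dif X (n - 1) v \<in> carrier (obj X n)" by (rule bc_closed[OF X v(1)]) simp
    have dfv: "dif Y (n - 1) (f (n - 1) v) \<in> carrier (obj Y n)" by (rule bc_closed[OF Y cm_closed[OF f v(1)]]) simp
    have "f n z' = dif Y (n - 1) (f (n - 1) v) \<oplus>\<^bsub>obj Y n\<^esub> f n z"
      using v(1) dv z by (simp add: v(2) cm_add[OF f] cm_dif[OF f v(1), of n])
    then have "f n z' \<ominus>\<^bsub>obj Y n\<^esub> f n z = dif Y (n - 1) (f (n - 1) v)"
      using dfv z by (simp add: YG.minus_eq_iff cm_closed[OF f])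
    then have "f n z' \<ominus>\<^bsub>obj Y n\<^esub> f n z \<in> coboundaries Y n" using cm_closed[OF f v(1)] by (auto simp: coboundaries_def)
    then show ?thesis
      using coset_eq_iff[OF bc_group[OF Y] coboundaries_subgroup[OF Y], of "f n z'" n "f n z"] z dv v(2)
      by (simp add: cm_closed[OF f])
  qed
  moreover have "z \<in> coboundaries X n +>\<^bsub>obj X n\<^esub> z" by (rule S.a_rcos_self[OF z])
  ultimately show ?thesis unfolding cohomology_map_def by blast
qed

text \<open>The two clauses are injectivity and surjectivity on cohomology in terms of elements. All
  later arguments use this form, so cosets do not occur in them.\<close>

lemma quasi_iso_iff:
  assumes X: "bounded_complex A X" and Y: "bounded_complex A Y"
  shows "f \<in> quasi_iso A X Y \<longleftrightarrow> f \<in> chain_map A X Y \<and>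
    (\<forall>n. \<forall>z\<in>carrier (obj X n). \<forall>w\<in>carrier (obj Y (n - 1)). dif X n z = \<zero>\<^bsub>obj X (n + 1)\<^esub> \<longrightarrow> f n z = dif Y (n - 1) w \<longrightarrow>
       (\<exists>v\<in>carrier (obj X (n - 1)). z = dif X (n - 1) v)) \<and>
    (\<forall>n. \<forall>y\<in>carrier (obj Y n). dif Y n y = \<zero>\<^bsub>obj Y (n + 1)\<^esub> \<longrightarrow>
       (\<exists>z\<in>carrier (obj X n). dif X n z = \<zero>\<^bsub>obj X (n + 1)\<^esub> \<and> (\<exists>w\<in>carrier (obj Y (n - 1)). y = dif Y (n - 1) w \<oplus>\<^bsub>obj Y n\<^esub> f n z)))"
proof (cases "f \<in> chain_map A X Y")
  case f: True
  have main: "bij_betw (cohomology_map Y f n) (cohomology X n) (cohomology Y n) \<longleftrightarrow>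
    (\<forall>z\<in>carrier (obj X n). \<forall>w\<in>carrier (obj Y (n - 1)). dif X n z = \<zero>\<^bsub>obj X (n + 1)\<^esub> \<longrightarrow> f n z = dif Y (n - 1) w \<longrightarrow>
       (\<exists>v\<in>carrier (obj X (n - 1)). z = dif X (n - 1) v)) \<and>
    (\<forall>y\<in>carrier (obj Y n). dif Y n y = \<zero>\<^bsub>obj Y (n + 1)\<^esub> \<longrightarrow>
       (\<exists>z\<in>carrier (obj X n). dif X n z = \<zero>\<^bsub>obj X (n + 1)\<^esub> \<and> (\<exists>w\<in>carrier (obj Y (n - 1)). y = dif Y (n - 1) w \<oplus>\<^bsub>obj Y n\<^esub> f n z)))"
    (is "_ \<longleftrightarrow> ?I \<and> ?S") for n
  proof -
    interpret XG: abelian_group "obj X n" by (rule bc_group[OF X])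
    interpret YG: abelian_group "obj Y n" by (rule bc_group[OF Y])
    interpret SX: additive_subgroup "coboundaries X n" "obj X n" by (rule coboundaries_subgroup[OF X])
    interpret SY: additive_subgroup "coboundaries Y n" "obj Y n" by (rule coboundaries_subgroup[OF Y])
    note eqX = coset_eq_iff[OF bc_group[OF X] coboundaries_subgroup[OF X]]
    note eqY = coset_eq_iff[OF bc_group[OF Y] coboundaries_subgroup[OF Y]]
    note map = cohomology_map_coset[OF X Y f]
    have cyc: "z \<in> cocycles X n \<longleftrightarrow> z \<in> carrier (obj X n) \<and> dif X n z = \<zero>\<^bsub>obj X (n + 1)\<^esub>" for z
      by (auto simp: cocycles_def)
    have cycY: "z \<in> cocycles Y n \<longleftrightarrow> z \<in> carrier (obj Y n) \<and> dif Y n z = \<zero>\<^bsub>obj Y (n + 1)\<^esub>" for z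
      by (auto simp: cocycles_def)
    have fcyc: "f n z \<in> cocycles Y n" if "z \<in> cocycles X n" for z
      using that cm_dif[OF f, of z n] cm_zero[OF f X Y] by (simp add: cyc cycY cm_closed[OF f])
    have zcyc: "\<zero>\<^bsub>obj X n\<^esub> \<in> cocycles X n" by (simp add: cyc bc_zero[OF X])
    have mcyc: "z \<ominus>\<^bsub>obj X n\<^esub> z' \<in> cocycles X n" if "z \<in> cocycles X n" "z' \<in> cocycles X n" for z z'
      using that mod_hom_minus[OF bc_dif[OF X refl] bc_group[OF X] bc_group[OF X], of z n z']
      by (simp add: cyc abelian_group.minus_self[OF bc_group[OF X]] abelian_groupE(2)[OF bc_group[OF X]])
    have fm: "f n (z \<ominus>\<^bsub>obj X n\<^esub> z') = f n z \<ominus>\<^bsub>obj Y n\<^esub> f n z'" if "z \<in> cocycles X n" "z' \<in> cocycles X n" for z z'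
      using that mod_hom_minus[OF cm_hom[OF f] bc_group[OF X] bc_group[OF Y]] by (simp add: cyc)
    have f0: "f n \<zero>\<^bsub>obj X n\<^esub> = \<zero>\<^bsub>obj Y n\<^esub>" by (rule cm_zero[OF f X Y])
    \<comment> \<open>Injectivity is tested on differences of cocycles, that is, on the
      kernel.\<close>
    have I: "inj_on (cohomology_map Y f n) (cohomology X n) \<longleftrightarrow> ?I"
    proof
      assume inj: "inj_on (cohomology_map Y f n) (cohomology X n)"
      have "z \<in> coboundaries X n" if z: "z \<in> cocycles X n" and w: "f n z \<in> coboundaries Y n" for z
      proof -
        have "cohomology_map Y f n (coboundaries X n +>\<^bsub>obj X n\<^esub> z) = cohomology_map Y f n (coboundaries X n +>\<^bsub>obj X n\<^esub> \<zero>\<^bsub>obj X n\<^esub>)"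
          using z w fcyc[OF z] by (simp add: cyc cycY map f0 eqY YG.minus_eq abelian_group_uminus_zero[OF bc_group[OF Y]])
        then have "coboundaries X n +>\<^bsub>obj X n\<^esub> z = coboundaries X n +>\<^bsub>obj X n\<^esub> \<zero>\<^bsub>obj X n\<^esub>"
          using inj z zcyc unfolding inj_on_def cohomology_def by blast
        then show ?thesis using z by (simp add: cyc eqX XG.minus_eq abelian_group_uminus_zero[OF bc_group[OF X]])
      qed
      then show ?I unfolding cyc coboundariesD by blast
    next
      assume ?I
      then have k: "z \<in> coboundaries X n" if "z \<in> cocycles X n" "f n z \<in> coboundaries Y n" for z
        using that unfolding cyc coboundariesD by blast
      show "inj_on (cohomology_map Y f n) (cohomology X n)"
      proof (rule inj_onI)
        fix a b assume a: "a \<in> cohomology X n" and b: "b \<in> cohomology X n" and e: "cohomology_map Y f n a = cohomology_map Y f n b"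
        obtain z z' where z: "z \<in> cocycles X n" "z' \<in> cocycles X n"
          and ab: "a = coboundaries X n +>\<^bsub>obj X n\<^esub> z" "b = coboundaries X n +>\<^bsub>obj X n\<^esub> z'"
          using a b unfolding cohomology_def by blast
        have "f n z \<ominus>\<^bsub>obj Y n\<^esub> f n z' \<in> coboundaries Y n"
          using e z fcyc[OF z(1)] fcyc[OF z(2)] by (simp add: ab map cyc cycY eqY)
        then have "z \<ominus>\<^bsub>obj X n\<^esub> z' \<in> coboundaries X n" using k[OF mcyc[OF z]] fm[OF z] by simp
        then show "a = b" using z by (simp add: ab eqX cyc)
      qed
    qed
    have S: "cohomology_map Y f n ` cohomology X n = cohomology Y n \<longleftrightarrow> ?S"
    proof
      assume s: "cohomology_map Y f n ` cohomology X n = cohomology Y n"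
      show ?S
      proof (intro ballI impI)
        fix y assume y: "y \<in> carrier (obj Y n)" "dif Y n y = \<zero>\<^bsub>obj Y (n + 1)\<^esub>"
        then have "coboundaries Y n +>\<^bsub>obj Y n\<^esub> y \<in> cohomology_map Y f n ` cohomology X n"
          unfolding s by (auto simp: cohomology_def cycY)
        then obtain z where z: "z \<in> cocycles X n"
          "coboundaries Y n +>\<^bsub>obj Y n\<^esub> y = coboundaries Y n +>\<^bsub>obj Y n\<^esub> f n z"
          unfolding cohomology_def using map by (auto simp: cyc)
        then have "y \<ominus>\<^bsub>obj Y n\<^esub> f n z \<in> coboundaries Y n" using eqY y fcyc[OF z(1)] by (simp add: cycY)
        then obtain w where w: "w \<in> carrier (obj Y (n - 1))" "y \<ominus>\<^bsub>obj Y n\<^esub> f n z = dif Y (n - 1) w"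
          by (auto simp: coboundariesD)
        have "dif Y (n - 1) w \<in> carrier (obj Y n)" using bc_closed[OF Y w(1), of n] by simp
        then have "y = dif Y (n - 1) w \<oplus>\<^bsub>obj Y n\<^esub> f n z"
          using w y fcyc[OF z(1)] by (simp add: YG.minus_eq_iff cycY)
        then show "\<exists>z\<in>carrier (obj X n). dif X n z = \<zero>\<^bsub>obj X (n + 1)\<^esub> \<and> (\<exists>w\<in>carrier (obj Y (n - 1)). y = dif Y (n - 1) w \<oplus>\<^bsub>obj Y n\<^esub> f n z)"
          using z(1) w(1) unfolding cyc by blast
      qed
    next
      assume s: ?S
      show "cohomology_map Y f n ` cohomology X n = cohomology Y n"
      proof (intro equalityI subsetI)
        fix c assume "c \<in> cohomology_map Y f n ` cohomology X n"
        then obtain z where z: "z \<in> cocycles X n" "c = coboundaries Y n +>\<^bsub>obj Y n\<^esub> f n z"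
          unfolding cohomology_def using map by (auto simp: cyc)
        then show "c \<in> cohomology Y n" using fcyc unfolding cohomology_def by blast
      next
        fix c assume "c \<in> cohomology Y n"
        then obtain y where y: "y \<in> cocycles Y n" "c = coboundaries Y n +>\<^bsub>obj Y n\<^esub> y" unfolding cohomology_def by blast
        then obtain z w where z: "z \<in> cocycles X n" and w: "w \<in> carrier (obj Y (n - 1))" "y = dif Y (n - 1) w \<oplus>\<^bsub>obj Y n\<^esub> f n z"
          using s unfolding cyc cycY by blast
        have "dif Y (n - 1) w \<in> carrier (obj Y n)" using bc_closed[OF Y w(1)] by simp
        then have "y \<ominus>\<^bsub>obj Y n\<^esub> f n z = dif Y (n - 1) w" using w y fcyc[OF z] by (simp add: YG.minus_eq_iff cycY)
        then have "y \<ominus>\<^bsub>obj Y n\<^esub> f n z \<in> coboundaries Y n" using w(1) by (auto simp: coboundariesD)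
        then have "c = coboundaries Y n +>\<^bsub>obj Y n\<^esub> f n z" using y fcyc[OF z] eqY by (simp add: cycY)
        then have "c = cohomology_map Y f n (coboundaries X n +>\<^bsub>obj X n\<^esub> z)" using z map by (simp add: cyc)
        then show "c \<in> cohomology_map Y f n ` cohomology X n" using z unfolding cohomology_def by blast
      qed
    qed
    show ?thesis unfolding bij_betw_def using I S by blast
  qed
  show ?thesis using f unfolding quasi_iso_def mem_Collect_eq main by blast
qed (simp add: quasi_iso_def)

lemma qi_cm: "f \<in> quasi_iso A X Y \<Longrightarrow> f \<in> chain_map A X Y"
  by (simp add: quasi_iso_def)

lemma qi_inj:
  assumes "f \<in> quasi_iso A X Y" "bounded_complex A X" "bounded_complex A Y"
    and "z \<in> carrier (obj X n)" "w \<in> carrier (obj Y (n - 1))" "dif X n z = \<zero>\<^bsub>obj X (n + 1)\<^esub>" "f n z = dif Y (n - 1) w"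
  obtains v where "v \<in> carrier (obj X (n - 1))" "z = dif X (n - 1) v"
  using assms(1,4-) unfolding quasi_iso_iff[OF assms(2,3)] by blast

lemma qi_surj:
  assumes "f \<in> quasi_iso A X Y" "bounded_complex A X" "bounded_complex A Y"
    and "y \<in> carrier (obj Y n)" "dif Y n y = \<zero>\<^bsub>obj Y (n + 1)\<^esub>"
  obtains z w where "z \<in> carrier (obj X n)" "dif X n z = \<zero>\<^bsub>obj X (n + 1)\<^esub>" "w \<in> carrier (obj Y (n - 1))"
    "y = dif Y (n - 1) w \<oplus>\<^bsub>obj Y n\<^esub> f n z"
  using assms(1,4-) unfolding quasi_iso_iff[OF assms(2,3)] by blast

lemma quasi_isoI:
  assumes "bounded_complex A X" "bounded_complex A Y" "f \<in> chain_map A X Y"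
    and "\<And>n z w. z \<in> carrier (obj X n) \<Longrightarrow> w \<in> carrier (obj Y (n - 1)) \<Longrightarrow> dif X n z = \<zero>\<^bsub>obj X (n + 1)\<^esub> \<Longrightarrow>
      f n z = dif Y (n - 1) w \<Longrightarrow> \<exists>v\<in>carrier (obj X (n - 1)). z = dif X (n - 1) v"
    and "\<And>n y. y \<in> carrier (obj Y n) \<Longrightarrow> dif Y n y = \<zero>\<^bsub>obj Y (n + 1)\<^esub> \<Longrightarrow>
      \<exists>z\<in>carrier (obj X n). dif X n z = \<zero>\<^bsub>obj X (n + 1)\<^esub> \<and> (\<exists>w\<in>carrier (obj Y (n - 1)). y = dif Y (n - 1) w \<oplus>\<^bsub>obj Y n\<^esub> f n z)"
  shows "f \<in> quasi_iso A X Y"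
  using assms(3-5) unfolding quasi_iso_iff[OF assms(1,2)] by blast

lemma qi_comp:
  assumes f: "f \<in> quasi_iso A X Y" and g: "g \<in> quasi_iso A Y Z"
    and X: "bounded_complex A X" and Y: "bounded_complex A Y" and Z: "bounded_complex A Z"
  shows "(\<lambda>n. g n \<circ> f n) \<in> quasi_iso A X Z"
proof -
  have "bij_betw (cohomology_map Z (\<lambda>n. g n \<circ> f n) n) (cohomology X n) (cohomology Z n)" for n
  proof -
    have "cohomology_map Z (\<lambda>n. g n \<circ> f n) n c = (cohomology_map Z g n \<circ> cohomology_map Y f n) c" if "c \<in> cohomology X n" for c
    proof -
      obtain z where z: "z \<in> carrier (obj X n)" "c = coboundaries X n +>\<^bsub>obj X n\<^esub> z"
        using \<open>c \<in> cohomology X n\<close> by (auto simp: cohomology_def cocycles_def)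
      then show ?thesis
        using cohomology_map_coset[OF X Y qi_cm[OF f]] cohomology_map_coset[OF Y Z qi_cm[OF g]]
          cohomology_map_coset[OF X Z cm_comp[OF qi_cm[OF f] qi_cm[OF g]]]
        by (simp add: cm_closed[OF qi_cm[OF f]])
    qed
    moreover have "bij_betw (cohomology_map Z g n \<circ> cohomology_map Y f n) (cohomology X n) (cohomology Z n)"
      using f g by (auto simp: quasi_iso_def intro: bij_betw_trans)
    ultimately show ?thesis by (subst bij_betw_cong) auto
  qed
  then show ?thesis using cm_comp[OF qi_cm[OF f] qi_cm[OF g]] by (simp add: quasi_iso_def)
qed

text \<open>On a cocycle the summand h d of the homotopy formula vanishes, so homotopic maps differ
  there by a boundary.\<close>

lemma homotopic_cocycle:
  assumes "homotopic A X Y f g" "bounded_complex A X" "bounded_complex A Y"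
    and "\<And>n. f n \<in> mod_hom A (obj X n) (obj Y n)" "\<And>n. g n \<in> mod_hom A (obj X n) (obj Y n)"
    and "z \<in> carrier (obj X n)" "dif X n z = \<zero>\<^bsub>obj X (n + 1)\<^esub>"
  obtains w where "w \<in> carrier (obj Y (n - 1))" "f n z = dif Y (n - 1) w \<oplus>\<^bsub>obj Y n\<^esub> g n z"
proof -
  interpret Y: abelian_group "obj Y n" by (rule bc_group[OF assms(3)])
  obtain h where h: "\<And>n. h n \<in> mod_hom A (obj X n) (obj Y (n - 1))"
    "\<And>n x. x \<in> carrier (obj X n) \<Longrightarrow>
      f n x = (dif Y (n - 1) (h n x) \<oplus>\<^bsub>obj Y n\<^esub> h (n + 1) (dif X n x)) \<oplus>\<^bsub>obj Y n\<^esub> g n x"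
    using homotopicD[OF assms(1-5)] by blast
  have w: "h n z \<in> carrier (obj Y (n - 1))" by (rule mod_hom_closed[OF h(1) assms(6)])
  have dw: "dif Y (n - 1) (h n z) \<in> carrier (obj Y n)" by (rule bc_closed[OF assms(3) w]) simp
  have "h (n + 1) \<zero>\<^bsub>obj X (n + 1)\<^esub> = \<zero>\<^bsub>obj Y n\<^esub>"
    using mod_hom_zero[OF h(1) bc_group[OF assms(2)] bc_group[OF assms(3)], of "n + 1"] by simp
  then have "f n z = dif Y (n - 1) (h n z) \<oplus>\<^bsub>obj Y n\<^esub> g n z" using h(2)[OF assms(6)] assms(7) dw by simp
  then show thesis using that w by blast
qed

text \<open>Homotopic chain maps induce the same map on cohomology.\<close>

lemma qi_homotopic:
  assumes f: "f \<in> quasi_iso A X Y" and g: "g \<in> chain_map A X Y" and H: "homotopic A X Y f g"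
    and X: "bounded_complex A X" and Y: "bounded_complex A Y"
  shows "g \<in> quasi_iso A X Y"
proof -
  note hf = cm_hom[OF qi_cm[OF f]] and hg = cm_hom[OF g]
  have "cohomology_map Y f n c = cohomology_map Y g n c" if "c \<in> cohomology X n" for n c
  proof -
    interpret YG: abelian_group "obj Y n" by (rule bc_group[OF Y])
    obtain z where z: "z \<in> carrier (obj X n)" "dif X n z = \<zero>\<^bsub>obj X (n + 1)\<^esub>" "c = coboundaries X n +>\<^bsub>obj X n\<^esub> z"
      using \<open>c \<in> cohomology X n\<close> by (auto simp: cohomology_def cocycles_def)
    obtain w where w: "w \<in> carrier (obj Y (n - 1))" "f n z = dif Y (n - 1) w \<oplus>\<^bsub>obj Y n\<^esub> g n z"
      by (rule homotopic_cocycle[OF H X Y hf hg z(1,2)])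
    have "dif Y (n - 1) w \<in> carrier (obj Y n)" by (rule bc_closed[OF Y w(1)]) simp
    then have "f n z \<ominus>\<^bsub>obj Y n\<^esub> g n z = dif Y (n - 1) w"
      using w(2) z mod_hom_closed[OF hf] mod_hom_closed[OF hg] by (simp add: YG.minus_eq_iff)
    then have "f n z \<ominus>\<^bsub>obj Y n\<^esub> g n z \<in> coboundaries Y n" using w(1) by (auto simp: coboundariesD)
    then show ?thesis
      using coset_eq_iff[OF bc_group[OF Y] coboundaries_subgroup[OF Y] mod_hom_closed[OF hf z(1)] mod_hom_closed[OF hg z(1)]] z
      by (simp add: cohomology_map_coset[OF X Y qi_cm[OF f]] cohomology_map_coset[OF X Y g])
  qed
  then have "bij_betw (cohomology_map Y g n) (cohomology X n) (cohomology Y n)" for n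
    using f bij_betw_cong[of "cohomology X n" "cohomology_map Y f n" "cohomology_map Y g n"]
    unfolding quasi_iso_def by blast
  then show ?thesis using g by (simp add: quasi_iso_def)
qed

subsection \<open>Isomorphisms and copies of complexes\<close>

definition cx_iso :: "('a, 'b) cochain \<Rightarrow> ('a, 'c) cochain \<Rightarrow> (int \<Rightarrow> 'b \<Rightarrow> 'c) set" where
  "cx_iso X Y = {f \<in> chain_map A X Y. \<forall>n. bij_betw (f n) (carrier (obj X n)) (carrier (obj Y n))}"

lemma cx_iso_cm: "f \<in> cx_iso X Y \<Longrightarrow> f \<in> chain_map A X Y"
  by (simp add: cx_iso_def)

lemma cx_iso_bij: "f \<in> cx_iso X Y \<Longrightarrow> bij_betw (f n) (carrier (obj X n)) (carrier (obj Y n))"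
  by (simp add: cx_iso_def)

lemma cx_isoI:
  assumes "\<And>n. f n \<in> mod_hom A (obj X n) (obj Y n)"
    and "\<And>n x. x \<in> carrier (obj X n) \<Longrightarrow> f (n + 1) (dif X n x) = dif Y n (f n x)"
    and "\<And>n. bij_betw (f n) (carrier (obj X n)) (carrier (obj Y n))"
  shows "f \<in> cx_iso X Y"
  using assms by (simp add: cx_iso_def cmI)

lemma cx_iso_id: "(\<lambda>n. id) \<in> cx_iso X X"
  by (simp add: cx_iso_def cm_id)

lemma cx_iso_comp: "f \<in> cx_iso X Y \<Longrightarrow> g \<in> cx_iso Y Z \<Longrightarrow> (\<lambda>n. g n \<circ> f n) \<in> cx_iso X Z"
  unfolding cx_iso_def by (auto intro: cm_comp bij_betw_trans)

lemma cx_iso_inv: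
  assumes f: "f \<in> cx_iso X Y" and X: "bounded_complex A X"
  shows "(\<lambda>n. inv_into (carrier (obj X n)) (f n)) \<in> cx_iso Y X"
proof (rule cx_isoI)
  let ?g = "\<lambda>n. inv_into (carrier (obj X n)) (f n)"
  show "?g n \<in> mod_hom A (obj Y n) (obj X n)" for n
    by (rule mod_hom_inv_into[OF bc_right[OF X] cm_hom[OF cx_iso_cm[OF f]] cx_iso_bij[OF f]])
  show b: "bij_betw (?g n) (carrier (obj Y n)) (carrier (obj X n))" for n by (rule bij_betw_inv_into[OF cx_iso_bij[OF f]])
  fix n y assume "y \<in> carrier (obj Y n)"
  then obtain x where x: "x \<in> carrier (obj X n)" "y = f n x" using cx_iso_bij[OF f, of n] by (auto simp: bij_betw_def)
  have i: "inj_on (f m) (carrier (obj X m))" for m using cx_iso_bij[OF f] by (auto simp: bij_betw_def)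
  have "dif Y n y = f (n + 1) (dif X n x)" using cm_dif[OF cx_iso_cm[OF f] x(1)] x(2) by simp
  then show "?g (n + 1) (dif Y n y) = dif X n (?g n y)" using x i bc_closed[OF X x(1)] by simp
qed

text \<open>On the carriers the differential of Y is the conjugate of that of X by f, and so
  inherits all its properties. Of Y only the module axioms have to be supplied.\<close>

lemma cx_iso_bounded:
  assumes X: "bounded_complex A X" and Y: "\<And>n. right_module A (obj Y n)" and f: "f \<in> cx_iso X Y"
  shows "bounded_complex A Y"
proof -
  let ?g = "\<lambda>n. inv_into (carrier (obj X n)) (f n)"
  note hf = cm_hom[OF cx_iso_cm[OF f]]
  have g: "?g n \<in> mod_hom A (obj Y n) (obj X n)" for n by (rule mod_hom_inv_into[OF bc_right[OF X] hf cx_iso_bij[OF f]])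
  have fg: "f n (?g n y) = y" if "y \<in> carrier (obj Y n)" for n y
    using that cx_iso_bij[OF f, of n] by (auto simp: bij_betw_def f_inv_into_f)
  have d: "dif Y n y = f (n + 1) (dif X n (?g n y))" if "y \<in> carrier (obj Y n)" for n y
    using cm_dif[OF cx_iso_cm[OF f] mod_hom_closed[OF g that] refl] fg[OF that] by simp
  have d': "dif Y n (f n x) = f (n + 1) (dif X n x)" if "x \<in> carrier (obj X n)" for n x
    using cm_dif[OF cx_iso_cm[OF f] that refl] by simp
  have z: "f n \<zero>\<^bsub>obj X n\<^esub> = \<zero>\<^bsub>obj Y n\<^esub>" for n by (rule mod_hom_zero[OF hf bc_group[OF X] right_module_group[OF Y]])
  obtain N where N: "\<forall>n. \<bar>n\<bar> > N \<longrightarrow> carrier (obj X n) = {\<zero>\<^bsub>obj X n\<^esub>}" using X by (auto simp: bounded_complex_def)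
  show ?thesis
  proof (rule bounded_complexI)
    show "fd_module A (obj Y n)" for n
      by (rule fd_module_image[OF bc_fd[OF X] Y hf]) (use cx_iso_bij[OF f] in \<open>auto simp: bij_betw_def\<close>)
    show "dif Y n \<in> mod_hom A (obj Y n) (obj Y (n + 1))" for n
      by (rule mod_hom_cong[OF mod_hom_comp[OF mod_hom_comp[OF g bc_dif[OF X refl]] hf] Y]) (simp add: d)
    show "dif Y (n + 1) (dif Y n y) = \<zero>\<^bsub>obj Y (n + 1 + 1)\<^esub>" if y: "y \<in> carrier (obj Y n)" for n y
      by (simp only: d[OF y] d'[OF bc_closed[OF X mod_hom_closed[OF g y] refl]] bc_dd[OF X mod_hom_closed[OF g y] refl refl] z)
    show "carrier (obj Y n) = {\<zero>\<^bsub>obj Y n\<^esub>}" if "\<bar>n\<bar> > N" for n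
      using N that cx_iso_bij[OF f, of n] z[of n] by (auto simp: bij_betw_def)
  qed
qed

lemma cx_iso_projective:
  assumes X: "projective_complex A X" and Y: "\<And>n. right_module A (obj Y n)" and f: "f \<in> cx_iso X Y"
  shows "projective_complex A Y"
  using cx_iso_bounded[OF _ Y f] X fg_projective_iso[OF _ Y cm_hom[OF cx_iso_cm[OF f]] cx_iso_bij[OF f]]
  by (simp add: projective_complex_def)

lemma pc_bc: "projective_complex A X \<Longrightarrow> bounded_complex A X"
  by (simp add: projective_complex_def)

lemma cx_iso_qi:
  assumes f: "f \<in> cx_iso X Y" and X: "bounded_complex A X" and Y: "bounded_complex A Y"
  shows "f \<in> quasi_iso A X Y"
proof (rule quasi_isoI[OF X Y cx_iso_cm[OF f]])
  note c = cx_iso_cm[OF f]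
  have i: "inj_on (f m) (carrier (obj X m))" and s: "f m ` carrier (obj X m) = carrier (obj Y m)" for m
    using cx_iso_bij[OF f] by (auto simp: bij_betw_def)
  fix n z w assume z: "z \<in> carrier (obj X n)" and "w \<in> carrier (obj Y (n - 1))" and e: "f n z = dif Y (n - 1) w"
  then obtain v where v: "v \<in> carrier (obj X (n - 1))" "w = f (n - 1) v" using s[of "n - 1"] by auto
  have "f n z = f n (dif X (n - 1) v)" using e v cm_dif[OF c v(1), of n] by simp
  then have "z = dif X (n - 1) v" using i[of n] z bc_closed[OF X v(1), of n] by (simp add: inj_on_eq_iff)
  then show "\<exists>v\<in>carrier (obj X (n - 1)). z = dif X (n - 1) v" using v(1) by blast
next
  note c = cx_iso_cm[OF f]
  have i: "inj_on (f m) (carrier (obj X m))" and s: "f m ` carrier (obj X m) = carrier (obj Y m)" for m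
    using cx_iso_bij[OF f] by (auto simp: bij_betw_def)
  fix n y assume y: "y \<in> carrier (obj Y n)" and d: "dif Y n y = \<zero>\<^bsub>obj Y (n + 1)\<^esub>"
  interpret Y: abelian_group "obj Y n" by (rule bc_group[OF Y])
  obtain z where z: "z \<in> carrier (obj X n)" "y = f n z" using y s[of n] by auto
  have "f (n + 1) (dif X n z) = f (n + 1) \<zero>\<^bsub>obj X (n + 1)\<^esub>" using d z cm_dif[OF c z(1)] cm_zero[OF c X Y] by simp
  then have "dif X n z = \<zero>\<^bsub>obj X (n + 1)\<^esub>"
    using i[of "n + 1"] bc_closed[OF X z(1)] abelian_groupE(2)[OF bc_group[OF X]] by (simp add: inj_on_eq_iff)
  moreover have "y = dif Y (n - 1) \<zero>\<^bsub>obj Y (n - 1)\<^esub> \<oplus>\<^bsub>obj Y n\<^esub> f n z" using bc_zero[OF Y, of n "n - 1"] y z by simp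
  moreover have "\<zero>\<^bsub>obj Y (n - 1)\<^esub> \<in> carrier (obj Y (n - 1))" by (rule abelian_groupE(2)[OF bc_group[OF Y]])
  ultimately show "\<exists>z\<in>carrier (obj X n). dif X n z = \<zero>\<^bsub>obj X (n + 1)\<^esub> \<and> (\<exists>w\<in>carrier (obj Y (n - 1)). y = dif Y (n - 1) w \<oplus>\<^bsub>obj Y n\<^esub> f n z)"
    using z(1) by blast
qed

text \<open>Roofs, perfect complexes and \<open>tri_generated\<close> are defined with complexes of
  this element type.\<close>

definition copy_cx :: "('a, 'b) cochain \<Rightarrow> ('a, nat \<Rightarrow> 'k) cochain" where
  "copy_cx X = \<lparr>obj = (\<lambda>n. copy_mod (obj X n)), dif = (\<lambda>n. enc (obj X (n + 1)) \<circ> dif X n \<circ> dec (obj X n))\<rparr>"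

abbreviation enc_cx :: "('a, 'b) cochain \<Rightarrow> int \<Rightarrow> 'b \<Rightarrow> nat \<Rightarrow> 'k" where
  "enc_cx X \<equiv> \<lambda>n. enc (obj X n)"

abbreviation dec_cx :: "('a, 'b) cochain \<Rightarrow> int \<Rightarrow> (nat \<Rightarrow> 'k) \<Rightarrow> 'b" where
  "dec_cx X \<equiv> \<lambda>n. dec (obj X n)"

lemma copy_cx:
  assumes "bounded_complex A X"
  shows "bounded_complex A (copy_cx X)" "enc_cx X \<in> cx_iso X (copy_cx X)" "dec_cx X \<in> cx_iso (copy_cx X) X"
proof -
  note c = copy_mod[OF bc_fd[OF assms]]
  show e: "enc_cx X \<in> cx_iso X (copy_cx X)"
    by (rule cx_isoI) (auto simp: copy_cx_def c)
  show b: "bounded_complex A (copy_cx X)"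
    by (rule cx_iso_bounded[OF assms _ e]) (auto simp: copy_cx_def intro: fd_right c(1))
  show "dec_cx X \<in> cx_iso (copy_cx X) X"
    by (rule cx_isoI) (auto simp: copy_cx_def c(4,5) intro!: c(6) bc_closed[OF assms] mod_hom_closed[OF c(4)])
qed

lemma copy_cx_projective:
  assumes "projective_complex A X" shows "projective_complex A (copy_cx X)"
  by (rule cx_iso_projective[OF assms bc_right[OF copy_cx(1)] copy_cx(2)]) (rule pc_bc[OF assms])+

subsection \<open>Sums, shifts and cones\<close>

lemma bounded_degree: "bounded_complex A X \<Longrightarrow> \<exists>N\<ge>0. \<forall>n. \<bar>n\<bar> > N \<longrightarrow> carrier (obj X n) = {\<zero>\<^bsub>obj X n\<^esub>}"
  unfolding bounded_complex_def by (metis abs_ge_self abs_ge_zero le_less_trans)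

lemma cochain_sum_bounded:
  assumes X: "bounded_complex A X" and Y: "bounded_complex A Y"
  shows "bounded_complex A (cochain_sum X Y)"
proof -
  obtain N N' where N: "\<forall>n. \<bar>n\<bar> > N \<longrightarrow> carrier (obj X n) = {\<zero>\<^bsub>obj X n\<^esub>}" "\<forall>n. \<bar>n\<bar> > N' \<longrightarrow> carrier (obj Y n) = {\<zero>\<^bsub>obj Y n\<^esub>}"
    using bounded_degree[OF X] bounded_degree[OF Y] by blast
  show ?thesis
  proof (rule bounded_complexI[where N = "max N N'"])
    show "dif (cochain_sum X Y) n \<in> mod_hom A (obj (cochain_sum X Y) n) (obj (cochain_sum X Y) (n + 1))" for n
      by (rule mod_homI) (auto simp: cochain_sum_def mod_hom_closed[OF bc_dif[OF X refl]] mod_hom_closed[OF bc_dif[OF Y refl]]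
          mod_hom_add[OF bc_dif[OF X refl]] mod_hom_add[OF bc_dif[OF Y refl]] mod_hom_ract[OF bc_dif[OF X refl]] mod_hom_ract[OF bc_dif[OF Y refl]])
  qed (auto simp: cochain_sum_def fd_module_mod_sum bc_fd[OF X] bc_fd[OF Y] bc_dd[OF X] bc_dd[OF Y] N)
qed

lemma cochain_sum_projective:
  assumes "projective_complex A X" "projective_complex A Y"
  shows "projective_complex A (cochain_sum X Y)"
  using assms cochain_sum_bounded[of X Y] fg_projective_mod_sum unfolding projective_complex_def
  by (auto simp: cochain_sum_def)

lemma mod_hom_zero_mod: "(\<lambda>x. undefined) \<in> mod_hom A M zero_mod"
  by (rule mod_homI) auto

lemma mod_hom_pair:
  "f \<in> mod_hom A L M \<Longrightarrow> g \<in> mod_hom A L N \<Longrightarrow> (\<lambda>x. (f x, g x)) \<in> mod_hom A L (mod_sum M N)"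
  by (rule mod_homI) (auto simp: mod_hom_closed mod_hom_add mod_hom_ract)

lemma stalk_bounded: "fd_module A M \<Longrightarrow> bounded_complex A (stalk M)"
  by (rule bounded_complexI[where N = 0])
    (auto simp: stalk_def fd_module_zero_mod mod_hom_zero_mod intro: mod_hom_zero_map fd_right fd_module_zero_mod)

lemma stalk_projective: "fg_projective A M \<Longrightarrow> projective_complex A (stalk M)"
  using stalk_bounded[OF fg_projective_fd] by (auto simp: projective_complex_def stalk_def fg_projective_zero_mod)

lemma two_term_bounded:
  assumes M: "fd_module A M" and N: "fd_module A N" and f: "f \<in> mod_hom A M N"
  shows "bounded_complex A (two_term d M N f)"
proof -
  have fd: "fd_module A (two_term_obj d M N n)" for n
    using assms by (auto simp: two_term_obj_def intro!: fd_module_mod_sum fd_module_zero_mod)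
  have f0: "f \<zero>\<^bsub>M\<^esub> = \<zero>\<^bsub>N\<^esub>" by (rule mod_hom_zero[OF f]) (rule right_module_group[OF fd_right], rule assms)+
  show ?thesis
  proof (rule bounded_complexI[where N = "\<bar>d\<bar> + 1"])
    show "fd_module A (obj (two_term d M N f) n)" for n using fd by (simp add: two_term_def)
    show "dif (two_term d M N f) n \<in> mod_hom A (obj (two_term d M N f) n) (obj (two_term d M N f) (n + 1))" for n
    proof (cases "n = d")
      case True
      then show ?thesis using f by (intro mod_homI)
        (auto simp: two_term_def two_term_obj_def mod_hom_closed mod_hom_add mod_hom_ract)
    next
      case False
      then show ?thesis using mod_hom_zero_map[OF fd_right[OF fd[of "n + 1"]], of "two_term_obj d M N n"]
        by (simp add: two_term_def case_prod_beta')
    qed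
    show "dif (two_term d M N f) (n + 1) (dif (two_term d M N f) n x) = \<zero>\<^bsub>obj (two_term d M N f) (n + 1 + 1)\<^esub>" for n x
      by (cases "n = d") (auto simp: two_term_def two_term_obj_def f0 split: prod.split)
  qed (auto simp: two_term_def two_term_obj_def)
qed

lemma two_term_projective:
  assumes M: "fg_projective A M" and N: "fg_projective A N" and f: "f \<in> mod_hom A M N"
  shows "projective_complex A (two_term d M N f)"
  using two_term_bounded[OF fg_projective_fd[OF M] fg_projective_fd[OF N] f] assms
  by (auto simp: projective_complex_def two_term_def two_term_obj_def intro!: fg_projective_mod_sum fg_projective_zero_mod)

lemma shift_bounded:
  assumes X: "bounded_complex A X" shows "bounded_complex A (shift r X)"
proof -
  obtain N where N: "N \<ge> 0" "\<forall>n. \<bar>n\<bar> > N \<longrightarrow> carrier (obj X n) = {\<zero>\<^bsub>obj X n\<^esub>}" using bounded_degree[OF X] by blast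
  show ?thesis
  proof (rule bounded_complexI[where N = "N + \<bar>r\<bar>"])
    show "dif (shift r X) n \<in> mod_hom A (obj (shift r X) n) (obj (shift r X) (n + 1))" for n
      by (cases "even r") (auto simp: shift_def intro!: mod_hom_neg_map bc_dif[OF X] bc_right[OF X])
    fix n x assume x: "x \<in> carrier (obj (shift r X) n)"
    have "dif X (n + 1 + r) (\<ominus>\<^bsub>obj X (n + 1 + r)\<^esub> dif X (n + r) x) = \<ominus>\<^bsub>obj X (n + 1 + 1 + r)\<^esub> dif X (n + 1 + r) (dif X (n + r) x)"
      by (rule mod_hom_uminus[OF bc_dif[OF X] bc_group[OF X] bc_group[OF X] bc_closed[OF X]]) (use x in \<open>auto simp: shift_def\<close>)
    then show "dif (shift r X) (n + 1) (dif (shift r X) n x) = \<zero>\<^bsub>obj (shift r X) (n + 1 + 1)\<^esub>"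
      using x bc_dd[OF X, of x "n + r" "n + 1 + r" "n + 1 + 1 + r"]
      by (simp add: shift_def abelian_group_uminus_zero[OF bc_group[OF X]])
  qed (use N in \<open>auto simp: shift_def intro: bc_fd[OF X]\<close>)
qed

lemma shift_projective: "projective_complex A X \<Longrightarrow> projective_complex A (shift r X)"
  using shift_bounded[of X] by (auto simp: projective_complex_def) (simp add: shift_def)

lemma cone_bounded:
  assumes X: "bounded_complex A X" and Y: "bounded_complex A Y" and f: "f \<in> chain_map A X Y"
  shows "bounded_complex A (cone X Y f)"
proof -
  obtain N N' where N: "\<forall>n. \<bar>n\<bar> > N \<longrightarrow> carrier (obj X n) = {\<zero>\<^bsub>obj X n\<^esub>}" "\<forall>n. \<bar>n\<bar> > N' \<longrightarrow> carrier (obj Y n) = {\<zero>\<^bsub>obj Y n\<^esub>}"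
    using bounded_degree[OF X] bounded_degree[OF Y] by blast
  show ?thesis
  proof (rule bounded_complexI[where N = "max N N' + 1"])
    fix n
    note m = mod_sum_maps[OF bc_right[OF X, of "n + 1"] bc_right[OF Y, of n]]
    have d1: "(\<lambda>p. \<ominus>\<^bsub>obj X (n + 1 + 1)\<^esub> dif X (n + 1) (fst p)) \<in> mod_hom A (mod_sum (obj X (n + 1)) (obj Y n)) (obj X (n + 1 + 1))"
      using mod_hom_neg_map[OF mod_hom_comp[OF m(3) bc_dif[OF X refl]] right_module_mod_sum[OF bc_right[OF X] bc_right[OF Y]] bc_right[OF X]]
      by (simp add: comp_def)
    have d2: "(\<lambda>p. f (n + 1) (fst p) \<oplus>\<^bsub>obj Y (n + 1)\<^esub> dif Y n (snd p)) \<in> mod_hom A (mod_sum (obj X (n + 1)) (obj Y n)) (obj Y (n + 1))"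
      using mod_hom_add_map[OF mod_hom_comp[OF m(3) cm_hom[OF f]] mod_hom_comp[OF m(4) bc_dif[OF Y refl]] bc_right[OF Y]]
      by (simp add: comp_def)
    show "dif (cone X Y f) n \<in> mod_hom A (obj (cone X Y f) n) (obj (cone X Y f) (n + 1))"
      using mod_hom_pair[OF d1 d2] by (simp add: cone_def case_prod_beta')
    fix p assume "p \<in> carrier (obj (cone X Y f) n)"
    then obtain x y where p: "p = (x, y)" "x \<in> carrier (obj X (n + 1))" "y \<in> carrier (obj Y n)" by (auto simp: cone_def)
    interpret Y2: abelian_group "obj Y (n + 1 + 1)" by (rule bc_group[OF Y])
    note u = mod_hom_uminus[OF bc_dif[OF X refl] bc_group[OF X] bc_group[OF X]]
      mod_hom_uminus[OF cm_hom[OF f] bc_group[OF X] bc_group[OF Y]]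
    have dx: "dif X (n + 1) x \<in> carrier (obj X (n + 1 + 1))" using bc_closed[OF X p(2)] by simp
    have fx: "f (n + 1) x \<in> carrier (obj Y (n + 1))" using cm_closed[OF f p(2)] .
    have dfx: "dif Y (n + 1) (f (n + 1) x) \<in> carrier (obj Y (n + 1 + 1))" using bc_closed[OF Y fx] by simp
    have dy: "dif Y n y \<in> carrier (obj Y (n + 1))" using bc_closed[OF Y p(3)] by simp
    have 1: "dif X (n + 1 + 1) (\<ominus>\<^bsub>obj X (n + 1 + 1)\<^esub> dif X (n + 1) x) = \<zero>\<^bsub>obj X (n + 1 + 1 + 1)\<^esub>"
      unfolding u(1)[OF dx] bc_dd[OF X p(2) refl refl] by (rule abelian_group_uminus_zero[OF bc_group[OF X]])
    \<comment> \<open>The sign in the first component of the cone differential makes the two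
      contributions d f x cancel.\<close>
    have 2: "f (n + 1 + 1) (\<ominus>\<^bsub>obj X (n + 1 + 1)\<^esub> dif X (n + 1) x) = \<ominus>\<^bsub>obj Y (n + 1 + 1)\<^esub> dif Y (n + 1) (f (n + 1) x)"
      unfolding u(2)[OF dx] cm_dif[OF f p(2) refl] ..
    have 3: "dif Y (n + 1) (f (n + 1) x \<oplus>\<^bsub>obj Y (n + 1)\<^esub> dif Y n y) = dif Y (n + 1) (f (n + 1) x)"
      unfolding mod_hom_add[OF bc_dif[OF Y refl] fx dy] bc_dd[OF Y p(3) refl refl] by (rule Y2.r_zero[OF dfx])
    show "dif (cone X Y f) (n + 1) (dif (cone X Y f) n p) = \<zero>\<^bsub>obj (cone X Y f) (n + 1 + 1)\<^esub>"
      using dfx abelian_group_uminus_zero[OF bc_group[OF X]]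
      by (simp only: cone_def p(1) cochain.simps prod.case 1 2 3 mod_sum_simps Y2.l_neg)
  qed (use N in \<open>auto simp: cone_def intro: bc_fd[OF X] bc_fd[OF Y] fd_module_mod_sum\<close>)
qed

lemma cone_projective:
  assumes "projective_complex A X" "projective_complex A Y" "f \<in> chain_map A X Y"
  shows "projective_complex A (cone X Y f)"
  using assms cone_bounded[of X Y f] fg_projective_mod_sum unfolding projective_complex_def
  by (auto simp: cone_def)

end

section \<open>Morphisms in the bounded derived category\<close>

context kalg
begin

lemma homotopic_sym:
  assumes "homotopic A X Y f g" "bounded_complex A X" "bounded_complex A Y"
    and f: "\<And>n. f n \<in> mod_hom A (obj X n) (obj Y n)" and g: "\<And>n. g n \<in> mod_hom A (obj X n) (obj Y n)"
  shows "homotopic A X Y g f"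
proof -
  obtain h where h: "\<And>n. h n \<in> mod_hom A (obj X n) (obj Y (n - 1))"
    "\<And>n x. x \<in> carrier (obj X n) \<Longrightarrow>
      f n x = (dif Y (n - 1) (h n x) \<oplus>\<^bsub>obj Y n\<^esub> h (n + 1) (dif X n x)) \<oplus>\<^bsub>obj Y n\<^esub> g n x"
    using homotopicD[OF assms] by blast
  show ?thesis
  proof (rule homotopicI[OF assms(2,3) g f, where h = "\<lambda>n x. \<ominus>\<^bsub>obj Y (n - 1)\<^esub> h n x"])
    show "(\<lambda>x. \<ominus>\<^bsub>obj Y (n - 1)\<^esub> h n x) \<in> mod_hom A (obj X n) (obj Y (n - 1))" for n
      by (rule mod_hom_neg_map[OF h(1) bc_right[OF assms(2)] bc_right[OF assms(3)]])
    fix n x assume x: "x \<in> carrier (obj X n)"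
    interpret Y: abelian_group "obj Y n" by (rule bc_group[OF assms(3)])
    have q: "h (n + 1) (dif X n x) \<in> carrier (obj Y n)"
      using mod_hom_closed[OF h(1)[of "n + 1"] bc_closed[OF assms(2) x refl]] by simp
    have hx: "h n x \<in> carrier (obj Y (n - 1))" by (rule mod_hom_closed[OF h(1) x])
    have p: "dif Y (n - 1) (h n x) \<in> carrier (obj Y n)" using bc_closed[OF assms(3) hx, of n] by simp
    have p': "dif Y (n - 1) (\<ominus>\<^bsub>obj Y (n - 1)\<^esub> h n x) = \<ominus>\<^bsub>obj Y n\<^esub> dif Y (n - 1) (h n x)"
      by (rule mod_hom_uminus[OF bc_dif[OF assms(3)] bc_group[OF assms(3)] bc_group[OF assms(3)] hx]) simp
    have gx: "g n x \<in> carrier (obj Y n)" by (rule mod_hom_closed[OF g x])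
    let ?p = "dif Y (n - 1) (h n x)" and ?q = "h (n + 1) (dif X n x)"
    have "(\<ominus>\<^bsub>obj Y n\<^esub> ?p \<oplus>\<^bsub>obj Y n\<^esub> \<ominus>\<^bsub>obj Y n\<^esub> ?q) \<oplus>\<^bsub>obj Y n\<^esub> ((?p \<oplus>\<^bsub>obj Y n\<^esub> ?q) \<oplus>\<^bsub>obj Y n\<^esub> g n x) = g n x"
      using p q gx Y.r_neg1[of "?p \<oplus>\<^bsub>obj Y n\<^esub> ?q" "g n x"] by (simp only: Y.minus_add Y.a_closed)
    then show "g n x = (dif Y (n - 1) (\<ominus>\<^bsub>obj Y (n - 1)\<^esub> h n x) \<oplus>\<^bsub>obj Y n\<^esub> \<ominus>\<^bsub>obj Y (n + 1 - 1)\<^esub> h (n + 1) (dif X n x)) \<oplus>\<^bsub>obj Y n\<^esub> f n x"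
      using h(2)[OF x] p' by simp
  qed
qed

lemma qi_id: "bounded_complex A X \<Longrightarrow> (\<lambda>n. id) \<in> quasi_iso A X X"
  by (rule cx_iso_qi[OF cx_iso_id])

lemma homotopic_refl:
  "bounded_complex A X \<Longrightarrow> bounded_complex A Y \<Longrightarrow> f \<in> chain_map A X Y \<Longrightarrow> homotopic A X Y f f"
  by (rule homotopic_cong(1)) (auto intro: cm_hom)

text \<open>A copy Z of X serves as the top of both roofs, X \<leftarrow> Z \<rightarrow> Y and Y
  \<leftarrow> Z \<rightarrow> X. The middle square of either composite is filled with identities,
  leaving a roof with two equal legs.\<close>

lemma qi_Db_iso:
  assumes f: "f \<in> quasi_iso A X Y" and X: "bounded_complex A X" and Y: "bounded_complex A Y"
  shows "Db_iso A X Y"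
proof -
  let ?Z = "copy_cx X" and ?s = "dec_cx X" and ?f = "\<lambda>n. f n \<circ> dec_cx X n"
  have Z: "bounded_complex A ?Z" by (rule copy_cx(1)[OF X])
  have s: "?s \<in> quasi_iso A ?Z X" by (rule cx_iso_qi[OF copy_cx(3)[OF X] Z X])
  have f': "?f \<in> quasi_iso A ?Z Y" by (rule qi_comp[OF s f Z X Y])
  \<comment> \<open>A roof with equal legs r is the identity: r itself compares it with the trivial
    roof.\<close>
  have id_eq: "roof_eq A V V ?Z r r V (\<lambda>n. id) (\<lambda>n. id)" if r: "r \<in> quasi_iso A ?Z V" and V: "bounded_complex A V"
    for V :: "('a, 'd) cochain" and r
    unfolding roof_eq_def
    by (rule exI[of _ ?Z], rule exI[of _ "\<lambda>n. id"], rule exI[of _ r])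
      (use r V Z in \<open>auto simp: cm_id qi_cm intro: homotopic_refl\<close>)
  have "roof_comp_id A X Y ?Z ?s ?f ?Z ?f ?s"
    unfolding roof_comp_id_def
    by (rule exI[of _ ?Z], rule exI[of _ "\<lambda>n. id"], rule exI[of _ "\<lambda>n. id"])
      (use Z f' s X Y in \<open>auto simp: cm_id qi_cm qi_id intro: homotopic_refl id_eq\<close>)
  moreover have "roof_comp_id A Y X ?Z ?f ?s ?Z ?s ?f"
    unfolding roof_comp_id_def
    by (rule exI[of _ ?Z], rule exI[of _ "\<lambda>n. id"], rule exI[of _ "\<lambda>n. id"])
      (use Z f' s X Y id_eq[OF f' Y] in \<open>auto simp: cm_id qi_cm qi_id intro: homotopic_refl\<close>)
  moreover have "roof A X Y ?Z ?s ?f" "roof A Y X ?Z ?f ?s"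
    using X Y Z s f' by (auto simp: roof_def qi_cm)
  ultimately show ?thesis unfolding Db_iso_def by blast
qed

lemma Db_iso_sym: "Db_iso A X Y \<Longrightarrow> Db_iso A Y X"
  unfolding Db_iso_def by blast

lemma coboundary_image:
  assumes f: "f \<in> chain_map A X Y" and x: "x \<in> coboundaries X n"
  shows "f n x \<in> coboundaries Y n"
proof -
  obtain v where v: "v \<in> carrier (obj X (n - 1))" "x = dif X (n - 1) v" using x by (auto simp: coboundaries_def)
  then have "f n x = dif Y (n - 1) (f (n - 1) v)" using cm_dif[OF f v(1), of n] by simp
  then show ?thesis using cm_closed[OF f v(1)] by (auto simp: coboundaries_def)
qed

lemma coboundary_add_iff:
  assumes X: "bounded_complex A X" and w: "w \<in> carrier (obj X (n - 1))" and y: "y \<in> carrier (obj X n)"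
  shows "dif X (n - 1) w \<oplus>\<^bsub>obj X n\<^esub> y \<in> coboundaries X n \<longleftrightarrow> y \<in> coboundaries X n"
proof -
  interpret S: additive_subgroup "coboundaries X n" "obj X n" by (rule coboundaries_subgroup[OF X])
  interpret G: abelian_group "obj X n" by (rule bc_group[OF X])
  have d: "dif X (n - 1) w \<in> coboundaries X n" "dif X (n - 1) w \<in> carrier (obj X n)"
    using w bc_closed[OF X w, of n] by (auto simp: coboundaries_def)
  have "y = \<ominus>\<^bsub>obj X n\<^esub> dif X (n - 1) w \<oplus>\<^bsub>obj X n\<^esub> (dif X (n - 1) w \<oplus>\<^bsub>obj X n\<^esub> y)"
    using d y by (simp add: G.r_neg1)
  moreover have "\<ominus>\<^bsub>obj X n\<^esub> dif X (n - 1) w \<in> coboundaries X n" using d(1) G.abelian_group_axioms S.a_inv_closed by blast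
  ultimately show ?thesis using S.a_closed d(1) by metis
qed

text \<open>The composite X \<rightarrow> Y \<rightarrow> X is the identity in the derived category,
  but on cohomology in degree n it factors through zero. Following one cocycle through the roofs
  makes this explicit.\<close>

lemma Db_iso_acyclic:
  assumes "Db_iso A X Y" and Y0: "\<And>y. y \<in> carrier (obj Y n) \<Longrightarrow> dif Y n y = \<zero>\<^bsub>obj Y (n + 1)\<^esub> \<Longrightarrow> y \<in> coboundaries Y n"
    and x: "x \<in> carrier (obj X n)" "dif X n x = \<zero>\<^bsub>obj X (n + 1)\<^esub>"
  shows "x \<in> coboundaries X n"
proof -
  obtain Z :: "('a, nat \<Rightarrow> 'k) cochain" and s f and Z' :: "('a, nat \<Rightarrow> 'k) cochain" and t g
    where r: "roof A X Y Z s f" "roof A Y X Z' t g" and c: "roof_comp_id A X Y Z s f Z' t g"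
    using assms(1) unfolding Db_iso_def by blast
  have b: "bounded_complex A X" "bounded_complex A Y" "bounded_complex A Z" "bounded_complex A Z'"
    and q: "s \<in> quasi_iso A Z X" "f \<in> chain_map A Z Y" "t \<in> quasi_iso A Z' Y" "g \<in> chain_map A Z' X"
    using r by (auto simp: roof_def)
  obtain W :: "('a, nat \<Rightarrow> 'k) cochain" and u v where W: "bounded_complex A W" "u \<in> quasi_iso A W Z" "v \<in> chain_map A W Z'"
    and re: "roof_eq A X X W (\<lambda>n. s n \<circ> u n) (\<lambda>n. g n \<circ> v n) X (\<lambda>n. id) (\<lambda>n. id)"
    using c unfolding roof_comp_id_def by blast
  obtain W1 :: "('a, nat \<Rightarrow> 'k) cochain" and u1 u1' where W1: "bounded_complex A W1" "u1 \<in> chain_map A W1 W" "u1' \<in> chain_map A W1 X"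
    "(\<lambda>n. (s n \<circ> u n) \<circ> u1 n) \<in> quasi_iso A W1 X"
    "homotopic A W1 X (\<lambda>n. (s n \<circ> u n) \<circ> u1 n) (\<lambda>n. id \<circ> u1' n)"
    "homotopic A W1 X (\<lambda>n. (g n \<circ> v n) \<circ> u1 n) (\<lambda>n. id \<circ> u1' n)"
    using re unfolding roof_eq_def by blast
  let ?p = "\<lambda>n. (s n \<circ> u n) \<circ> u1 n" and ?q = "\<lambda>n. (g n \<circ> v n) \<circ> u1 n" and ?u = "\<lambda>n. id \<circ> u1' n"
  have hv: "(\<lambda>n. v n \<circ> u1 n) \<in> chain_map A W1 Z'" by (rule cm_comp[OF W1(2) W(3)])
  have hu: "?u \<in> chain_map A W1 X" using W1(3) by simp
  have hq: "?q \<in> chain_map A W1 X" by (rule cm_comp[OF W1(2) cm_comp[OF W(3) q(4)]])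
  \<comment> \<open>Up to a boundary, x comes from a cocycle z at the top of the roof that compares
    the composite with the identity.\<close>
  obtain z w where z: "z \<in> carrier (obj W1 n)" "dif W1 n z = \<zero>\<^bsub>obj W1 (n + 1)\<^esub>" "w \<in> carrier (obj X (n - 1))"
    "x = dif X (n - 1) w \<oplus>\<^bsub>obj X n\<^esub> ?p n z"
    by (rule qi_surj[OF W1(4) W1(1) b(1) x])
  define z' where "z' = v n (u1 n z)"
  have z': "z' \<in> carrier (obj Z' n)" "dif Z' n z' = \<zero>\<^bsub>obj Z' (n + 1)\<^esub>"
    using cm_closed[OF hv z(1)] cm_dif[OF hv z(1) refl] cm_zero[OF hv W1(1) b(4)] z(2) by (auto simp: z'_def)
  \<comment> \<open>Here acyclicity of Y enters: t z' is a boundary, hence so is z', because t is a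
    quasi-isomorphism.\<close>
  have "dif Y n (t n z') = \<zero>\<^bsub>obj Y (n + 1)\<^esub>"
    using cm_dif[OF qi_cm[OF q(3)] z'(1) refl] z'(2) cm_zero[OF qi_cm[OF q(3)] b(4,2)] by simp
  then obtain c where c: "c \<in> carrier (obj Y (n - 1))" "t n z' = dif Y (n - 1) c"
    using Y0[OF cm_closed[OF qi_cm[OF q(3)] z'(1)]] by (auto simp: coboundaries_def)
  obtain e where "e \<in> carrier (obj Z' (n - 1))" "z' = dif Z' (n - 1) e"
    using qi_inj[OF q(3) b(4,2) z'(1) c(1) z'(2)] c(2) by blast
  then have "z' \<in> coboundaries Z' n" by (auto simp: coboundaries_def)
  then have qz: "?q n z \<in> coboundaries X n" using coboundary_image[OF q(4), of z' n] by (simp add: z'_def)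
  \<comment> \<open>On z the maps \<open>?q\<close>, \<open>?u\<close> and \<open>?p\<close> agree
    up to boundaries, so the class of x is that of \<open>?q n z\<close>, which is zero.\<close>
  obtain w1 where w1: "w1 \<in> carrier (obj X (n - 1))" "?q n z = dif X (n - 1) w1 \<oplus>\<^bsub>obj X n\<^esub> ?u n z"
    by (rule homotopic_cocycle[OF W1(6,1) b(1) cm_hom[OF hq] cm_hom[OF hu] z(1,2)])
  obtain w2 where w2: "w2 \<in> carrier (obj X (n - 1))" "?p n z = dif X (n - 1) w2 \<oplus>\<^bsub>obj X n\<^esub> ?u n z"
    by (rule homotopic_cocycle[OF W1(5,1) b(1) cm_hom[OF qi_cm[OF W1(4)]] cm_hom[OF hu] z(1,2)])
  have "?u n z \<in> coboundaries X n"
    using qz coboundary_add_iff[OF b(1) w1(1) cm_closed[OF hu z(1)]] unfolding w1(2) by blast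
  then have "?p n z \<in> coboundaries X n"
    using coboundary_add_iff[OF b(1) w2(1) cm_closed[OF hu z(1)]] unfolding w2(2) by blast
  then show ?thesis
    using coboundary_add_iff[OF b(1) z(3) cm_closed[OF qi_cm[OF W1(4)] z(1)]] unfolding z(4) by blast
qed

text \<open>A zero morphism of the derived category induces zero on cohomology. This is the test by
  which a non-zero self-extension is recognised.\<close>

lemma Db_Hom_zero_cohomology:
  assumes "Db_Hom_zero A X Y" and X: "bounded_complex A X" and Y: "bounded_complex A Y" and f: "f \<in> chain_map A X Y"
    and x: "x \<in> carrier (obj X n)" "dif X n x = \<zero>\<^bsub>obj X (n + 1)\<^esub>"
  shows "f n x \<in> coboundaries Y n"
proof -
  let ?Z = "copy_cx X" and ?s = "dec_cx X" and ?f = "\<lambda>n. f n \<circ> dec_cx X n"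
  have Z: "bounded_complex A ?Z" by (rule copy_cx(1)[OF X])
  have s: "?s \<in> quasi_iso A ?Z X" by (rule cx_iso_qi[OF copy_cx(3)[OF X] Z X])
  have f': "?f \<in> chain_map A ?Z Y" by (rule cm_comp[OF qi_cm[OF s] f])
  have "roof A X Y ?Z ?s ?f" using X Y Z s f' by (auto simp: roof_def)
  then have "roof_eq A X Y ?Z ?s ?f ?Z ?s (\<lambda>n x. \<zero>\<^bsub>obj Y n\<^esub>)" using assms(1) unfolding Db_Hom_zero_def by blast
  then obtain W :: "('a, nat \<Rightarrow> 'k) cochain" and u u' where W: "bounded_complex A W" "u \<in> chain_map A W ?Z"
    "(\<lambda>n. ?s n \<circ> u n) \<in> quasi_iso A W X" "homotopic A W Y (\<lambda>n. ?f n \<circ> u n) (\<lambda>n. (\<lambda>x. \<zero>\<^bsub>obj Y n\<^esub>) \<circ> u' n)"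
      "u' \<in> chain_map A W ?Z"
    unfolding roof_eq_def by blast
  have z0: "(\<lambda>n. (\<lambda>x. \<zero>\<^bsub>obj Y n\<^esub>) \<circ> u' n) \<in> chain_map A W Y" using cm_zero_map[OF W(1) Y] by (simp add: comp_def)
  obtain z w where z: "z \<in> carrier (obj W n)" "dif W n z = \<zero>\<^bsub>obj W (n + 1)\<^esub>" "w \<in> carrier (obj X (n - 1))"
    "x = dif X (n - 1) w \<oplus>\<^bsub>obj X n\<^esub> (?s n \<circ> u n) z"
    by (rule qi_surj[OF W(3,1) X x])
  have sz: "(?s n \<circ> u n) z \<in> carrier (obj X n)" using cm_closed[OF qi_cm[OF W(3)] z(1)] .
  have dw: "dif X (n - 1) w \<in> carrier (obj X n)" using bc_closed[OF X z(3), of n] by simp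
  obtain w1 where w1: "w1 \<in> carrier (obj Y (n - 1))" "(?f n \<circ> u n) z = dif Y (n - 1) w1 \<oplus>\<^bsub>obj Y n\<^esub> ((\<lambda>x. \<zero>\<^bsub>obj Y n\<^esub>) \<circ> u' n) z"
    by (rule homotopic_cocycle[OF W(4,1) Y cm_hom[OF cm_comp[OF W(2) f']] cm_hom[OF z0] z(1,2)])
  have "\<zero>\<^bsub>obj Y n\<^esub> \<in> coboundaries Y n"
    using additive_subgroup.zero_closed[OF coboundaries_subgroup[OF Y]] .
  then have "f n ((?s n \<circ> u n) z) \<in> coboundaries Y n"
    using w1 coboundary_add_iff[OF Y w1(1), of "\<zero>\<^bsub>obj Y n\<^esub>"] abelian_groupE(2)[OF bc_group[OF Y]] by simp
  moreover have "f n x = dif Y (n - 1) (f (n - 1) w) \<oplus>\<^bsub>obj Y n\<^esub> f n ((?s n \<circ> u n) z)"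
    using z(4) cm_add[OF f dw sz] cm_dif[OF f z(3), of n] by simp
  ultimately show ?thesis using coboundary_add_iff[OF Y cm_closed[OF f z(3)] cm_closed[OF f sz]] by simp
qed

text \<open>A bounded complex of projectives is K-projective: the section and the homotopy are
  built by descending induction on the degree, lifting along \<open>(w, v) \<mapsto> (d w, s w - d v)\<close>.\<close>

lemma projective_section:
  assumes P: "projective_complex A P" and Z: "bounded_complex A Z" and s: "s \<in> quasi_iso A Z P"
  shows "\<exists>t\<in>chain_map A P Z. homotopic A P P (\<lambda>n. s n \<circ> t n) (\<lambda>n. id)"
proof -
  note bP = pc_bc[OF P] and cs = qi_cm[OF s]
  \<comment> \<open>The conditions in degree n for t to be a chain map and h a homotopy from s t to
    the identity. They involve only degrees n and n + 1 of t and h, so a choice in degree m leaves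
    those above untouched.\<close>
  define C where "C t h n \<longleftrightarrow> t n \<in> mod_hom A (obj P n) (obj Z n) \<and> h n \<in> mod_hom A (obj P n) (obj P (n - 1)) \<and>
    (\<forall>x\<in>carrier (obj P n). dif Z n (t n x) = t (n + 1) (dif P n x) \<and>
       s n (t n x) = (dif P (n - 1) (h n x) \<oplus>\<^bsub>obj P n\<^esub> h (n + 1) (dif P n x)) \<oplus>\<^bsub>obj P n\<^esub> x)" for t h n
  obtain N where N: "N \<ge> 0" "\<forall>n. \<bar>n\<bar> > N \<longrightarrow> carrier (obj P n) = {\<zero>\<^bsub>obj P n\<^esub>}" using bounded_degree[OF bP] by blast
  \<comment> \<open>Where P vanishes the zero maps will do; the maps one degree higher only have to
    send 0 to 0.\<close>
  have triv: "C t h n" if n: "\<bar>n\<bar> > N" and t: "t n = (\<lambda>_. \<zero>\<^bsub>obj Z n\<^esub>)" and h: "h n = (\<lambda>_. \<zero>\<^bsub>obj P (n - 1)\<^esub>)"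
    and t': "t (n + 1) \<in> mod_hom A (obj P (n + 1)) (obj Z (n + 1))" and h': "h (n + 1) \<in> mod_hom A (obj P (n + 1)) (obj P (n + 1 - 1))"
    for t h n
  proof -
    interpret P: abelian_group "obj P n" by (rule bc_group[OF bP])
    have "h (n + 1) \<zero>\<^bsub>obj P (n + 1)\<^esub> = \<zero>\<^bsub>obj P n\<^esub>" using mod_hom_zero[OF h' bc_group[OF bP] bc_group[OF bP]] by simp
    then show ?thesis
      using N(2) n mod_hom_zero[OF t' bc_group[OF bP] bc_group[OF Z]] bc_zero[OF bP, of n "n - 1"] bc_zero[OF bP, of "n + 1" n] bc_zero[OF Z, of "n + 1" n]
      by (auto simp: C_def t h cm_zero[OF cs Z bP] intro!: mod_hom_zero_map bc_right[OF Z] bc_right[OF bP])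
  qed
  have step: "\<exists>t h. \<forall>n\<ge>m. C t h n" if ex: "\<exists>t h. \<forall>n\<ge>m + 1. C t h n" for m
  proof -
    obtain t h where th: "\<forall>n\<ge>m + 1. C t h n" using ex by blast
    have t1: "t (m + 1) \<in> mod_hom A (obj P (m + 1)) (obj Z (m + 1))"
      and h1: "h (m + 1) \<in> mod_hom A (obj P (m + 1)) (obj P m)" using th[rule_format, of "m + 1"] by (auto simp: C_def)
    have e2: "m + 2 - 1 = m + 1" by simp
    have t2: "t (m + 2) \<in> mod_hom A (obj P (m + 2)) (obj Z (m + 2))"
      and h2: "h (m + 2) \<in> mod_hom A (obj P (m + 2)) (obj P (m + 1))" using th[rule_format, of "m + 2"] unfolding C_def e2 by auto
    let ?M = "mod_sum (obj Z m) (obj P (m - 1))" and ?N = "mod_sum (obj Z (m + 1)) (obj P m)"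
    have fM: "fd_module A ?M" by (intro fd_module_mod_sum bc_fd[OF Z] bc_fd[OF bP])
    note mm = mod_sum_maps[OF bc_right[OF Z, of m] bc_right[OF bP, of "m - 1"]]
    have dP': "dif P (m - 1) \<in> mod_hom A (obj P (m - 1)) (obj P m)" using bc_dif[OF bP, of m "m - 1"] by simp
    have e: "(\<lambda>p. ((dif Z m \<circ> fst) p, (s m \<circ> fst) p \<ominus>\<^bsub>obj P m\<^esub> (dif P (m - 1) \<circ> snd) p)) \<in> mod_hom A ?M ?N" (is "?e \<in> _")
      by (intro mod_hom_pair mod_hom_minus_map mod_hom_comp[OF mm(3)] mod_hom_comp[OF mm(4)] bc_dif[OF Z refl] cm_hom[OF cs] dP' fd_right[OF fM] bc_right[OF bP])
    have l: "(\<lambda>x. ((t (m + 1) \<circ> dif P m) x, id x \<oplus>\<^bsub>obj P m\<^esub> (h (m + 1) \<circ> dif P m) x)) \<in> mod_hom A (obj P m) ?N" (is "?l \<in> _")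
      by (intro mod_hom_pair mod_hom_add_map mod_hom_comp[OF bc_dif[OF bP refl]] t1 h1 mod_hom_id bc_right[OF bP])
    \<comment> \<open>The lift exists once every x has w and v with d w = t (d x) and s w - d v = x
      + h (d x).\<close>
    have "?l ` carrier (obj P m) \<subseteq> ?e ` carrier ?M"
    proof (rule image_subsetI)
      fix x assume x: "x \<in> carrier (obj P m)"
      interpret Pm: abelian_group "obj P m" by (rule bc_group[OF bP])
      interpret Pm1: abelian_group "obj P (m + 1)" by (rule bc_group[OF bP])
      interpret Zm: abelian_group "obj Z m" by (rule bc_group[OF Z])
      interpret Zm1: abelian_group "obj Z (m + 1)" by (rule bc_group[OF Z])
      have dx: "dif P m x \<in> carrier (obj P (m + 1))" by (rule bc_closed[OF bP x refl])
      define a where "a = t (m + 1) (dif P m x)"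
      define b where "b = x \<oplus>\<^bsub>obj P m\<^esub> h (m + 1) (dif P m x)"
      have ac: "a \<in> carrier (obj Z (m + 1))" unfolding a_def by (rule mod_hom_closed[OF t1 dx])
      have hx: "h (m + 1) (dif P m x) \<in> carrier (obj P m)" by (rule mod_hom_closed[OF h1 dx])
      have bc: "b \<in> carrier (obj P m)" unfolding b_def using x hx by simp
      have ddx: "dif P (m + 1) (dif P m x) = \<zero>\<^bsub>obj P (m + 2)\<^esub>" using bc_dd[OF bP x refl, of "m + 2"] by simp
      have "C t h (m + 1)" using th by simp
      then have c1: "dif Z (m + 1) a = t (m + 2) (dif P (m + 1) (dif P m x))"
        and c2: "s (m + 1) a = (dif P m (h (m + 1) (dif P m x)) \<oplus>\<^bsub>obj P (m + 1)\<^esub> h (m + 2) (dif P (m + 1) (dif P m x))) \<oplus>\<^bsub>obj P (m + 1)\<^esub> dif P m x"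
        using dx by (auto simp: C_def a_def add.commute)
      have da: "dif Z (m + 1) a = \<zero>\<^bsub>obj Z (m + 1 + 1)\<^esub>"
        using c1 ddx mod_hom_zero[OF t2 bc_group[OF bP] bc_group[OF Z]] by (simp add: add.commute)
      have dhx: "dif P m (h (m + 1) (dif P m x)) \<in> carrier (obj P (m + 1))" by (rule bc_closed[OF bP hx refl])
      have sa: "s (m + 1) a = dif P m b"
        using c2 ddx mod_hom_zero[OF h2 bc_group[OF bP] bc_group[OF bP]] dhx dx
        by (simp add: b_def mod_hom_add[OF bc_dif[OF bP refl] x hx] Pm1.a_comm)
      \<comment> \<open>By the conditions in degree m + 1, a is a cocycle with s a = d b.
        Injectivity of s on cohomology gives a first candidate for w.\<close>
      obtain w0 where w0: "w0 \<in> carrier (obj Z m)" "a = dif Z m w0"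
        using qi_inj[OF s Z bP ac, of b] bc da sa by auto
      have sw0: "s m w0 \<in> carrier (obj P m)" by (rule cm_closed[OF cs w0(1)])
      \<comment> \<open>The error of w0 is a cocycle of P. Surjectivity of s on cohomology writes it
        as d v + s z with a cocycle z, and w0 - z is the corrected choice.\<close>
      define c where "c = s m w0 \<ominus>\<^bsub>obj P m\<^esub> b"
      have cc: "c \<in> carrier (obj P m)" unfolding c_def using sw0 bc by simp
      have "dif P m c = \<zero>\<^bsub>obj P (m + 1)\<^esub>"
        unfolding c_def mod_hom_minus[OF bc_dif[OF bP refl] bc_group[OF bP] bc_group[OF bP] sw0 bc]
        using cm_dif[OF cs w0(1) refl] sa w0(2) bc_closed[OF bP bc refl] by (simp add: Pm1.minus_self)
      then obtain z v where z: "z \<in> carrier (obj Z m)" "dif Z m z = \<zero>\<^bsub>obj Z (m + 1)\<^esub>" "v \<in> carrier (obj P (m - 1))"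
        "c = dif P (m - 1) v \<oplus>\<^bsub>obj P m\<^esub> s m z"
        by (rule qi_surj[OF s Z bP cc])
      have sz: "s m z \<in> carrier (obj P m)" by (rule cm_closed[OF cs z(1)])
      have dv: "dif P (m - 1) v \<in> carrier (obj P m)" by (rule mod_hom_closed[OF dP' z(3)])
      have w: "w0 \<ominus>\<^bsub>obj Z m\<^esub> z \<in> carrier (obj Z m)" using w0(1) z(1) by simp
      have dw: "dif Z m (w0 \<ominus>\<^bsub>obj Z m\<^esub> z) = a"
        using mod_hom_minus[OF bc_dif[OF Z refl] bc_group[OF Z] bc_group[OF Z] w0(1) z(1)] z(2) w0(2) ac
        by (simp add: Zm1.minus_eq abelian_group_uminus_zero[OF bc_group[OF Z]])
      have "s m w0 = (dif P (m - 1) v \<oplus>\<^bsub>obj P m\<^esub> s m z) \<oplus>\<^bsub>obj P m\<^esub> b"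
        using z(4) sw0 bc cc unfolding c_def by (simp add: Pm.minus_eq_iff[OF sw0 bc] dv sz)
      then have "s m w0 \<ominus>\<^bsub>obj P m\<^esub> s m z = dif P (m - 1) v \<oplus>\<^bsub>obj P m\<^esub> b"
        using sw0 sz dv bc by (simp add: Pm.minus_eq_iff Pm.a_ac)
      then have "s m (w0 \<ominus>\<^bsub>obj Z m\<^esub> z) = b \<oplus>\<^bsub>obj P m\<^esub> dif P (m - 1) v"
        using mod_hom_minus[OF cm_hom[OF cs] bc_group[OF Z] bc_group[OF bP] w0(1) z(1)] dv bc by (simp add: Pm.a_comm)
      then have "s m (w0 \<ominus>\<^bsub>obj Z m\<^esub> z) \<ominus>\<^bsub>obj P m\<^esub> dif P (m - 1) v = b"
        using dv bc by (simp add: Pm.minus_eq_iff)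
      then have "?l x = ?e (w0 \<ominus>\<^bsub>obj Z m\<^esub> z, v)" using dw by (simp add: a_def b_def)
      moreover have "(w0 \<ominus>\<^bsub>obj Z m\<^esub> z, v) \<in> carrier ?M" using w z(3) by simp
      ultimately show "?l x \<in> ?e ` carrier ?M" by (rule image_eqI)
    qed
    then obtain k where k: "k \<in> mod_hom A (obj P m) ?M" "\<forall>x\<in>carrier (obj P m). ?e (k x) = ?l x"
      using fg_projective_lift[OF _ fM right_module_mod_sum[OF bc_right[OF Z] bc_right[OF bP]] e l] P by (auto simp: projective_complex_def)
    let ?t = "t(m := fst \<circ> k)" and ?h = "h(m := snd \<circ> k)"
    have "C ?t ?h m"
      unfolding C_def
    proof (intro conjI ballI)
      show "?t m \<in> mod_hom A (obj P m) (obj Z m)" "?h m \<in> mod_hom A (obj P m) (obj P (m - 1))"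
        using mod_hom_comp[OF k(1) mm(3)] mod_hom_comp[OF k(1) mm(4)] by simp_all
      fix x assume x: "x \<in> carrier (obj P m)"
      interpret Pm: abelian_group "obj P m" by (rule bc_group[OF bP])
      have kx: "fst (k x) \<in> carrier (obj Z m)" "snd (k x) \<in> carrier (obj P (m - 1))"
        using mod_hom_closed[OF k(1) x] by auto
      have hx: "h (m + 1) (dif P m x) \<in> carrier (obj P m)" by (rule mod_hom_closed[OF h1 bc_closed[OF bP x refl]])
      have k1: "dif Z m (fst (k x)) = t (m + 1) (dif P m x)"
        and k2: "s m (fst (k x)) \<ominus>\<^bsub>obj P m\<^esub> dif P (m - 1) (snd (k x)) = x \<oplus>\<^bsub>obj P m\<^esub> h (m + 1) (dif P m x)"
        using k(2) x by auto
      show "dif Z m (?t m x) = ?t (m + 1) (dif P m x)" using k1 by simp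
      have "s m (fst (k x)) = (x \<oplus>\<^bsub>obj P m\<^esub> h (m + 1) (dif P m x)) \<oplus>\<^bsub>obj P m\<^esub> dif P (m - 1) (snd (k x))"
        using k2 x hx cm_closed[OF cs kx(1)] mod_hom_closed[OF dP' kx(2)] by (simp add: Pm.minus_eq_iff)
      then show "s m (?t m x) = (dif P (m - 1) (?h m x) \<oplus>\<^bsub>obj P m\<^esub> ?h (m + 1) (dif P m x)) \<oplus>\<^bsub>obj P m\<^esub> x"
        using x hx mod_hom_closed[OF dP' kx(2)] by (simp add: Pm.a_ac)
    qed
    moreover have "C ?t ?h n" if "n \<ge> m + 1" for n
    proof -
      have "C t h n" using th that by blast
      then show ?thesis using that by (auto simp: C_def)
    qed
    ultimately have "\<forall>n\<ge>m. C ?t ?h n" by (metis antisym_conv2 zless_imp_add1_zle)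
    then show ?thesis by blast
  qed
  \<comment> \<open>Here j counts the degrees treated below N + 1; after 2 N + 1 of them degree -N
    is reached.\<close>
  have "\<exists>t h. \<forall>n\<ge>N + 1 - int j. C t h n" for j
  proof (induction j)
    case 0
    have "C (\<lambda>n _. \<zero>\<^bsub>obj Z n\<^esub>) (\<lambda>n _. \<zero>\<^bsub>obj P (n - 1)\<^esub>) n" if "n \<ge> N + 1" for n
      by (rule triv) (use that N(1) in \<open>auto intro!: mod_hom_zero_map bc_right[OF Z] bc_right[OF bP]\<close>)
    then show ?case by auto
  next
    case (Suc j)
    have e: "N + 1 - int (Suc j) + 1 = N + 1 - int j" by simp
    show ?case by (rule step) (unfold e, rule Suc.IH)
  qed
  from this[of "nat (2 * N + 1)"] obtain t h where th: "\<forall>n\<ge>- N. C t h n" using N(1) by auto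
  \<comment> \<open>Below -N the complex P is zero, and both maps are set to zero there.\<close>
  define t' where "t' n = (if n \<ge> - N then t n else (\<lambda>_. \<zero>\<^bsub>obj Z n\<^esub>))" for n
  define h' where "h' n = (if n \<ge> - N then h n else (\<lambda>_. \<zero>\<^bsub>obj P (n - 1)\<^esub>))" for n
  have homs: "t' n \<in> mod_hom A (obj P n) (obj Z n)" "h' n \<in> mod_hom A (obj P n) (obj P (n - 1))" for n
    using th by (auto simp: t'_def h'_def C_def intro!: mod_hom_zero_map bc_right[OF Z] bc_right[OF bP])
  have C: "C t' h' n" for n
  proof (cases "n \<ge> - N")
    case True
    then have "C t h n" using th by blast
    then show ?thesis using True by (auto simp: C_def t'_def h'_def)
  next
    case False
    then show ?thesis using N(1) by (intro triv homs) (auto simp: t'_def h'_def)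
  qed
  have t': "t' \<in> chain_map A P Z" using C by (intro cmI homs) (auto simp: C_def)
  have "homotopic A P P (\<lambda>n. s n \<circ> t' n) (\<lambda>n. id)"
    by (rule homotopicI[OF bP bP cm_hom[OF cm_comp[OF t' cs]] mod_hom_id(1) homs(2)])
      (use C in \<open>auto simp: C_def\<close>)
  then show ?thesis using t' by blast
qed

text \<open>By \<open>projective_section\<close> the leg s of a roof has a homotopy section t, so
  the roof (s, f) represents the chain map f t, which is null-homotopic by assumption.\<close>

lemma Db_Hom_zeroI:
  assumes X: "projective_complex A X" and Y: "bounded_complex A Y"
    and null: "\<And>f. f \<in> chain_map A X Y \<Longrightarrow> homotopic A X Y f (\<lambda>n x. \<zero>\<^bsub>obj Y n\<^esub>)"
  shows "Db_Hom_zero A X Y"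
  unfolding Db_Hom_zero_def
proof (intro allI impI)
  fix Z :: "('a, nat \<Rightarrow> 'k) cochain" and s f
  assume r: "roof A X Y Z s f"
  then have Z: "bounded_complex A Z" and s: "s \<in> quasi_iso A Z X" and f: "f \<in> chain_map A Z Y" by (auto simp: roof_def)
  note bX = pc_bc[OF X]
  obtain t where t: "t \<in> chain_map A X Z" "homotopic A X X (\<lambda>n. s n \<circ> t n) (\<lambda>n. id)"
    using projective_section[OF X Z s] by blast
  \<comment> \<open>The dominating roof starts at a copy of X, because \<open>roof_eq\<close> fixes
    the element type of its top.\<close>
  let ?W = "copy_cx X" and ?d = "dec_cx X"
  let ?u = "\<lambda>n. t n \<circ> ?d n"
  have W: "bounded_complex A ?W" by (rule copy_cx(1)[OF bX])
  have d: "?d \<in> quasi_iso A ?W X" by (rule cx_iso_qi[OF copy_cx(3)[OF bX] W bX])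
  have u: "?u \<in> chain_map A ?W Z" by (rule cm_comp[OF qi_cm[OF d] t(1)])
  have su: "(\<lambda>n. s n \<circ> ?u n) \<in> chain_map A ?W X" by (rule cm_comp[OF u qi_cm[OF s]])
  have st: "(\<lambda>n. s n \<circ> t n) \<in> chain_map A X X" by (rule cm_comp[OF t(1) qi_cm[OF s]])
  \<comment> \<open>Since s t is homotopic to the identity, s u is homotopic to the isomorphism
    \<open>?d\<close> and hence a quasi-isomorphism.\<close>
  have "homotopic A ?W X (\<lambda>n. (s n \<circ> t n) \<circ> ?d n) (\<lambda>n. id \<circ> ?d n)"
    by (rule homotopic_pre[OF t(2) bX bX W cm_hom[OF st] mod_hom_id(1) qi_cm[OF d]])
  then have "homotopic A ?W X ?d (\<lambda>n. s n \<circ> ?u n)"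
    using homotopic_sym[OF _ W bX cm_hom[OF su] cm_hom[OF qi_cm[OF d]]] by (simp add: comp_assoc)
  then have q: "(\<lambda>n. s n \<circ> ?u n) \<in> quasi_iso A ?W X" by (rule qi_homotopic[OF d su _ W bX])
  have ft: "(\<lambda>n. f n \<circ> t n) \<in> chain_map A X Y" by (rule cm_comp[OF t(1) f])
  have "homotopic A ?W Y (\<lambda>n. (f n \<circ> t n) \<circ> ?d n) (\<lambda>n. (\<lambda>x. \<zero>\<^bsub>obj Y n\<^esub>) \<circ> ?d n)"
    by (rule homotopic_pre[OF null[OF ft] bX Y W cm_hom[OF ft] cm_hom[OF cm_zero_map[OF bX Y]] qi_cm[OF d]])
  then have h: "homotopic A ?W Y (\<lambda>n. f n \<circ> ?u n) (\<lambda>n. (\<lambda>x. \<zero>\<^bsub>obj Y n\<^esub>) \<circ> ?u n)"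
    by (simp add: comp_def)
  show "roof_eq A X Y Z s f Z s (\<lambda>n x. \<zero>\<^bsub>obj Y n\<^esub>)"
    unfolding roof_eq_def
    by (rule exI[of _ ?W], rule exI[of _ ?u], rule exI[of _ ?u]) (intro conjI W u q h homotopic_refl[OF W bX su])
qed

end

section \<open>Generation of the perfect complexes\<close>

context kalg
begin

lemma cx_iso_shift:
  assumes f: "f \<in> cx_iso X Y" and X: "bounded_complex A X" and Y: "bounded_complex A Y"
  shows "(\<lambda>n. f (n + r)) \<in> cx_iso (shift r X) (shift r Y)"
proof (rule cx_isoI)
  note c = cx_iso_cm[OF f]
  show "f (n + r) \<in> mod_hom A (obj (shift r X) n) (obj (shift r Y) n)" for n using cm_hom[OF c] by (simp add: shift_def)
  show "bij_betw (f (n + r)) (carrier (obj (shift r X) n)) (carrier (obj (shift r Y) n))" for n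
    using cx_iso_bij[OF f] by (simp add: shift_def)
  fix n x assume "x \<in> carrier (obj (shift r X) n)"
  then have x: "x \<in> carrier (obj X (n + r))" by (simp add: shift_def)
  have d: "dif X (n + r) x \<in> carrier (obj X (n + 1 + r))" using bc_closed[OF X x, of "n + 1 + r"] by simp
  show "f (n + 1 + r) (dif (shift r X) n x) = dif (shift r Y) n (f (n + r) x)"
    using cm_dif[OF c x, of "n + 1 + r"] mod_hom_uminus[OF cm_hom[OF c] bc_group[OF X] bc_group[OF Y] d]
    by (simp add: shift_def)
qed

lemma cx_iso_cone:
  assumes p: "p \<in> cx_iso X X'" and q: "q \<in> cx_iso Y Y'"
    and b: "bounded_complex A X" "bounded_complex A Y" "bounded_complex A X'" "bounded_complex A Y'"
    and f: "f \<in> chain_map A X Y"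
    and comm: "\<And>n x. x \<in> carrier (obj X n) \<Longrightarrow> q n (f n x) = f' n (p n x)"
  shows "(\<lambda>n (x, y). (p (n + 1) x, q n y)) \<in> cx_iso (cone X Y f) (cone X' Y' f')"
proof (rule cx_isoI)
  note cp = cx_iso_cm[OF p] and cq = cx_iso_cm[OF q]
  show "(\<lambda>(x, y). (p (n + 1) x, q n y)) \<in> mod_hom A (obj (cone X Y f) n) (obj (cone X' Y' f') n)" for n
    by (rule mod_homI) (auto simp: cone_def cm_closed[OF cp] cm_closed[OF cq] mod_hom_add[OF cm_hom[OF cp]] mod_hom_add[OF cm_hom[OF cq]]
        mod_hom_ract[OF cm_hom[OF cp]] mod_hom_ract[OF cm_hom[OF cq]])
  show "bij_betw (\<lambda>(x, y). (p (n + 1) x, q n y)) (carrier (obj (cone X Y f) n)) (carrier (obj (cone X' Y' f') n))" for n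
    using bij_betw_map_prod[OF cx_iso_bij[OF p, of "n + 1"] cx_iso_bij[OF q, of n]] by (simp add: cone_def map_prod_def)
  fix n z assume "z \<in> carrier (obj (cone X Y f) n)"
  then obtain x y where z: "z = (x, y)" "x \<in> carrier (obj X (n + 1))" "y \<in> carrier (obj Y n)" by (auto simp: cone_def)
  have "p (n + 1 + 1) (\<ominus>\<^bsub>obj X (n + 1 + 1)\<^esub> dif X (n + 1) x) = \<ominus>\<^bsub>obj X' (n + 1 + 1)\<^esub> dif X' (n + 1) (p (n + 1) x)"
    using mod_hom_uminus[OF cm_hom[OF cp] bc_group[OF b(1)] bc_group[OF b(3)] bc_closed[OF b(1) z(2) refl]] cm_dif[OF cp z(2) refl] by simp
  moreover have "q (n + 1) (f (n + 1) x \<oplus>\<^bsub>obj Y (n + 1)\<^esub> dif Y n y) = f' (n + 1) (p (n + 1) x) \<oplus>\<^bsub>obj Y' (n + 1)\<^esub> dif Y' n (q n y)"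
    using cm_add[OF cq cm_closed[OF f z(2)] bc_closed[OF b(2) z(3) refl]] cm_dif[OF cq z(3) refl] comm[OF z(2)] by simp
  ultimately show "(\<lambda>(x, y). (p (n + 1 + 1) x, q (n + 1) y)) (dif (cone X Y f) n z) = dif (cone X' Y' f') n ((\<lambda>(x, y). (p (n + 1) x, q n y)) z)"
    by (simp add: cone_def z(1))
qed

lemma cx_iso_sum:
  assumes p: "p \<in> cx_iso X X'" and q: "q \<in> cx_iso Y Y'"
  shows "(\<lambda>n (x, y). (p n x, q n y)) \<in> cx_iso (cochain_sum X Y) (cochain_sum X' Y')"
proof (rule cx_isoI)
  note cp = cx_iso_cm[OF p] and cq = cx_iso_cm[OF q]
  show "(\<lambda>(x, y). (p n x, q n y)) \<in> mod_hom A (obj (cochain_sum X Y) n) (obj (cochain_sum X' Y') n)" for n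
    by (rule mod_homI) (auto simp: cochain_sum_def cm_closed[OF cp] cm_closed[OF cq] mod_hom_add[OF cm_hom[OF cp]] mod_hom_add[OF cm_hom[OF cq]]
        mod_hom_ract[OF cm_hom[OF cp]] mod_hom_ract[OF cm_hom[OF cq]])
  show "bij_betw (\<lambda>(x, y). (p n x, q n y)) (carrier (obj (cochain_sum X Y) n)) (carrier (obj (cochain_sum X' Y') n))" for n
    using bij_betw_map_prod[OF cx_iso_bij[OF p, of n] cx_iso_bij[OF q, of n]] by (simp add: cochain_sum_def map_prod_def)
qed (auto simp: cochain_sum_def cm_dif[OF cx_iso_cm[OF p]] cm_dif[OF cx_iso_cm[OF q]])

lemma stalk_iso:
  assumes "f \<in> mod_hom A M N" "bij_betw f (carrier M) (carrier N)" "f \<zero>\<^bsub>M\<^esub> = \<zero>\<^bsub>N\<^esub>"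
  shows "(\<lambda>n. if n = 0 then f else (\<lambda>_. undefined)) \<in> cx_iso (stalk M) (stalk N)"
  by (rule cx_isoI) (use assms in \<open>auto simp: stalk_def mod_hom_zero_mod bij_betw_def\<close>)

section \<open>Complexes of arbitrary element type generated by T\<close>

lemma perfect_projective: "projective_complex A (X :: ('a, nat \<Rightarrow> 'k) cochain) \<Longrightarrow> perfect A X"
  unfolding perfect_def by (rule exI[of _ X]) (auto intro: qi_Db_iso qi_id pc_bc)

text \<open>Extends \<open>tri_generated\<close> to complexes of any element type, so that cones and
  direct sums, whose elements are pairs, can be treated directly.\<close>

definition gen :: "('a, 'b) cochain \<Rightarrow> ('a, 'c) cochain \<Rightarrow> bool" where
  "gen T X \<longleftrightarrow> tri_generated A T (copy_cx X)"

lemma gen_Db_iso: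
  assumes "gen T X" "projective_complex A Y" "Db_iso A (copy_cx X) (copy_cx Y)" shows "gen T Y"
  using tri_generated.iso[OF _ perfect_projective[OF copy_cx_projective]] assms unfolding gen_def by blast

lemma copy_cx_qi:
  assumes "f \<in> quasi_iso A X Y" "bounded_complex A X" "bounded_complex A Y"
  shows "Db_iso A (copy_cx X) (copy_cx Y)"
proof -
  note X = copy_cx[OF assms(2)] and Y = copy_cx[OF assms(3)]
  have "(\<lambda>n. enc_cx Y n \<circ> (f n \<circ> dec_cx X n)) \<in> quasi_iso A (copy_cx X) (copy_cx Y)"
    by (rule qi_comp[OF qi_comp[OF cx_iso_qi[OF X(3,1) assms(2)] assms(1) X(1) assms(2,3)] cx_iso_qi[OF Y(2) assms(3) Y(1)] X(1) assms(3) Y(1)])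
  then show ?thesis by (rule qi_Db_iso[OF _ X(1) Y(1)])
qed

lemma gen_qi:
  assumes "gen T X" "projective_complex A X" "projective_complex A Y" "f \<in> quasi_iso A X Y" shows "gen T Y"
  by (rule gen_Db_iso[OF assms(1,3) copy_cx_qi[OF assms(4) assms(2,3)[THEN pc_bc]]])

lemma gen_qi':
  assumes "gen T X" "projective_complex A X" "projective_complex A Y" "f \<in> quasi_iso A Y X" shows "gen T Y"
  by (rule gen_Db_iso[OF assms(1,3) Db_iso_sym[OF copy_cx_qi[OF assms(4) assms(3,2)[THEN pc_bc]]]])

lemma gen_iso:
  assumes "gen T X" "projective_complex A X" "projective_complex A Y" "f \<in> cx_iso X Y" shows "gen T Y"
  by (rule gen_qi[OF assms(1-3) cx_iso_qi[OF assms(4) assms(2,3)[THEN pc_bc]]])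

lemma tri_generated_gen:
  assumes "tri_generated A T X'" "projective_complex A X'" "projective_complex A X" "f \<in> cx_iso X' X" shows "gen T X"
proof -
  note b = assms(2,3)[THEN pc_bc]
  note c = copy_cx[OF b(2)]
  have "(\<lambda>n. enc_cx X n \<circ> f n) \<in> quasi_iso A X' (copy_cx X)"
    by (rule cx_iso_qi[OF cx_iso_comp[OF assms(4) c(2)] b(1) c(1)])
  then have "Db_iso A X' (copy_cx X)" by (rule qi_Db_iso[OF _ b(1) c(1)])
  then show ?thesis unfolding gen_def
    by (rule tri_generated.iso[OF assms(1) perfect_projective[OF copy_cx_projective[OF assms(3)]]])
qed

lemma gen_shift:
  assumes "gen T X" "projective_complex A X" shows "gen T (shift r X)"
proof (rule tri_generated_gen)
  note b = assms(2)[THEN pc_bc]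
  show "tri_generated A T (shift r (copy_cx X))" using assms(1) unfolding gen_def by (rule tri_generated.shift)
  show "projective_complex A (shift r (copy_cx X))" "projective_complex A (shift r X)"
    using assms(2) by (auto intro: shift_projective copy_cx_projective)
  show "(\<lambda>n. dec_cx X (n + r)) \<in> cx_iso (shift r (copy_cx X)) (shift r X)"
    by (rule cx_iso_shift[OF copy_cx(3)[OF b] copy_cx(1)[OF b] b])
qed

lemma shift_shift:
  assumes "bounded_complex A X" shows "(\<lambda>n x. x) \<in> cx_iso (shift (- r) (shift r X)) X"
proof (rule cx_isoI)
  fix n x assume x: "x \<in> carrier (obj (shift (- r) (shift r X)) n)"
  interpret G: abelian_group "obj X (n + 1)" by (rule bc_group[OF assms])
  show "dif (shift (- r) (shift r X)) n x = dif X n x"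
    using x bc_closed[OF assms, of x n "n + 1"] by (simp add: shift_def)
qed (auto simp: shift_def mod_hom_id bij_betw_def)

lemma gen_unshift:
  assumes "gen T (shift r X)" "projective_complex A X" shows "gen T X"
  by (rule gen_iso[OF gen_shift[OF assms(1) shift_projective[OF assms(2)], of "- r"] _ assms(2) shift_shift[OF pc_bc[OF assms(2)]]])
    (intro shift_projective assms)

text \<open>The cone of the copies has pairs as elements. The triangle rule admits any isomorphic
  perfect complex in its place, here the copy of the cone of f.\<close>

lemma gen_cone:
  assumes "gen T X" "gen T Y" "projective_complex A X" "projective_complex A Y" "f \<in> chain_map A X Y"
  shows "gen T (cone X Y f)"
proof -
  note bX = assms(3)[THEN pc_bc] and bY = assms(4)[THEN pc_bc]
  note X = copy_cx[OF bX] and Y = copy_cx[OF bY]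
  let ?f = "\<lambda>n. enc_cx Y n \<circ> (f n \<circ> dec_cx X n)"
  let ?C = "cone X Y f"
  have f': "?f \<in> chain_map A (copy_cx X) (copy_cx Y)"
    by (rule cm_comp[OF cm_comp[OF cx_iso_cm[OF X(3)] assms(5)] cx_iso_cm[OF Y(2)]])
  have C: "projective_complex A ?C" by (rule cone_projective[OF assms(3-5)])
  note bC = pc_bc[OF C]
  have "dec_cx Y n (?f n x) = f n (dec_cx X n x)" if "x \<in> carrier (obj (copy_cx X) n)" for n x
    using copy_mod(6)[OF bc_fd[OF bY] cm_closed[OF assms(5) cm_closed[OF cx_iso_cm[OF X(3)] that]]] by simp
  then have i: "(\<lambda>n (x, y). (dec_cx X (n + 1) x, dec_cx Y n y)) \<in> cx_iso (cone (copy_cx X) (copy_cx Y) ?f) ?C"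
    by (rule cx_iso_cone[OF X(3) Y(3) X(1) Y(1) bX bY f'])
  have "Db_iso A (cone (copy_cx X) (copy_cx Y) ?f) (copy_cx ?C)"
    by (rule qi_Db_iso[OF cx_iso_qi[OF cx_iso_comp[OF i copy_cx(2)[OF bC]]]]) (intro cone_bounded X(1) Y(1) f' copy_cx(1)[OF bC])+
  then show ?thesis
    using tri_generated.triangle[OF _ _ f' perfect_projective[OF copy_cx_projective[OF C]]] assms(1,2) unfolding gen_def by blast
qed

lemma gen_summand:
  assumes X: "projective_complex A X" and Y: "bounded_complex A Y" and T: "bounded_complex A T"
    and f: "f \<in> quasi_iso A (cochain_sum X Y) T"
  shows "gen T X"
proof -
  note bX = pc_bc[OF X]
  note cX = copy_cx[OF bX] and cY = copy_cx[OF Y]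
  have b: "bounded_complex A (cochain_sum (copy_cx X) (copy_cx Y))" "bounded_complex A (cochain_sum X Y)"
    by (intro cochain_sum_bounded cX cY bX Y)+
  have "Db_iso A (cochain_sum (copy_cx X) (copy_cx Y)) T"
    by (rule qi_Db_iso[OF qi_comp[OF cx_iso_qi[OF cx_iso_sum[OF cX(3) cY(3)] b] f b T] b(1) T])
  then show ?thesis unfolding gen_def
    by (rule tri_generated.summand[OF perfect_projective[OF copy_cx_projective[OF X]] cY(1)])
qed

text \<open>A zero complex is a direct summand of T with complement T itself.\<close>

lemma gen_trivial:
  assumes X: "projective_complex A X" and T: "bounded_complex A T" and X0: "\<And>n. carrier (obj X n) = {\<zero>\<^bsub>obj X n\<^esub>}"
  shows "gen T X"
proof (rule gen_summand[OF X T T])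
  have "(\<lambda>n. snd) \<in> cx_iso (cochain_sum X T) T"
    by (rule cx_isoI) (auto simp: cochain_sum_def X0 bij_betw_def inj_on_def image_iff intro!: mod_sum_maps bc_right T pc_bc[OF X])
  then show "(\<lambda>n. snd) \<in> quasi_iso A (cochain_sum X T) T"
    by (rule cx_iso_qi) (intro cochain_sum_bounded T pc_bc[OF X])+
qed

lemma gen_stalk_iso:
  assumes "gen T (stalk M)" "fg_projective A M" "right_module A N" "f \<in> mod_hom A M N" "bij_betw f (carrier M) (carrier N)"
  shows "gen T (stalk N)"
proof -
  have N: "fg_projective A N" by (rule fg_projective_iso[OF assms(2-5)])
  have "f \<zero>\<^bsub>M\<^esub> = \<zero>\<^bsub>N\<^esub>" by (rule mod_hom_zero[OF assms(4)]) (rule right_module_group[OF fd_right[OF fg_projective_fd]], rule assms N)+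
  then show ?thesis
    by (rule gen_iso[OF assms(1) stalk_projective[OF assms(2)] stalk_projective[OF N] stalk_iso[OF assms(4,5)]])
qed

text \<open>M \<oplus> N is the cone of the zero map M[-1] \<rightarrow> N.\<close>

lemma gen_stalk_mod_sum:
  assumes "gen T (stalk M)" "gen T (stalk N)" and M: "fg_projective A M" and N: "fg_projective A N"
  shows "gen T (stalk (mod_sum M N))"
proof -
  let ?X = "shift (- 1) (stalk M)" and ?Y = "stalk N"
  have p: "projective_complex A ?X" "projective_complex A ?Y"
    by (intro shift_projective stalk_projective M N)+
  let ?z = "\<lambda>n x. \<zero>\<^bsub>obj ?Y n\<^esub>"
  have z: "?z \<in> chain_map A ?X ?Y" by (rule cm_zero_map[OF p[THEN pc_bc]])
  have "gen T (cone ?X ?Y ?z)"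
    by (rule gen_cone[OF gen_shift[OF assms(1) stalk_projective[OF M]] assms(2) p z])
  moreover have "(\<lambda>n p. if n = 0 then p else undefined) \<in> cx_iso (cone ?X ?Y ?z) (stalk (mod_sum M N))"
  proof (rule cx_isoI)
    fix n :: int
    show "(\<lambda>p. if n = 0 then p else undefined) \<in> mod_hom A (obj (cone ?X ?Y ?z) n) (obj (stalk (mod_sum M N)) n)"
      by (cases "n = 0") (auto simp: cone_def shift_def stalk_def mod_hom_zero_mod mod_hom_id)
    show "bij_betw (\<lambda>p. if n = 0 then p else undefined) (carrier (obj (cone ?X ?Y ?z) n)) (carrier (obj (stalk (mod_sum M N)) n))"
      by (cases "n = 0") (auto simp: cone_def shift_def stalk_def bij_betw_def)
    fix x assume x: "x \<in> carrier (obj (cone ?X ?Y ?z) n)"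
    interpret N: abelian_group N by (rule right_module_group[OF fd_right[OF fg_projective_fd[OF N]]])
    interpret M: abelian_group M by (rule right_module_group[OF fd_right[OF fg_projective_fd[OF M]]])
    show "(if n + 1 = 0 then dif (cone ?X ?Y ?z) n x else undefined) = dif (stalk (mod_sum M N)) n (if n = 0 then x else undefined)"
      by (auto simp: cone_def shift_def stalk_def abelian_group_uminus_zero[OF M.abelian_group_axioms] split: prod.splits)
  qed
  ultimately show ?thesis
    by (rule gen_iso[OF _ cone_projective[OF p z] stalk_projective[OF fg_projective_mod_sum[OF M N]]])
qed

lemma gen_stalk_mod_Sum:
  assumes J: "finite J" and T: "bounded_complex A T"
    and M: "\<And>j. j \<in> J \<Longrightarrow> fg_projective A (M j)" "\<And>j. j \<in> J \<Longrightarrow> gen T (stalk (M j))"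
  shows "gen T (stalk (mod_Sum J M))"
proof -
  have "fg_projective A (mod_Sum J M) \<and> gen T (stalk (mod_Sum J M))"
    using J
  proof (rule mod_Sum_induct)
    fix X :: "('a, 'd) right_mod" and Y Z :: "('a, 'b \<Rightarrow> 'd) right_mod" and f j J'
    assume a: "j \<in> J" "X = M j" "fg_projective A Y \<and> gen T (stalk Y)" "right_module A Z" "f \<in> mod_hom A (mod_sum X Y) Z"
      "bij_betw f (carrier (mod_sum X Y)) (carrier Z)"
    then have p: "fg_projective A (mod_sum X Y)" "gen T (stalk (mod_sum X Y))"
      using M by (auto intro: fg_projective_mod_sum gen_stalk_mod_sum)
    then show "fg_projective A Z \<and> gen T (stalk Z)" using a(4-6) by (blast intro: fg_projective_iso gen_stalk_iso)
  next
    fix Y :: "('a, 'b \<Rightarrow> 'd) right_mod" assume "right_module A Y" "carrier Y = {\<zero>\<^bsub>Y\<^esub>}"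
    then show "fg_projective A Y \<and> gen T (stalk Y)"
      by (intro conjI fg_projective_trivial gen_trivial[OF stalk_projective T]) (simp_all add: stalk_def)
  qed (use M fg_projective_fd fd_right in blast)
  then show ?thesis ..
qed

text \<open>Brutal truncation: \<open>P\<close> is the cone of \<open>d : P\<^sup>a[-a-1] \<rightarrow> P\<^sup>\<ge>\<^sup>a\<^sup>+\<^sup>1\<close>.\<close>

lemma gen_projective_complex:
  fixes P :: "('a, 'b) cochain"
  assumes T: "bounded_complex A T" and stalks: "\<And>M :: ('a, 'b) right_mod. fg_projective A M \<Longrightarrow> gen T (stalk M)"
    and P: "projective_complex A P"
  shows "gen T P"
proof -
  \<comment> \<open>Induction on the length j of the interval from a to a + j - 1 outside which P
    vanishes. Both a and P vary, as the truncated complex starts at a + 1.\<close>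
  have main: "gen T P" if "projective_complex A P" "\<And>n. n < a \<or> n \<ge> a + int j \<Longrightarrow> carrier (obj P n) = {\<zero>\<^bsub>obj P n\<^esub>}"
    for a j and P :: "('a, 'b) cochain"
    using that
  proof (induction j arbitrary: a P)
    case 0
    show ?case by (rule gen_trivial[OF 0(1) T]) (use 0(2) in force)
  next
    case (Suc j)
    note P = Suc.prems(1)
    note bP = pc_bc[OF P]
    have proj: "fg_projective A (obj P n)" for n using P by (simp add: projective_complex_def)
    \<comment> \<open>P^a is placed in degree a + 1, because the cone lowers the degree of its
      source by one.\<close>
    let ?X = "shift (- a - 1) (stalk (obj P a))"
    \<comment> \<open>All terms up to degree a become \<open>zero_mod\<close>, including those below
      a, which are zero already.\<close>
    define Y where "Y = \<lparr>obj = (\<lambda>n. if n \<le> a then zero_mod else obj P n), dif = (\<lambda>n x. if n \<le> a then \<zero>\<^bsub>if n + 1 \<le> a then zero_mod else obj P (n + 1)\<^esub> else dif P n x)\<rparr>"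
    have X: "projective_complex A ?X" by (intro shift_projective stalk_projective proj)
    obtain N where N: "N \<ge> 0" "\<forall>n. \<bar>n\<bar> > N \<longrightarrow> carrier (obj P n) = {\<zero>\<^bsub>obj P n\<^esub>}" using bounded_degree[OF bP] by blast
    have rY: "right_module A (if n \<le> a then zero_mod else obj P n)" for n
      by (auto intro: bc_right[OF bP] right_module_zero_mod ring_axioms)
    have bY: "bounded_complex A Y"
    proof (rule bounded_complexI[where N = N])
      show "dif Y n \<in> mod_hom A (obj Y n) (obj Y (n + 1))" for n
      proof (cases "n \<le> a")
        case True
        then show ?thesis using mod_hom_zero_map[OF rY[of "n + 1"], of zero_mod] by (simp add: Y_def mod_hom_zero_mod split: if_splits)
      next
        case False
        then show ?thesis using bc_dif[OF bP refl, of n] by (simp add: Y_def mod_hom_def)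
      qed
      show "dif Y (n + 1) (dif Y n x) = \<zero>\<^bsub>obj Y (n + 1 + 1)\<^esub>" if "x \<in> carrier (obj Y n)" for n x
        using that bc_dd[OF bP, of x n "n + 1"] bc_zero[OF bP, of "n + 1 + 1" "n + 1"] by (auto simp: Y_def split: if_splits)
    qed (use N in \<open>auto simp: Y_def intro: bc_fd[OF bP] fd_module_zero_mod\<close>)
    have Y: "projective_complex A Y" using bY proj by (auto simp: projective_complex_def Y_def fg_projective_zero_mod)
    have gY: "gen T Y" by (rule Suc.IH[OF Y, of "a + 1"]) (use Suc.prems(2) in \<open>auto simp: Y_def\<close>)
    define f where "f n = (if n = a + 1 then dif P a else (\<lambda>x. \<zero>\<^bsub>obj Y n\<^esub>))" for n
    have Xn: "obj ?X n = (if n = a + 1 then obj P a else zero_mod)" for n by (auto simp: shift_def stalk_def)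
    have dX: "dif ?X n x = \<zero>\<^bsub>obj ?X (n + 1)\<^esub>" for n x
      using abelian_group_uminus_zero[OF bc_group[OF pc_bc[OF X]], of "n + 1"]
      by (auto simp: shift_def stalk_def algebra_simps)
    have f: "f \<in> chain_map A ?X Y"
    proof (rule cmI)
      show "f n \<in> mod_hom A (obj ?X n) (obj Y n)" for n
      proof (cases "n = a + 1")
        case True
        then show ?thesis using bc_dif[OF bP refl, of a] by (simp add: f_def Xn Y_def)
      next
        case False
        then show ?thesis using mod_hom_zero_map[OF bc_right[OF bY, of n], of zero_mod] by (simp add: f_def Xn)
      qed
      then have f0: "f n \<zero>\<^bsub>obj ?X n\<^esub> = \<zero>\<^bsub>obj Y n\<^esub>" for n by (rule mod_hom_zero[OF _ bc_group[OF pc_bc[OF X]] bc_group[OF bY]])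
      fix n x assume x: "x \<in> carrier (obj ?X n)"
      have "dif Y n (f n x) = \<zero>\<^bsub>obj Y (n + 1)\<^esub>"
      proof (cases "n = a + 1")
        case True
        then show ?thesis using x bc_dd[OF bP, of x a "a + 1"] by (simp add: f_def Xn) (simp add: Y_def)
      next
        case False
        then show ?thesis using bc_zero[OF bY, of "n + 1" n] by (simp add: f_def)
      qed
      then show "f (n + 1) (dif ?X n x) = dif Y n (f n x)" by (simp only: dX f0)
    qed
    have "gen T (cone ?X Y f)"
      by (rule gen_cone[OF gen_shift[OF stalks[OF proj] stalk_projective[OF proj]] gY X Y f])
    \<comment> \<open>Below a the terms of the cone and of P are both zero but have different zero
      elements; there the map takes the zero of P as its value.\<close>
    moreover have "(\<lambda>n (x, y). if n = a then x else if n < a then \<zero>\<^bsub>obj P n\<^esub> else y) \<in> cx_iso (cone ?X Y f) P" (is "?i \<in> _")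
    proof (rule cx_isoI)
      have low: "n < a \<Longrightarrow> carrier (obj P n) = {\<zero>\<^bsub>obj P n\<^esub>}" for n using Suc.prems(2) by blast
      fix n
      have o: "obj (cone ?X Y f) n = mod_sum (if n = a then obj P a else zero_mod) (if n \<le> a then zero_mod else obj P n)" for n
        by (simp add: cone_def Xn del: shift_def) (simp add: Y_def)
      interpret G: right_module A "obj P n" by (rule bc_right[OF bP])
      interpret G1: right_module A "obj P (n + 1)" by (rule bc_right[OF bP])
      consider "n = a" | "n < a" | "n > a" by linarith
      then show "?i n \<in> mod_hom A (obj (cone ?X Y f) n) (obj P n)"
        by cases (auto intro!: mod_homI simp: o)
      consider "n = a" | "n < a" | "n > a" by linarith
      then show "bij_betw (?i n) (carrier (obj (cone ?X Y f) n)) (carrier (obj P n))"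
        by cases (auto simp: o bij_betw_def inj_on_def image_iff low)
      fix z assume "z \<in> carrier (obj (cone ?X Y f) n)"
      then obtain x y where z: "z = (x, y)" "x \<in> carrier (if n = a then obj P a else zero_mod)" "y \<in> carrier (if n \<le> a then zero_mod else obj P n)"
        by (auto simp: o)
      have d: "dif (cone ?X Y f) n z = (\<ominus>\<^bsub>obj ?X (n + 1 + 1)\<^esub> dif ?X (n + 1) x, f (n + 1) x \<oplus>\<^bsub>obj Y (n + 1)\<^esub> dif Y n y)"
        by (simp add: cone_def z(1))
      have d0: "\<ominus>\<^bsub>obj ?X (n + 1 + 1)\<^esub> dif ?X (n + 1) x = \<zero>\<^bsub>obj ?X (n + 1 + 1)\<^esub>"
        unfolding dX by (rule abelian_group_uminus_zero[OF bc_group[OF pc_bc[OF X]]])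
      consider "n = a" | "n + 1 = a" | "n + 1 < a" | "n > a" by linarith
      then show "?i (n + 1) (dif (cone ?X Y f) n z) = dif P n (?i n z)"
      proof cases
        case 1
        have "dif P a x \<in> carrier (obj P (n + 1))" using z(2) bc_closed[OF bP, of x a "a + 1"] 1 by simp
        then show ?thesis unfolding d using 1 z abelian_monoid.r_zero[OF abelian_group.axioms(1)[OF bc_group[OF bP]], of _ "a + 1"]
          by (simp add: f_def Y_def)
      next
        case 2
        then show ?thesis unfolding d unfolding d0 unfolding Xn using bc_zero[OF bP, of "n + 1" n] by (auto simp: z(1))
      next
        case 3
        then show ?thesis unfolding d using bc_zero[OF bP, of "n + 1" n] by (auto simp: z(1))
      next
        case 4
        have "dif P n y \<in> carrier (obj P (n + 1))" using z(3) bc_closed[OF bP, of y n "n + 1"] 4 by simp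
        then show ?thesis unfolding d using 4 by (simp add: f_def Y_def z(1))
      qed
    qed
    ultimately show ?case by (rule gen_iso[OF _ cone_projective[OF X Y f] P])
  qed
  obtain N where N: "N \<ge> 0" "\<forall>n. \<bar>n\<bar> > N \<longrightarrow> carrier (obj P n) = {\<zero>\<^bsub>obj P n\<^esub>}" using bounded_degree[OF pc_bc[OF P]] by blast
  show ?thesis
  proof (rule main[OF P, of "- N" "nat (2 * N + 1)"])
    fix n assume "n < - N \<or> n \<ge> - N + int (nat (2 * N + 1))"
    then have "\<bar>n\<bar> > N" using N(1) by auto
    then show "carrier (obj P n) = {\<zero>\<^bsub>obj P n\<^esub>}" using N(2) by blast
  qed
qed

text \<open>A perfect complex is isomorphic to a bounded complex of projectives, and
  \<open>tri_generated\<close> is closed under isomorphism.\<close>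

lemma generates_perI:
  assumes "\<And>P :: ('a, nat \<Rightarrow> 'k) cochain. projective_complex A P \<Longrightarrow> gen T P"
  shows "generates_per A T"
  unfolding generates_per_def
proof (intro allI impI)
  fix X :: "('a, nat \<Rightarrow> 'k) cochain" assume X: "perfect A X"
  then obtain P :: "('a, nat \<Rightarrow> 'k) cochain" where P: "projective_complex A P" "Db_iso A X P" unfolding perfect_def by blast
  note b = pc_bc[OF P(1)]
  have "Db_iso A (copy_cx P) P" by (rule qi_Db_iso[OF cx_iso_qi[OF copy_cx(3)[OF b]] copy_cx(1)[OF b] b]) (intro b copy_cx(1))+
  then have "tri_generated A T P"
    using tri_generated.iso[OF _ perfect_projective[OF P(1)]] assms[OF P(1)] unfolding gen_def by blast
  then show "tri_generated A T X" by (rule tri_generated.iso[OF _ X Db_iso_sym[OF P(2)]])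
qed

end

section \<open>Bound quiver algebras\<close>

subsection \<open>Monomials in the path algebra\<close>

definition path_mono :: "'k::field \<Rightarrow> ('v, 'e) path \<Rightarrow> ('v, 'e) path \<Rightarrow> 'k" where
  "path_mono c p = (\<lambda>q. if q = p then c else 0)"

lemma pa_simps:
  "carrier (path_algebra Q) = {x. finite {p. x p \<noteq> 0} \<and> {p. x p \<noteq> 0} \<subseteq> paths Q}"
  "\<zero>\<^bsub>path_algebra Q\<^esub> = (\<lambda>p. 0)"
  "x \<oplus>\<^bsub>path_algebra Q\<^esub> y = (\<lambda>p. x p + y p)"
  "c \<odot>\<^bsub>path_algebra Q\<^esub> x = (\<lambda>p. c * x p)"
  by (simp_all add: path_algebra_def)

lemma pa_mult:
  "(x \<otimes>\<^bsub>path_algebra Q\<^esub> y) (u, es) = (\<Sum>j\<le>length es. x (u, take j es) * y (path_end Q (u, take j es), drop j es))"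
  by (simp add: path_algebra_def)

lemma mono_closed: "p \<in> paths Q \<Longrightarrow> path_mono c p \<in> carrier (path_algebra Q)"
  by (auto simp: pa_simps path_mono_def intro: finite_subset[of _ "{p}"])

text \<open>Among all cuts of a path only the one after \<open>length es\<close> arrows can
  contribute, and only if its two pieces are the given paths.\<close>

lemma mono_mult:
  "path_mono c (u, es) \<otimes>\<^bsub>path_algebra Q\<^esub> path_mono d (path_end Q (u, es), fs) = path_mono (c * d) (u, es @ fs)"
proof (rule ext, clarify)
  fix w gs
  have "(path_mono c (u, es) \<otimes>\<^bsub>path_algebra Q\<^esub> path_mono d (path_end Q (u, es), fs)) (w, gs) =
      (\<Sum>j\<le>length gs. if j = length es then (if w = u \<and> gs = es @ fs then c * d else 0) else 0)"
    unfolding pa_mult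
  proof (rule sum.cong[OF refl])
    fix j assume "j \<in> {..length gs}"
    then have "take j gs = es \<and> drop j gs = fs \<longleftrightarrow> j = length es \<and> gs = es @ fs"
      by (metis append_eq_conv_conj append_take_drop_id atMost_iff length_take min.absorb2)
    moreover have "path_mono c (u, es) (w, take j gs) * path_mono d (path_end Q (u, es), fs) (path_end Q (w, take j gs), drop j gs) =
        (if w = u \<and> (take j gs = es \<and> drop j gs = fs) then c * d else 0)"
      by (auto simp: path_mono_def)
    ultimately show "path_mono c (u, es) (w, take j gs) * path_mono d (path_end Q (u, es), fs) (path_end Q (w, take j gs), drop j gs) =
        (if j = length es then (if w = u \<and> gs = es @ fs then c * d else 0) else 0)"
      by simp
  qed
  then show "(path_mono c (u, es) \<otimes>\<^bsub>path_algebra Q\<^esub> path_mono d (path_end Q (u, es), fs)) (w, gs) = path_mono (c * d) (u, es @ fs) (w, gs)"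
    by (auto simp: path_mono_def)
qed

lemma arrow_elt_mono: "arrow_elt Q a = path_mono 1 (tail Q a, [a])"
  by (simp add: arrow_elt_def path_mono_def)

lemma mono_Cons: "path_mono c (tail Q a, a # es) = arrow_elt Q a \<otimes>\<^bsub>path_algebra Q\<^esub> path_mono c (head Q a, es)"
  using mono_mult[where c = 1 and u = "tail Q a" and es = "[a]" and Q = Q and d = c and fs = es] by (simp add: arrow_elt_mono path_end_simp)

lemma mono_snoc:
  "path_end Q (u, es) = tail Q a \<Longrightarrow> path_mono c (u, es @ [a]) = path_mono c (u, es) \<otimes>\<^bsub>path_algebra Q\<^esub> arrow_elt Q a"
  using mono_mult[where c = c and u = u and es = es and Q = Q and d = 1 and fs = "[a]"] by (simp add: arrow_elt_mono)

lemma vtx_mult: "(path_mono 1 (v, []) \<otimes>\<^bsub>path_algebra Q\<^esub> x) (u, es) = (if u = v then x (u, es) else 0)"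
proof -
  have "(path_mono 1 (v, []) \<otimes>\<^bsub>path_algebra Q\<^esub> x) (u, es) = (\<Sum>j\<le>length es. if j = 0 then (if u = v then x (u, es) else 0) else 0)"
    unfolding pa_mult by (rule sum.cong[OF refl]) (auto simp: path_mono_def path_end_simp)
  then show ?thesis by simp
qed

lemma mult_vtx: "(x \<otimes>\<^bsub>path_algebra Q\<^esub> path_mono 1 (v, [])) (u, es) = (if path_end Q (u, es) = v then x (u, es) else 0)"
proof -
  have "(x \<otimes>\<^bsub>path_algebra Q\<^esub> path_mono 1 (v, [])) (u, es) =
      (\<Sum>j\<le>length es. if j = length es then (if path_end Q (u, es) = v then x (u, es) else 0) else 0)"
    unfolding pa_mult by (rule sum.cong[OF refl]) (auto simp: path_mono_def)
  then show ?thesis by simp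
qed

lemma pa_mult_smult: "x \<otimes>\<^bsub>path_algebra Q\<^esub> (c \<odot>\<^bsub>path_algebra Q\<^esub> y) = c \<odot>\<^bsub>path_algebra Q\<^esub> (x \<otimes>\<^bsub>path_algebra Q\<^esub> y)"
  by (rule ext, clarify) (simp add: pa_mult pa_simps sum_distrib_left mult_ac)

lemma pa_smult_mult: "(c \<odot>\<^bsub>path_algebra Q\<^esub> x) \<otimes>\<^bsub>path_algebra Q\<^esub> y = c \<odot>\<^bsub>path_algebra Q\<^esub> (x \<otimes>\<^bsub>path_algebra Q\<^esub> y)"
  by (rule ext, clarify) (simp add: pa_mult pa_simps sum_distrib_left mult_ac)

lemma pa_smult_closed: "x \<in> carrier (path_algebra Q) \<Longrightarrow> c \<odot>\<^bsub>path_algebra Q\<^esub> x \<in> carrier (path_algebra Q)"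
  by (auto simp: pa_simps intro: rev_finite_subset)

lemma pa_restrict: "x \<in> carrier (path_algebra Q) \<Longrightarrow> (\<lambda>p. if P p then x p else 0) \<in> carrier (path_algebra Q)"
  by (auto simp: pa_simps intro: rev_finite_subset)

lemma pa_mult_support:
  assumes "(x \<otimes>\<^bsub>path_algebra Q\<^esub> y) (u, es) \<noteq> 0"
  obtains j where "j \<le> length es" "x (u, take j es) \<noteq> 0" "y (path_end Q (u, take j es), drop j es) \<noteq> 0"
proof -
  have "\<exists>j\<le>length es. x (u, take j es) * y (path_end Q (u, take j es), drop j es) \<noteq> 0"
    using assms unfolding pa_mult by (meson atMost_iff sum.not_neutral_contains_not_neutral)
  then show thesis using that by auto
qed

text \<open>The monomials are restricted to paths in the support of x, so that information on their
  start, end or length stays available in the induction.\<close>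

lemma pa_induct:
  assumes "x \<in> carrier (path_algebra Q)" and zero: "(\<lambda>p. 0) \<in> S"
    and add: "\<And>y z. y \<in> S \<Longrightarrow> z \<in> S \<Longrightarrow> (\<lambda>p. y p + z p) \<in> S"
    and mono: "\<And>p c. x p \<noteq> 0 \<Longrightarrow> p \<in> paths Q \<Longrightarrow> path_mono c p \<in> S"
  shows "x \<in> S"
proof -
  have "(\<lambda>p. if p \<in> F then x p else 0) \<in> S" if "finite F" "F \<subseteq> {p. x p \<noteq> 0}" for F
    using that
  proof (induction F rule: finite_induct)
    case empty
    then show ?case using zero by simp
  next
    case (insert p F)
    have "p \<in> paths Q" using insert assms(1) by (auto simp: pa_simps)
    then have "(\<lambda>q. path_mono (x p) p q + (if q \<in> F then x q else 0)) \<in> S" using insert by (intro add mono insert.IH) auto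
    moreover have "(\<lambda>q. path_mono (x p) p q + (if q \<in> F then x q else 0)) = (\<lambda>q. if q \<in> insert p F then x q else 0)"
      using insert by (auto simp: path_mono_def fun_eq_iff)
    ultimately show ?case by simp
  qed
  from this[of "{p. x p \<noteq> 0}"] have "(\<lambda>p. if p \<in> {p. x p \<noteq> 0} then x p else 0) \<in> S" using assms(1) by (simp add: pa_simps)
  moreover have "(\<lambda>p. if p \<in> {p. x p \<noteq> 0} then x p else 0) = x" by (auto simp: fun_eq_iff)
  ultimately show ?thesis by simp
qed

lemma paths_iff: "(u, es) \<in> paths Q \<longleftrightarrow> u \<in> verts Q \<and> set es \<subseteq> arcs Q \<and> pre_digraph.cas Q u es (path_end Q (u, es))"
  by (simp add: paths_def pre_digraph.awalk_def)

lemma path_end_Cons: "path_end Q (u, a # es) = path_end Q (head Q a, es)"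
  by (simp add: path_end_simp)

lemma path_end_snoc: "path_end Q (u, es @ [a]) = head Q a"
  by (simp add: path_end_simp)

lemma paths_Cons:
  assumes "wf_digraph Q" "(u, a # es) \<in> paths Q"
  shows "a \<in> arcs Q" "u = tail Q a" "(head Q a, es) \<in> paths Q"
  using assms wf_digraph.head_in_verts[OF assms(1), of a]
  by (auto simp: paths_iff path_end_Cons pre_digraph.cas.simps)

lemma paths_snoc:
  assumes "wf_digraph Q" "(u, es @ [a]) \<in> paths Q"
  shows "a \<in> arcs Q" "path_end Q (u, es) = tail Q a" "(u, es) \<in> paths Q"
proof -
  have c: "pre_digraph.cas Q u (es @ [a]) (head Q a)" "a \<in> arcs Q" "u \<in> verts Q" "set es \<subseteq> arcs Q"
    using assms(2) by (auto simp: paths_iff path_end_snoc)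
  have "pre_digraph.cas Q u es (pre_digraph.awlast Q u es)" "pre_digraph.awlast Q u es = tail Q a"
    using c(1) pre_digraph.cas_append_iff[of Q u es "[a]" "head Q a"] by (auto simp: pre_digraph.cas.simps)
  then show "a \<in> arcs Q" "path_end Q (u, es) = tail Q a" "(u, es) \<in> paths Q"
    using c by (auto simp: paths_iff path_end_def)
qed

subsection \<open>The quotient\<close>

locale bound_quiver =
  fixes Q :: "('v, 'e) pre_digraph" and I :: "(('v, 'e) path \<Rightarrow> 'k::field) set"
  assumes fin: "fin_digraph Q" and adm: "admissible_ideal Q I"
begin

abbreviation KQ :: "('k, ('v, 'e) path \<Rightarrow> 'k) module" where "KQ \<equiv> path_algebra Q"
abbreviation A :: "('k, ('v, 'e, 'k) qelt) module" where "A \<equiv> quiver_algebra Q I"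
abbreviation cls :: "(('v, 'e) path \<Rightarrow> 'k) \<Rightarrow> ('v, 'e, 'k) qelt" where "cls \<equiv> residue_class Q I"

lemma wf: "wf_digraph Q"
  using fin by (rule fin_digraph.axioms)

lemma KQ_ring: "ring KQ"
  by (rule path_algebra_ring[OF fin])

lemma I_ideal: "ideal I KQ"
  using adm by (simp add: admissible_ideal_def)

lemma carrier_A: "carrier A = cls ` carrier KQ"
  by (auto simp: quiver_algebra_simps FactRing_def A_RCOSETS_def' residue_class_def)

lemma cls_closed: "x \<in> carrier KQ \<Longrightarrow> cls x \<in> carrier A"
  by (simp add: carrier_A)

lemma cls_mult: "x \<in> carrier KQ \<Longrightarrow> y \<in> carrier KQ \<Longrightarrow> cls x \<otimes>\<^bsub>A\<^esub> cls y = cls (x \<otimes>\<^bsub>KQ\<^esub> y)"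
  using ideal.rcoset_mult_add[OF I_ideal, of x y] by (simp add: quiver_algebra_simps FactRing_def residue_class_def)

lemma cls_add: "x \<in> carrier KQ \<Longrightarrow> y \<in> carrier KQ \<Longrightarrow> cls x \<oplus>\<^bsub>A\<^esub> cls y = cls (\<lambda>p. x p + y p)"
proof -
  assume xy: "x \<in> carrier KQ" "y \<in> carrier KQ"
  interpret ideal I KQ by (rule I_ideal)
  show ?thesis using a_rcos_sum[OF xy] by (simp add: quiver_algebra_simps FactRing_def residue_class_def pa_simps)
qed

lemma cls_eq_iff: "x \<in> carrier KQ \<Longrightarrow> y \<in> carrier KQ \<Longrightarrow> cls x = cls y \<longleftrightarrow> x \<ominus>\<^bsub>KQ\<^esub> y \<in> I"
  unfolding residue_class_def
  by (rule coset_eq_iff) (use KQ_ring I_ideal in \<open>auto simp: ring_def ideal_def\<close>)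

lemma zero_cls: "\<zero>\<^bsub>A\<^esub> = cls (\<lambda>p. 0)"
proof -
  interpret ideal I KQ by (rule I_ideal)
  show ?thesis using a_coset_add_zero[OF a_subset] by (simp add: quiver_algebra_simps residue_class_def pa_simps)
qed

lemma cls_zero_iff: "x \<in> carrier KQ \<Longrightarrow> cls x = \<zero>\<^bsub>A\<^esub> \<longleftrightarrow> x \<in> I"
proof -
  assume x: "x \<in> carrier KQ"
  interpret ring KQ by (rule KQ_ring)
  have "x \<ominus>\<^bsub>KQ\<^esub> \<zero>\<^bsub>KQ\<^esub> = x" using x by (simp add: minus_eq)
  then show ?thesis using cls_eq_iff[OF x zero_closed] by (simp add: zero_cls pa_simps)
qed

lemma nonzero_in_iff: "nonzero_in Q I x \<longleftrightarrow> cls x \<noteq> \<zero>\<^bsub>A\<^esub>"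
  by (simp add: nonzero_in_def)

lemma one_cls: "\<one>\<^bsub>A\<^esub> = cls \<one>\<^bsub>KQ\<^esub>"
  by (simp add: quiver_algebra_simps FactRing_def residue_class_def)

lemma cls_smult: "x \<in> carrier KQ \<Longrightarrow> c \<odot>\<^bsub>A\<^esub> cls x = cls (c \<odot>\<^bsub>KQ\<^esub> x)"
proof -
  assume x: "x \<in> carrier KQ"
  interpret KQ: ring KQ by (rule KQ_ring)
  interpret ideal I KQ by (rule I_ideal)
  have "cls (c \<odot>\<^bsub>KQ\<^esub> z) = cls (c \<odot>\<^bsub>KQ\<^esub> x)" if "z \<in> cls x" for z
  proof -
    obtain i where i: "i \<in> I" "z = i \<oplus>\<^bsub>KQ\<^esub> x" using \<open>z \<in> cls x\<close> by (auto simp: residue_class_def a_r_coset_mem)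
    have ic: "i \<in> carrier KQ" using i(1) by (rule a_Hcarr)
    \<comment> \<open>Ideals of the ring are stable under scalars, because c i = (c 1) i.\<close>
    have "c \<odot>\<^bsub>KQ\<^esub> i = (c \<odot>\<^bsub>KQ\<^esub> \<one>\<^bsub>KQ\<^esub>) \<otimes>\<^bsub>KQ\<^esub> i" using KQ.l_one[OF ic] by (simp add: pa_smult_mult)
    then have ci: "c \<odot>\<^bsub>KQ\<^esub> i \<in> I" using I_l_closed[OF i(1)] pa_smult_closed[OF KQ.one_closed] by simp
    have e: "c \<odot>\<^bsub>KQ\<^esub> z = c \<odot>\<^bsub>KQ\<^esub> i \<oplus>\<^bsub>KQ\<^esub> c \<odot>\<^bsub>KQ\<^esub> x" by (simp add: i(2) pa_simps algebra_simps)
    have "c \<odot>\<^bsub>KQ\<^esub> z \<ominus>\<^bsub>KQ\<^esub> c \<odot>\<^bsub>KQ\<^esub> x = c \<odot>\<^bsub>KQ\<^esub> i"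
      using pa_smult_closed[OF x] pa_smult_closed[OF ic] KQ.a_closed by (subst KQ.minus_eq_iff) (auto simp: e)
    then have "c \<odot>\<^bsub>KQ\<^esub> z \<ominus>\<^bsub>KQ\<^esub> c \<odot>\<^bsub>KQ\<^esub> x \<in> I" using ci by simp
    moreover have "z \<in> carrier KQ" using i(2) ic x by simp
    ultimately show ?thesis using cls_eq_iff[OF pa_smult_closed pa_smult_closed] x by blast
  qed
  moreover have "x \<in> cls x" using a_rcos_self[OF x] by (simp add: residue_class_def)
  ultimately have "(\<Union>z\<in>cls x. cls (c \<odot>\<^bsub>KQ\<^esub> z)) = cls (c \<odot>\<^bsub>KQ\<^esub> x)" by blast
  then show ?thesis by (simp add: quiver_algebra_simps(6) residue_class_def)
qed

lemma A_ring: "ring A"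
proof -
  interpret F: ring "KQ Quot I" by (rule ideal.quotient_is_ring[OF I_ideal])
  have z: "\<zero>\<^bsub>A\<^esub> = \<zero>\<^bsub>KQ Quot I\<^esub>" by (simp add: quiver_algebra_simps FactRing_def)
  show ?thesis
    by (intro ringI abelian_groupI monoidI)
      (auto simp: quiver_algebra_simps(1-4) z F.a_ac F.m_assoc F.l_distr F.r_distr intro: F.l_neg F.a_inv_closed)
qed

sublocale kalg A
proof (intro kalg.intro kalg_axioms.intro A_ring)
  interpret KQ: ring KQ by (rule KQ_ring)
  fix c d :: 'k
  have o: "\<one>\<^bsub>KQ\<^esub> \<in> carrier KQ" by simp
  show "c \<odot>\<^bsub>A\<^esub> \<one>\<^bsub>A\<^esub> \<in> carrier A" unfolding one_cls cls_smult[OF o] by (intro cls_closed pa_smult_closed o)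
  show "(c + d) \<odot>\<^bsub>A\<^esub> \<one>\<^bsub>A\<^esub> = c \<odot>\<^bsub>A\<^esub> \<one>\<^bsub>A\<^esub> \<oplus>\<^bsub>A\<^esub> d \<odot>\<^bsub>A\<^esub> \<one>\<^bsub>A\<^esub>"
    unfolding one_cls cls_smult[OF o] cls_add[OF pa_smult_closed[OF o] pa_smult_closed[OF o]]
    by (simp add: pa_simps algebra_simps)
qed

lemma cls_mult_scalar: "x \<in> carrier KQ \<Longrightarrow> cls x \<otimes>\<^bsub>A\<^esub> (c \<odot>\<^bsub>A\<^esub> \<one>\<^bsub>A\<^esub>) = cls (\<lambda>p. c * x p)"
proof -
  interpret KQ: ring KQ by (rule KQ_ring)
  assume x: "x \<in> carrier KQ"
  then show ?thesis unfolding one_cls cls_smult[OF KQ.one_closed] cls_mult[OF x pa_smult_closed[OF KQ.one_closed]]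
    by (simp add: pa_mult_smult) (simp add: pa_simps)
qed

section \<open>Vertex idempotents e_v, arrows, and the modules P_i\<close>

definition vtx :: "'v \<Rightarrow> ('v, 'e, 'k) qelt" where "vtx v = cls (path_mono 1 (v, []))"
definition arr :: "'e \<Rightarrow> ('v, 'e, 'k) qelt" where "arr a = cls (arrow_elt Q a)"
abbreviation P :: "'v \<Rightarrow> (('v, 'e, 'k) qelt, ('v, 'e, 'k) qelt) right_mod" where "P \<equiv> proj_mod Q I"

lemma trivial_path: "v \<in> verts Q \<Longrightarrow> (v, []) \<in> paths Q"
  by (simp add: paths_iff path_end_simp pre_digraph.cas.simps)

lemma arrow_path: "a \<in> arcs Q \<Longrightarrow> (tail Q a, [a]) \<in> paths Q"
  using wf_digraph.tail_in_verts[OF wf] by (simp add: paths_iff path_end_simp pre_digraph.cas.simps)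

lemma vtx_KQ: "v \<in> verts Q \<Longrightarrow> path_mono 1 (v, []) \<in> carrier KQ"
  by (intro mono_closed trivial_path)

lemma arrow_KQ: "a \<in> arcs Q \<Longrightarrow> arrow_elt Q a \<in> carrier KQ"
  unfolding arrow_elt_mono by (intro mono_closed arrow_path)

lemma vtx_closed [simp]: "v \<in> verts Q \<Longrightarrow> vtx v \<in> carrier A"
  unfolding vtx_def by (intro cls_closed vtx_KQ)

lemma arr_closed [simp]: "a \<in> arcs Q \<Longrightarrow> arr a \<in> carrier A"
  unfolding arr_def by (intro cls_closed arrow_KQ)

lemma vtx_mult_cls: "v \<in> verts Q \<Longrightarrow> x \<in> carrier KQ \<Longrightarrow> vtx v \<otimes>\<^bsub>A\<^esub> cls x = cls (\<lambda>p. if fst p = v then x p else 0)"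
  unfolding vtx_def using cls_mult[OF vtx_KQ, of v x] by (simp add: vtx_mult fun_eq_iff arg_cong[of _ _ cls])

lemma cls_mult_vtx: "v \<in> verts Q \<Longrightarrow> x \<in> carrier KQ \<Longrightarrow> cls x \<otimes>\<^bsub>A\<^esub> vtx v = cls (\<lambda>p. if path_end Q p = v then x p else 0)"
  unfolding vtx_def using cls_mult[OF _ vtx_KQ, of x v] by (simp add: mult_vtx fun_eq_iff arg_cong[of _ _ cls])

lemma vtx_idem: "v \<in> verts Q \<Longrightarrow> vtx v \<otimes>\<^bsub>A\<^esub> vtx v = vtx v"
  using vtx_mult_cls[of v "path_mono 1 (v, [])"] vtx_KQ[of v]
  by (auto simp: vtx_def path_mono_def intro!: arg_cong[of _ _ cls])

lemma arr_left: "a \<in> arcs Q \<Longrightarrow> vtx (tail Q a) \<otimes>\<^bsub>A\<^esub> arr a = arr a"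
  using vtx_mult_cls[of "tail Q a" "arrow_elt Q a"] arrow_KQ[of a] wf_digraph.tail_in_verts[OF wf, of a]
  by (auto simp: arr_def arrow_elt_def intro!: arg_cong[of _ _ cls])

lemma arr_right: "a \<in> arcs Q \<Longrightarrow> arr a \<otimes>\<^bsub>A\<^esub> vtx (head Q a) = arr a"
  using cls_mult_vtx[of "head Q a" "arrow_elt Q a"] arrow_KQ[of a] wf_digraph.head_in_verts[OF wf, of a]
  by (auto simp: arr_def arrow_elt_def path_end_simp intro!: arg_cong[of _ _ cls])

lemma P_simps [simp]: "\<zero>\<^bsub>P i\<^esub> = \<zero>\<^bsub>A\<^esub>" "x \<oplus>\<^bsub>P i\<^esub> y = x \<oplus>\<^bsub>A\<^esub> y" "x \<bullet>\<^bsub>P i\<^esub> a = x \<otimes>\<^bsub>A\<^esub> a"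
  by (simp_all add: proj_mod_def)

lemma left_mult_arrow_arr: "left_mult_arrow Q I a x = arr a \<otimes>\<^bsub>A\<^esub> x"
  by (simp add: left_mult_arrow_def arr_def)

text \<open>P_i = e_i A: left multiplication by e_i cuts a representative down to the paths starting
  at i. Membership in P_i thereby becomes an equation.\<close>

lemma P_carrier: "i \<in> verts Q \<Longrightarrow> carrier (P i) = {x \<in> carrier A. vtx i \<otimes>\<^bsub>A\<^esub> x = x}"
proof (intro equalityI subsetI)
  fix x assume i: "i \<in> verts Q" and "x \<in> carrier (P i)"
  then obtain f where f: "f \<in> carrier KQ" "\<forall>p. f p \<noteq> 0 \<longrightarrow> fst p = i" "x = cls f" by (auto simp: proj_mod_def)
  then have "(\<lambda>p. if fst p = i then f p else 0) = f" by (auto simp: fun_eq_iff)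
  then show "x \<in> {x \<in> carrier A. vtx i \<otimes>\<^bsub>A\<^esub> x = x}" using f i vtx_mult_cls[OF i f(1)] cls_closed by simp
next
  fix x assume i: "i \<in> verts Q" and "x \<in> {x \<in> carrier A. vtx i \<otimes>\<^bsub>A\<^esub> x = x}"
  then obtain f where f: "f \<in> carrier KQ" "x = cls f" "vtx i \<otimes>\<^bsub>A\<^esub> x = x" by (auto simp: carrier_A)
  then have "x = cls (\<lambda>p. if fst p = i then f p else 0)" using vtx_mult_cls[OF i f(1)] by simp
  then show "x \<in> carrier (P i)" using pa_restrict[OF f(1), of "\<lambda>p. fst p = i"] by (auto simp: proj_mod_def)
qed

lemma P_rep: "i \<in> verts Q \<Longrightarrow> x \<in> carrier (P i) \<Longrightarrow> \<exists>f\<in>carrier KQ. (\<forall>p. f p \<noteq> 0 \<longrightarrow> fst p = i) \<and> x = cls f"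
  by (auto simp: proj_mod_def)

lemma mono_P: "(i, es) \<in> paths Q \<Longrightarrow> cls (path_mono c (i, es)) \<in> carrier (P i)"
proof -
  assume "(i, es) \<in> paths Q"
  then have "path_mono c (i, es) \<in> {x \<in> carrier KQ. \<forall>p. x p \<noteq> 0 \<longrightarrow> fst p = i}"
    by (simp add: mono_closed) (simp add: path_mono_def)
  then show ?thesis unfolding proj_mod_def by simp
qed

text \<open>The classes of combinations of paths from i to j form e_i A e_j; this is the dictionary
  between the stated conditions and equations in A.\<close>

lemma path_combs_cls:
  assumes "i \<in> verts Q" "j \<in> verts Q"
  shows "cls ` path_combs Q i j = {x \<in> carrier A. vtx i \<otimes>\<^bsub>A\<^esub> x = x \<and> x \<otimes>\<^bsub>A\<^esub> vtx j = x}"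
proof (intro equalityI subsetI)
  fix x assume "x \<in> cls ` path_combs Q i j"
  then obtain f where f: "f \<in> carrier KQ" "\<forall>p. f p \<noteq> 0 \<longrightarrow> fst p = i \<and> path_end Q p = j" "x = cls f" by (auto simp: path_combs_def)
  then have "(\<lambda>p. if fst p = i then f p else 0) = f" "(\<lambda>p. if path_end Q p = j then f p else 0) = f" by (auto simp: fun_eq_iff)
  then show "x \<in> {x \<in> carrier A. vtx i \<otimes>\<^bsub>A\<^esub> x = x \<and> x \<otimes>\<^bsub>A\<^esub> vtx j = x}"
    using f vtx_mult_cls[OF assms(1) f(1)] cls_mult_vtx[OF assms(2) f(1)] cls_closed by simp
next
  fix x assume "x \<in> {x \<in> carrier A. vtx i \<otimes>\<^bsub>A\<^esub> x = x \<and> x \<otimes>\<^bsub>A\<^esub> vtx j = x}"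
  then obtain f where f: "f \<in> carrier KQ" "x = cls f" "vtx i \<otimes>\<^bsub>A\<^esub> x = x" "x \<otimes>\<^bsub>A\<^esub> vtx j = x" by (auto simp: carrier_A)
  let ?g = "\<lambda>p. if fst p = i then f p else 0"
  have g: "?g \<in> carrier KQ" "x = cls ?g" using vtx_mult_cls[OF assms(1) f(1)] f pa_restrict[OF f(1)] by auto
  let ?h = "\<lambda>p. if path_end Q p = j then ?g p else 0"
  have "?h \<in> carrier KQ" "x = cls ?h" using cls_mult_vtx[OF assms(2) g(1)] f(4) g pa_restrict[OF g(1)] by auto
  moreover have "\<forall>p. ?h p \<noteq> 0 \<longrightarrow> fst p = i \<and> path_end Q p = j" by auto
  ultimately show "x \<in> cls ` path_combs Q i j" unfolding path_combs_def by blast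
qed

lemma P_right: assumes i: "i \<in> verts Q" shows "right_module A (P i)"
proof (intro right_module.intro right_module_axioms.intro abelian_groupI A_ring)
  fix x assume x: "x \<in> carrier (P i)"
  then show "\<exists>y\<in>carrier (P i). y \<oplus>\<^bsub>P i\<^esub> x = \<zero>\<^bsub>P i\<^esub>"
    by (intro bexI[of _ "\<ominus>\<^bsub>A\<^esub> x"]) (auto simp: P_carrier[OF i] l_neg r_minus i)
qed (auto simp: P_carrier[OF i] i a_ac r_distr l_distr m_assoc[symmetric])

lemma P_incl: "i \<in> verts Q \<Longrightarrow> x \<in> carrier (P i) \<Longrightarrow> x \<in> carrier A"
  by (simp add: P_carrier)

lemma vtx_P: "i \<in> verts Q \<Longrightarrow> vtx i \<in> carrier (P i)"
  by (simp add: P_carrier vtx_idem)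

lemma cls_induct:
  assumes x: "x \<in> carrier KQ" and S: "\<zero>\<^bsub>A\<^esub> \<in> S" "\<And>y z. y \<in> S \<Longrightarrow> z \<in> S \<Longrightarrow> y \<oplus>\<^bsub>A\<^esub> z \<in> S"
    and mono: "\<And>p c. x p \<noteq> 0 \<Longrightarrow> p \<in> paths Q \<Longrightarrow> cls (path_mono c p) \<in> S"
  shows "cls x \<in> S"
proof -
  have "x \<in> {y \<in> carrier KQ. cls y \<in> S}"
  proof (rule pa_induct[OF x])
    interpret KQ: ring KQ by (rule KQ_ring)
    show "(\<lambda>p. 0) \<in> {y \<in> carrier KQ. cls y \<in> S}" using S(1) KQ.zero_closed by (simp add: zero_cls pa_simps)
    fix y z assume "y \<in> {y \<in> carrier KQ. cls y \<in> S}" "z \<in> {y \<in> carrier KQ. cls y \<in> S}"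
    then have yz: "y \<in> carrier KQ" "z \<in> carrier KQ" "cls y \<in> S" "cls z \<in> S" by blast+
    have "(\<lambda>p. y p + z p) \<in> carrier KQ" using KQ.a_closed[OF yz(1,2)] unfolding pa_simps(3) .
    moreover have "cls (\<lambda>p. y p + z p) \<in> S" using S(2)[OF yz(3,4)] unfolding cls_add[OF yz(1,2)] .
    ultimately show "(\<lambda>p. y p + z p) \<in> {y \<in> carrier KQ. cls y \<in> S}" by blast
  qed (use mono mono_closed in auto)
  then show ?thesis by simp
qed

text \<open>As i \<noteq> j, a path from i to j is not trivial and has a last arrow, which ends at
  j. So e_i A e_j lies in the sum of the P_i a over the arrows a ending at j.\<close>

lemma in_arrows_induct:
  assumes ij: "i \<in> verts Q" "j \<in> verts Q" "i \<noteq> j" and x: "x \<in> carrier A" "vtx i \<otimes>\<^bsub>A\<^esub> x = x" "x \<otimes>\<^bsub>A\<^esub> vtx j = x"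
    and S: "\<zero>\<^bsub>A\<^esub> \<in> S" "\<And>y z. y \<in> S \<Longrightarrow> z \<in> S \<Longrightarrow> y \<oplus>\<^bsub>A\<^esub> z \<in> S"
    and arr: "\<And>y a. y \<in> carrier (P i) \<Longrightarrow> a \<in> in_arrows Q j \<Longrightarrow> y \<otimes>\<^bsub>A\<^esub> arr a \<in> S"
  shows "x \<in> S"
proof -
  have "x \<in> cls ` path_combs Q i j" unfolding path_combs_cls[OF ij(1,2)] using x by simp
  then obtain f where f: "f \<in> carrier KQ" "\<And>p. f p \<noteq> 0 \<Longrightarrow> fst p = i \<and> path_end Q p = j" "x = cls f" by (auto simp: path_combs_def)
  show ?thesis unfolding f(3)
  proof (rule cls_induct[OF f(1) S])
    fix p c assume p: "f p \<noteq> 0" "p \<in> paths Q"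
    obtain es where es: "p = (i, es)" using f(2)[OF p(1)] by (cases p) auto
    have "es \<noteq> []" using f(2)[OF p(1)] ij(3) by (auto simp: es path_end_simp)
    then obtain fs a where fs: "es = fs @ [a]" by (cases es rule: rev_cases) auto
    note pp = paths_snoc[OF wf p(2)[unfolded es fs]]
    have a: "a \<in> in_arrows Q j" using pp(1) f(2)[OF p(1)] by (simp add: in_arrows_def es fs path_end_snoc)
    have "cls (path_mono c (i, fs)) \<in> carrier (P i)" by (rule mono_P[OF pp(3)])
    moreover have "cls (path_mono c p) = cls (path_mono c (i, fs)) \<otimes>\<^bsub>A\<^esub> arr a"
      by (simp add: es fs mono_snoc[OF pp(2)] arr_def cls_mult mono_closed pp arrow_KQ)
    ultimately show "cls (path_mono c p) \<in> S" using arr a by simp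
  qed
qed

text \<open>The mirror image: a path between different vertices has a first arrow, which starts at
  i.\<close>

lemma out_arrows_induct:
  assumes ij: "i \<in> verts Q" "j \<in> verts Q" "i \<noteq> j" and x: "x \<in> carrier A" "vtx i \<otimes>\<^bsub>A\<^esub> x = x" "x \<otimes>\<^bsub>A\<^esub> vtx j = x"
    and S: "\<zero>\<^bsub>A\<^esub> \<in> S" "\<And>y z. y \<in> S \<Longrightarrow> z \<in> S \<Longrightarrow> y \<oplus>\<^bsub>A\<^esub> z \<in> S"
    and arr: "\<And>y a. a \<in> out_arrows Q i \<Longrightarrow> y \<in> carrier (P (head Q a)) \<Longrightarrow> arr a \<otimes>\<^bsub>A\<^esub> y \<in> S"
  shows "x \<in> S"
proof -
  have "x \<in> cls ` path_combs Q i j" unfolding path_combs_cls[OF ij(1,2)] using x by simp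
  then obtain f where f: "f \<in> carrier KQ" "\<And>p. f p \<noteq> 0 \<Longrightarrow> fst p = i \<and> path_end Q p = j" "x = cls f" by (auto simp: path_combs_def)
  show ?thesis unfolding f(3)
  proof (rule cls_induct[OF f(1) S])
    fix p c assume p: "f p \<noteq> 0" "p \<in> paths Q"
    obtain es where es: "p = (i, es)" using f(2)[OF p(1)] by (cases p) auto
    have "es \<noteq> []" using f(2)[OF p(1)] ij(3) by (auto simp: es path_end_simp)
    then obtain a fs where fs: "es = a # fs" by (cases es) auto
    note pp = paths_Cons[OF wf p(2)[unfolded es fs]]
    have a: "a \<in> out_arrows Q i" using pp by (simp add: out_arrows_def)
    have "cls (path_mono c (head Q a, fs)) \<in> carrier (P (head Q a))" by (rule mono_P[OF pp(3)])
    moreover have "cls (path_mono c p) = arr a \<otimes>\<^bsub>A\<^esub> cls (path_mono c (head Q a, fs))"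
      by (simp add: es fs pp(2) mono_Cons arr_def cls_mult mono_closed pp(1,3) arrow_KQ)
    ultimately show "cls (path_mono c p) \<in> S" using arr a by simp
  qed
qed

subsection \<open>The radical filtration\<close>

text \<open>The image of the n-th power of the arrow ideal, which is the n-th power of the radical
  of A since I is admissible.\<close>

definition rad :: "nat \<Rightarrow> ('v, 'e, 'k) qelt set" where
  "rad n = cls ` {x \<in> carrier KQ. \<forall>p. x p \<noteq> 0 \<longrightarrow> n \<le> length (snd p)}"

lemma rad_subset: "rad n \<subseteq> carrier A"
  by (auto simp: rad_def cls_closed)

lemma rad_0: "rad 0 = carrier A"
  by (simp add: rad_def carrier_A)

lemma rad_zero: "\<zero>\<^bsub>A\<^esub> \<in> rad n"
proof -
  interpret KQ: ring KQ by (rule KQ_ring)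
  show ?thesis unfolding rad_def zero_cls using KQ.zero_closed by (auto simp: pa_simps)
qed

lemma rad_add:
  assumes "x \<in> rad n" "y \<in> rad n" shows "x \<oplus>\<^bsub>A\<^esub> y \<in> rad n"
proof -
  interpret KQ: ring KQ by (rule KQ_ring)
  obtain f g where f: "f \<in> carrier KQ" "\<forall>p. f p \<noteq> 0 \<longrightarrow> n \<le> length (snd p)" "x = cls f"
    and g: "g \<in> carrier KQ" "\<forall>p. g p \<noteq> 0 \<longrightarrow> n \<le> length (snd p)" "y = cls g" using assms by (auto simp: rad_def)
  have "(\<lambda>p. f p + g p) \<in> carrier KQ" using KQ.a_closed[OF f(1) g(1)] by (simp add: pa_simps)
  moreover have "\<forall>p. f p + g p \<noteq> 0 \<longrightarrow> n \<le> length (snd p)" using f(2) g(2) by (metis add.right_neutral add.left_neutral)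
  ultimately show ?thesis unfolding f(3) g(3) cls_add[OF f(1) g(1)] rad_def by blast
qed

lemma rad_mult:
  assumes "x \<in> rad n" "y \<in> rad m" shows "x \<otimes>\<^bsub>A\<^esub> y \<in> rad (n + m)"
proof -
  interpret KQ: ring KQ by (rule KQ_ring)
  obtain f g where f: "f \<in> carrier KQ" "\<forall>p. f p \<noteq> 0 \<longrightarrow> n \<le> length (snd p)" "x = cls f"
    and g: "g \<in> carrier KQ" "\<forall>p. g p \<noteq> 0 \<longrightarrow> m \<le> length (snd p)" "y = cls g" using assms by (auto simp: rad_def)
  have "n + m \<le> length (snd p)" if nz: "(f \<otimes>\<^bsub>KQ\<^esub> g) p \<noteq> 0" for p
  proof -
    obtain u es where p: "p = (u, es)" by (cases p)
    obtain j where "j \<le> length es" "f (u, take j es) \<noteq> 0" "g (path_end Q (u, take j es), drop j es) \<noteq> 0"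
      by (rule pa_mult_support[OF nz[unfolded p]])
    then show ?thesis using f(2) g(2) by (fastforce simp: p)
  qed
  then show ?thesis unfolding f(3) g(3) cls_mult[OF f(1) g(1)] rad_def using KQ.m_closed[OF f(1) g(1)] by blast
qed

lemma rad_mono: "n \<le> m \<Longrightarrow> rad m \<subseteq> rad n"
  unfolding rad_def by (rule image_mono) (auto intro: order_trans)

lemma arr_rad: "a \<in> arcs Q \<Longrightarrow> arr a \<in> rad 1"
  unfolding rad_def arr_def using arrow_KQ[of a] by (auto simp: arrow_elt_def)

lemma arrow_ideal_power_ideal: "ideal (arrow_ideal_power Q n :: (('v, 'e) path \<Rightarrow> 'k) set) KQ"
proof (induction n)
  case 0
  show ?case using ring.oneideal[OF KQ_ring] by (simp add: arrow_ideal_power_def)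
next
  case (Suc n)
  have "ideal (arrow_ideal Q) KQ" unfolding arrow_ideal_def
    by (rule ring.genideal_ideal[OF KQ_ring]) (auto intro: arrow_KQ)
  then show ?case using ring.ideal_prod_is_ideal[OF KQ_ring _ Suc] by (simp add: arrow_ideal_power_def)
qed

text \<open>The power is built by multiplying with the arrow ideal from the left, so the induction
  splits off the first arrow.\<close>

lemma mono_arrow_ideal_power: "(u, es) \<in> paths Q \<Longrightarrow> n \<le> length es \<Longrightarrow> path_mono (c :: 'k) (u, es) \<in> arrow_ideal_power Q n"
proof (induction n arbitrary: u es)
  case 0
  then show ?case by (simp add: arrow_ideal_power_def mono_closed)
next
  case (Suc n)
  then obtain a fs where es: "es = a # fs" by (cases es) auto
  note pp = paths_Cons[OF wf Suc.prems(1)[unfolded es]]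
  have "(arrow_elt Q a :: _ \<Rightarrow> 'k) \<in> arrow_ideal Q" unfolding arrow_ideal_def
  proof (rule subsetD[OF ring.genideal_self[OF KQ_ring]])
    show "arrow_elt Q ` arcs Q \<subseteq> carrier KQ" by (rule image_subsetI) (rule arrow_KQ)
  qed (rule imageI[OF pp(1)])
  moreover have "(path_mono c (head Q a, fs) :: _ \<Rightarrow> 'k) \<in> arrow_ideal_power Q n" using Suc pp(3) es by simp
  ultimately show ?case unfolding es pp(2) mono_Cons
    by (simp add: arrow_ideal_power_def ideal_prod.prod)
qed

text \<open>Admissibility puts some power of the arrow ideal inside I, and every path that is long
  enough lies in this power.\<close>

lemma rad_nilpotent: "\<exists>m. rad m = {\<zero>\<^bsub>A\<^esub>}"
proof -
  obtain m where m: "arrow_ideal_power Q m \<subseteq> I" using adm by (auto simp: admissible_ideal_def)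
  have "x \<in> I" if x: "x \<in> carrier KQ" "\<forall>p. x p \<noteq> 0 \<longrightarrow> m \<le> length (snd p)" for x
  proof -
    interpret J: ideal "arrow_ideal_power Q m" KQ by (rule arrow_ideal_power_ideal)
    have "x \<in> arrow_ideal_power Q m"
    proof (rule pa_induct[OF x(1)])
      show "(\<lambda>p. 0 :: 'k) \<in> arrow_ideal_power Q m"
        using additive_subgroup.zero_closed[OF J.additive_subgroup_axioms] by (simp add: pa_simps)
      show "(\<lambda>p. y p + z p) \<in> arrow_ideal_power Q m" if "y \<in> arrow_ideal_power Q m" "z \<in> arrow_ideal_power Q m" for y z :: "_ \<Rightarrow> 'k"
        using additive_subgroup.a_closed[OF J.additive_subgroup_axioms that] by (simp add: pa_simps)
      fix p and c :: 'k assume "x p \<noteq> 0" "p \<in> paths Q"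
      then show "path_mono c p \<in> arrow_ideal_power Q m" using x(2)[rule_format, of p] mono_arrow_ideal_power[of "fst p" "snd p" m c] by simp
    qed
    then show ?thesis using m by blast
  qed
  then have "cls x = \<zero>\<^bsub>A\<^esub>" if "x \<in> carrier KQ" "\<forall>p. x p \<noteq> 0 \<longrightarrow> m \<le> length (snd p)" for x
    using cls_zero_iff[OF that(1)] that by blast
  then have "rad m \<subseteq> {\<zero>\<^bsub>A\<^esub>}" unfolding rad_def by blast
  then show ?thesis using rad_zero by blast
qed

text \<open>The radical of P_i is the sum of the P_i a over all arrows a: a path of positive length
  from i has a last arrow, and what precedes it still starts at i.\<close>

lemma rad_arrow_induct:
  assumes i: "i \<in> verts Q" and x: "x \<in> carrier (P i)" "x \<in> rad 1"
    and S: "\<zero>\<^bsub>A\<^esub> \<in> S" "\<And>y z. y \<in> S \<Longrightarrow> z \<in> S \<Longrightarrow> y \<oplus>\<^bsub>A\<^esub> z \<in> S"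
    and arr: "\<And>y a. y \<in> carrier (P i) \<Longrightarrow> a \<in> arcs Q \<Longrightarrow> y \<otimes>\<^bsub>A\<^esub> arr a \<in> S"
  shows "x \<in> S"
proof -
  obtain g where g: "g \<in> carrier KQ" "\<forall>p. g p \<noteq> 0 \<longrightarrow> 1 \<le> length (snd p)" "x = cls g" using x(2) by (auto simp: rad_def)
  let ?f = "\<lambda>p. if fst p = i then g p else 0"
  have f: "?f \<in> carrier KQ" by (rule pa_restrict[OF g(1)])
  have "x = vtx i \<otimes>\<^bsub>A\<^esub> x" using x(1) by (simp add: P_carrier i)
  then have xf: "x = cls ?f" using vtx_mult_cls[OF i g(1)] g(3) by simp
  show ?thesis unfolding xf
  proof (rule cls_induct[OF f S])
    fix p c assume p: "?f p \<noteq> 0" "p \<in> paths Q"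
    obtain es where es: "p = (i, es)" using p(1) by (cases p) (auto split: if_splits)
    have "es \<noteq> []" using p(1) g(2) by (fastforce simp: es)
    then obtain fs a where fs: "es = fs @ [a]" by (cases es rule: rev_cases) auto
    note pp = paths_snoc[OF wf p(2)[unfolded es fs]]
    have "cls (path_mono c (i, fs)) \<in> carrier (P i)" by (rule mono_P[OF pp(3)])
    moreover have "cls (path_mono c p) = cls (path_mono c (i, fs)) \<otimes>\<^bsub>A\<^esub> arr a"
      by (simp add: es fs mono_snoc[OF pp(2)] arr_def cls_mult mono_closed pp arrow_KQ)
    ultimately show "cls (path_mono c p) \<in> S" using arr pp(1) by simp
  qed
qed

text \<open>P_i is local, with the coefficient of the trivial path as its residue: an element in
  which it is non-zero generates P_i.\<close>

lemma P_rad_or_unit: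
  assumes i: "i \<in> verts Q" and x: "x \<in> carrier (P i)"
  shows "x \<in> rad 1 \<or> (\<exists>b\<in>carrier A. x \<otimes>\<^bsub>A\<^esub> b = vtx i)"
proof -
  obtain f where f: "f \<in> carrier KQ" "\<forall>p. f p \<noteq> 0 \<longrightarrow> fst p = i" "x = cls f" using P_rep[OF i x] by blast
  have xA: "x \<in> carrier A" by (rule P_incl[OF i x])
  show ?thesis
  proof (cases "f (i, []) = 0")
    case True
    have "1 \<le> length (snd p)" if "f p \<noteq> 0" for p
      using that True f(2) by (cases p) (auto simp: Suc_le_eq)
    then show ?thesis using f by (auto simp: rad_def)
  next
    case False
    \<comment> \<open>Dividing by c gives e_i plus a remainder of paths of positive length;
      nilpotency of the radical will remove the remainder.\<close>
    define c where "c = f (i, [])"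
    let ?s = "inverse c \<odot>\<^bsub>A\<^esub> \<one>\<^bsub>A\<^esub>"
    let ?g = "\<lambda>p. if p \<noteq> (i, []) then inverse c * f p else 0"
    have "(\<lambda>p. inverse c * f p) \<in> carrier KQ" using pa_smult_closed[OF f(1), of "inverse c"] unfolding pa_simps(4) .
    from pa_restrict[OF this, of "\<lambda>p. p \<noteq> (i, [])"] have g: "?g \<in> carrier KQ" .
    have gr: "cls ?g \<in> rad 1"
    proof -
      have "1 \<le> length (snd p)" if "?g p \<noteq> 0" for p
        using that f(2) by (cases p) (auto simp: Suc_le_eq split: if_splits)
      then show ?thesis using g by (auto simp: rad_def)
    qed
    have "(\<lambda>p. inverse c * f p) = (\<lambda>p. path_mono 1 (i, []) p + ?g p)" using False by (auto simp: path_mono_def c_def fun_eq_iff)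
    then have "x \<otimes>\<^bsub>A\<^esub> ?s = vtx i \<oplus>\<^bsub>A\<^esub> cls ?g"
      unfolding f(3) cls_mult_scalar[OF f(1)] vtx_def cls_add[OF vtx_KQ[OF i] g] by simp
    then have base: "\<exists>b\<in>carrier A. \<exists>r\<in>rad 1. x \<otimes>\<^bsub>A\<^esub> b = vtx i \<oplus>\<^bsub>A\<^esub> r" using gr smult_one_closed by blast
    text \<open>\<open>(e + r)(1 - r) = e - r\<^sup>2\<close> when \<open>e r = r\<close>\<close>
    have step: "\<exists>b\<in>carrier A. \<exists>r\<in>rad (Suc n). x \<otimes>\<^bsub>A\<^esub> b = vtx i \<oplus>\<^bsub>A\<^esub> r" for n
    proof (induction n)
      case 0
      then show ?case using base by simp
    next
      case (Suc n)
      then obtain b r where br: "b \<in> carrier A" "r \<in> rad (Suc n)" "x \<otimes>\<^bsub>A\<^esub> b = vtx i \<oplus>\<^bsub>A\<^esub> r" by blast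
      have rA: "r \<in> carrier A" using br(2) rad_subset by blast
      have v: "vtx i \<in> carrier A" using i by simp
      have "vtx i \<otimes>\<^bsub>A\<^esub> (x \<otimes>\<^bsub>A\<^esub> b) = x \<otimes>\<^bsub>A\<^esub> b" using x br(1) xA v by (simp add: P_carrier i m_assoc[symmetric])
      then have "vtx i \<oplus>\<^bsub>A\<^esub> vtx i \<otimes>\<^bsub>A\<^esub> r = vtx i \<oplus>\<^bsub>A\<^esub> r" using v rA by (simp add: br(3) r_distr vtx_idem i)
      then have vr: "vtx i \<otimes>\<^bsub>A\<^esub> r = r" using v rA by (metis add.inv_solve_left' m_closed a_closed)
      have "x \<otimes>\<^bsub>A\<^esub> (b \<otimes>\<^bsub>A\<^esub> (\<one>\<^bsub>A\<^esub> \<ominus>\<^bsub>A\<^esub> r)) = (vtx i \<oplus>\<^bsub>A\<^esub> r) \<otimes>\<^bsub>A\<^esub> (\<one>\<^bsub>A\<^esub> \<ominus>\<^bsub>A\<^esub> r)"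
        using xA br rA by (simp add: m_assoc[symmetric])
      also have "\<dots> = (vtx i \<oplus>\<^bsub>A\<^esub> r) \<oplus>\<^bsub>A\<^esub> (\<ominus>\<^bsub>A\<^esub> r \<oplus>\<^bsub>A\<^esub> \<ominus>\<^bsub>A\<^esub> (r \<otimes>\<^bsub>A\<^esub> r))"
        using v rA by (simp add: minus_eq r_distr l_distr r_minus vr minus_add)
      also have "\<dots> = vtx i \<oplus>\<^bsub>A\<^esub> \<ominus>\<^bsub>A\<^esub> (r \<otimes>\<^bsub>A\<^esub> r)"
        using v rA by (simp add: a_assoc r_neg2)
      finally have e: "x \<otimes>\<^bsub>A\<^esub> (b \<otimes>\<^bsub>A\<^esub> (\<one>\<^bsub>A\<^esub> \<ominus>\<^bsub>A\<^esub> r)) = vtx i \<oplus>\<^bsub>A\<^esub> (r \<otimes>\<^bsub>A\<^esub> \<ominus>\<^bsub>A\<^esub> r)" using rA by (simp add: r_minus)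
      have "\<ominus>\<^bsub>A\<^esub> r = r \<otimes>\<^bsub>A\<^esub> \<ominus>\<^bsub>A\<^esub> \<one>\<^bsub>A\<^esub>" using rA by (simp add: r_minus)
      then have "\<ominus>\<^bsub>A\<^esub> r \<in> rad (Suc n)" using rad_mult[OF br(2), of "\<ominus>\<^bsub>A\<^esub> \<one>\<^bsub>A\<^esub>" 0] by (simp add: rad_0)
      then have "r \<otimes>\<^bsub>A\<^esub> \<ominus>\<^bsub>A\<^esub> r \<in> rad (Suc n + Suc n)" by (rule rad_mult[OF br(2)])
      \<comment> \<open>Squaring doubles the exponent; the induction asks only for an increase by
        one.\<close>
      then have "r \<otimes>\<^bsub>A\<^esub> \<ominus>\<^bsub>A\<^esub> r \<in> rad (Suc (Suc n))" using rad_mono[of "Suc (Suc n)" "Suc n + Suc n"] by auto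
      moreover have "b \<otimes>\<^bsub>A\<^esub> (\<one>\<^bsub>A\<^esub> \<ominus>\<^bsub>A\<^esub> r) \<in> carrier A" using br(1) rA by simp
      ultimately show ?case using e by blast
    qed
    obtain m where m: "rad m = {\<zero>\<^bsub>A\<^esub>}" using rad_nilpotent by blast
    obtain b r where br: "b \<in> carrier A" "r \<in> rad (Suc m)" "x \<otimes>\<^bsub>A\<^esub> b = vtx i \<oplus>\<^bsub>A\<^esub> r" using step by blast
    have "r = \<zero>\<^bsub>A\<^esub>" using br(2) rad_mono[of m "Suc m"] m by auto
    then have "x \<otimes>\<^bsub>A\<^esub> b = vtx i" using br(3) i by simp
    then show ?thesis using br(1) by blast
  qed
qed

text \<open>Long paths vanish in A and a finite quiver has finitely many short ones; m is the
  exponent at which the radical filtration reaches zero.\<close>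

lemma P_fd: assumes i: "i \<in> verts Q" shows "fd_module A (P i)"
proof -
  obtain m where m: "rad m = {\<zero>\<^bsub>A\<^esub>}" using rad_nilpotent by blast
  let ?L = "{es. (i, es) \<in> paths Q \<and> length es \<le> m}"
  let ?B = "(\<lambda>es. cls (path_mono 1 (i, es))) ` ?L"
  have "finite {es. set es \<subseteq> arcs Q \<and> length es \<le> m}"
    by (rule finite_lists_length_le) (rule fin_digraph.finite_arcs[OF fin])
  then have finL: "finite ?L" by (rule rev_finite_subset) (auto simp: paths_iff)
  have "spanning (P i) ?B"
  proof (rule spanningI)
    show "finite ?B" "?B \<subseteq> carrier (P i)" using finL mono_P by auto
    fix S assume S: "S \<subseteq> carrier (P i)" "\<zero>\<^bsub>P i\<^esub> \<in> S" "\<And>x y. x \<in> S \<Longrightarrow> y \<in> S \<Longrightarrow> x \<oplus>\<^bsub>P i\<^esub> y \<in> S"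
      "\<And>b c. b \<in> ?B \<Longrightarrow> b \<bullet>\<^bsub>P i\<^esub> (c \<odot>\<^bsub>A\<^esub> \<one>\<^bsub>A\<^esub>) \<in> S"
    show "carrier (P i) \<subseteq> S"
    proof
      fix x assume "x \<in> carrier (P i)"
      then obtain f where f: "f \<in> carrier KQ" "\<forall>p. f p \<noteq> 0 \<longrightarrow> fst p = i" "x = cls f" using P_rep[OF i] by blast
      show "x \<in> S" unfolding f(3)
      proof (rule cls_induct[OF f(1)])
        show "\<zero>\<^bsub>A\<^esub> \<in> S" "\<And>y z. y \<in> S \<Longrightarrow> z \<in> S \<Longrightarrow> y \<oplus>\<^bsub>A\<^esub> z \<in> S" using S(2,3) by simp_all
        fix p c assume p: "f p \<noteq> 0" "p \<in> paths Q"
        then obtain es where es: "p = (i, es)" using f(2) by (cases p) auto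
        show "cls (path_mono c p) \<in> S"
        proof (cases "length es \<le> m")
          case True
          have "cls (path_mono 1 p) \<otimes>\<^bsub>A\<^esub> (c \<odot>\<^bsub>A\<^esub> \<one>\<^bsub>A\<^esub>) = cls (path_mono c p)"
            using cls_mult_scalar[OF mono_closed[OF p(2), of 1], of c] by (simp add: path_mono_def if_distrib cong: if_cong)
          then show ?thesis using S(4)[of "cls (path_mono 1 p)" c] True p(2) by (auto simp: es)
        next
          case False
          then have "path_mono c p \<in> {x \<in> carrier KQ. \<forall>p. x p \<noteq> 0 \<longrightarrow> m \<le> length (snd p)}"
            using mono_closed[OF p(2), of c] by (auto simp: es) (auto simp: path_mono_def split: if_splits)
          then have "cls (path_mono c p) \<in> rad m" unfolding rad_def by (rule imageI)
          then show ?thesis using m S(2) by simp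
        qed
      qed
    qed
  qed
  then show ?thesis using fd_module_iff P_right[OF i] by blast
qed

lemma P_hom:
  assumes i: "i \<in> verts Q" and M: "right_module A M" and m: "m \<in> carrier M"
  shows "(\<lambda>x. m \<bullet>\<^bsub>M\<^esub> x) \<in> mod_hom A (P i) M"
proof -
  interpret M: right_module A M by fact
  show ?thesis by (rule mod_homI) (use m P_incl[OF i] in \<open>auto simp: M.ract_closed M.ract_add_right M.ract_mult\<close>)
qed

text \<open>The Yoneda description of Hom(P_i, M): since x = e_i x, the image of e_i determines the
  map.\<close>

lemma P_hom_eq:
  assumes i: "i \<in> verts Q" and f: "f \<in> mod_hom A (P i) M" and x: "x \<in> carrier (P i)"
  shows "f x = f (vtx i) \<bullet>\<^bsub>M\<^esub> x"
  using mod_hom_ract[OF f vtx_P[OF i] P_incl[OF i x]] x by (simp add: P_carrier[OF i])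

text \<open>Any preimage m of h(e_i) yields the lift x \<mapsto> m x, as h is itself multiplication
  by h(e_i).\<close>

lemma P_projective: assumes i: "i \<in> verts Q" shows "fg_projective A (P i)"
  unfolding fg_projective_def
proof (intro conjI allI ballI impI P_fd[OF i])
  fix M N :: "(('v, 'e, 'k) qelt, nat \<Rightarrow> 'k) right_mod" and e h
  assume e: "e \<in> mod_hom A M N" and h: "h \<in> mod_hom A (P i) N" and *: "fd_module A M \<and> fd_module A N \<and> e ` carrier M = carrier N"
  then have M: "right_module A M" using fd_right by blast
  have "h (vtx i) \<in> e ` carrier M" using mod_hom_closed[OF h vtx_P[OF i]] * by simp
  then obtain m where m: "m \<in> carrier M" "e m = h (vtx i)" by auto
  have "e (m \<bullet>\<^bsub>M\<^esub> x) = h x" if "x \<in> carrier (P i)" for x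
    using mod_hom_ract[OF e m(1) P_incl[OF i that]] P_hom_eq[OF i h that] m(2) by simp
  then show "\<exists>l\<in>mod_hom A (P i) M. \<forall>x\<in>carrier (P i). e (l x) = h x"
    using P_hom[OF i M m(1)] by blast
qed

end

section \<open>Projective modules over a bound quiver algebra\<close>

context kalg
begin

definition incl :: "'j set \<Rightarrow> ('j \<Rightarrow> ('a, 'b) right_mod) \<Rightarrow> 'j \<Rightarrow> 'b \<Rightarrow> 'j \<Rightarrow> 'b" where
  "incl J M j z = (\<lambda>i\<in>J. if i = j then z else \<zero>\<^bsub>M i\<^esub>)"

lemma incl_hom:
  assumes "\<And>j. j \<in> J \<Longrightarrow> right_module A (M j)" "j \<in> J"
  shows "incl J M j \<in> mod_hom A (M j) (mod_Sum J M)"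
proof -
  note g = right_module_group[OF assms(1)]
  show ?thesis
    by (rule mod_homI)
      (use assms in \<open>auto simp: incl_def fun_eq_iff abelian_groupE(2)[OF g] abelian_groupE(5)[OF g] right_module.zero_ract[OF assms(1)]\<close>)
qed

text \<open>An element of a finite direct sum is the sum of its components; the induction adds one
  coordinate at a time.\<close>

lemma mod_Sum_induct_elem:
  assumes "finite J" and M: "\<And>j. j \<in> J \<Longrightarrow> right_module A (M j)" and x: "x \<in> carrier (mod_Sum J M)"
    and zero: "\<zero>\<^bsub>mod_Sum J M\<^esub> \<in> S" and add: "\<And>y z. y \<in> S \<Longrightarrow> z \<in> S \<Longrightarrow> y \<oplus>\<^bsub>mod_Sum J M\<^esub> z \<in> S"
    and incl: "\<And>j. j \<in> J \<Longrightarrow> incl J M j (x j) \<in> S"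
  shows "x \<in> S"
proof -
  have "(\<lambda>i\<in>J. if i \<in> F then x i else \<zero>\<^bsub>M i\<^esub>) \<in> S" if "finite F" "F \<subseteq> J" for F
    using that
  proof (induction F rule: finite_induct)
    case empty
    then show ?case using zero by (simp add: restrict_def)
  next
    case (insert j F)
    note g = right_module_group[OF M]
    have e: "incl J M j (x j) \<oplus>\<^bsub>mod_Sum J M\<^esub> (\<lambda>i\<in>J. if i \<in> F then x i else \<zero>\<^bsub>M i\<^esub>) = (\<lambda>i\<in>J. if i \<in> insert j F then x i else \<zero>\<^bsub>M i\<^esub>)"
      using insert x by (auto simp: incl_def fun_eq_iff PiE_iff abelian_groupE(2,5)[OF g] abelian_monoid.r_zero[OF abelian_group.axioms(1)[OF g]])
    have "incl J M j (x j) \<oplus>\<^bsub>mod_Sum J M\<^esub> (\<lambda>i\<in>J. if i \<in> F then x i else \<zero>\<^bsub>M i\<^esub>) \<in> S"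
      by (rule add[OF incl insert.IH]) (use insert in auto)
    then show ?case unfolding e .
  qed
  from this[OF assms(1) subset_refl] have "(\<lambda>i\<in>J. if i \<in> J then x i else \<zero>\<^bsub>M i\<^esub>) \<in> S" .
  moreover have "(\<lambda>i\<in>J. if i \<in> J then x i else \<zero>\<^bsub>M i\<^esub>) = x" using x by (auto simp: fun_eq_iff PiE_iff extensional_def)
  ultimately show ?thesis by simp
qed

lemma mod_Sum_proj: "j \<in> J \<Longrightarrow> (\<lambda>x. x j) \<in> mod_hom A (mod_Sum J M) (M j)"
  by (rule mod_homI) auto

lemma mod_Sum_hom:
  assumes "right_module A N" "\<And>j. j \<in> J \<Longrightarrow> \<phi> j \<in> mod_hom A (M j) N"
  shows "(\<lambda>y. \<Oplus>\<^bsub>N\<^esub>j\<in>J. \<phi> j (y j)) \<in> mod_hom A (mod_Sum J M) N"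
proof -
  interpret N: right_module A N by fact
  have c: "\<phi> j (y j) \<in> carrier N" if "j \<in> J" "y \<in> carrier (mod_Sum J M)" for j y
    using mod_hom_closed[OF assms(2)] that by auto
  show ?thesis
  proof (rule mod_homI)
    fix x y assume xy: "x \<in> carrier (mod_Sum J M)" "y \<in> carrier (mod_Sum J M)"
    have "(\<Oplus>\<^bsub>N\<^esub>j\<in>J. \<phi> j ((x \<oplus>\<^bsub>mod_Sum J M\<^esub> y) j)) = (\<Oplus>\<^bsub>N\<^esub>j\<in>J. \<phi> j (x j) \<oplus>\<^bsub>N\<^esub> \<phi> j (y j))"
      by (rule N.finsum_cong') (use xy c in \<open>auto simp: mod_hom_add[OF assms(2)] PiE_iff\<close>)
    then show "(\<Oplus>\<^bsub>N\<^esub>j\<in>J. \<phi> j ((x \<oplus>\<^bsub>mod_Sum J M\<^esub> y) j)) = (\<Oplus>\<^bsub>N\<^esub>j\<in>J. \<phi> j (x j)) \<oplus>\<^bsub>N\<^esub> (\<Oplus>\<^bsub>N\<^esub>j\<in>J. \<phi> j (y j))"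
      using c xy by (simp add: N.finsum_addf)
  next
    fix x a assume xa: "x \<in> carrier (mod_Sum J M)" "a \<in> carrier A"
    have "(\<Oplus>\<^bsub>N\<^esub>j\<in>J. \<phi> j ((x \<bullet>\<^bsub>mod_Sum J M\<^esub> a) j)) = (\<Oplus>\<^bsub>N\<^esub>j\<in>J. \<phi> j (x j) \<bullet>\<^bsub>N\<^esub> a)"
      by (rule N.finsum_cong') (use xa c in \<open>auto simp: mod_hom_ract[OF assms(2)] PiE_iff N.ract_closed\<close>)
    then show "(\<Oplus>\<^bsub>N\<^esub>j\<in>J. \<phi> j ((x \<bullet>\<^bsub>mod_Sum J M\<^esub> a) j)) = (\<Oplus>\<^bsub>N\<^esub>j\<in>J. \<phi> j (x j)) \<bullet>\<^bsub>N\<^esub> a"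
      using c[OF _ xa(1)] xa(2) by (simp add: N.ract_finsum)
  qed (use c in \<open>auto intro!: N.finsum_closed\<close>)
qed

lemma mod_Sum_hom_incl:
  assumes "right_module A N" "\<And>j. j \<in> J \<Longrightarrow> right_module A (M j)" "\<And>j. j \<in> J \<Longrightarrow> \<phi> j \<in> mod_hom A (M j) N"
    and "finite J" "j \<in> J" "z \<in> carrier (M j)"
  shows "(\<Oplus>\<^bsub>N\<^esub>i\<in>J. \<phi> i (incl J M j z i)) = \<phi> j z"
proof -
  interpret N: right_module A N by fact
  have c: "\<phi> j z \<in> carrier N" by (rule mod_hom_closed[OF assms(3)[OF assms(5)] assms(6)])
  have "(\<Oplus>\<^bsub>N\<^esub>i\<in>J. \<phi> i (incl J M j z i)) = (\<Oplus>\<^bsub>N\<^esub>i\<in>J. if j = i then \<phi> j z else \<zero>\<^bsub>N\<^esub>)"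
  proof (rule N.finsum_cong'[OF refl])
    fix i assume i: "i \<in> J"
    have "\<phi> i \<zero>\<^bsub>M i\<^esub> = \<zero>\<^bsub>N\<^esub>"
      by (rule mod_hom_zero[OF assms(3)[OF i] right_module_group[OF assms(2)[OF i]] right_module_group[OF assms(1)]])
    then show "\<phi> i (incl J M j z i) = (if j = i then \<phi> j z else \<zero>\<^bsub>N\<^esub>)" using i by (simp add: incl_def)
  qed (use c in auto)
  then show ?thesis using N.finsum_singleton[OF assms(5,4), of "\<lambda>_. \<phi> j z"] c by simp
qed

lemma finsum_in_closed:
  assumes "abelian_group M" "finite J" "S \<subseteq> carrier M" "\<zero>\<^bsub>M\<^esub> \<in> S" "\<And>x y. x \<in> S \<Longrightarrow> y \<in> S \<Longrightarrow> x \<oplus>\<^bsub>M\<^esub> y \<in> S"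
    and "\<And>j. j \<in> J \<Longrightarrow> f j \<in> S"
  shows "(\<Oplus>\<^bsub>M\<^esub>j\<in>J. f j) \<in> S"
proof -
  interpret abelian_group M by fact
  show ?thesis using assms(2,6)
  proof (induction J rule: finite_induct)
    case empty
    then show ?case using assms(4) by simp
  next
    case (insert j J)
    have "f \<in> J \<rightarrow> carrier M" "f j \<in> carrier M" using insert assms(3) by auto
    then show ?case using insert assms(5) by (simp add: finsum_insert)
  qed
qed

lemma mod_hom_inj:
  assumes f: "f \<in> mod_hom A M N" and M: "right_module A M" and N: "right_module A N"
    and k: "\<And>x. x \<in> carrier M \<Longrightarrow> f x = \<zero>\<^bsub>N\<^esub> \<Longrightarrow> x = \<zero>\<^bsub>M\<^esub>"
  shows "inj_on f (carrier M)"
proof (rule inj_onI)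
  interpret M: abelian_group M by (rule right_module_group[OF M])
  interpret N: abelian_group N by (rule right_module_group[OF N])
  fix x y assume xy: "x \<in> carrier M" "y \<in> carrier M" "f x = f y"
  then have "f (x \<ominus>\<^bsub>M\<^esub> y) = \<zero>\<^bsub>N\<^esub>"
    using mod_hom_minus[OF f M.abelian_group_axioms N.abelian_group_axioms xy(1,2)] mod_hom_closed[OF f] by (simp add: N.minus_self)
  then have "x \<ominus>\<^bsub>M\<^esub> y = \<zero>\<^bsub>M\<^esub>" using k xy by simp
  then show "x = y" using xy by (simp add: M.minus_eq_iff)
qed

end

context bound_quiver
begin

text \<open>1 is the sum of the vertex idempotents. The closure form serves to split an element of a
  module into its parts m e_v.\<close>

lemma one_induct:
  assumes "\<zero>\<^bsub>A\<^esub> \<in> S" "\<And>y z. y \<in> S \<Longrightarrow> z \<in> S \<Longrightarrow> y \<oplus>\<^bsub>A\<^esub> z \<in> S"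
    and "\<And>v a. v \<in> verts Q \<Longrightarrow> a \<in> carrier A \<Longrightarrow> vtx v \<otimes>\<^bsub>A\<^esub> a \<in> S"
  shows "\<one>\<^bsub>A\<^esub> \<in> S"
proof -
  interpret KQ: ring KQ by (rule KQ_ring)
  show ?thesis unfolding one_cls
  proof (rule cls_induct[OF KQ.one_closed assms(1,2)])
    fix p and c :: 'k assume p: "\<one>\<^bsub>KQ\<^esub> p \<noteq> 0" "p \<in> paths Q"
    then obtain v where v: "p = (v, [])" "v \<in> verts Q" by (cases p) (auto simp: path_algebra_def split: if_splits)
    have "cls (path_mono c p) = vtx v \<otimes>\<^bsub>A\<^esub> (c \<odot>\<^bsub>A\<^esub> \<one>\<^bsub>A\<^esub>)"
      unfolding vtx_def cls_mult_scalar[OF vtx_KQ[OF v(2)]] v(1) by (rule arg_cong[of _ _ cls]) (auto simp: path_mono_def fun_eq_iff)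
    then show "cls (path_mono c p) \<in> S" using assms(3)[OF v(2) smult_one_closed] by simp
  qed
qed

text \<open>A finite set of elements \<open>m = m e\<^sub>i\<close>, recorded as pairs \<open>(m, i)\<close>, that generates \<open>M\<close>.\<close>

definition generating :: "(('v, 'e, 'k) qelt, 'b) right_mod \<Rightarrow> ('b \<times> 'v) set \<Rightarrow> bool" where
  "generating M G \<longleftrightarrow> finite G \<and> (\<forall>g\<in>G. fst g \<in> carrier M \<and> snd g \<in> verts Q \<and> fst g \<bullet>\<^bsub>M\<^esub> vtx (snd g) = fst g) \<and>
     (\<forall>S. S \<subseteq> carrier M \<longrightarrow> \<zero>\<^bsub>M\<^esub> \<in> S \<longrightarrow> (\<forall>x\<in>S. \<forall>y\<in>S. x \<oplus>\<^bsub>M\<^esub> y \<in> S) \<longrightarrow>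
        (\<forall>g\<in>G. \<forall>a\<in>carrier A. fst g \<bullet>\<^bsub>M\<^esub> a \<in> S) \<longrightarrow> carrier M \<subseteq> S)"

lemma generatingD:
  assumes "generating M G" "S \<subseteq> carrier M" "\<zero>\<^bsub>M\<^esub> \<in> S" "\<And>x y. x \<in> S \<Longrightarrow> y \<in> S \<Longrightarrow> x \<oplus>\<^bsub>M\<^esub> y \<in> S"
    and "\<And>g a. g \<in> G \<Longrightarrow> a \<in> carrier A \<Longrightarrow> fst g \<bullet>\<^bsub>M\<^esub> a \<in> S"
  shows "carrier M \<subseteq> S"
proof -
  have "\<forall>x\<in>S. \<forall>y\<in>S. x \<oplus>\<^bsub>M\<^esub> y \<in> S" "\<forall>g\<in>G. \<forall>a\<in>carrier A. fst g \<bullet>\<^bsub>M\<^esub> a \<in> S" using assms(4,5) by simp_all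
  then show ?thesis using assms(1)[unfolded generating_def, THEN conjunct2, THEN conjunct2, rule_format, OF assms(2,3)] by simp
qed

text \<open>Each element b of a spanning set is the sum of the b e_v, and each of these is supported
  at a single vertex.\<close>

lemma ex_generating: assumes "fd_module A M" shows "\<exists>G. generating M G"
proof -
  interpret M: right_module A M using assms by (rule fd_right)
  obtain B where B: "spanning M B" using assms fd_module_iff by blast
  then have fB: "finite B" "B \<subseteq> carrier M" by (auto simp: spanning_def)
  let ?G = "(\<lambda>(b, v). (b \<bullet>\<^bsub>M\<^esub> vtx v, v)) ` (B \<times> verts Q)"
  have "generating M ?G"
    unfolding generating_def
  proof (intro conjI allI impI)
    show "finite ?G" using fB fin_digraph.finite_verts[OF fin] by simp
    show "\<forall>g\<in>?G. fst g \<in> carrier M \<and> snd g \<in> verts Q \<and> fst g \<bullet>\<^bsub>M\<^esub> vtx (snd g) = fst g"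
      using fB by (auto intro!: M.ract_closed simp: M.ract_mult[symmetric] vtx_idem subset_iff)
    fix S assume S: "S \<subseteq> carrier M" "\<zero>\<^bsub>M\<^esub> \<in> S" "\<forall>x\<in>S. \<forall>y\<in>S. x \<oplus>\<^bsub>M\<^esub> y \<in> S" "\<forall>g\<in>?G. \<forall>a\<in>carrier A. fst g \<bullet>\<^bsub>M\<^esub> a \<in> S"
    show "carrier M \<subseteq> S"
    proof (rule spanningD[OF B S(1,2)])
      show "x \<oplus>\<^bsub>M\<^esub> y \<in> S" if "x \<in> S" "y \<in> S" for x y using S(3) that by blast
      fix b and c :: 'k assume b: "b \<in> B" "b \<in> carrier M"
      let ?c = "c \<odot>\<^bsub>A\<^esub> \<one>\<^bsub>A\<^esub>"
      \<comment> \<open>The factor 1 in b (1 c) is decomposed, so that only terms (b e_v)(a c) have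
        to lie in S.\<close>
      have "\<one>\<^bsub>A\<^esub> \<in> {a \<in> carrier A. b \<bullet>\<^bsub>M\<^esub> (a \<otimes>\<^bsub>A\<^esub> ?c) \<in> S}"
      proof (rule one_induct)
        show "\<zero>\<^bsub>A\<^esub> \<in> {a \<in> carrier A. b \<bullet>\<^bsub>M\<^esub> (a \<otimes>\<^bsub>A\<^esub> ?c) \<in> S}" using S(2) b by simp
        fix y z assume "y \<in> {a \<in> carrier A. b \<bullet>\<^bsub>M\<^esub> (a \<otimes>\<^bsub>A\<^esub> ?c) \<in> S}" "z \<in> {a \<in> carrier A. b \<bullet>\<^bsub>M\<^esub> (a \<otimes>\<^bsub>A\<^esub> ?c) \<in> S}"
        then show "y \<oplus>\<^bsub>A\<^esub> z \<in> {a \<in> carrier A. b \<bullet>\<^bsub>M\<^esub> (a \<otimes>\<^bsub>A\<^esub> ?c) \<in> S}" using S(3) b by (simp add: l_distr M.ract_add_right)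
      next
        fix v a assume v: "v \<in> verts Q" and a: "a \<in> carrier A"
        have "(b \<bullet>\<^bsub>M\<^esub> vtx v, v) \<in> ?G" using b v by auto
        then have "(b \<bullet>\<^bsub>M\<^esub> vtx v) \<bullet>\<^bsub>M\<^esub> (a \<otimes>\<^bsub>A\<^esub> ?c) \<in> S" using S(4) a by fastforce
        then show "vtx v \<otimes>\<^bsub>A\<^esub> a \<in> {a \<in> carrier A. b \<bullet>\<^bsub>M\<^esub> (a \<otimes>\<^bsub>A\<^esub> ?c) \<in> S}"
          using v a b by (simp add: M.ract_mult[symmetric] m_assoc)
      qed
      then show "b \<bullet>\<^bsub>M\<^esub> ?c \<in> S" by simp
    qed
  qed
  then show ?thesis by blast
qed

text \<open>Krull--Schmidt for projectives: for a generating set of minimal size the kernel of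
  \<open>\<Oplus> P\<^sub>i \<rightarrow> M\<close> lies in the radical; as it is a direct summand, it lies in every power of the radical.\<close>

lemma projective_decomposition:
  fixes M :: "(('v, 'e, 'k) qelt, 'b) right_mod"
  assumes M: "fg_projective A M"
  shows "\<exists>(G :: ('b \<times> 'v) set) f. finite G \<and> snd ` G \<subseteq> verts Q \<and> f \<in> mod_hom A (mod_Sum G (\<lambda>g. P (snd g))) M \<and>
    bij_betw f (carrier (mod_Sum G (\<lambda>g. P (snd g)))) (carrier M)"
proof -
  note fM = fg_projective_fd[OF M]
  interpret M: right_module A M using fM by (rule fd_right)
  obtain G where G: "generating M G" and min: "\<And>H. generating M H \<Longrightarrow> card G \<le> card H"
    using ex_has_least_nat[of "generating M" _ card] ex_generating[OF fM] by blast
  have fG: "finite G" and G1: "\<And>g. g \<in> G \<Longrightarrow> fst g \<in> carrier M" "\<And>g. g \<in> G \<Longrightarrow> snd g \<in> verts Q"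
    "\<And>g. g \<in> G \<Longrightarrow> fst g \<bullet>\<^bsub>M\<^esub> vtx (snd g) = fst g" using G by (auto simp: generating_def)
  define PP where "PP = (\<lambda>g :: 'b \<times> 'v. P (snd g))"
  define F where "F = mod_Sum G PP"
  have rP: "right_module A (PP g)" "fd_module A (PP g)" if "g \<in> G" for g using P_right[OF G1(2)[OF that]] P_fd[OF G1(2)[OF that]] by (simp_all add: PP_def)
  have fF: "fd_module A F" unfolding F_def by (rule fd_module_mod_Sum[OF fG rP(2)])
  interpret F: right_module A F using fF by (rule fd_right)
  note gM = M.abelian_group_axioms and gF = F.abelian_group_axioms
  let ?\<phi> = "\<lambda>g z. fst g \<bullet>\<^bsub>M\<^esub> z"
  define \<pi> where "\<pi> y = (\<Oplus>\<^bsub>M\<^esub>g\<in>G. ?\<phi> g (y g))" for y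
  have \<phi>: "?\<phi> g \<in> mod_hom A (PP g) M" if "g \<in> G" for g
    unfolding PP_def by (rule P_hom[OF G1(2)[OF that] M.right_module_axioms G1(1)[OF that]])
  have \<pi>: "\<pi> \<in> mod_hom A F M" unfolding \<pi>_def F_def by (rule mod_Sum_hom[OF M.right_module_axioms \<phi>])
  have \<pi>_incl: "\<pi> (incl G PP g z) = fst g \<bullet>\<^bsub>M\<^esub> z" if "g \<in> G" "z \<in> carrier (PP g)" for g z
    unfolding \<pi>_def by (rule mod_Sum_hom_incl[where \<phi> = ?\<phi> and M = PP, OF M.right_module_axioms rP(1) \<phi> fG that])
  have inclh: "incl G PP g \<in> mod_hom A (PP g) F" if "g \<in> G" for g unfolding F_def by (rule incl_hom[OF rP(1) that])
  have vP: "vtx (snd g) \<otimes>\<^bsub>A\<^esub> a \<in> carrier (PP g)" if "g \<in> G" "a \<in> carrier A" for g a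
    using that G1(2) by (simp add: PP_def P_carrier m_assoc[symmetric] vtx_idem)
  have \<pi>_gen: "\<pi> (incl G PP g (vtx (snd g) \<otimes>\<^bsub>A\<^esub> a)) = fst g \<bullet>\<^bsub>M\<^esub> a" if "g \<in> G" "a \<in> carrier A" for g a
    using \<pi>_incl[OF that(1) vP[OF that]] M.ract_mult[OF G1(1)[OF that(1)] vtx_closed[OF G1(2)[OF that(1)]] that(2)] G1(3)[OF that(1)] by simp
  have surj: "\<pi> ` carrier F = carrier M"
  proof
    interpret S: additive_subgroup "\<pi> ` carrier F" M by (rule additive_subgroup_image[OF F.right_module_axioms M.right_module_axioms \<pi>])
    have "fst g \<bullet>\<^bsub>M\<^esub> a \<in> \<pi> ` carrier F" if "g \<in> G" "a \<in> carrier A" for g a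
      using \<pi>_gen[OF that] mod_hom_closed[OF inclh[OF that(1)] vP[OF that]] by (metis imageI)
    then show "carrier M \<subseteq> \<pi> ` carrier F" by (intro generatingD[OF G S.a_subset S.zero_closed S.a_closed])
  qed (use mod_hom_closed[OF \<pi>] in blast)
  \<comment> \<open>A component outside the radical generates its summand. The relation \<pi> x = 0
    would then express the generator g through the others, against minimality.\<close>
  have ker1: "x g \<in> rad 1" if x: "x \<in> carrier F" "\<pi> x = \<zero>\<^bsub>M\<^esub>" and g: "g \<in> G" for x g
  proof (rule ccontr)
    assume "x g \<notin> rad 1"
    have xP: "x j \<in> carrier (PP j)" if "j \<in> G" for j using x(1) that by (auto simp: F_def)
    have xA: "x j \<in> carrier A" if "j \<in> G" for j using P_incl[OF G1(2)[OF that]] xP[OF that] by (simp add: PP_def)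
    obtain b where b: "b \<in> carrier A" "x g \<otimes>\<^bsub>A\<^esub> b = vtx (snd g)"
      using P_rad_or_unit[OF G1(2)[OF g]] xP[OF g] \<open>x g \<notin> rad 1\<close> by (auto simp: PP_def)
    have "generating M (G - {g})"
      unfolding generating_def
    proof (intro conjI allI impI)
      fix S assume S: "S \<subseteq> carrier M" "\<zero>\<^bsub>M\<^esub> \<in> S" "\<forall>x\<in>S. \<forall>y\<in>S. x \<oplus>\<^bsub>M\<^esub> y \<in> S"
        "\<forall>g\<in>G - {g}. \<forall>a\<in>carrier A. fst g \<bullet>\<^bsub>M\<^esub> a \<in> S"
      have new: "fst g \<bullet>\<^bsub>M\<^esub> a \<in> S" if a: "a \<in> carrier A" for a
      proof -
        let ?c = "b \<otimes>\<^bsub>A\<^esub> a"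
        have c: "?c \<in> carrier A" using a b(1) by simp
        \<comment> \<open>Here y is minus the multiple x c in every component except g, where it is
          zero. Since x c is killed by \<pi>, the sum y + x c has the image \<pi> y, yet its only
          component is that of g.\<close>
        define y where "y = (\<lambda>j\<in>G. if j = g then \<zero>\<^bsub>A\<^esub> else \<ominus>\<^bsub>A\<^esub> (x j \<otimes>\<^bsub>A\<^esub> ?c))"
        have xc: "x j \<otimes>\<^bsub>A\<^esub> ?c \<in> carrier (PP j)" if "j \<in> G" for j
          using right_module.ract_closed[OF rP(1)[OF that] xP[OF that] c] by (simp add: PP_def)
        have nP: "\<ominus>\<^bsub>A\<^esub> z \<in> carrier (PP j)" if "z \<in> carrier (PP j)" "j \<in> G" for j z
          using that G1(2)[OF that(2)] by (simp add: PP_def P_carrier r_minus)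
        have y: "y \<in> carrier F" using xc nP abelian_groupE(2)[OF right_module_group[OF rP(1)]] by (auto simp: F_def y_def PP_def)
        have e: "incl G PP g (x g \<otimes>\<^bsub>A\<^esub> ?c) = y \<oplus>\<^bsub>F\<^esub> x \<bullet>\<^bsub>F\<^esub> ?c"
          using xA c by (auto simp: F_def y_def incl_def PP_def fun_eq_iff l_neg)
        have "x g \<otimes>\<^bsub>A\<^esub> ?c = vtx (snd g) \<otimes>\<^bsub>A\<^esub> a" using b a xA[OF g] by (simp add: m_assoc[symmetric])
        then have "fst g \<bullet>\<^bsub>M\<^esub> a = \<pi> (y \<oplus>\<^bsub>F\<^esub> x \<bullet>\<^bsub>F\<^esub> ?c)" using \<pi>_gen[OF g a] e by simp
        also have "\<dots> = \<pi> y \<oplus>\<^bsub>M\<^esub> \<zero>\<^bsub>M\<^esub>"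
          using mod_hom_add[OF \<pi> y F.ract_closed[OF x(1) c]] mod_hom_ract[OF \<pi> x(1) c] x(2) M.zero_ract[OF c] by simp
        finally have "fst g \<bullet>\<^bsub>M\<^esub> a = \<pi> y" using mod_hom_closed[OF \<pi> y] by simp
        moreover have "\<pi> y \<in> S" unfolding \<pi>_def
        proof (rule finsum_in_closed[OF gM fG S(1,2)])
          show "u \<oplus>\<^bsub>M\<^esub> v \<in> S" if "u \<in> S" "v \<in> S" for u v using S(3) that by blast
          fix j assume j: "j \<in> G"
          show "fst j \<bullet>\<^bsub>M\<^esub> y j \<in> S"
          proof (cases "j = g")
            case True
            then show ?thesis using S(2) G1(1)[OF j] j by (simp add: y_def)
          next
            case False
            then have "y j \<in> carrier A" using j xA[OF j] c by (simp add: y_def)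
            then show ?thesis using S(4) j False by blast
          qed
        qed
        ultimately show ?thesis by simp
      qed
      show "carrier M \<subseteq> S"
      proof (rule generatingD[OF G S(1,2)])
        show "u \<oplus>\<^bsub>M\<^esub> v \<in> S" if "u \<in> S" "v \<in> S" for u v using S(3) that by blast
        show "fst j \<bullet>\<^bsub>M\<^esub> a \<in> S" if "j \<in> G" "a \<in> carrier A" for j a
          using new[OF that(2)] S(4) that by (cases "j = g") blast+
      qed
    qed (use fG G1 in auto)
    then show False using min[of "G - {g}"] fG g by (meson card_Diff1_less leD)
  qed
  obtain \<sigma> where \<sigma>: "\<sigma> \<in> mod_hom A M F" "\<forall>m\<in>carrier M. \<pi> (\<sigma> m) = m"
    using fg_projective_lift[OF M fF M.right_module_axioms \<pi> mod_hom_id(2)] surj by auto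
  \<comment> \<open>The projection onto the kernel of \<pi> along the section \<sigma>; it is a
    homomorphism and fixes the kernel.\<close>
  define \<rho> where "\<rho> y = y \<ominus>\<^bsub>F\<^esub> (\<sigma> \<circ> \<pi>) y" for y
  have \<rho>: "\<rho> \<in> mod_hom A F F" unfolding \<rho>_def
    by (rule mod_hom_minus_map[OF mod_hom_id(2) mod_hom_comp[OF \<pi> \<sigma>(1)] F.right_module_axioms F.right_module_axioms])
  have \<pi>\<rho>: "\<pi> (\<rho> y) = \<zero>\<^bsub>M\<^esub>" if y: "y \<in> carrier F" for y
  proof -
    have p: "\<pi> y \<in> carrier M" by (rule mod_hom_closed[OF \<pi> y])
    have "\<pi> (\<rho> y) = \<pi> y \<ominus>\<^bsub>M\<^esub> \<pi> (\<sigma> (\<pi> y))"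
      unfolding \<rho>_def comp_def by (rule mod_hom_minus[OF \<pi> gF gM y mod_hom_closed[OF \<sigma>(1) p]])
    then show ?thesis using \<sigma>(2) p abelian_group.minus_self[OF gM p] by simp
  qed
  have \<rho>N: "\<rho> x = x" if "x \<in> carrier F" "\<pi> x = \<zero>\<^bsub>M\<^esub>" for x
    using that mod_hom_zero[OF \<sigma>(1) gM gF] abelian_group_uminus_zero[OF gF] by (simp add: \<rho>_def a_minus_def)
  have ker: "x g \<in> rad n" if "x \<in> carrier F" "\<pi> x = \<zero>\<^bsub>M\<^esub>" "g \<in> G" for x g n
    using that
  proof (induction n arbitrary: x g)
    case 0
    then show ?case using P_incl[OF G1(2)[OF 0(3)]] by (auto simp: rad_0 F_def PP_def)
  next
    case (Suc n)
    \<comment> \<open>By \<open>ker1\<close>, x is a sum of terms y a with an arrow a, and x =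
      \<rho> x. As \<rho>(y a) = \<rho>(y) a and \<rho>(y) lies in the kernel, the induction
      hypothesis puts \<rho>(y) in rad^n, and the arrow adds one power.\<close>
    let ?S = "{z \<in> carrier F. \<forall>g\<in>G. \<rho> z g \<in> rad (Suc n)}"
    have S0: "\<zero>\<^bsub>F\<^esub> \<in> ?S"
      unfolding mem_Collect_eq mod_hom_zero[OF \<rho> gF gF] using abelian_groupE(2)[OF gF] rad_zero by (simp add: F_def PP_def)
    have Sadd: "y \<oplus>\<^bsub>F\<^esub> z \<in> ?S" if "y \<in> ?S" "z \<in> ?S" for y z
      using that F.a_closed mod_hom_add[OF \<rho>] rad_add by (simp add: F_def PP_def)
    have "x \<in> ?S"
    proof (rule mod_Sum_induct_elem[OF fG rP(1)])
      fix j assume j: "j \<in> G"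
      have xj: "x j \<in> carrier (P (snd j))" using Suc.prems(1) j by (auto simp: F_def PP_def)
      have "x j \<in> {z \<in> carrier (P (snd j)). incl G PP j z \<in> ?S}"
      proof (rule rad_arrow_induct[OF G1(2)[OF j] xj ker1[OF Suc.prems(1,2) j]])
        interpret Pj: right_module A "P (snd j)" by (rule P_right[OF G1(2)[OF j]])
        show "\<zero>\<^bsub>A\<^esub> \<in> {z \<in> carrier (P (snd j)). incl G PP j z \<in> ?S}"
          using Pj.zero_closed mod_hom_zero[OF inclh[OF j] right_module_group[OF rP(1)[OF j]] gF] S0 by (simp add: PP_def)
        fix y z assume "y \<in> {z \<in> carrier (P (snd j)). incl G PP j z \<in> ?S}" "z \<in> {z \<in> carrier (P (snd j)). incl G PP j z \<in> ?S}"
        then show "y \<oplus>\<^bsub>A\<^esub> z \<in> {z \<in> carrier (P (snd j)). incl G PP j z \<in> ?S}"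
          using Pj.a_closed[of y z] mod_hom_add[OF inclh[OF j], of y z] Sadd[of "incl G PP j y" "incl G PP j z"] by (simp add: PP_def)
      next
        fix y a assume y: "y \<in> carrier (P (snd j))" and a: "a \<in> arcs Q"
        interpret Pj: right_module A "P (snd j)" by (rule P_right[OF G1(2)[OF j]])
        have aA: "arr a \<in> carrier A" using a by simp
        have iy: "incl G PP j y \<in> carrier F" using mod_hom_closed[OF inclh[OF j]] y by (simp add: PP_def)
        have r: "\<rho> (incl G PP j y) g \<in> rad n" if "g \<in> G" for g
          by (rule Suc.IH[OF mod_hom_closed[OF \<rho> iy] \<pi>\<rho>[OF iy] that])
        have e: "incl G PP j (y \<otimes>\<^bsub>A\<^esub> arr a) = incl G PP j y \<bullet>\<^bsub>F\<^esub> arr a"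
          using mod_hom_ract[OF inclh[OF j] _ aA, of y] y by (simp add: PP_def)
        have "\<rho> (incl G PP j (y \<otimes>\<^bsub>A\<^esub> arr a)) g \<in> rad (Suc n)" if "g \<in> G" for g
          using rad_mult[OF r[OF that] arr_rad[OF a]] that unfolding e mod_hom_ract[OF \<rho> iy aA] by (simp add: F_def PP_def)
        moreover have "y \<otimes>\<^bsub>A\<^esub> arr a \<in> carrier (P (snd j))" using Pj.ract_closed[OF y aA] by simp
        moreover have "incl G PP j (y \<otimes>\<^bsub>A\<^esub> arr a) \<in> carrier F" unfolding e by (rule F.ract_closed[OF iy aA])
        ultimately show "y \<otimes>\<^bsub>A\<^esub> arr a \<in> {z \<in> carrier (P (snd j)). incl G PP j z \<in> ?S}" by blast
      qed
      then show "incl G PP j (x j) \<in> ?S" by blast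
    qed (use Suc.prems(1) S0 Sadd in \<open>simp_all only: F_def\<close>)
    then show ?case using \<rho>N[OF Suc.prems(1,2)] Suc.prems(3) by simp
  qed
  obtain m where m: "rad m = {\<zero>\<^bsub>A\<^esub>}" using rad_nilpotent by blast
  have "x = \<zero>\<^bsub>F\<^esub>" if x: "x \<in> carrier F" "\<pi> x = \<zero>\<^bsub>M\<^esub>" for x
    using ker[OF x, of _ m] x(1) by (auto simp: m F_def PP_def fun_eq_iff PiE_iff extensional_def)
  then have "inj_on \<pi> (carrier F)" by (rule mod_hom_inj[OF \<pi> F.right_module_axioms M.right_module_axioms])
  then have "bij_betw \<pi> (carrier F) (carrier M)" using surj by (simp add: bij_betw_def)
  then show ?thesis using fG G1(2) \<pi> unfolding F_def PP_def by blast
qed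

lemma generates_per_bound_quiver:
  assumes T: "bounded_complex A T" and g: "\<And>i. i \<in> verts Q \<Longrightarrow> gen T (stalk (P i))"
  shows "generates_per A T"
proof (rule generates_perI, rule gen_projective_complex[OF T])
  fix M :: "(('v, 'e, 'k) qelt, nat \<Rightarrow> 'k) right_mod" assume M: "fg_projective A M"
  obtain G :: "((nat \<Rightarrow> 'k) \<times> 'v) set" and f where G: "finite G" "snd ` G \<subseteq> verts Q" "f \<in> mod_hom A (mod_Sum G (\<lambda>g. P (snd g))) M"
    "bij_betw f (carrier (mod_Sum G (\<lambda>g. P (snd g)))) (carrier M)"
    using projective_decomposition[OF M] by blast
  have p: "fg_projective A (P (snd j))" "gen T (stalk (P (snd j)))" if "j \<in> G" for j
    using G(2) that by (auto intro: P_projective g)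
  show "gen T (stalk M)"
    by (rule gen_stalk_iso[OF gen_stalk_mod_Sum[OF G(1) T p] fg_projective_mod_Sum[OF G(1) p(1)] fd_right[OF fg_projective_fd[OF M]] G(3,4)])
qed

end

section \<open>Rotation of triangles and complexes in two consecutive degrees\<close>

lemma (in abelian_group) minus_add_cancel:
  "p \<in> carrier G \<Longrightarrow> q \<in> carrier G \<Longrightarrow> r \<in> carrier G \<Longrightarrow> \<ominus> (p \<oplus> q) \<oplus> (p \<oplus> r) = \<ominus> q \<oplus> r"
  by (simp add: minus_add a_comm[of "\<ominus> p" "\<ominus> q"] a_assoc r_neg1)

context kalg
begin

lemma zero_mod_uminus: "\<ominus>\<^bsub>zero_mod :: ('a, 'b) right_mod\<^esub> undefined = undefined"
  using abelian_group_uminus_zero[OF right_module_group[OF right_module_zero_mod[OF ring_axioms]]] by simp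

lemma zero_sum_uminus:
  "\<ominus>\<^bsub>mod_sum (zero_mod :: ('a, 'b) right_mod) (zero_mod :: ('a, 'c) right_mod)\<^esub> (undefined, undefined) = (undefined, undefined)"
  using abelian_group_uminus_zero[OF right_module_group[OF right_module_mod_sum[OF right_module_zero_mod[OF ring_axioms] right_module_zero_mod[OF ring_axioms]]]]
  by simp

lemma cone_simps:
  "obj (cone X Y f) n = mod_sum (obj X (n + 1)) (obj Y n)"
  "dif (cone X Y f) n (x, y) = (\<ominus>\<^bsub>obj X (n + 1 + 1)\<^esub> dif X (n + 1) x, f (n + 1) x \<oplus>\<^bsub>obj Y (n + 1)\<^esub> dif Y n y)"
  by (simp_all add: cone_def)

lemma shift1_simps:
  "obj (shift 1 X) n = obj X (n + 1)" "dif (shift 1 X) n x = \<ominus>\<^bsub>obj X (n + 1 + 1)\<^esub> dif X (n + 1) x"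
  by (simp_all add: shift_def)

text \<open>Rotation: X[1] is quasi-isomorphic to the cone of the inclusion of Y into the cone of f.
  As \<open>triangle\<close> only builds cones, this is how the source is recovered.\<close>

lemma gen_cone_source:
  fixes X :: "('a, 'x) cochain" and Y :: "('a, 'y) cochain"
  assumes Y: "gen T Y" and C: "gen T (cone X Y f)" and pX: "projective_complex A X" and pY: "projective_complex A Y"
    and f: "f \<in> chain_map A X Y"
  shows "gen T X"
proof -
  note bX = pc_bc[OF pX] and bY = pc_bc[OF pY]
  let ?C = "cone X Y f"
  define i where "i n y = (\<zero>\<^bsub>obj X (n + 1)\<^esub>, y)" for n and y :: 'y
  \<comment> \<open>The component - f x cancels the contribution f x that the differential of the
    inner cone produces.\<close>
  define q where "q n x = (\<ominus>\<^bsub>obj Y (n + 1)\<^esub> f (n + 1) x, (x, \<zero>\<^bsub>obj Y n\<^esub>))" for n x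
  have pC: "projective_complex A ?C" by (rule cone_projective[OF pX pY f])
  note bC = pc_bc[OF pC]
  note gX = bc_group[OF bX] and gY = bc_group[OF bY]
  note X0 = abelian_groupE(2)[OF gX] and Y0 = abelian_groupE(2)[OF gY]
  note uX = abelian_group_uminus_zero[OF gX] and uY = abelian_group_uminus_zero[OF gY]
  note lX = abelian_groupE(5)[OF gX] and lY = abelian_groupE(5)[OF gY]
  note rX = abelian_monoid.r_zero[OF abelian_group.axioms(1)[OF gX]] and rY = abelian_monoid.r_zero[OF abelian_group.axioms(1)[OF gY]]
  have i: "i \<in> chain_map A Y ?C"
  proof (rule cmI)
    show "i n \<in> mod_hom A (obj Y n) (obj ?C n)" for n
      unfolding i_def cone_simps by (rule mod_sum_maps(2)[OF bc_right[OF bX] bc_right[OF bY]])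
    fix n y assume y: "y \<in> carrier (obj Y n)"
    show "i (n + 1) (dif Y n y) = dif ?C n (i n y)"
      using bc_closed[OF bY y refl] by (simp add: i_def cone_simps bc_zero[OF bX, of "n + 1 + 1"] uX cm_zero[OF f bX bY] lY)
  qed
  have pS: "projective_complex A (shift 1 X)" by (rule shift_projective[OF pX])
  have pD: "projective_complex A (cone Y ?C i)" by (rule cone_projective[OF pY pC i])
  have q: "q \<in> chain_map A (shift 1 X) (cone Y ?C i)"
  proof (rule cmI)
    show "q n \<in> mod_hom A (obj (shift 1 X) n) (obj (cone Y ?C i) n)" for n
      unfolding q_def cone_simps shift1_simps
      by (intro mod_hom_pair mod_hom_neg_map cm_hom[OF f] mod_hom_id(2) mod_hom_zero_map bc_right bX bY)
    fix n x assume "x \<in> carrier (obj (shift 1 X) n)"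
    then have x: "x \<in> carrier (obj X (n + 1))" by (simp add: shift1_simps)
    have fx: "f (n + 1) x \<in> carrier (obj Y (n + 1))" by (rule cm_closed[OF f x])
    have dx: "dif X (n + 1) x \<in> carrier (obj X (n + 1 + 1))" by (rule bc_closed[OF bX x refl])
    have 1: "f (n + 1 + 1) (\<ominus>\<^bsub>obj X (n + 1 + 1)\<^esub> dif X (n + 1) x) = dif Y (n + 1) (\<ominus>\<^bsub>obj Y (n + 1)\<^esub> f (n + 1) x)"
      using mod_hom_uminus[OF cm_hom[OF f] gX gY dx] mod_hom_uminus[OF bc_dif[OF bY refl] gY gY fx] cm_dif[OF f x refl] by simp
    have 2: "\<ominus>\<^bsub>obj Y (n + 1)\<^esub> f (n + 1) x \<oplus>\<^bsub>obj Y (n + 1)\<^esub> (f (n + 1) x \<oplus>\<^bsub>obj Y (n + 1)\<^esub> \<zero>\<^bsub>obj Y (n + 1)\<^esub>) = \<zero>\<^bsub>obj Y (n + 1)\<^esub>"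
      using fx by (simp add: rY abelian_group.l_neg[OF gY])
    show "q (n + 1) (dif (shift 1 X) n x) = dif (cone Y ?C i) n (q n x)"
      unfolding q_def shift1_simps cone_simps i_def 1
      using 2 abelian_group.a_inv_closed[OF gX dx] by (simp add: cone_simps bc_zero[OF bY, of "n + 1" n] lX)
  qed
  have "q \<in> quasi_iso A (shift 1 X) (cone Y ?C i)"
  proof (rule quasi_isoI[OF pc_bc[OF pS] pc_bc[OF pD] q])
    fix n z w assume "z \<in> carrier (obj (shift 1 X) n)" and "w \<in> carrier (obj (cone Y ?C i) (n - 1))"
      and e: "q n z = dif (cone Y ?C i) (n - 1) w"
    then obtain b x y where w: "w = (b, (x, y))" "b \<in> carrier (obj Y n)" "x \<in> carrier (obj X n)" "y \<in> carrier (obj Y (n - 1))"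
      by (auto simp: cone_simps)
    have dx: "dif X n x \<in> carrier (obj X (n + 1))" by (rule bc_closed[OF bX w(3) refl])
    have "z = \<ominus>\<^bsub>obj X (n + 1)\<^esub> dif X n x"
      using e abelian_group.a_inv_closed[OF gX dx] by (simp add: w(1) q_def cone_simps i_def lX)
    then have "z = dif (shift 1 X) (n - 1) x" by (simp add: shift1_simps)
    then show "\<exists>v\<in>carrier (obj (shift 1 X) (n - 1)). z = dif (shift 1 X) (n - 1) v" using w(3) by (auto simp: shift1_simps)
  next
    fix n c assume "c \<in> carrier (obj (cone Y ?C i) n)" and e: "dif (cone Y ?C i) n c = \<zero>\<^bsub>obj (cone Y ?C i) (n + 1)\<^esub>"
    then obtain b x y where c: "c = (b, (x, y))" "b \<in> carrier (obj Y (n + 1))" "x \<in> carrier (obj X (n + 1))" "y \<in> carrier (obj Y n)"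
      by (auto simp: cone_simps)
    interpret Y1: abelian_group "obj Y (n + 1)" by (rule gY)
    have dx: "dif X (n + 1) x \<in> carrier (obj X (n + 1 + 1))" by (rule bc_closed[OF bX c(3) refl])
    have dy: "dif Y n y \<in> carrier (obj Y (n + 1))" by (rule bc_closed[OF bY c(4) refl])
    have fx: "f (n + 1) x \<in> carrier (obj Y (n + 1))" by (rule cm_closed[OF f c(3)])
    have e1: "\<ominus>\<^bsub>obj X (n + 1 + 1)\<^esub> dif X (n + 1) x = \<zero>\<^bsub>obj X (n + 1 + 1)\<^esub>"
      and e2: "b \<oplus>\<^bsub>obj Y (n + 1)\<^esub> (f (n + 1) x \<oplus>\<^bsub>obj Y (n + 1)\<^esub> dif Y n y) = \<zero>\<^bsub>obj Y (n + 1)\<^esub>"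
      using e abelian_group.a_inv_closed[OF gX dx] by (simp_all add: c(1) cone_simps i_def lX)
    have e3: "b = \<ominus>\<^bsub>obj Y (n + 1)\<^esub> dif Y n y \<oplus>\<^bsub>obj Y (n + 1)\<^esub> \<ominus>\<^bsub>obj Y (n + 1)\<^esub> f (n + 1) x"
      using Y1.minus_equality[OF e2] fx dy c(2) by (simp add: Y1.minus_add Y1.a_comm)
    \<comment> \<open>A cocycle (b, (x, y)) has d x = 0 and b = - d y - f x, so it differs from q x
      by the boundary of this element.\<close>
    let ?w = "(y, (\<zero>\<^bsub>obj X n\<^esub>, \<zero>\<^bsub>obj Y (n - 1)\<^esub>))"
    have d: "dif (cone Y ?C i) (n - 1) ?w = (\<ominus>\<^bsub>obj Y (n + 1)\<^esub> dif Y n y, (\<zero>\<^bsub>obj X (n + 1)\<^esub>, y))"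
      using c(4) Y0[of n] X0[of "n + 1"] by (simp add: cone_simps i_def bc_zero[OF bX, of "n + 1" n] uX lX bc_zero[OF bY, of n "n - 1"] cm_zero[OF f bX bY] lY rY)
    have "dif (shift 1 X) n x = \<zero>\<^bsub>obj (shift 1 X) (n + 1)\<^esub>" using e1 by (simp add: shift1_simps)
    moreover have "c = dif (cone Y ?C i) (n - 1) ?w \<oplus>\<^bsub>obj (cone Y ?C i) n\<^esub> q n x"
      unfolding d using e3 c(3,4) by (simp add: c(1) q_def cone_simps lX rY)
    moreover have "?w \<in> carrier (obj (cone Y ?C i) (n - 1))" using c(4) X0[of n] Y0[of "n - 1"] by (simp add: cone_simps)
    ultimately show "\<exists>z\<in>carrier (obj (shift 1 X) n). dif (shift 1 X) n z = \<zero>\<^bsub>obj (shift 1 X) (n + 1)\<^esub> \<and>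
        (\<exists>w\<in>carrier (obj (cone Y ?C i) (n - 1)). c = dif (cone Y ?C i) (n - 1) w \<oplus>\<^bsub>obj (cone Y ?C i) n\<^esub> q n z)"
      using c(3) by (auto simp: shift1_simps)
  qed
  then have "gen T (shift 1 X)" by (rule gen_qi'[OF gen_cone[OF Y C pY pC i] pD pS])
  then show ?thesis by (rule gen_unshift[OF _ pX])
qed

text \<open>The other rotation: the cone of the projection from the cone of f to X[1] is
  quasi-isomorphic to Y[1]. The map is ((x, y), x') \<mapsto> y + f x', because the two copies of X
  cancel.\<close>

lemma gen_cone_target:
  fixes X :: "('a, 'x) cochain" and Y :: "('a, 'y) cochain"
  assumes X: "gen T X" and C: "gen T (cone X Y f)" and pX: "projective_complex A X" and pY: "projective_complex A Y"
    and f: "f \<in> chain_map A X Y"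
  shows "gen T Y"
proof -
  note bX = pc_bc[OF pX] and bY = pc_bc[OF pY]
  let ?C = "cone X Y f" and ?S = "shift 1 X"
  define p where "p n c = fst c" for n :: int and c :: "'x \<times> 'y"
  define q where "q n c = snd (fst c) \<oplus>\<^bsub>obj Y (n + 1)\<^esub> f (n + 1) (snd c)" for n and c :: "('x \<times> 'y) \<times> 'x"
  have pC: "projective_complex A ?C" by (rule cone_projective[OF pX pY f])
  note bC = pc_bc[OF pC]
  have pS: "projective_complex A ?S" by (rule shift_projective[OF pX])
  have pSY: "projective_complex A (shift 1 Y)" by (rule shift_projective[OF pY])
  note bS = pc_bc[OF pS]
  note gX = bc_group[OF bX] and gY = bc_group[OF bY]
  note X0 = abelian_groupE(2)[OF gX] and Y0 = abelian_groupE(2)[OF gY]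
  note uX = abelian_group_uminus_zero[OF gX] and uY = abelian_group_uminus_zero[OF gY]
  note lX = abelian_groupE(5)[OF gX] and lY = abelian_groupE(5)[OF gY]
  note rX = abelian_monoid.r_zero[OF abelian_group.axioms(1)[OF gX]] and rY = abelian_monoid.r_zero[OF abelian_group.axioms(1)[OF gY]]
  have p: "p \<in> chain_map A ?C ?S"
  proof (rule cmI)
    show "p n \<in> mod_hom A (obj ?C n) (obj ?S n)" for n
      unfolding p_def cone_simps shift1_simps by (rule mod_sum_maps(3)[OF bc_right[OF bX] bc_right[OF bY]])
    fix n c assume "c \<in> carrier (obj ?C n)"
    show "p (n + 1) (dif ?C n c) = dif ?S n (p n c)" by (cases c) (simp add: p_def cone_simps shift1_simps)
  qed
  let ?D = "cone ?C ?S p"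
  have pD: "projective_complex A ?D" by (rule cone_projective[OF pC pS p])
  have D: "dif ?D n ((x, y), x') = ((dif X (n + 1 + 1) x, \<ominus>\<^bsub>obj Y (n + 1 + 1)\<^esub> (f (n + 1 + 1) x \<oplus>\<^bsub>obj Y (n + 1 + 1)\<^esub> dif Y (n + 1) y)),
      x \<oplus>\<^bsub>obj X (n + 1 + 1)\<^esub> \<ominus>\<^bsub>obj X (n + 1 + 1)\<^esub> dif X (n + 1) x')"
    if x: "x \<in> carrier (obj X (n + 1 + 1))" and y: "y \<in> carrier (obj Y (n + 1))" for n x y x'
  proof -
    have dx: "dif X (n + 1 + 1) x \<in> carrier (obj X (n + 1 + 1 + 1))" by (rule bc_closed[OF bX x refl])
    have s: "f (n + 1 + 1) x \<oplus>\<^bsub>obj Y (n + 1 + 1)\<^esub> dif Y (n + 1) y \<in> carrier (obj Y (n + 1 + 1))"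
      by (rule abelian_groupE(1)[OF gY cm_closed[OF f x] bc_closed[OF bY y refl]])
    show ?thesis
      unfolding cone_simps shift1_simps p_def fst_conv
        mod_sum_uminus[OF bc_right[OF bX] bc_right[OF bY] abelian_group.a_inv_closed[OF gX dx] s]
        abelian_group.minus_minus[OF gX dx] ..
  qed
  have q: "q \<in> chain_map A ?D (shift 1 Y)"
  proof (rule cmI)
    note r = right_module_mod_sum[OF bc_right[OF bX] bc_right[OF bY]]
    show "q n \<in> mod_hom A (obj ?D n) (obj (shift 1 Y) n)" for n
      unfolding q_def cone_simps shift1_simps
      using mod_hom_add_map[OF mod_hom_comp[OF mod_sum_maps(3)[OF r bc_right[OF bX]] mod_sum_maps(4)[OF bc_right[OF bX] bc_right[OF bY]]]
          mod_hom_comp[OF mod_sum_maps(4)[OF r bc_right[OF bX]] cm_hom[OF f]] bc_right[OF bY]] by (simp add: comp_def)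
    fix n c assume "c \<in> carrier (obj ?D n)"
    then obtain x y x' where c: "c = ((x, y), x')" "x \<in> carrier (obj X (n + 1 + 1))" "y \<in> carrier (obj Y (n + 1))" "x' \<in> carrier (obj X (n + 1))"
      by (auto simp: cone_simps shift1_simps)
    interpret Y2: abelian_group "obj Y (n + 1 + 1)" by (rule gY)
    interpret X2: abelian_group "obj X (n + 1 + 1)" by (rule gX)
    have fx: "f (n + 1 + 1) x \<in> carrier (obj Y (n + 1 + 1))" by (rule cm_closed[OF f c(2)])
    have fx': "f (n + 1) x' \<in> carrier (obj Y (n + 1))" by (rule cm_closed[OF f c(4)])
    have dy: "dif Y (n + 1) y \<in> carrier (obj Y (n + 1 + 1))" by (rule bc_closed[OF bY c(3) refl])
    have dx': "dif X (n + 1) x' \<in> carrier (obj X (n + 1 + 1))" by (rule bc_closed[OF bX c(4) refl])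
    have dfx': "dif Y (n + 1) (f (n + 1) x') \<in> carrier (obj Y (n + 1 + 1))" by (rule bc_closed[OF bY fx' refl])
    have "q (n + 1) (dif ?D n c) = \<ominus>\<^bsub>obj Y (n + 1 + 1)\<^esub> (f (n + 1 + 1) x \<oplus>\<^bsub>obj Y (n + 1 + 1)\<^esub> dif Y (n + 1) y) \<oplus>\<^bsub>obj Y (n + 1 + 1)\<^esub>
        (f (n + 1 + 1) x \<oplus>\<^bsub>obj Y (n + 1 + 1)\<^esub> \<ominus>\<^bsub>obj Y (n + 1 + 1)\<^esub> dif Y (n + 1) (f (n + 1) x'))"
      unfolding c(1) D[OF c(2,3)] q_def
      using cm_add[OF f c(2) X2.a_inv_closed[OF dx']] mod_hom_uminus[OF cm_hom[OF f] gX gY dx'] cm_dif[OF f c(4) refl] by simp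
    also have "\<dots> = \<ominus>\<^bsub>obj Y (n + 1 + 1)\<^esub> dif Y (n + 1) y \<oplus>\<^bsub>obj Y (n + 1 + 1)\<^esub> \<ominus>\<^bsub>obj Y (n + 1 + 1)\<^esub> dif Y (n + 1) (f (n + 1) x')"
      by (rule Y2.minus_add_cancel[OF fx dy Y2.a_inv_closed[OF dfx']])
    also have "\<dots> = \<ominus>\<^bsub>obj Y (n + 1 + 1)\<^esub> dif Y (n + 1) (y \<oplus>\<^bsub>obj Y (n + 1)\<^esub> f (n + 1) x')"
      unfolding mod_hom_add[OF bc_dif[OF bY refl] c(3) fx'] Y2.minus_add[OF dy dfx'] ..
    finally show "q (n + 1) (dif ?D n c) = dif (shift 1 Y) n (q n c)" by (simp add: c(1) q_def shift1_simps)
  qed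
  have "q \<in> quasi_iso A ?D (shift 1 Y)"
  proof (rule quasi_isoI[OF pc_bc[OF pD] pc_bc[OF pSY] q])
    fix n c w assume "c \<in> carrier (obj ?D n)" and "w \<in> carrier (obj (shift 1 Y) (n - 1))"
      and d: "dif ?D n c = \<zero>\<^bsub>obj ?D (n + 1)\<^esub>" and e: "q n c = dif (shift 1 Y) (n - 1) w"
    then obtain x y x' where c: "c = ((x, y), x')" "x \<in> carrier (obj X (n + 1 + 1))" "y \<in> carrier (obj Y (n + 1))" "x' \<in> carrier (obj X (n + 1))"
      and w: "w \<in> carrier (obj Y n)" by (auto simp: cone_simps shift1_simps)
    interpret X1: abelian_group "obj X (n + 1)" by (rule gX)
    interpret X2: abelian_group "obj X (n + 1 + 1)" by (rule gX)
    interpret Y1: abelian_group "obj Y (n + 1)" by (rule gY)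
    have fx': "f (n + 1) x' \<in> carrier (obj Y (n + 1))" by (rule cm_closed[OF f c(4)])
    have dx': "dif X (n + 1) x' \<in> carrier (obj X (n + 1 + 1))" by (rule bc_closed[OF bX c(4) refl])
    have dw: "dif Y n w \<in> carrier (obj Y (n + 1))" by (rule bc_closed[OF bY w refl])
    have "x \<oplus>\<^bsub>obj X (n + 1 + 1)\<^esub> \<ominus>\<^bsub>obj X (n + 1 + 1)\<^esub> dif X (n + 1) x' = \<zero>\<^bsub>obj X (n + 1 + 1)\<^esub>"
      using d unfolding c(1) D[OF c(2,3)] by (simp add: cone_simps shift1_simps)
    then have x: "x = dif X (n + 1) x'"
      unfolding X2.minus_eq[symmetric] X2.minus_eq_iff[OF c(2) dx' X2.zero_closed] X2.l_zero[OF dx'] .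
    have "y \<oplus>\<^bsub>obj Y (n + 1)\<^esub> f (n + 1) x' = \<ominus>\<^bsub>obj Y (n + 1)\<^esub> dif Y n w"
      using e by (simp add: c(1) q_def shift1_simps)
    then have "\<ominus>\<^bsub>obj Y (n + 1)\<^esub> dif Y n w \<ominus>\<^bsub>obj Y (n + 1)\<^esub> f (n + 1) x' = y"
      using c(3) fx' dw by (simp add: Y1.minus_eq_iff)
    then have y: "y = \<ominus>\<^bsub>obj Y (n + 1)\<^esub> (f (n + 1) x' \<oplus>\<^bsub>obj Y (n + 1)\<^esub> dif Y n w)"
      using fx' dw by (simp add: Y1.minus_add Y1.minus_eq Y1.a_comm)
    \<comment> \<open>The hypotheses have expressed x and y through x' and w; these two assemble to
      a primitive of c.\<close>
    let ?v = "((x', w), \<zero>\<^bsub>obj X n\<^esub>)"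
    have "dif ?D (n - 1) ?v = ((dif X (n + 1) x', \<ominus>\<^bsub>obj Y (n + 1)\<^esub> (f (n + 1) x' \<oplus>\<^bsub>obj Y (n + 1)\<^esub> dif Y n w)), x')"
      using D[of x' "n - 1" w "\<zero>\<^bsub>obj X n\<^esub>"] c(4) w by (simp add: bc_zero[OF bX, of "n + 1" n] uX rX)
    then have "c = dif ?D (n - 1) ?v" by (simp add: c(1) x y)
    moreover have "?v \<in> carrier (obj ?D (n - 1))" using c(4) w X0[of n] by (simp add: cone_simps shift1_simps)
    ultimately show "\<exists>v\<in>carrier (obj ?D (n - 1)). c = dif ?D (n - 1) v" by blast
  next
    fix n y assume "y \<in> carrier (obj (shift 1 Y) n)" and d: "dif (shift 1 Y) n y = \<zero>\<^bsub>obj (shift 1 Y) (n + 1)\<^esub>"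
    then have y: "y \<in> carrier (obj Y (n + 1))" by (simp add: shift1_simps)
    have dy: "dif Y (n + 1) y \<in> carrier (obj Y (n + 1 + 1))" by (rule bc_closed[OF bY y refl])
    have d0: "\<ominus>\<^bsub>obj Y (n + 1 + 1)\<^esub> dif Y (n + 1) y = \<zero>\<^bsub>obj Y (n + 1 + 1)\<^esub>" using d by (simp add: shift1_simps)
    let ?z = "((\<zero>\<^bsub>obj X (n + 1 + 1)\<^esub>, y), \<zero>\<^bsub>obj X (n + 1)\<^esub>)"
    have z: "?z \<in> carrier (obj ?D n)" using y X0 by (simp add: cone_simps shift1_simps)
    have dz: "dif ?D n ?z = \<zero>\<^bsub>obj ?D (n + 1)\<^esub>"
      unfolding D[OF X0 y] unfolding cm_zero[OF f bX bY] lY[OF dy] d0 bc_zero[OF bX refl] uX lX[OF X0] cone_simps shift1_simps mod_sum_simps ..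
    have qz: "q n ?z = y" using y by (simp add: q_def cm_zero[OF f bX bY] rY)
    have "dif (shift 1 Y) (n - 1) \<zero>\<^bsub>obj (shift 1 Y) (n - 1)\<^esub> = \<zero>\<^bsub>obj (shift 1 Y) n\<^esub>"
      by (rule bc_zero[OF pc_bc[OF pSY]]) simp
    then have "y = dif (shift 1 Y) (n - 1) \<zero>\<^bsub>obj (shift 1 Y) (n - 1)\<^esub> \<oplus>\<^bsub>obj (shift 1 Y) n\<^esub> q n ?z"
      unfolding qz using lY[OF y] by (simp add: shift1_simps)
    then show "\<exists>z\<in>carrier (obj ?D n). dif ?D n z = \<zero>\<^bsub>obj ?D (n + 1)\<^esub> \<and>
        (\<exists>w\<in>carrier (obj (shift 1 Y) (n - 1)). y = dif (shift 1 Y) (n - 1) w \<oplus>\<^bsub>obj (shift 1 Y) n\<^esub> q n z)"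
      using z dz abelian_groupE(2)[OF bc_group[OF pc_bc[OF pSY]]] by blast
  qed
  then have "gen T (shift 1 Y)" by (rule gen_qi[OF gen_cone[OF C gen_shift[OF X pX] pC pS p] pD pSY])
  then show ?thesis by (rule gen_unshift[OF _ pY])
qed

section \<open>Two-term complexes as cones of maps between stalks\<close>

lemma stalk_chain_map:
  assumes M: "fd_module A M" and N: "fd_module A N" and f: "f \<in> mod_hom A M N"
  shows "(\<lambda>n. if n = 0 then f else (\<lambda>_. undefined)) \<in> chain_map A (stalk M) (stalk N)"
  by (rule cmI)
    (use mod_hom_zero[OF f right_module_group[OF fd_right[OF M]] right_module_group[OF fd_right[OF N]]] f in
      \<open>auto simp: stalk_def mod_hom_zero_mod\<close>)

text \<open>With M in degree -1 the two-term complex is literally the cone of f between the stalks,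
  so M is recovered by rotation. This will give P_k from L_k.\<close>

lemma gen_two_term_source:
  assumes C: "gen T (two_term (- 1) M N f)" and N: "gen T (stalk N)" and pM: "fg_projective A M" and pN: "fg_projective A N"
    and f: "f \<in> mod_hom A M N"
  shows "gen T (stalk M)"
proof -
  let ?f = "\<lambda>n :: int. if n = 0 then f else (\<lambda>_. undefined)"
  note sM = stalk_projective[OF pM] and sN = stalk_projective[OF pN]
  have f': "?f \<in> chain_map A (stalk M) (stalk N)" by (rule stalk_chain_map[OF fg_projective_fd[OF pM] fg_projective_fd[OF pN] f])
  interpret M: abelian_group M by (rule right_module_group[OF fd_right[OF fg_projective_fd[OF pM]]])
  interpret N: abelian_group N by (rule right_module_group[OF fd_right[OF fg_projective_fd[OF pN]]])
  note z = zero_mod_uminus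
  have i: "(\<lambda>n. id) \<in> cx_iso (two_term (- 1) M N f) (cone (stalk M) (stalk N) ?f)"
  proof (rule cx_isoI)
    have o: "obj (two_term (- 1) M N f) n = obj (cone (stalk M) (stalk N) ?f) n" for n
      by (auto simp: two_term_def two_term_obj_def cone_simps stalk_def)
    show "id \<in> mod_hom A (obj (two_term (- 1) M N f) n) (obj (cone (stalk M) (stalk N) ?f) n)" for n
      unfolding o by (rule mod_hom_id)
    show "bij_betw id (carrier (obj (two_term (- 1) M N f) n)) (carrier (obj (cone (stalk M) (stalk N) ?f) n))" for n
      unfolding o by simp
    fix n x assume x: "x \<in> carrier (obj (two_term (- 1) M N f) n)"
    show "id (dif (two_term (- 1) M N f) n x) = dif (cone (stalk M) (stalk N) ?f) n (id x)"
      using x mod_hom_closed[OF f]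
      by (cases x) (auto simp: two_term_def two_term_obj_def cone_def stalk_def z abelian_group_uminus_zero[OF M.abelian_group_axioms])
  qed
  show ?thesis
    by (rule gen_cone_source[OF N gen_iso[OF C two_term_projective[OF pM pN f] cone_projective[OF sM sN f'] i] sM sN f'])
qed

text \<open>With M in degree 0 the complex must be shifted by one to become a cone. The shift
  negates the differential, so it is the cone of -f. This will give P_k from R_k.\<close>

lemma gen_two_term_target:
  assumes C: "gen T (two_term 0 M N f)" and M: "gen T (stalk M)" and pM: "fg_projective A M" and pN: "fg_projective A N"
    and f: "f \<in> mod_hom A M N"
  shows "gen T (stalk N)"
proof -
  let ?g = "\<lambda>x. \<ominus>\<^bsub>N\<^esub> f x"
  let ?f = "\<lambda>n :: int. if n = 0 then ?g else (\<lambda>_. undefined)"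
  let ?R = "two_term 0 M N f"
  note sM = stalk_projective[OF pM] and sN = stalk_projective[OF pN]
  note rM = fd_right[OF fg_projective_fd[OF pM]] and rN = fd_right[OF fg_projective_fd[OF pN]]
  have f': "?f \<in> chain_map A (stalk M) (stalk N)"
    by (rule stalk_chain_map[OF fg_projective_fd[OF pM] fg_projective_fd[OF pN] mod_hom_neg_map[OF f rM rN]])
  interpret M: abelian_group M by (rule right_module_group[OF rM])
  interpret N: abelian_group N by (rule right_module_group[OF rN])
  note rz = right_module_zero_mod[OF ring_axioms]
  note z = zero_mod_uminus
  have zN: "\<ominus>\<^bsub>mod_sum zero_mod N\<^esub> (undefined, y) = (undefined, \<ominus>\<^bsub>N\<^esub> y)" if "y \<in> carrier N" for y
    using mod_sum_uminus[OF rz rN, of undefined y] that by (simp add: z)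
  note zz = zero_sum_uminus
  have zM: "\<ominus>\<^bsub>mod_sum M zero_mod\<^esub> (\<zero>\<^bsub>M\<^esub>, undefined) = (\<zero>\<^bsub>M\<^esub>, undefined)"
    using mod_sum_uminus[OF rM rz, of "\<zero>\<^bsub>M\<^esub>" undefined] by (simp add: z abelian_group_uminus_zero[OF M.abelian_group_axioms])
  have i: "(\<lambda>n. id) \<in> cx_iso (shift 1 ?R) (cone (stalk M) (stalk N) ?f)"
  proof (rule cx_isoI)
    have o: "obj (shift 1 ?R) n = obj (cone (stalk M) (stalk N) ?f) n" for n
      by (auto simp: shift1_simps two_term_def two_term_obj_def cone_simps stalk_def)
    show "id \<in> mod_hom A (obj (shift 1 ?R) n) (obj (cone (stalk M) (stalk N) ?f) n)" for n
      unfolding o by (rule mod_hom_id)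
    show "bij_betw id (carrier (obj (shift 1 ?R) n)) (carrier (obj (cone (stalk M) (stalk N) ?f) n))" for n
      unfolding o by simp
    fix n x assume x: "x \<in> carrier (obj (shift 1 ?R) n)"
    consider "n = - 1" | "n = - 2" | "n \<noteq> - 1" "n \<noteq> - 2" by blast
    then show "id (dif (shift 1 ?R) n x) = dif (cone (stalk M) (stalk N) ?f) n (id x)"
    proof cases
      case 1
      then show ?thesis using x mod_hom_closed[OF f]
        by (cases x) (auto simp: shift1_simps two_term_def two_term_obj_def cone_def stalk_def z zN)
    next
      case 2
      then show ?thesis using x
        by (cases x) (auto simp: shift1_simps two_term_def two_term_obj_def cone_def stalk_def z zM abelian_group_uminus_zero[OF M.abelian_group_axioms])
    next
      case 3
      then show ?thesis using x
        by (cases x) (auto simp: shift1_simps two_term_def two_term_obj_def cone_def stalk_def z zz)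
    qed
  qed
  have pR: "projective_complex A ?R" by (rule two_term_projective[OF pM pN f])
  show ?thesis
    by (rule gen_cone_target[OF M gen_iso[OF gen_shift[OF C pR] shift_projective[OF pR] cone_projective[OF sM sN f'] i] sM sN f'])
qed

section \<open>Self-extensions of a complex in two consecutive degrees\<close>

lemma trivial_hom:
  assumes "f \<in> mod_hom A M N" "right_module A M" "right_module A N" "carrier M = {\<zero>\<^bsub>M\<^esub>} \<or> carrier N = {\<zero>\<^bsub>N\<^esub>}" "x \<in> carrier M"
  shows "f x = \<zero>\<^bsub>N\<^esub>"
  using assms(4)
proof
  assume "carrier M = {\<zero>\<^bsub>M\<^esub>}"
  then show ?thesis using mod_hom_zero[OF assms(1) right_module_group[OF assms(2)] right_module_group[OF assms(3)]] assms(5) by simp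
next
  assume "carrier N = {\<zero>\<^bsub>N\<^esub>}"
  then show ?thesis using mod_hom_closed[OF assms(1,5)] by simp
qed

text \<open>For r other than 1 and -1 source or target vanishes in every degree. \<open>H1\<close>
  provides the homotopy for r = 1. For r = -1 there is no room for a non-zero homotopy, so
  \<open>H2\<close> asks that the map itself be zero.\<close>

lemma two_degree_null_homotopic:
  assumes X: "bounded_complex A X" and conc: "\<And>n. n \<noteq> d \<Longrightarrow> n \<noteq> d + 1 \<Longrightarrow> carrier (obj X n) = {\<zero>\<^bsub>obj X n\<^esub>}"
    and H1: "\<And>\<phi>. \<phi> \<in> mod_hom A (obj X d) (obj X (d + 1)) \<Longrightarrow>
      \<exists>a\<in>mod_hom A (obj X d) (obj X d). \<exists>b\<in>mod_hom A (obj X (d + 1)) (obj X (d + 1)).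
        \<forall>x\<in>carrier (obj X d). \<phi> x = dif X d (a x) \<oplus>\<^bsub>obj X (d + 1)\<^esub> b (dif X d x)"
    and H2: "\<And>\<phi> y. \<phi> \<in> mod_hom A (obj X (d + 1)) (obj X d) \<Longrightarrow>
      (\<And>y. y \<in> carrier (obj X (d + 1)) \<Longrightarrow> dif X d (\<phi> y) = \<zero>\<^bsub>obj X (d + 1)\<^esub>) \<Longrightarrow>
      (\<And>x. x \<in> carrier (obj X d) \<Longrightarrow> \<phi> (dif X d x) = \<zero>\<^bsub>obj X d\<^esub>) \<Longrightarrow>
      y \<in> carrier (obj X (d + 1)) \<Longrightarrow> \<phi> y = \<zero>\<^bsub>obj X d\<^esub>"
    and r: "r \<noteq> 0" and f: "f \<in> chain_map A X (shift r X)"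
  shows "homotopic A X (shift r X) f (\<lambda>n x. \<zero>\<^bsub>obj (shift r X) n\<^esub>)"
proof -
  have bS: "bounded_complex A (shift r X)" by (rule shift_bounded[OF X])
  have S: "obj (shift r X) n = obj X (n + r)" for n by (simp add: shift_def)
  have fn: "f n \<in> mod_hom A (obj X n) (obj X (n + r))" for n using cm_hom[OF f] by (simp add: S)
  have zero: ?thesis if "\<And>n x. x \<in> carrier (obj X n) \<Longrightarrow> f n x = \<zero>\<^bsub>obj X (n + r)\<^esub>"
    by (rule homotopic_cong(1)[OF X bS cm_hom[OF f]]) (simp add: that S)
  have triv: "f n x = \<zero>\<^bsub>obj X (n + r)\<^esub>" if "x \<in> carrier (obj X n)" "(n \<noteq> d \<and> n \<noteq> d + 1) \<or> (n + r \<noteq> d \<and> n + r \<noteq> d + 1)" for n x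
    by (rule trivial_hom[OF fn bc_right[OF X] bc_right[OF X] _ that(1)]) (use conc that(2) in blast)
  consider "r = 1" | "r = - 1" | "r \<noteq> 1" "r \<noteq> - 1" by blast
  then show ?thesis
  proof cases
    case 3
    show ?thesis by (rule zero, rule triv) (use r 3 in auto)
  next
    case 2
    have f1: "f (d + 1) \<in> mod_hom A (obj X (d + 1)) (obj X d)" using fn[of "d + 1"] 2 by simp
    show ?thesis
    proof (rule zero)
      fix n x assume x: "x \<in> carrier (obj X n)"
      show "f n x = \<zero>\<^bsub>obj X (n + r)\<^esub>"
      proof (cases "n = d + 1")
        case True
        \<comment> \<open>Both composites of this component with the differential vanish, because
          the neighbouring components of f are zero for reasons of degree.\<close>
        have "f (d + 1) x = \<zero>\<^bsub>obj X d\<^esub>"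
        proof (rule H2[OF f1])
          fix y assume y: "y \<in> carrier (obj X (d + 1))"
          have fy: "f (d + 1) y \<in> carrier (obj X d)" by (rule mod_hom_closed[OF f1 y])
          have dy: "dif X (d + 1) y \<in> carrier (obj X (d + 1 + 1))" by (rule bc_closed[OF X y refl])
          have "f (d + 1 + 1) (dif X (d + 1) y) = \<ominus>\<^bsub>obj X (d + 1)\<^esub> dif X d (f (d + 1) y)"
            using cm_dif[OF f y refl] 2 by (simp add: shift_def)
          moreover have "f (d + 1 + 1) (dif X (d + 1) y) = \<zero>\<^bsub>obj X (d + 1)\<^esub>"
            using triv[OF dy] 2 by (simp add: add.commute)
          ultimately have "\<ominus>\<^bsub>obj X (d + 1)\<^esub> dif X d (f (d + 1) y) = \<zero>\<^bsub>obj X (d + 1)\<^esub>" by simp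
          then show "dif X d (f (d + 1) y) = \<zero>\<^bsub>obj X (d + 1)\<^esub>"
            using abelian_group.minus_minus[OF bc_group[OF X] bc_closed[OF X fy refl]] abelian_group_uminus_zero[OF bc_group[OF X]] by metis
        next
          fix y assume y: "y \<in> carrier (obj X d)"
          have "f d y = \<zero>\<^bsub>obj X (d - 1)\<^esub>" using triv[OF y] 2 by simp
          then show "f (d + 1) (dif X d y) = \<zero>\<^bsub>obj X d\<^esub>"
            using cm_dif[OF f y refl] 2 bc_zero[OF X, of d "d - 1"] abelian_group_uminus_zero[OF bc_group[OF X]] by (simp add: shift_def)
        qed (use x True in simp)
        then show ?thesis using True 2 by simp
      next
        case False
        then show ?thesis using triv[OF x] 2 by auto
      qed
    qed
  next
    case 1
    have "f d \<in> mod_hom A (obj X d) (obj X (d + 1))" using fn[of d] 1 by simp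
    then obtain a b where a: "a \<in> mod_hom A (obj X d) (obj X d)" and b: "b \<in> mod_hom A (obj X (d + 1)) (obj X (d + 1))"
      and ab: "\<forall>x\<in>carrier (obj X d). f d x = dif X d (a x) \<oplus>\<^bsub>obj X (d + 1)\<^esub> b (dif X d x)" using H1 by blast
    \<comment> \<open>The sign of -a compensates the negated differential of the shift by
      one.\<close>
    define h where "h n = (if n = d then (\<lambda>x. \<ominus>\<^bsub>obj X d\<^esub> a x) else if n = d + 1 then b else (\<lambda>x. \<zero>\<^bsub>obj X n\<^esub>))" for n
    have h: "h n \<in> mod_hom A (obj X n) (obj X n)" for n
      using a b by (auto simp: h_def intro!: mod_hom_neg_map mod_hom_zero_map bc_right[OF X])
    show ?thesis
    proof (rule homotopicI[OF X bS cm_hom[OF f] cm_hom[OF cm_zero_map[OF X bS]]])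
      show "h n \<in> mod_hom A (obj X n) (obj (shift r X) (n - 1))" for n unfolding S using h[of n] 1 by simp
      fix n x assume x: "x \<in> carrier (obj X n)"
      interpret X1: abelian_group "obj X (n + 1)" by (rule bc_group[OF X])
      have hx: "h n x \<in> carrier (obj X n)" by (rule mod_hom_closed[OF h x])
      have dhx: "dif X n (h n x) \<in> carrier (obj X (n + 1))" by (rule bc_closed[OF X hx refl])
      have hdx: "h (n + 1) (dif X n x) \<in> carrier (obj X (n + 1))" by (rule mod_hom_closed[OF h bc_closed[OF X x refl]])
      have main: "f n x = \<ominus>\<^bsub>obj X (n + 1)\<^esub> dif X n (h n x) \<oplus>\<^bsub>obj X (n + 1)\<^esub> h (n + 1) (dif X n x)"
      proof (cases "n = d")
        case True
        have ax: "a x \<in> carrier (obj X d)" using mod_hom_closed[OF a] x True by simp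
        have "\<ominus>\<^bsub>obj X (d + 1)\<^esub> dif X d (\<ominus>\<^bsub>obj X d\<^esub> a x) = dif X d (a x)"
          using mod_hom_uminus[OF bc_dif[OF X refl] bc_group[OF X] bc_group[OF X] ax]
            abelian_group.minus_minus[OF bc_group[OF X] bc_closed[OF X ax refl]] by simp
        then show ?thesis using ab x True by (simp add: h_def)
      next
        case False
        then consider "carrier (obj X (n + 1)) = {\<zero>\<^bsub>obj X (n + 1)\<^esub>}" | "carrier (obj X n) = {\<zero>\<^bsub>obj X n\<^esub>}"
          using conc[of n] conc[of "n + 1"] by fastforce
        then show ?thesis
        proof cases
          case c: 1
          have "f n x \<in> carrier (obj X (n + 1))" using mod_hom_closed[OF fn x] 1 by simp
          then show ?thesis using c dhx hdx by (simp add: abelian_group_uminus_zero[OF bc_group[OF X]])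
        next
          case 2
          then have "x = \<zero>\<^bsub>obj X n\<^esub>" using x by simp
          moreover have "f n \<zero>\<^bsub>obj X n\<^esub> = \<zero>\<^bsub>obj X (n + 1)\<^esub>" using mod_hom_zero[OF fn bc_group[OF X] bc_group[OF X], of n] 1 by simp
          moreover have "h m \<zero>\<^bsub>obj X m\<^esub> = \<zero>\<^bsub>obj X m\<^esub>" for m by (rule mod_hom_zero[OF h bc_group[OF X] bc_group[OF X]])
          ultimately show ?thesis by (simp add: bc_zero[OF X, of "n + 1" n] abelian_group_uminus_zero[OF bc_group[OF X]])
        qed
      qed
      show "f n x = (dif (shift r X) (n - 1) (h n x) \<oplus>\<^bsub>obj (shift r X) n\<^esub> h (n + 1) (dif X n x)) \<oplus>\<^bsub>obj (shift r X) n\<^esub> \<zero>\<^bsub>obj (shift r X) n\<^esub>"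
      proof -
        have "dif (shift r X) (n - 1) (h n x) = \<ominus>\<^bsub>obj X (n + 1)\<^esub> dif X n (h n x)"
          using 1 by (simp add: shift_def add.commute)
        moreover have "obj (shift r X) n = obj X (n + 1)" unfolding S using 1 by simp
        ultimately show ?thesis using main dhx hdx by simp
      qed
    qed
  qed
qed

text \<open>Extend \<phi> by zero to a chain map X \<rightarrow> X[-1]. Every element of X^(d+1) is
  a cocycle, and the target has no non-zero boundary in this degree, as X^(d-1) = 0; so vanishing on
  cohomology means \<phi> = 0.\<close>

lemma two_degree_Hom_zero:
  assumes X: "bounded_complex A X" and conc: "\<And>n. n \<noteq> d \<Longrightarrow> n \<noteq> d + 1 \<Longrightarrow> carrier (obj X n) = {\<zero>\<^bsub>obj X n\<^esub>}"
    and H: "Db_Hom_zero A X (shift (- 1) X)" and \<phi>: "\<phi> \<in> mod_hom A (obj X (d + 1)) (obj X d)"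
    and \<phi>1: "\<And>y. y \<in> carrier (obj X (d + 1)) \<Longrightarrow> dif X d (\<phi> y) = \<zero>\<^bsub>obj X (d + 1)\<^esub>"
    and \<phi>2: "\<And>x. x \<in> carrier (obj X d) \<Longrightarrow> \<phi> (dif X d x) = \<zero>\<^bsub>obj X d\<^esub>"
    and y: "y \<in> carrier (obj X (d + 1))"
  shows "\<phi> y = \<zero>\<^bsub>obj X d\<^esub>"
proof -
  have bS: "bounded_complex A (shift (- 1) X)" by (rule shift_bounded[OF X])
  define f where "f n = (if n = d + 1 then \<phi> else (\<lambda>x. \<zero>\<^bsub>obj X (n - 1)\<^esub>))" for n
  note u = abelian_group_uminus_zero[OF bc_group[OF X]]
  have f: "f \<in> chain_map A X (shift (- 1) X)"
  proof (rule cmI)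
    show "f n \<in> mod_hom A (obj X n) (obj (shift (- 1) X) n)" for n
      using \<phi> by (auto simp: f_def shift_def intro: mod_hom_zero_map bc_right[OF X])
    fix n x assume x: "x \<in> carrier (obj X n)"
    have "f (n + 1) (dif X n x) = \<zero>\<^bsub>obj X n\<^esub>" using \<phi>2 x by (auto simp: f_def)
    moreover have "dif X (n - 1) (f n x) = \<zero>\<^bsub>obj X n\<^esub>"
      using \<phi>1 x bc_zero[OF X, of n "n - 1"] by (auto simp: f_def)
    ultimately show "f (n + 1) (dif X n x) = dif (shift (- 1) X) n (f n x)" by (simp add: shift_def u)
  qed
  have "dif X (d + 1) y \<in> carrier (obj X (d + 1 + 1))" by (rule bc_closed[OF X y refl])
  then have "dif X (d + 1) y = \<zero>\<^bsub>obj X (d + 1 + 1)\<^esub>" using conc[of "d + 1 + 1"] by auto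
  then have "f (d + 1) y \<in> coboundaries (shift (- 1) X) (d + 1)" by (rule Db_Hom_zero_cohomology[OF H X bS f y])
  then obtain v where v: "v \<in> carrier (obj X (d - 1))" "\<phi> y = \<ominus>\<^bsub>obj X d\<^esub> dif X (d - 1) v"
    by (auto simp: coboundaries_def f_def shift_def)
  have "v = \<zero>\<^bsub>obj X (d - 1)\<^esub>" using v(1) conc[of "d - 1"] by simp
  then show ?thesis using v(2) bc_zero[OF X, of d "d - 1"] by (simp add: u)
qed

lemma homotopic_eq:
  assumes "homotopic A X Y f g" "\<And>n x. x \<in> carrier (obj X n) \<Longrightarrow> f' n x = f n x" "\<And>n x. x \<in> carrier (obj X n) \<Longrightarrow> g' n x = g n x"
  shows "homotopic A X Y f' g'"
  using assms unfolding homotopic_def by metis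

text \<open>Conjugation by e. It carries the vanishing of self-extensions from T to its copy, which
  is the complex that witnesses a tilting module.\<close>

lemma null_homotopic_iso:
  assumes e: "e \<in> cx_iso X X'" and X: "bounded_complex A X" and X': "bounded_complex A X'"
    and null: "\<And>f. f \<in> chain_map A X (shift r X) \<Longrightarrow> homotopic A X (shift r X) f (\<lambda>n x. \<zero>\<^bsub>obj (shift r X) n\<^esub>)"
    and f: "f \<in> chain_map A X' (shift r X')"
  shows "homotopic A X' (shift r X') f (\<lambda>n x. \<zero>\<^bsub>obj (shift r X') n\<^esub>)"
proof -
  let ?i = "\<lambda>n. inv_into (carrier (obj X n)) (e n)"
  have i: "?i \<in> cx_iso X' X" by (rule cx_iso_inv[OF e X])
  have ei: "e n (?i n x) = x" if "x \<in> carrier (obj X' n)" for n x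
    using that cx_iso_bij[OF e, of n] by (auto simp: bij_betw_def f_inv_into_f)
  note ci = cx_iso_cm[OF i] and ce = cx_iso_cm[OF e]
  note cir = cx_iso_cm[OF cx_iso_shift[OF i X' X, of r]] and cer = cx_iso_cm[OF cx_iso_shift[OF e X X', of r]]
  have S: "bounded_complex A (shift r X)" "bounded_complex A (shift r X')" by (intro shift_bounded X X')+
  define g where "g = (\<lambda>n. ?i (n + r) \<circ> (f n \<circ> e n))"
  have g: "g \<in> chain_map A X (shift r X)" unfolding g_def by (rule cm_comp[OF cm_comp[OF ce f] cir])
  let ?z = "\<lambda>n x. \<zero>\<^bsub>obj (shift r X) n\<^esub>"
  have z: "?z \<in> chain_map A X (shift r X)" by (rule cm_zero_map[OF X S(1)])
  have "homotopic A X' (shift r X) (\<lambda>n. g n \<circ> ?i n) (\<lambda>n. ?z n \<circ> ?i n)"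
    by (rule homotopic_pre[OF null[OF g] X S(1) X' cm_hom[OF g] cm_hom[OF z] ci])
  then have "homotopic A X' (shift r X') (\<lambda>n. e (n + r) \<circ> (g n \<circ> ?i n)) (\<lambda>n. e (n + r) \<circ> (?z n \<circ> ?i n))"
    by (rule homotopic_post[OF _ X' S(1,2) cm_hom[OF cm_comp[OF ci g]] cm_hom[OF cm_comp[OF ci z]] cer])
  then show ?thesis
  proof (rule homotopic_eq)
    fix n x assume x: "x \<in> carrier (obj X' n)"
    show "f n x = (e (n + r) \<circ> (g n \<circ> ?i n)) x"
      using ei[OF x] ei[of "f n x" "n + r"] cm_closed[OF f x] by (simp add: g_def shift_def)
    show "\<zero>\<^bsub>obj (shift r X') n\<^esub> = (e (n + r) \<circ> (?z n \<circ> ?i n)) x"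
      using cm_zero[OF ce X X', of "n + r"] by (simp add: shift_def)
  qed
qed

end

section \<open>The complexes \<open>T\<^sup>-\<^sub>k\<close> and \<open>T\<^sup>+\<^sub>k\<close>\<close>

context kalg
begin

text \<open>Brings one summand of the stalk to the front, the position from which
  \<open>gen_summand\<close> can split it off.\<close>

lemma sum_stalk_iso:
  assumes \<theta>: "\<theta> \<in> mod_hom A (mod_sum M1 M2) N" and bij: "bij_betw \<theta> (carrier (mod_sum M1 M2)) (carrier N)"
    and z: "\<theta> (\<zero>\<^bsub>M1\<^esub>, \<zero>\<^bsub>M2\<^esub>) = \<zero>\<^bsub>N\<^esub>"
  shows "(\<lambda>n (p, (l, s)). (l, if n = 0 then \<theta> (p, s) else undefined)) \<in>
    cx_iso (cochain_sum (stalk M1) (cochain_sum L (stalk M2))) (cochain_sum L (stalk N))"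
proof (rule cx_isoI)
  let ?X = "cochain_sum (stalk M1) (cochain_sum L (stalk M2))" and ?Y = "cochain_sum L (stalk N)"
  let ?i = "\<lambda>n :: int. \<lambda>(p, (l, s)). (l, if n = 0 then \<theta> (p, s) else undefined)"
  have inj: "inj_on \<theta> (carrier M1 \<times> carrier M2)" and surj: "\<theta> ` (carrier M1 \<times> carrier M2) = carrier N"
    using bij by (auto simp: bij_betw_def)
  fix n :: int
  show "?i n \<in> mod_hom A (obj ?X n) (obj ?Y n)"
  proof (cases "n = 0")
    case True
    then show ?thesis using mod_hom_closed[OF \<theta>] mod_hom_add[OF \<theta>] mod_hom_ract[OF \<theta>]
      by (intro mod_homI) (auto simp: cochain_sum_def stalk_def)
  next
    case False
    then show ?thesis by (intro mod_homI) (auto simp: cochain_sum_def stalk_def)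
  qed
  show "bij_betw (?i n) (carrier (obj ?X n)) (carrier (obj ?Y n))"
  proof (cases "n = 0")
    case True
    have "\<exists>p s. p \<in> carrier M1 \<and> s \<in> carrier M2 \<and> w = \<theta> (p, s)" if "w \<in> carrier N" for w
      using that unfolding surj[symmetric] by auto
    then show ?thesis using True mod_hom_closed[OF \<theta>] inj
      by (auto simp: cochain_sum_def stalk_def bij_betw_def inj_on_def image_iff) blast+
  next
    case False
    then show ?thesis by (auto simp: cochain_sum_def stalk_def bij_betw_def inj_on_def image_iff)
  qed
  fix x assume "x \<in> carrier (obj ?X n)"
  show "?i (n + 1) (dif ?X n x) = dif ?Y n (?i n x)"
    by (cases x) (auto simp: cochain_sum_def stalk_def z)
qed

text \<open>L is a summand as it stands; a single \<open>M j\<close> becomes one after the index j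
  is removed from the family and the sum is regrouped.\<close>

lemma gen_sum_stalk:
  assumes T: "bounded_complex A T" and e: "e \<in> cx_iso (cochain_sum L (stalk (mod_Sum V M))) T"
    and L: "projective_complex A L" and V: "finite V" and M: "\<And>j. j \<in> V \<Longrightarrow> fg_projective A (M j)"
  shows "gen T L" "\<And>j. j \<in> V \<Longrightarrow> gen T (stalk (M j))"
proof -
  note bL = pc_bc[OF L]
  have S: "bounded_complex A (stalk (mod_Sum V M))" by (rule stalk_bounded[OF fg_projective_fd[OF fg_projective_mod_Sum[OF V M]]])
  show "gen T L" by (rule gen_summand[OF L S T cx_iso_qi[OF e cochain_sum_bounded[OF bL S] T]])
  fix j assume j: "j \<in> V"
  let ?V = "V - {j}"
  have fV: "finite ?V" using V by simp
  have pV: "fg_projective A (M i)" if "i \<in> ?V" for i using M that by simp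
  have ins: "insert j ?V = V" using j by blast
  have j': "j \<notin> ?V" by simp
  note \<theta> = mod_Sum_insert(1)[where M = M and A = A, OF j', unfolded ins] mod_Sum_insert(2)[where M = M, OF j', unfolded ins]
  have pR: "fg_projective A (mod_Sum ?V M)" by (rule fg_projective_mod_Sum[OF fV pV])
  note gr = right_module_group[OF fd_right[OF fg_projective_fd]]
  have z: "(\<lambda>(x, p). p(j := x)) (\<zero>\<^bsub>M j\<^esub>, \<zero>\<^bsub>mod_Sum ?V M\<^esub>) = \<zero>\<^bsub>mod_Sum V M\<^esub>"
    using mod_hom_zero[OF \<theta>(1) gr[OF fg_projective_mod_sum[OF M[OF j] pR]] gr[OF fg_projective_mod_Sum[OF V M]]] by simp
  let ?Y = "cochain_sum L (stalk (mod_Sum ?V M))"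
  have bY: "bounded_complex A ?Y" by (rule cochain_sum_bounded[OF bL stalk_bounded[OF fg_projective_fd[OF pR]]])
  note pj = stalk_projective[OF M[OF j]]
  show "gen T (stalk (M j))"
    by (rule gen_summand[OF pj bY T cx_iso_qi[OF cx_iso_comp[OF sum_stalk_iso[OF \<theta>(1,2) z] e] cochain_sum_bounded[OF pc_bc[OF pj] bY] T]])
qed

end

locale mutation = bound_quiver Q I for Q :: "('v, 'e) pre_digraph" and I :: "(('v, 'e) path \<Rightarrow> 'k::field) set" +
  fixes k :: 'v
  assumes kv: "k \<in> verts Q" and noloop: "\<forall>e\<in>arcs Q. \<not> (tail Q e = k \<and> head Q e = k)"
begin

abbreviation "In \<equiv> in_arrows Q k"
abbreviation "Out \<equiv> out_arrows Q k"
abbreviation "NI \<equiv> mod_Sum In (\<lambda>e. P (tail Q e))"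
abbreviation "NO \<equiv> mod_Sum Out (\<lambda>e. P (head Q e))"
abbreviation "S \<equiv> mod_Sum (verts Q - {k}) P"
abbreviation "f \<equiv> (\<lambda>x. \<lambda>e\<in>In. left_mult_arrow Q I e x)"
abbreviation "g \<equiv> (\<lambda>y. \<Oplus>\<^bsub>P k\<^esub>e\<in>Out. left_mult_arrow Q I e (y e))"
abbreviation "Tm \<equiv> T_minus Q I k"
abbreviation "Tp \<equiv> T_plus Q I k"

lemma In_facts: "e \<in> In \<Longrightarrow> e \<in> arcs Q" "e \<in> In \<Longrightarrow> head Q e = k" "e \<in> In \<Longrightarrow> tail Q e \<in> verts Q" "e \<in> In \<Longrightarrow> tail Q e \<noteq> k"
  using noloop wf_digraph.tail_in_verts[OF wf] by (auto simp: in_arrows_def)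

lemma Out_facts: "e \<in> Out \<Longrightarrow> e \<in> arcs Q" "e \<in> Out \<Longrightarrow> tail Q e = k" "e \<in> Out \<Longrightarrow> head Q e \<in> verts Q" "e \<in> Out \<Longrightarrow> head Q e \<noteq> k"
  using noloop wf_digraph.head_in_verts[OF wf] by (auto simp: out_arrows_def)

lemma fin_sets: "finite In" "finite Out" "finite (verts Q - {k})"
  using fin_digraph.finite_arcs[OF fin] fin_digraph.finite_verts[OF fin] by (auto simp: in_arrows_def out_arrows_def)

lemma projs: "fg_projective A (P k)" "fg_projective A NI" "fg_projective A NO" "fg_projective A S"
  by (auto intro!: P_projective kv fg_projective_mod_Sum fin_sets In_facts Out_facts)

lemmas rights = projs[THEN fg_projective_fd, THEN fd_right]

lemma arr_mult_P: "e \<in> arcs Q \<Longrightarrow> x \<in> carrier A \<Longrightarrow> arr e \<otimes>\<^bsub>A\<^esub> x \<in> carrier (P (tail Q e))"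
  using wf_digraph.tail_in_verts[OF wf, of e] by (simp add: P_carrier m_assoc[symmetric] arr_left)

lemma f_hom: "f \<in> mod_hom A (P k) NI"
  by (rule mod_homI)
    (auto simp: left_mult_arrow_arr In_facts arr_mult_P P_incl[OF kv] r_distr m_assoc intro!: restrict_ext)

lemma arr_hom: "e \<in> Out \<Longrightarrow> left_mult_arrow Q I e \<in> mod_hom A (P (head Q e)) (P k)"
  using P_hom[OF Out_facts(3) P_right[OF kv], of e "arr e"] arr_mult_P[of e "\<one>\<^bsub>A\<^esub>"] Out_facts[of e]
  by (simp add: left_mult_arrow_arr[abs_def])

lemma g_hom: "g \<in> mod_hom A NO (P k)"
  by (rule mod_Sum_hom[OF rights(1) arr_hom])

lemma g_incl: "e \<in> Out \<Longrightarrow> z \<in> carrier (P (head Q e)) \<Longrightarrow> g (incl Out (\<lambda>e. P (head Q e)) e z) = arr e \<otimes>\<^bsub>A\<^esub> z"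
  using mod_Sum_hom_incl[where \<phi> = "left_mult_arrow Q I" and M = "\<lambda>e. P (head Q e)", OF rights(1) P_right[OF Out_facts(3)] arr_hom fin_sets(2)]
  by (simp add: left_mult_arrow_arr)

lemma Tm_obj: "obj Tm n = mod_sum (mod_sum (if n = - 1 then P k else zero_mod) (if n = 0 then NI else zero_mod)) (if n = 0 then S else zero_mod)"
  by (simp add: T_minus_def L_complex_def cochain_sum_def two_term_def two_term_obj_def stalk_def)

lemma Tm_dif: "dif Tm (- 1) z = ((undefined, f (fst (fst z))), \<zero>\<^bsub>S\<^esub>)"
  by (simp add: T_minus_def L_complex_def cochain_sum_def two_term_def stalk_def case_prod_beta')

lemma Tp_obj: "obj Tp n = mod_sum (mod_sum (if n = 0 then NO else zero_mod) (if n = 1 then P k else zero_mod)) (if n = 0 then S else zero_mod)"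
  by (simp add: T_plus_def R_complex_def cochain_sum_def two_term_def two_term_obj_def stalk_def)

lemma Tp_dif: "dif Tp 0 z = ((undefined, g (fst (fst z))), undefined)"
  by (simp add: T_plus_def R_complex_def cochain_sum_def two_term_def stalk_def case_prod_beta')

lemma L_projective: "projective_complex A (L_complex Q I k)"
  unfolding L_complex_def by (rule two_term_projective[OF projs(1,2) f_hom])

lemma R_projective: "projective_complex A (R_complex Q I k)"
  unfolding R_complex_def by (rule two_term_projective[OF projs(3,1) g_hom])

lemma Tm_projective: "projective_complex A Tm"
  unfolding T_minus_def by (rule cochain_sum_projective[OF L_projective stalk_projective[OF projs(4)]])

lemma Tp_projective: "projective_complex A Tp"
  unfolding T_plus_def by (rule cochain_sum_projective[OF R_projective stalk_projective[OF projs(4)]])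

lemmas Tm_bounded = pc_bc[OF Tm_projective]
lemmas Tp_bounded = pc_bc[OF Tp_projective]

lemma P_off_k: "i \<in> verts Q - {k} \<Longrightarrow> fg_projective A (P i)"
  by (auto intro: P_projective)

text \<open>Stated for every complex isomorphic to T^-_k, since part (b) applies it to the copy. As
  k has no loops, the target of f involves only P_i with i \<noteq> k, which are summands of
  T.\<close>

lemma Tm_generates:
  assumes e: "e \<in> cx_iso Tm T" and T: "bounded_complex A T" shows "generates_per A T"
proof (rule generates_per_bound_quiver[OF T])
  note gg = gen_sum_stalk[OF T e[unfolded T_minus_def] L_projective fin_sets(3) P_off_k]
  have N: "gen T (stalk NI)" by (rule gen_stalk_mod_Sum[OF fin_sets(1) T P_projective[OF In_facts(3)] gg(2)]) (auto simp: In_facts)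
  have "gen T (stalk (P k))"
    by (rule gen_two_term_source[OF gg(1)[unfolded L_complex_def] N projs(1,2) f_hom])
  then show "gen T (stalk (P i))" if "i \<in> verts Q" for i using gg(2)[of i] that by (cases "i = k") auto
qed

text \<open>Now the source of g involves only P_i with i \<noteq> k, so P_k is recovered as the
  target of a two-term complex.\<close>

lemma Tp_generates:
  assumes e: "e \<in> cx_iso Tp T" and T: "bounded_complex A T" shows "generates_per A T"
proof (rule generates_per_bound_quiver[OF T])
  note gg = gen_sum_stalk[OF T e[unfolded T_plus_def] R_projective fin_sets(3) P_off_k]
  have N: "gen T (stalk NO)" by (rule gen_stalk_mod_Sum[OF fin_sets(2) T P_projective[OF Out_facts(3)] gg(2)]) (auto simp: Out_facts)
  have "gen T (stalk (P k))"
    by (rule gen_two_term_target[OF gg(1)[unfolded R_complex_def] N projs(3,1) g_hom])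
  then show "gen T (stalk (P i))" if "i \<in> verts Q" for i using gg(2)[of i] that by (cases "i = k") auto
qed

text \<open>\<open>M\<close> is generated by the \<open>M e\<^sub>i\<close> with \<open>i \<noteq> k\<close>.\<close>

definition ogen :: "(('v, 'e, 'k) qelt, 'b) right_mod \<Rightarrow> bool" where
  "ogen M \<longleftrightarrow> (\<forall>U. U \<subseteq> carrier M \<longrightarrow> \<zero>\<^bsub>M\<^esub> \<in> U \<longrightarrow> (\<forall>x\<in>U. \<forall>y\<in>U. x \<oplus>\<^bsub>M\<^esub> y \<in> U) \<longrightarrow>
     (\<forall>y\<in>carrier M. \<forall>i\<in>verts Q - {k}. \<forall>a\<in>carrier A. (y \<bullet>\<^bsub>M\<^esub> vtx i) \<bullet>\<^bsub>M\<^esub> a \<in> U) \<longrightarrow> carrier M \<subseteq> U)"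

lemma ogenI:
  assumes "\<And>U z. U \<subseteq> carrier M \<Longrightarrow> \<zero>\<^bsub>M\<^esub> \<in> U \<Longrightarrow> (\<And>x y. x \<in> U \<Longrightarrow> y \<in> U \<Longrightarrow> x \<oplus>\<^bsub>M\<^esub> y \<in> U) \<Longrightarrow>
     (\<And>y i a. y \<in> carrier M \<Longrightarrow> i \<in> verts Q - {k} \<Longrightarrow> a \<in> carrier A \<Longrightarrow> (y \<bullet>\<^bsub>M\<^esub> vtx i) \<bullet>\<^bsub>M\<^esub> a \<in> U) \<Longrightarrow> z \<in> carrier M \<Longrightarrow> z \<in> U"
  shows "ogen M"
  unfolding ogen_def
proof (intro allI impI subsetI)
  fix U z assume U: "U \<subseteq> carrier M" "\<zero>\<^bsub>M\<^esub> \<in> U" "\<forall>x\<in>U. \<forall>y\<in>U. x \<oplus>\<^bsub>M\<^esub> y \<in> U"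
    "\<forall>y\<in>carrier M. \<forall>i\<in>verts Q - {k}. \<forall>a\<in>carrier A. (y \<bullet>\<^bsub>M\<^esub> vtx i) \<bullet>\<^bsub>M\<^esub> a \<in> U" "z \<in> carrier M"
  show "z \<in> U" by (rule assms[OF U(1,2) _ _ U(5)]) (rule U(3,4)[rule_format], assumption+)+
qed

lemma ogenD:
  assumes "ogen M" "U \<subseteq> carrier M" "\<zero>\<^bsub>M\<^esub> \<in> U" "\<And>x y. x \<in> U \<Longrightarrow> y \<in> U \<Longrightarrow> x \<oplus>\<^bsub>M\<^esub> y \<in> U"
    and "\<And>y i a. y \<in> carrier M \<Longrightarrow> i \<in> verts Q \<Longrightarrow> i \<noteq> k \<Longrightarrow> a \<in> carrier A \<Longrightarrow> (y \<bullet>\<^bsub>M\<^esub> vtx i) \<bullet>\<^bsub>M\<^esub> a \<in> U"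
    and "z \<in> carrier M"
  shows "z \<in> U"
proof -
  have "\<forall>x\<in>U. \<forall>y\<in>U. x \<oplus>\<^bsub>M\<^esub> y \<in> U" "\<forall>y\<in>carrier M. \<forall>i\<in>verts Q - {k}. \<forall>a\<in>carrier A. (y \<bullet>\<^bsub>M\<^esub> vtx i) \<bullet>\<^bsub>M\<^esub> a \<in> U"
    using assms(4,5) by simp_all
  from assms(1)[unfolded ogen_def, rule_format, OF assms(2,3) this[rule_format]] show ?thesis using assms(6) by auto
qed

lemma ogen_zero_mod: "ogen zero_mod"
  by (rule ogenI) simp

lemma ogen_mod_sum:
  assumes M: "right_module A M" "ogen M" and N: "right_module A N" "ogen N"
  shows "ogen (mod_sum M N)"
proof (rule ogenI)
  interpret M: right_module A M by fact
  interpret N: right_module A N by fact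
  note M0 = abelian_groupE(2)[OF right_module_group[OF M(1)]] and N0 = abelian_groupE(2)[OF right_module_group[OF N(1)]]
  note Ml = abelian_groupE(5)[OF right_module_group[OF M(1)]] and Nl = abelian_groupE(5)[OF right_module_group[OF N(1)]]
  note Nr = abelian_monoid.r_zero[OF abelian_group.axioms(1)[OF right_module_group[OF M(1)]]]
  fix U z assume U: "\<zero>\<^bsub>mod_sum M N\<^esub> \<in> U" "\<And>x y. x \<in> U \<Longrightarrow> y \<in> U \<Longrightarrow> x \<oplus>\<^bsub>mod_sum M N\<^esub> y \<in> U"
    "\<And>y i a. y \<in> carrier (mod_sum M N) \<Longrightarrow> i \<in> verts Q - {k} \<Longrightarrow> a \<in> carrier A \<Longrightarrow> (y \<bullet>\<^bsub>mod_sum M N\<^esub> vtx i) \<bullet>\<^bsub>mod_sum M N\<^esub> a \<in> U"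
    and z: "z \<in> carrier (mod_sum M N)"
  have "fst z \<in> {x \<in> carrier M. (x, \<zero>\<^bsub>N\<^esub>) \<in> U}"
  proof (rule ogenD[OF M(2)])
    fix x y assume "x \<in> {x \<in> carrier M. (x, \<zero>\<^bsub>N\<^esub>) \<in> U}" "y \<in> {x \<in> carrier M. (x, \<zero>\<^bsub>N\<^esub>) \<in> U}"
    then show "x \<oplus>\<^bsub>M\<^esub> y \<in> {x \<in> carrier M. (x, \<zero>\<^bsub>N\<^esub>) \<in> U}" using U(2)[of "(x, \<zero>\<^bsub>N\<^esub>)" "(y, \<zero>\<^bsub>N\<^esub>)"] N0 by (simp add: Nl)
  next
    fix y i a assume "y \<in> carrier M" "i \<in> verts Q" "i \<noteq> k" "a \<in> carrier A"
    then show "(y \<bullet>\<^bsub>M\<^esub> vtx i) \<bullet>\<^bsub>M\<^esub> a \<in> {x \<in> carrier M. (x, \<zero>\<^bsub>N\<^esub>) \<in> U}"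
      using U(3)[of "(y, \<zero>\<^bsub>N\<^esub>)" i a] N0 by (simp add: M.ract_closed)
  qed (use U(1) M0 z in auto)
  moreover have "snd z \<in> {y \<in> carrier N. (\<zero>\<^bsub>M\<^esub>, y) \<in> U}"
  proof (rule ogenD[OF N(2)])
    fix x y assume "x \<in> {y \<in> carrier N. (\<zero>\<^bsub>M\<^esub>, y) \<in> U}" "y \<in> {y \<in> carrier N. (\<zero>\<^bsub>M\<^esub>, y) \<in> U}"
    then show "x \<oplus>\<^bsub>N\<^esub> y \<in> {y \<in> carrier N. (\<zero>\<^bsub>M\<^esub>, y) \<in> U}" using U(2)[of "(\<zero>\<^bsub>M\<^esub>, x)" "(\<zero>\<^bsub>M\<^esub>, y)"] M0 by (simp add: Ml)
  next
    fix y i a assume "y \<in> carrier N" "i \<in> verts Q" "i \<noteq> k" "a \<in> carrier A"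
    then show "(y \<bullet>\<^bsub>N\<^esub> vtx i) \<bullet>\<^bsub>N\<^esub> a \<in> {y \<in> carrier N. (\<zero>\<^bsub>M\<^esub>, y) \<in> U}"
      using U(3)[of "(\<zero>\<^bsub>M\<^esub>, y)" i a] M0 by (simp add: N.ract_closed)
  qed (use U(1) N0 z in auto)
  ultimately show "z \<in> U" using U(2)[of "(fst z, \<zero>\<^bsub>N\<^esub>)" "(\<zero>\<^bsub>M\<^esub>, snd z)"] by (simp add: Nl Nr)
qed

text \<open>Each summand is generated by its own idempotent, at a vertex different from k.\<close>

lemma ogen_mod_Sum:
  assumes J: "finite J" "\<sigma> ` J \<subseteq> verts Q - {k}" shows "ogen (mod_Sum J (\<lambda>j. P (\<sigma> j)))"
proof (rule ogenI)
  let ?M = "\<lambda>j. P (\<sigma> j)"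
  have v: "j \<in> J \<Longrightarrow> \<sigma> j \<in> verts Q" "j \<in> J \<Longrightarrow> \<sigma> j \<noteq> k" for j using J by auto
  have r: "right_module A (?M j)" if "j \<in> J" for j by (rule P_right[OF v(1)[OF that]])
  fix U z assume U: "\<zero>\<^bsub>mod_Sum J ?M\<^esub> \<in> U" "\<And>x y. x \<in> U \<Longrightarrow> y \<in> U \<Longrightarrow> x \<oplus>\<^bsub>mod_Sum J ?M\<^esub> y \<in> U"
    "\<And>y i a. y \<in> carrier (mod_Sum J ?M) \<Longrightarrow> i \<in> verts Q - {k} \<Longrightarrow> a \<in> carrier A \<Longrightarrow> (y \<bullet>\<^bsub>mod_Sum J ?M\<^esub> vtx i) \<bullet>\<^bsub>mod_Sum J ?M\<^esub> a \<in> U"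
    and z: "z \<in> carrier (mod_Sum J ?M)"
  show "z \<in> U"
  proof (rule mod_Sum_induct_elem[OF J(1) r z U(1,2)])
    fix j assume j: "j \<in> J"
    have zj: "z j \<in> carrier (?M j)" using z j by auto
    note h = incl_hom[where M = ?M and J = J and j = j, OF r j, simplified]
    have vj: "vtx (\<sigma> j) \<in> carrier (?M j)" by (rule vtx_P[OF v(1)[OF j]])
    have zA: "z j \<in> carrier A" by (rule P_incl[OF v(1)[OF j] zj])
    have "(incl J ?M j (vtx (\<sigma> j)) \<bullet>\<^bsub>mod_Sum J ?M\<^esub> vtx (\<sigma> j)) \<bullet>\<^bsub>mod_Sum J ?M\<^esub> z j \<in> U"
      by (rule U(3)[OF mod_hom_closed[OF h vj] _ zA]) (use v j in auto)
    moreover have "(incl J ?M j (vtx (\<sigma> j)) \<bullet>\<^bsub>mod_Sum J ?M\<^esub> vtx (\<sigma> j)) \<bullet>\<^bsub>mod_Sum J ?M\<^esub> z j = incl J ?M j (z j)"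
    proof -
      have vA: "vtx (\<sigma> j) \<in> carrier A" using v j by simp
      have "incl J ?M j (vtx (\<sigma> j)) \<bullet>\<^bsub>mod_Sum J ?M\<^esub> vtx (\<sigma> j) = incl J ?M j (vtx (\<sigma> j))"
        using mod_hom_ract[OF h vj vA] by (simp only: P_simps vtx_idem[OF v(1)[OF j]])
      moreover have "incl J ?M j (vtx (\<sigma> j)) \<bullet>\<^bsub>mod_Sum J ?M\<^esub> z j = incl J ?M j (z j)"
        using mod_hom_ract[OF h vj zA] zj by (simp only: P_simps P_carrier[OF v(1)[OF j]] mem_Collect_eq)
      ultimately show ?thesis by simp
    qed
    ultimately show "incl J ?M j (z j) \<in> U" by simp
  qed
qed

lemma ogen_sums: "ogen NI" "ogen NO" "ogen S"
proof -
  have "tail Q ` In \<subseteq> verts Q - {k}" "head Q ` Out \<subseteq> verts Q - {k}" using In_facts Out_facts by blast+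
  then show "ogen NI" "ogen NO" "ogen S"
    using ogen_mod_Sum[OF fin_sets(1)] ogen_mod_Sum[OF fin_sets(2)] ogen_mod_Sum[OF fin_sets(3), of "\<lambda>i. i"] by auto
qed

lemma ogen_Tm: "ogen (obj Tm 0)"
  unfolding Tm_obj by (simp add: ogen_mod_sum ogen_zero_mod ogen_sums right_module_mod_sum right_module_zero_mod ring_axioms rights)

lemma ogen_Tp: "ogen (obj Tp 0)"
  unfolding Tp_obj by (simp add: ogen_mod_sum ogen_zero_mod ogen_sums right_module_mod_sum right_module_zero_mod ring_axioms rights)

text \<open>Write y = y e_k as a sum of terms z e_i a e_k with i \<noteq> k. Each e_i a e_k is a
  combination of paths ending in an arrow into k, so y lies in the sum of the M b over the arrows b
  ending at k.\<close>

lemma ogen_factor: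
  assumes M: "right_module A M" "ogen M" and y: "y \<in> carrier M" "y \<bullet>\<^bsub>M\<^esub> vtx k = y"
    and U: "\<zero>\<^bsub>M\<^esub> \<in> U" "\<And>x y. x \<in> U \<Longrightarrow> y \<in> U \<Longrightarrow> x \<oplus>\<^bsub>M\<^esub> y \<in> U"
    and arr: "\<And>z a. z \<in> carrier M \<Longrightarrow> a \<in> In \<Longrightarrow> z \<bullet>\<^bsub>M\<^esub> arr a \<in> U"
  shows "y \<in> U"
proof -
  interpret M: right_module A M by fact
  have "y \<in> {z \<in> carrier M. z \<bullet>\<^bsub>M\<^esub> vtx k \<in> U}"
  proof (rule ogenD[OF M(2)])
    show "\<zero>\<^bsub>M\<^esub> \<in> {z \<in> carrier M. z \<bullet>\<^bsub>M\<^esub> vtx k \<in> U}" using U(1) abelian_groupE(2)[OF right_module_group[OF M(1)]] by (simp add: kv)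
    fix x z assume "x \<in> {z \<in> carrier M. z \<bullet>\<^bsub>M\<^esub> vtx k \<in> U}" "z \<in> {z \<in> carrier M. z \<bullet>\<^bsub>M\<^esub> vtx k \<in> U}"
    then show "x \<oplus>\<^bsub>M\<^esub> z \<in> {z \<in> carrier M. z \<bullet>\<^bsub>M\<^esub> vtx k \<in> U}"
      using U(2) abelian_groupE(1)[OF right_module_group[OF M(1)]] by (simp add: M.ract_add_left kv)
  next
    fix z i a assume z: "z \<in> carrier M" and i: "i \<in> verts Q" "i \<noteq> k" and a: "a \<in> carrier A"
    let ?w = "vtx i \<otimes>\<^bsub>A\<^esub> a \<otimes>\<^bsub>A\<^esub> vtx k"
    have w: "?w \<in> {w \<in> carrier A. z \<bullet>\<^bsub>M\<^esub> w \<in> U}"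
    proof (rule in_arrows_induct[OF i(1) kv i(2)])
      show "?w \<in> carrier A" "vtx i \<otimes>\<^bsub>A\<^esub> ?w = ?w" "?w \<otimes>\<^bsub>A\<^esub> vtx k = ?w"
        using i a kv vtx_idem by (simp_all add: m_assoc) (simp_all add: m_assoc[symmetric] vtx_idem)
      show "\<zero>\<^bsub>A\<^esub> \<in> {w \<in> carrier A. z \<bullet>\<^bsub>M\<^esub> w \<in> U}" using U(1) z by simp
      show "x \<oplus>\<^bsub>A\<^esub> y \<in> {w \<in> carrier A. z \<bullet>\<^bsub>M\<^esub> w \<in> U}" if "x \<in> {w \<in> carrier A. z \<bullet>\<^bsub>M\<^esub> w \<in> U}" "y \<in> {w \<in> carrier A. z \<bullet>\<^bsub>M\<^esub> w \<in> U}" for x y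
        using that U(2) z by (simp add: M.ract_add_right)
      fix y b assume "y \<in> carrier (P i)" and b: "b \<in> In"
      then have y: "y \<in> carrier A" using P_incl[OF i(1)] by blast
      have bA: "arr b \<in> carrier A" using In_facts(1)[OF b] by simp
      show "y \<otimes>\<^bsub>A\<^esub> arr b \<in> {w \<in> carrier A. z \<bullet>\<^bsub>M\<^esub> w \<in> U}"
        using arr[OF M.ract_closed[OF z y] b] y bA z by (simp add: M.ract_mult)
    qed
    have "((z \<bullet>\<^bsub>M\<^esub> vtx i) \<bullet>\<^bsub>M\<^esub> a) \<bullet>\<^bsub>M\<^esub> vtx k = z \<bullet>\<^bsub>M\<^esub> ?w"
      using z i a kv by (simp add: M.ract_mult[symmetric] m_assoc)
    then show "(z \<bullet>\<^bsub>M\<^esub> vtx i) \<bullet>\<^bsub>M\<^esub> a \<in> {z \<in> carrier M. z \<bullet>\<^bsub>M\<^esub> vtx k \<in> U}"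
      using w z i a by (simp add: M.ract_closed)
  qed (use y in auto)
  then show ?thesis using y by simp
qed

subsection \<open>The complex \<open>T\<^sup>-\<^sub>k\<close>\<close>

text \<open>By Yoneda this says Hom(P_i, Ker f) = 0.\<close>

definition condm :: "'v \<Rightarrow> bool" where
  "condm i \<longleftrightarrow> (\<forall>x\<in>carrier (P k). x \<otimes>\<^bsub>A\<^esub> vtx i = x \<longrightarrow> f x = \<zero>\<^bsub>NI\<^esub> \<longrightarrow> x = \<zero>\<^bsub>A\<^esub>)"

lemma f_zero_iff: "f x = \<zero>\<^bsub>NI\<^esub> \<longleftrightarrow> (\<forall>e\<in>In. arr e \<otimes>\<^bsub>A\<^esub> x = \<zero>\<^bsub>A\<^esub>)"
  by (auto simp: left_mult_arrow_arr fun_eq_iff restrict_def)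

lemma Tm_obj_m1: "obj Tm (- 1) = mod_sum (mod_sum (P k) zero_mod) zero_mod"
  by (simp add: Tm_obj)

lemma Tm_obj_0: "obj Tm 0 = mod_sum (mod_sum zero_mod NI) S"
  by (simp add: Tm_obj)

lemma Tm_conc: "n \<noteq> - 1 \<Longrightarrow> n \<noteq> 0 \<Longrightarrow> carrier (obj Tm n) = {\<zero>\<^bsub>obj Tm n\<^esub>}"
  by (simp add: Tm_obj)

lemma Tm_inject: "(\<lambda>x. ((x, undefined), undefined)) \<in> mod_hom A (P k) (obj Tm (- 1))"
  unfolding Tm_obj_m1 by (intro mod_hom_pair mod_hom_id(2) mod_hom_zero_mod)

text \<open>A map P_k \<rightarrow> T^0 is multiplication by some y = y e_k, and by
  \<open>ogen_factor\<close> y is a sum of terms z a with arrows a ending at k. For such a term, (z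
  a) x = z (a x) depends only on the component of f x at a.\<close>

lemma Tm_extend:
  assumes y: "y \<in> carrier (obj Tm 0)" "y \<bullet>\<^bsub>obj Tm 0\<^esub> vtx k = y"
  shows "\<exists>b\<in>mod_hom A (obj Tm 0) (obj Tm 0). \<forall>x\<in>carrier (P k). b ((undefined, f x), \<zero>\<^bsub>S\<^esub>) = y \<bullet>\<^bsub>obj Tm 0\<^esub> x"
proof -
  let ?Y = "obj Tm 0"
  note rY = bc_right[OF Tm_bounded, of 0]
  interpret Y: right_module A ?Y by (rule rY)
  note gY = right_module_group[OF rY]
  let ?E = "\<lambda>y. \<exists>b\<in>mod_hom A ?Y ?Y. \<forall>x\<in>carrier (P k). b ((undefined, f x), \<zero>\<^bsub>S\<^esub>) = y \<bullet>\<^bsub>?Y\<^esub> x"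
  have "y \<in> {y \<in> carrier ?Y. ?E y}"
  proof (rule ogen_factor[OF rY ogen_Tm y])
    have "?E \<zero>\<^bsub>?Y\<^esub>" using P_incl[OF kv] by (intro bexI[OF _ mod_hom_zero_map[OF rY]]) simp
    then show "\<zero>\<^bsub>?Y\<^esub> \<in> {y \<in> carrier ?Y. ?E y}" using abelian_groupE(2)[OF gY] by blast
    fix u v assume "u \<in> {y \<in> carrier ?Y. ?E y}" "v \<in> {y \<in> carrier ?Y. ?E y}"
    then obtain b c where u: "u \<in> carrier ?Y" "b \<in> mod_hom A ?Y ?Y" "\<forall>x\<in>carrier (P k). b ((undefined, f x), \<zero>\<^bsub>S\<^esub>) = u \<bullet>\<^bsub>?Y\<^esub> x"
      and v: "v \<in> carrier ?Y" "c \<in> mod_hom A ?Y ?Y" "\<forall>x\<in>carrier (P k). c ((undefined, f x), \<zero>\<^bsub>S\<^esub>) = v \<bullet>\<^bsub>?Y\<^esub> x" by blast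
    have "?E (u \<oplus>\<^bsub>?Y\<^esub> v)"
      by (rule bexI[OF _ mod_hom_add_map[OF u(2) v(2) rY]]) (use u(3) v(3) in \<open>simp add: Y.ract_add_left[OF u(1) v(1) P_incl[OF kv]]\<close>)
    then show "u \<oplus>\<^bsub>?Y\<^esub> v \<in> {y \<in> carrier ?Y. ?E y}" using abelian_groupE(1)[OF gY u(1) v(1)] by blast
  next
    fix z a assume z: "z \<in> carrier ?Y" and a: "a \<in> In"
    \<comment> \<open>Project onto the summand of \<open>NI\<close> belonging to the arrow a, then
      multiply by z.\<close>
    let ?b = "(\<lambda>p. z \<bullet>\<^bsub>?Y\<^esub> p) \<circ> ((\<lambda>n. n a) \<circ> (snd \<circ> fst))"
    note r1 = right_module_mod_sum[OF right_module_zero_mod[OF ring_axioms] rights(2)]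
    have b: "?b \<in> mod_hom A ?Y ?Y"
    proof -
      have s1: "fst \<in> mod_hom A ?Y (mod_sum zero_mod NI)" unfolding Tm_obj_0 by (rule mod_sum_maps(3)[OF r1 rights(4)])
      have s2: "snd \<in> mod_hom A (mod_sum zero_mod NI) NI" by (rule mod_sum_maps(4)[OF right_module_zero_mod[OF ring_axioms] rights(2)])
      have s3: "(\<lambda>n. n a) \<in> mod_hom A NI (P (tail Q a))" by (rule mod_Sum_proj[OF a])
      show ?thesis by (rule mod_hom_comp[OF mod_hom_comp[OF mod_hom_comp[OF s1 s2] s3] P_hom[OF In_facts(3)[OF a] rY z]])
    qed
    have aA: "arr a \<in> carrier A" using In_facts(1)[OF a] by simp
    have "?E (z \<bullet>\<^bsub>?Y\<^esub> arr a)"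
      by (rule bexI[OF _ b]) (simp add: a left_mult_arrow_arr Y.ract_mult[OF z aA P_incl[OF kv]])
    then show "z \<bullet>\<^bsub>?Y\<^esub> arr a \<in> {y \<in> carrier ?Y. ?E y}" using Y.ract_closed[OF z aA] by blast
  qed
  then show ?thesis by blast
qed

lemma Tm_null:
  assumes c: "\<And>i. i \<in> verts Q \<Longrightarrow> i \<noteq> k \<Longrightarrow> condm i" and r: "r \<noteq> 0" and h: "h \<in> chain_map A Tm (shift r Tm)"
  shows "homotopic A Tm (shift r Tm) h (\<lambda>n x. \<zero>\<^bsub>obj (shift r Tm) n\<^esub>)"
proof (rule two_degree_null_homotopic[where d = "- 1", OF Tm_bounded _ _ _ r h])
  have m1: "- 1 + 1 = (0::int)" by simp
  note r0 = bc_right[OF Tm_bounded, of 0] and rm = bc_right[OF Tm_bounded, of "- 1"]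
  show "carrier (obj Tm n) = {\<zero>\<^bsub>obj Tm n\<^esub>}" if "n \<noteq> - 1" "n \<noteq> - 1 + 1" for n using Tm_conc that by simp
  fix \<phi> assume "\<phi> \<in> mod_hom A (obj Tm (- 1)) (obj Tm (- 1 + 1))"
  then have \<phi>: "\<phi> \<in> mod_hom A (obj Tm (- 1)) (obj Tm 0)" unfolding m1 .
  let ?p = "\<phi> \<circ> (\<lambda>x. ((x, undefined), undefined))"
  have p: "?p \<in> mod_hom A (P k) (obj Tm 0)" by (rule mod_hom_comp[OF Tm_inject \<phi>])
  define y where "y = ?p (vtx k)"
  have y: "y \<in> carrier (obj Tm 0)" unfolding y_def by (rule mod_hom_closed[OF p vtx_P[OF kv]])
  have "y \<bullet>\<^bsub>obj Tm 0\<^esub> vtx k = y" using P_hom_eq[OF kv p vtx_P[OF kv]] unfolding y_def by simp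
  \<comment> \<open>Extending along f settles degree 1 completely, so the endomorphism of the term
    in degree -1 is taken to be zero.\<close>
  then obtain b where b: "b \<in> mod_hom A (obj Tm 0) (obj Tm 0)" "\<forall>x\<in>carrier (P k). b ((undefined, f x), \<zero>\<^bsub>S\<^esub>) = y \<bullet>\<^bsub>obj Tm 0\<^esub> x"
    using Tm_extend[OF y] by blast
  show "\<exists>a\<in>mod_hom A (obj Tm (- 1)) (obj Tm (- 1)). \<exists>b\<in>mod_hom A (obj Tm (- 1 + 1)) (obj Tm (- 1 + 1)).
      \<forall>x\<in>carrier (obj Tm (- 1)). \<phi> x = dif Tm (- 1) (a x) \<oplus>\<^bsub>obj Tm (- 1 + 1)\<^esub> b (dif Tm (- 1) x)"
    unfolding m1
  proof (rule bexI[OF _ mod_hom_zero_map[OF rm]], rule bexI[OF _ b(1)], rule ballI)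
    fix x assume "x \<in> carrier (obj Tm (- 1))"
    then obtain u where u: "u \<in> carrier (P k)" "x = ((u, undefined), undefined)" by (auto simp: Tm_obj_m1)
    have "\<phi> x = y \<bullet>\<^bsub>obj Tm 0\<^esub> u" using P_hom_eq[OF kv p u(1)] by (simp add: y_def u(2))
    moreover have "b (dif Tm (- 1) x) = y \<bullet>\<^bsub>obj Tm 0\<^esub> u" using b(2) u by (simp add: Tm_dif)
    moreover have "y \<bullet>\<^bsub>obj Tm 0\<^esub> u \<in> carrier (obj Tm 0)" by (rule right_module.ract_closed[OF r0 y P_incl[OF kv u(1)]])
    ultimately show "\<phi> x = dif Tm (- 1) \<zero>\<^bsub>obj Tm (- 1)\<^esub> \<oplus>\<^bsub>obj Tm 0\<^esub> b (dif Tm (- 1) x)"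
      using bc_zero[OF Tm_bounded, of 0 "- 1"] abelian_groupE(5)[OF bc_group[OF Tm_bounded]] by simp
  qed
next
  have m1: "- 1 + 1 = (0::int)" by simp
  note r0 = bc_right[OF Tm_bounded, of 0] and rm = bc_right[OF Tm_bounded, of "- 1"]
  fix \<phi> y assume "\<phi> \<in> mod_hom A (obj Tm (- 1 + 1)) (obj Tm (- 1))"
    and "\<And>y. y \<in> carrier (obj Tm (- 1 + 1)) \<Longrightarrow> dif Tm (- 1) (\<phi> y) = \<zero>\<^bsub>obj Tm (- 1 + 1)\<^esub>"
    and "y \<in> carrier (obj Tm (- 1 + 1))"
  then have \<phi>: "\<phi> \<in> mod_hom A (obj Tm 0) (obj Tm (- 1))" "\<And>y. y \<in> carrier (obj Tm 0) \<Longrightarrow> dif Tm (- 1) (\<phi> y) = \<zero>\<^bsub>obj Tm 0\<^esub>"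
    and y: "y \<in> carrier (obj Tm 0)" unfolding m1 by blast+
  interpret X: right_module A "obj Tm (- 1)" by (rule rm)
  interpret Y: right_module A "obj Tm 0" by (rule r0)
  note g0 = right_module_group[OF r0] and gm = right_module_group[OF rm]
  \<comment> \<open>It is enough to treat elements u e_i with i \<noteq> k. Their images lie in (Ker
    f) e_i, which is zero by \<open>condm\<close>.\<close>
  have "y \<in> {y \<in> carrier (obj Tm 0). \<phi> y = \<zero>\<^bsub>obj Tm (- 1)\<^esub>}"
  proof (rule ogenD[OF ogen_Tm])
    show "\<zero>\<^bsub>obj Tm 0\<^esub> \<in> {y \<in> carrier (obj Tm 0). \<phi> y = \<zero>\<^bsub>obj Tm (- 1)\<^esub>}"
      using mod_hom_zero[OF \<phi>(1) g0 gm] abelian_groupE(2)[OF g0] by blast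
    show "u \<oplus>\<^bsub>obj Tm 0\<^esub> v \<in> {y \<in> carrier (obj Tm 0). \<phi> y = \<zero>\<^bsub>obj Tm (- 1)\<^esub>}"
      if "u \<in> {y \<in> carrier (obj Tm 0). \<phi> y = \<zero>\<^bsub>obj Tm (- 1)\<^esub>}" "v \<in> {y \<in> carrier (obj Tm 0). \<phi> y = \<zero>\<^bsub>obj Tm (- 1)\<^esub>}" for u v
      using that mod_hom_add[OF \<phi>(1)] abelian_groupE(1)[OF g0] abelian_groupE(5)[OF gm abelian_groupE(2)[OF gm]] by simp
    fix u i a assume u: "u \<in> carrier (obj Tm 0)" and i: "i \<in> verts Q" "i \<noteq> k" and a: "a \<in> carrier A"
    have vi: "vtx i \<in> carrier A" using i by simp
    have ui: "u \<bullet>\<^bsub>obj Tm 0\<^esub> vtx i \<in> carrier (obj Tm 0)" by (rule Y.ract_closed[OF u vi])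
    define z where "z = \<phi> (u \<bullet>\<^bsub>obj Tm 0\<^esub> vtx i)"
    have zc: "z \<in> carrier (obj Tm (- 1))" unfolding z_def by (rule mod_hom_closed[OF \<phi>(1) ui])
    then obtain p where p: "p \<in> carrier (P k)" "z = ((p, undefined), undefined)" by (auto simp: Tm_obj_m1)
    have "z \<bullet>\<^bsub>obj Tm (- 1)\<^esub> vtx i = z"
      unfolding z_def mod_hom_ract[OF \<phi>(1) ui vi, symmetric] Y.ract_mult[OF u vi vi, symmetric] vtx_idem[OF i(1)] ..
    then have "p \<otimes>\<^bsub>A\<^esub> vtx i = p" by (simp add: p(2) Tm_obj_m1)
    moreover have "f p = \<zero>\<^bsub>NI\<^esub>" using \<phi>(2)[OF ui] unfolding z_def[symmetric] p(2) Tm_dif by (simp add: Tm_obj_0)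
    ultimately have "p = \<zero>\<^bsub>A\<^esub>" using c[OF i] p(1) unfolding condm_def by blast
    then have "z = \<zero>\<^bsub>obj Tm (- 1)\<^esub>" by (simp add: p(2) Tm_obj_m1)
    then have "\<phi> ((u \<bullet>\<^bsub>obj Tm 0\<^esub> vtx i) \<bullet>\<^bsub>obj Tm 0\<^esub> a) = \<zero>\<^bsub>obj Tm (- 1)\<^esub>"
      unfolding mod_hom_ract[OF \<phi>(1) ui a] z_def using X.zero_ract[OF a] by simp
    then show "(u \<bullet>\<^bsub>obj Tm 0\<^esub> vtx i) \<bullet>\<^bsub>obj Tm 0\<^esub> a \<in> {y \<in> carrier (obj Tm 0). \<phi> y = \<zero>\<^bsub>obj Tm (- 1)\<^esub>}"
      using Y.ract_closed[OF ui a] by blast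
  qed (use y in auto)
  then show "\<phi> y = \<zero>\<^bsub>obj Tm (- 1)\<^esub>" by blast
qed

text \<open>The generality in T covers both T^-_k itself and its copy.\<close>

lemma Tm_tilting_iso:
  assumes c: "\<And>i. i \<in> verts Q \<Longrightarrow> i \<noteq> k \<Longrightarrow> condm i" and T: "bounded_complex A T" and e: "e \<in> cx_iso Tm T"
  shows "tilting_complex A T"
  unfolding tilting_complex_def
proof (intro conjI allI impI)
  show pT: "projective_complex A T" by (rule cx_iso_projective[OF Tm_projective bc_right[OF T] e])
  show "generates_per A T" by (rule Tm_generates[OF e T])
  show "Db_Hom_zero A T (shift r T)" if "r \<noteq> 0" for r
    by (rule Db_Hom_zeroI[OF pT shift_bounded[OF T] null_homotopic_iso[OF e Tm_bounded T Tm_null[OF c that]]])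
qed

text \<open>An element x of e_k A e_i killed by f gives a map T^0 \<rightarrow> P_i \<rightarrow>
  P_k of degree -1, the projection followed by multiplication by x. Both composites with the
  differential vanish, so the map must be zero; but it sends e_i to x.\<close>

lemma Tm_tilting_cond:
  assumes T: "tilting_complex A Tm" and i: "i \<in> verts Q" "i \<noteq> k"
  shows "condm i"
  unfolding condm_def
proof (intro ballI impI)
  have m1: "- 1 + 1 = (0::int)" by simp
  fix x assume x: "x \<in> carrier (P k)" "x \<otimes>\<^bsub>A\<^esub> vtx i = x" "f x = \<zero>\<^bsub>NI\<^esub>"
  have xA: "x \<in> carrier A" by (rule P_incl[OF kv x(1)])
  have iS: "i \<in> verts Q - {k}" using i by simp
  let ?\<phi> = "(\<lambda>p. ((p, undefined), undefined)) \<circ> ((\<lambda>p. x \<bullet>\<^bsub>P k\<^esub> p) \<circ> ((\<lambda>s. s i) \<circ> snd))"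
  note r1 = right_module_mod_sum[OF right_module_zero_mod[OF ring_axioms] rights(2)]
  have \<phi>: "?\<phi> \<in> mod_hom A (obj Tm 0) (obj Tm (- 1))"
  proof -
    have s1: "snd \<in> mod_hom A (obj Tm 0) S" unfolding Tm_obj_0 by (rule mod_sum_maps(4)[OF r1 rights(4)])
    have s2: "(\<lambda>s. s i) \<in> mod_hom A S (P i)" by (rule mod_Sum_proj[OF iS])
    show ?thesis by (rule mod_hom_comp[OF mod_hom_comp[OF mod_hom_comp[OF s1 s2] P_hom[OF i(1) rights(1) x(1)]] Tm_inject])
  qed
  have H: "Db_Hom_zero A Tm (shift (- 1) Tm)" using T unfolding tilting_complex_def by simp
  let ?y = "((undefined :: ('v, 'e, 'k) qelt, \<zero>\<^bsub>NI\<^esub>), incl (verts Q - {k}) P i (vtx i))"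
  have y: "?y \<in> carrier (obj Tm 0)"
    using mod_hom_closed[OF incl_hom[where M = P and J = "verts Q - {k}" and j = i, OF fd_right[OF fg_projective_fd[OF P_off_k]] iS] vtx_P[OF i(1)]]
      abelian_groupE(2)[OF right_module_group[OF rights(2)]] by (simp add: Tm_obj_0)
  have "?\<phi> ?y = \<zero>\<^bsub>obj Tm (- 1)\<^esub>"
  proof (rule two_degree_Hom_zero[where d = "- 1" and X = Tm and \<phi> = "?\<phi>" and y = "?y", unfolded m1, OF Tm_bounded _ H \<phi> _ _ y])
    show "carrier (obj Tm n) = {\<zero>\<^bsub>obj Tm n\<^esub>}" if "n \<noteq> - 1" "n \<noteq> 0" for n using Tm_conc that by simp
    fix z assume "z \<in> carrier (obj Tm 0)"
    then have "snd z i \<in> carrier (P i)" using iS by (auto simp: Tm_obj_0)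
    then have s: "snd z i \<in> carrier A" by (rule P_incl[OF i(1)])
    have "f (x \<otimes>\<^bsub>A\<^esub> snd z i) = \<zero>\<^bsub>NI\<^esub>"
      unfolding f_zero_iff
    proof
      fix e assume e: "e \<in> In"
      have "arr e \<otimes>\<^bsub>A\<^esub> x = \<zero>\<^bsub>A\<^esub>" using x(3) e unfolding f_zero_iff by blast
      then show "arr e \<otimes>\<^bsub>A\<^esub> (x \<otimes>\<^bsub>A\<^esub> snd z i) = \<zero>\<^bsub>A\<^esub>" using s xA In_facts(1)[OF e] by (simp add: m_assoc[symmetric])
    qed
    then show "dif Tm (- 1) (?\<phi> z) = \<zero>\<^bsub>obj Tm 0\<^esub>" by (simp add: Tm_dif Tm_obj_0)
  next
    fix z assume "z \<in> carrier (obj Tm (- 1))"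
    show "?\<phi> (dif Tm (- 1) z) = \<zero>\<^bsub>obj Tm (- 1)\<^esub>" using iS xA by (simp add: Tm_dif Tm_obj_m1)
  qed
  then show "x = \<zero>\<^bsub>A\<^esub>" using x(2) iS by (simp add: incl_def Tm_obj_m1)
qed

lemma Tm_tilting_iff: "tilting_complex A Tm \<longleftrightarrow> (\<forall>i\<in>verts Q. i \<noteq> k \<longrightarrow> condm i)"
  using Tm_tilting_iso[OF _ Tm_bounded cx_iso_id] Tm_tilting_cond by blast

text \<open>Ker f is a submodule, so with x it contains every x e_v, and x is the sum of
  these.\<close>

lemma f_injective:
  assumes c: "\<And>i. i \<in> verts Q \<Longrightarrow> condm i" and x: "x \<in> carrier (P k)" "f x = \<zero>\<^bsub>NI\<^esub>"
  shows "x = \<zero>\<^bsub>A\<^esub>"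
proof -
  have xA: "x \<in> carrier A" by (rule P_incl[OF kv x(1)])
  interpret Pk: right_module A "P k" by (rule rights(1))
  have "\<one>\<^bsub>A\<^esub> \<in> {a \<in> carrier A. x \<otimes>\<^bsub>A\<^esub> a = \<zero>\<^bsub>A\<^esub>}"
  proof (rule one_induct)
    fix v a assume v: "v \<in> verts Q" and a: "a \<in> carrier A"
    have vA: "vtx v \<in> carrier A" using v by simp
    have "x \<otimes>\<^bsub>A\<^esub> vtx v = \<zero>\<^bsub>A\<^esub>"
    proof (rule c[OF v, unfolded condm_def, rule_format])
      show "x \<otimes>\<^bsub>A\<^esub> vtx v \<in> carrier (P k)" using Pk.ract_closed[OF x(1) vA] by simp
      show "x \<otimes>\<^bsub>A\<^esub> vtx v \<otimes>\<^bsub>A\<^esub> vtx v = x \<otimes>\<^bsub>A\<^esub> vtx v" using xA vA by (simp add: m_assoc vtx_idem[OF v])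
      show "f (x \<otimes>\<^bsub>A\<^esub> vtx v) = \<zero>\<^bsub>NI\<^esub>"
        unfolding f_zero_iff
      proof
        fix e assume e: "e \<in> In"
        have "arr e \<otimes>\<^bsub>A\<^esub> x = \<zero>\<^bsub>A\<^esub>" using x(2) e unfolding f_zero_iff by blast
        then show "arr e \<otimes>\<^bsub>A\<^esub> (x \<otimes>\<^bsub>A\<^esub> vtx v) = \<zero>\<^bsub>A\<^esub>" using vA xA In_facts(1)[OF e] by (simp add: m_assoc[symmetric])
      qed
    qed
    then show "vtx v \<otimes>\<^bsub>A\<^esub> a \<in> {a \<in> carrier A. x \<otimes>\<^bsub>A\<^esub> a = \<zero>\<^bsub>A\<^esub>}" using xA vA a by (simp add: m_assoc[symmetric])
  qed (use xA in \<open>auto simp: r_distr\<close>)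
  then show ?thesis using xA by simp
qed

text \<open>Since f is injective, the projection of T^-_k onto the cokernel of its differential, as
  a stalk in degree 0, is a quasi-isomorphism.\<close>

lemma Tm_module:
  assumes c: "\<And>i. i \<in> verts Q \<Longrightarrow> condm i"
  shows "iso_to_tilting_module A Tm"
proof -
  let ?d = "dif Tm (- 1)" and ?X = "obj Tm (- 1)" and ?Y = "obj Tm 0"
  have d: "?d \<in> mod_hom A ?X ?Y" by (rule bc_dif[OF Tm_bounded]) simp
  note rX = bc_right[OF Tm_bounded, of "- 1"] and rY = bc_right[OF Tm_bounded, of 0]
  let ?B = "?d ` carrier ?X"
  \<comment> \<open>The elements of the cokernel are cosets; its copy M has the element type that
    \<open>iso_to_tilting_module\<close> demands.\<close>
  define C where "C = mod_coker ?Y ?B"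
  note ck = mod_coker[OF rX rY d, folded C_def]
  have fC: "fd_module A C" by (rule fd_module_image[OF bc_fd[OF Tm_bounded, of 0] ck(1,2,3)])
  define M where "M = copy_mod C"
  note cm = copy_mod[OF fC, folded M_def]
  let ?p = "enc C \<circ> (\<lambda>y. ?B +>\<^bsub>?Y\<^esub> y)"
  have p: "?p \<in> mod_hom A ?Y M" by (rule mod_hom_comp[OF ck(2) cm(2)])
  have ps: "?p ` carrier ?Y = carrier M" using ck(3) bij_betw_imp_surj_on[OF cm(3)] by (simp only: image_comp[symmetric])
  note gC = right_module_group[OF ck(1)] and gM = right_module_group[OF fd_right[OF cm(1)]] and gY = right_module_group[OF rY] and gX = right_module_group[OF rX]
  have p0: "y \<in> ?B" if y: "y \<in> carrier ?Y" "?p y = \<zero>\<^bsub>M\<^esub>" for y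
  proof -
    have "?B +>\<^bsub>?Y\<^esub> y \<in> carrier C" using ck(3) y(1) by blast
    moreover have "enc C (?B +>\<^bsub>?Y\<^esub> y) = enc C \<zero>\<^bsub>C\<^esub>" using y(2) mod_hom_zero[OF cm(2) gC gM] by simp
    ultimately have "?B +>\<^bsub>?Y\<^esub> y = \<zero>\<^bsub>C\<^esub>"
      using bij_betw_imp_inj_on[OF cm(3)] abelian_groupE(2)[OF gC] by (simp add: inj_on_eq_iff)
    then show ?thesis using ck(4)[OF y(1)] by blast
  qed
  have pd: "?p (?d x) = \<zero>\<^bsub>M\<^esub>" if x: "x \<in> carrier ?X" for x
  proof -
    have "?B +>\<^bsub>?Y\<^esub> ?d x = \<zero>\<^bsub>C\<^esub>" using ck(4)[OF mod_hom_closed[OF d x]] x by blast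
    then show ?thesis using mod_hom_zero[OF cm(2) gC gM] by simp
  qed
  let ?q = "\<lambda>n :: int. if n = 0 then ?p else (\<lambda>_. undefined)"
  have bM: "bounded_complex A (stalk M)" by (rule stalk_bounded[OF cm(1)])
  have sM: "obj (stalk M) n = (if n = 0 then M else zero_mod)" "dif (stalk M) n x = \<zero>\<^bsub>obj (stalk M) (n + 1)\<^esub>" for n x by (simp_all add: stalk_def)
  have q: "?q \<in> chain_map A Tm (stalk M)"
  proof (rule cmI)
    show "?q n \<in> mod_hom A (obj Tm n) (obj (stalk M) n)" for n using p by (simp add: sM mod_hom_zero_mod)
    show "?q (n + 1) (dif Tm n x) = dif (stalk M) n (?q n x)" if "x \<in> carrier (obj Tm n)" for n x
      using pd that by (cases "n = - 1") (auto simp: sM)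
  qed
  have qi: "?q \<in> quasi_iso A Tm (stalk M)"
  proof (rule quasi_isoI[OF Tm_bounded bM q])
    fix n z w assume z: "z \<in> carrier (obj Tm n)" and dz: "dif Tm n z = \<zero>\<^bsub>obj Tm (n + 1)\<^esub>" and e: "?q n z = dif (stalk M) (n - 1) w"
    consider "n = 0" | "n = - 1" | "n \<noteq> 0" "n \<noteq> - 1" by blast
    then show "\<exists>v\<in>carrier (obj Tm (n - 1)). z = dif Tm (n - 1) v"
    proof cases
      case 1
      then have "?p z = \<zero>\<^bsub>M\<^esub>" using e by (simp add: sM)
      then show ?thesis using p0[of z] z 1 by auto
    next
      case 2
      obtain u where u: "u \<in> carrier (P k)" "z = ((u, undefined), undefined)" using z 2 by (auto simp: Tm_obj_m1)
      have "f u = \<zero>\<^bsub>NI\<^esub>" using dz 2 by (simp add: u(2) Tm_dif Tm_obj_0)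
      with u(1) have "u = \<zero>\<^bsub>A\<^esub>" by (intro f_injective) (auto intro: c)
      then have "z = \<zero>\<^bsub>obj Tm n\<^esub>" using 2 by (simp add: u(2) Tm_obj_m1)
      then show ?thesis using bc_zero[OF Tm_bounded, of n "n - 1"] abelian_groupE(2)[OF bc_group[OF Tm_bounded, of "n - 1"]] by force
    next
      case 3
      then have "z = \<zero>\<^bsub>obj Tm n\<^esub>" using z Tm_conc by simp
      then show ?thesis using bc_zero[OF Tm_bounded, of n "n - 1"] abelian_groupE(2)[OF bc_group[OF Tm_bounded, of "n - 1"]] by force
    qed
  next
    fix n y assume y: "y \<in> carrier (obj (stalk M) n)"
    have w: "\<zero>\<^bsub>obj (stalk M) (n - 1)\<^esub> \<in> carrier (obj (stalk M) (n - 1))" by (rule abelian_groupE(2)[OF bc_group[OF bM]])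
    have eq: "y = dif (stalk M) (n - 1) \<zero>\<^bsub>obj (stalk M) (n - 1)\<^esub> \<oplus>\<^bsub>obj (stalk M) n\<^esub> y"
      using bc_zero[OF bM, of n "n - 1"] abelian_groupE(5)[OF bc_group[OF bM] y] by simp
    have "\<exists>z\<in>carrier (obj Tm n). dif Tm n z = \<zero>\<^bsub>obj Tm (n + 1)\<^esub> \<and> y = ?q n z"
    proof (cases "n = 0")
      case True
      have "y \<in> ?p ` carrier ?Y" using y True unfolding ps by (simp add: sM)
      then obtain z where z: "z \<in> carrier ?Y" "y = ?p z" by (rule imageE) blast
      have "dif Tm 0 z \<in> carrier (obj Tm 1)" by (rule bc_closed[OF Tm_bounded z(1)]) simp
      then show ?thesis using z True Tm_conc[of 1] by auto
    next
      case False
      then have "y = undefined" using y by (simp add: sM)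
      then show ?thesis using False bc_zero[OF Tm_bounded refl, of n] abelian_groupE(2)[OF bc_group[OF Tm_bounded, of n]] by force
    qed
    then show "\<exists>z\<in>carrier (obj Tm n). dif Tm n z = \<zero>\<^bsub>obj Tm (n + 1)\<^esub> \<and>
        (\<exists>w\<in>carrier (obj (stalk M) (n - 1)). y = dif (stalk M) (n - 1) w \<oplus>\<^bsub>obj (stalk M) n\<^esub> ?q n z)"
      using w eq by metis
  qed
  note cT = copy_cx[OF Tm_bounded]
  \<comment> \<open>\<open>tilting_module\<close> requires a tilting complex of the fixed element
    type, hence the copy.\<close>
  have t: "tilting_complex A (copy_cx Tm)" by (rule Tm_tilting_iso[OF c cT(1,2)])
  have "Db_iso A (copy_cx Tm) (stalk M)"
    by (rule qi_Db_iso[OF qi_comp[OF cx_iso_qi[OF cT(3,1) Tm_bounded] qi cT(1) Tm_bounded bM] cT(1) bM])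
  then have "tilting_module A M" unfolding tilting_module_def using cm(1) t Db_iso_sym by blast
  then show ?thesis unfolding iso_to_tilting_module_def using qi_Db_iso[OF qi Tm_bounded bM] by blast
qed

text \<open>With no term in degree -2, the cohomology of T^-_k in degree -1 is Ker f, whereas a
  stalk in degree 0 has none there.\<close>

lemma Tm_module_cond:
  assumes T: "iso_to_tilting_module A Tm" shows "condm i"
  unfolding condm_def
proof (intro ballI impI)
  fix x assume x: "x \<in> carrier (P k)" "f x = \<zero>\<^bsub>NI\<^esub>"
  obtain M :: "(('v, 'e, 'k) qelt, nat \<Rightarrow> 'k) right_mod" where M: "Db_iso A Tm (stalk M)"
    using T unfolding iso_to_tilting_module_def by blast
  let ?z = "((x, undefined), undefined)"
  have "?z \<in> coboundaries Tm (- 1)"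
  proof (rule Db_iso_acyclic[OF M])
    fix y assume "y \<in> carrier (obj (stalk M) (- 1))"
    then show "y \<in> coboundaries (stalk M) (- 1)" by (auto simp: coboundaries_def stalk_def)
  qed (use x in \<open>auto simp: Tm_obj Tm_dif\<close>)
  then obtain v where "v \<in> carrier (obj Tm (- 1 - 1))" "?z = dif Tm (- 1 - 1) v" by (auto simp: coboundaries_def)
  moreover have "carrier (obj Tm (- 1 - 1)) = {\<zero>\<^bsub>obj Tm (- 1 - 1)\<^esub>}" by (rule Tm_conc) simp_all
  moreover have "dif Tm (- 1 - 1) \<zero>\<^bsub>obj Tm (- 1 - 1)\<^esub> = \<zero>\<^bsub>obj Tm (- 1)\<^esub>" by (rule bc_zero[OF Tm_bounded]) simp
  ultimately have "?z = \<zero>\<^bsub>obj Tm (- 1)\<^esub>" by simp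
  then show "x = \<zero>\<^bsub>A\<^esub>" by (simp add: Tm_obj_m1)
qed

lemma Tm_module_iff: "iso_to_tilting_module A Tm \<longleftrightarrow> (\<forall>i\<in>verts Q. condm i)"
  using Tm_module Tm_module_cond by blast

subsection \<open>The complex \<open>T\<^sup>+\<^sub>k\<close>\<close>

text \<open>As P_k represents M \<mapsto> M e_k, this says Hom(Coker g, P_i) = 0.\<close>

definition condp :: "'v \<Rightarrow> bool" where
  "condp i \<longleftrightarrow> (\<forall>x\<in>carrier (P i). x \<otimes>\<^bsub>A\<^esub> vtx k = x \<longrightarrow> (\<forall>e\<in>Out. x \<otimes>\<^bsub>A\<^esub> arr e = \<zero>\<^bsub>A\<^esub>) \<longrightarrow> x = \<zero>\<^bsub>A\<^esub>)"

text \<open>Hom(Coker g, M) = 0 for an arbitrary M; unlike \<open>condp\<close> it passes to direct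
  sums and so to the whole degree 0 term of T^+_k.\<close>

definition csep :: "(('v, 'e, 'k) qelt, 'b) right_mod \<Rightarrow> bool" where
  "csep M \<longleftrightarrow> (\<forall>y\<in>carrier M. y \<bullet>\<^bsub>M\<^esub> vtx k = y \<longrightarrow> (\<forall>e\<in>Out. y \<bullet>\<^bsub>M\<^esub> arr e = \<zero>\<^bsub>M\<^esub>) \<longrightarrow> y = \<zero>\<^bsub>M\<^esub>)"

lemma csep_mod_sum: "csep M \<Longrightarrow> csep N \<Longrightarrow> csep (mod_sum M N)"
  unfolding csep_def by (auto simp: prod_eq_iff)

lemma csep_zero_mod: "csep zero_mod"
  by (simp add: csep_def)

lemma csep_mod_Sum:
  assumes "\<And>j. j \<in> J \<Longrightarrow> csep (M j)" shows "csep (mod_Sum J M)"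
  unfolding csep_def
proof (intro ballI impI)
  fix y assume y: "y \<in> carrier (mod_Sum J M)" "y \<bullet>\<^bsub>mod_Sum J M\<^esub> vtx k = y" "\<forall>e\<in>Out. y \<bullet>\<^bsub>mod_Sum J M\<^esub> arr e = \<zero>\<^bsub>mod_Sum J M\<^esub>"
  have "y j = \<zero>\<^bsub>M j\<^esub>" if j: "j \<in> J" for j
  proof (rule assms[OF j, unfolded csep_def, rule_format])
    show "y j \<in> carrier (M j)" using y(1) j by auto
    show "y j \<bullet>\<^bsub>M j\<^esub> vtx k = y j" using fun_cong[OF y(2), of j] j by simp
    show "y j \<bullet>\<^bsub>M j\<^esub> arr e = \<zero>\<^bsub>M j\<^esub>" if "e \<in> Out" for e using fun_cong[OF y(3)[rule_format, OF that], of j] j by simp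
  qed
  then show "y = \<zero>\<^bsub>mod_Sum J M\<^esub>" using y(1) by (auto simp: fun_eq_iff PiE_iff extensional_def)
qed

lemma Tp_obj_0: "obj Tp 0 = mod_sum (mod_sum NO zero_mod) S"
  by (simp add: Tp_obj)

lemma Tp_obj_1: "obj Tp 1 = mod_sum (mod_sum zero_mod (P k)) zero_mod"
  by (simp add: Tp_obj)

lemma Tp_conc: "n \<noteq> 0 \<Longrightarrow> n \<noteq> 1 \<Longrightarrow> carrier (obj Tp n) = {\<zero>\<^bsub>obj Tp n\<^esub>}"
  by (simp add: Tp_obj)

lemma csep_Tp:
  assumes c: "\<And>i. i \<in> verts Q \<Longrightarrow> i \<noteq> k \<Longrightarrow> condp i" shows "csep (obj Tp 0)"
proof -
  have "csep (P i)" if "i \<in> verts Q" "i \<noteq> k" for i using c[OF that] by (simp add: csep_def condp_def)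
  then show ?thesis unfolding Tp_obj_0
    by (intro csep_mod_sum csep_mod_Sum csep_zero_mod) (auto simp: Out_facts)
qed

lemma Tp_inject: "(\<lambda>x. ((undefined, x), undefined)) \<in> mod_hom A (P k) (obj Tp 1)"
  unfolding Tp_obj_1 by (intro mod_hom_pair mod_hom_id(2) mod_hom_zero_mod)

lemma Tp_dif_incl:
  assumes e: "e \<in> Out" and z: "z \<in> carrier (P (head Q e))"
  shows "((incl Out (\<lambda>e. P (head Q e)) e z, undefined), \<zero>\<^bsub>S\<^esub>) \<in> carrier (obj Tp 0)"
    "dif Tp 0 ((incl Out (\<lambda>e. P (head Q e)) e z, undefined), \<zero>\<^bsub>S\<^esub>) = ((undefined, arr e \<otimes>\<^bsub>A\<^esub> z), undefined)"
proof -
  have "incl Out (\<lambda>e. P (head Q e)) e \<in> mod_hom A (P (head Q e)) NO"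
    by (rule incl_hom[where M = "\<lambda>e. P (head Q e)", OF P_right[OF Out_facts(3)] e])
  from mod_hom_closed[OF this z] abelian_groupE(2)[OF right_module_group[OF rights(4)]]
  show "((incl Out (\<lambda>e. P (head Q e)) e z, undefined), \<zero>\<^bsub>S\<^esub>) \<in> carrier (obj Tp 0)" unfolding Tp_obj_0 by simp
  show "dif Tp 0 ((incl Out (\<lambda>e. P (head Q e)) e z, undefined), \<zero>\<^bsub>S\<^esub>) = ((undefined, arr e \<otimes>\<^bsub>A\<^esub> z), undefined)"
    unfolding Tp_dif fst_conv g_incl[OF e z] ..
qed

text \<open>T^0 is generated by elements u e_i with i \<noteq> k. Their images in P_k are
  combinations of paths from k to i, all of which begin with an arrow out of k and so lie in the
  image of g.\<close>

lemma Tp_image: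
  assumes \<phi>: "\<phi> \<in> mod_hom A (obj Tp 0) (obj Tp 1)"
  shows "\<phi> ` carrier (obj Tp 0) \<subseteq> dif Tp 0 ` carrier (obj Tp 0)"
proof (rule image_subsetI)
  let ?X = "obj Tp 0" and ?Y = "obj Tp 1"
  note rX = bc_right[OF Tp_bounded, of 0] and rY = bc_right[OF Tp_bounded, of 1]
  have d: "dif Tp 0 \<in> mod_hom A ?X ?Y" by (rule bc_dif[OF Tp_bounded]) simp
  let ?B = "dif Tp 0 ` carrier ?X"
  interpret B: additive_subgroup ?B ?Y by (rule additive_subgroup_image[OF rX rY d])
  interpret X: right_module A ?X by (rule rX)
  interpret Y: right_module A ?Y by (rule rY)
  note gX = right_module_group[OF rX] and gY = right_module_group[OF rY]
  fix x assume x: "x \<in> carrier ?X"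
  have "x \<in> {z \<in> carrier ?X. \<phi> z \<in> ?B}"
  proof (rule ogenD[OF ogen_Tp])
    show "\<zero>\<^bsub>?X\<^esub> \<in> {z \<in> carrier ?X. \<phi> z \<in> ?B}"
      using mod_hom_zero[OF \<phi> gX gY] B.zero_closed abelian_groupE(2)[OF gX] by simp
    show "u \<oplus>\<^bsub>?X\<^esub> v \<in> {z \<in> carrier ?X. \<phi> z \<in> ?B}" if "u \<in> {z \<in> carrier ?X. \<phi> z \<in> ?B}" "v \<in> {z \<in> carrier ?X. \<phi> z \<in> ?B}" for u v
      using that mod_hom_add[OF \<phi>] B.a_closed abelian_groupE(1)[OF gX] by simp
    fix u i a assume u: "u \<in> carrier ?X" and i: "i \<in> verts Q" "i \<noteq> k" and a: "a \<in> carrier A"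
    have vi: "vtx i \<in> carrier A" using i by simp
    have ui: "u \<bullet>\<^bsub>?X\<^esub> vtx i \<in> carrier ?X" by (rule X.ract_closed[OF u vi])
    define z where "z = \<phi> (u \<bullet>\<^bsub>?X\<^esub> vtx i)"
    have "z \<in> carrier ?Y" unfolding z_def by (rule mod_hom_closed[OF \<phi> ui])
    then obtain p where p: "p \<in> carrier (P k)" "z = ((undefined, p), undefined)" by (auto simp: Tp_obj_1)
    have "z \<bullet>\<^bsub>?Y\<^esub> vtx i = z"
      unfolding z_def mod_hom_ract[OF \<phi> ui vi, symmetric] X.ract_mult[OF u vi vi, symmetric] vtx_idem[OF i(1)] ..
    then have pi: "p \<otimes>\<^bsub>A\<^esub> vtx i = p" by (simp add: p(2) Tp_obj_1)
    \<comment> \<open>The first arrow e of a path from k to i exhibits it as the value of g on the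
      summand of \<open>NO\<close> at e.\<close>
    have "p \<in> {p \<in> carrier (P k). ((undefined, p), undefined) \<in> ?B}"
    proof (rule out_arrows_induct[OF kv i(1) i(2)[symmetric] P_incl[OF kv p(1)] _ pi])
      interpret Pk: right_module A "P k" by (rule rights(1))
      note gk = right_module_group[OF rights(1)]
      show "vtx k \<otimes>\<^bsub>A\<^esub> p = p" using p(1) by (simp add: P_carrier[OF kv])
      show "\<zero>\<^bsub>A\<^esub> \<in> {p \<in> carrier (P k). ((undefined, p), undefined) \<in> ?B}"
        using B.zero_closed abelian_groupE(2)[OF gk] by (simp add: Tp_obj_1)
      show "u \<oplus>\<^bsub>A\<^esub> v \<in> {p \<in> carrier (P k). ((undefined, p), undefined) \<in> ?B}"
        if "u \<in> {p \<in> carrier (P k). ((undefined, p), undefined) \<in> ?B}" "v \<in> {p \<in> carrier (P k). ((undefined, p), undefined) \<in> ?B}" for u v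
        using that B.a_closed[of "((undefined, u), undefined)" "((undefined, v), undefined)"] abelian_groupE(1)[OF gk, of u v] by (simp add: Tp_obj_1)
      fix w e assume e: "e \<in> Out" and w: "w \<in> carrier (P (head Q e))"
      have "arr e \<otimes>\<^bsub>A\<^esub> w \<in> carrier (P k)"
        using arr_mult_P[OF Out_facts(1)[OF e] P_incl[OF Out_facts(3)[OF e] w]] Out_facts(2)[OF e] by simp
      moreover have "((undefined, arr e \<otimes>\<^bsub>A\<^esub> w), undefined) \<in> ?B"
        unfolding Tp_dif_incl(2)[OF e w, symmetric] by (rule imageI[OF Tp_dif_incl(1)[OF e w]])
      ultimately show "arr e \<otimes>\<^bsub>A\<^esub> w \<in> {p \<in> carrier (P k). ((undefined, p), undefined) \<in> ?B}" by blast
    qed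
    then obtain x' where x': "x' \<in> carrier ?X" "z = dif Tp 0 x'" unfolding p(2) by blast
    have "\<phi> ((u \<bullet>\<^bsub>?X\<^esub> vtx i) \<bullet>\<^bsub>?X\<^esub> a) = dif Tp 0 (x' \<bullet>\<^bsub>?X\<^esub> a)"
      unfolding mod_hom_ract[OF \<phi> ui a] mod_hom_ract[OF d x'(1) a] x'(2)[symmetric] z_def ..
    then show "(u \<bullet>\<^bsub>?X\<^esub> vtx i) \<bullet>\<^bsub>?X\<^esub> a \<in> {z \<in> carrier ?X. \<phi> z \<in> ?B}"
      using X.ract_closed[OF x'(1) a] X.ract_closed[OF ui a] by blast
  qed (use x in auto)
  then show "\<phi> x \<in> ?B" by blast
qed

lemma Tp_null:
  assumes c: "\<And>i. i \<in> verts Q \<Longrightarrow> i \<noteq> k \<Longrightarrow> condp i" and r: "r \<noteq> 0" and h: "h \<in> chain_map A Tp (shift r Tp)"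
  shows "homotopic A Tp (shift r Tp) h (\<lambda>n x. \<zero>\<^bsub>obj (shift r Tp) n\<^esub>)"
proof (rule two_degree_null_homotopic[where d = 0, OF Tp_bounded _ _ _ r h])
  note r0 = bc_right[OF Tp_bounded, of 0] and r1 = bc_right[OF Tp_bounded, of 1]
  have d: "dif Tp 0 \<in> mod_hom A (obj Tp 0) (obj Tp 1)" by (rule bc_dif[OF Tp_bounded]) simp
  show "carrier (obj Tp n) = {\<zero>\<^bsub>obj Tp n\<^esub>}" if "n \<noteq> 0" "n \<noteq> 0 + 1" for n using Tp_conc that by simp
  fix \<phi> assume "\<phi> \<in> mod_hom A (obj Tp 0) (obj Tp (0 + 1))"
  then have \<phi>: "\<phi> \<in> mod_hom A (obj Tp 0) (obj Tp 1)" by simp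
  have p0: "fg_projective A (obj Tp 0)" using Tp_projective by (simp add: projective_complex_def)
  \<comment> \<open>T^0 is projective, so the map into the image of the differential lifts through
    it; the other endomorphism is zero.\<close>
  obtain a where a: "a \<in> mod_hom A (obj Tp 0) (obj Tp 0)" "\<forall>x\<in>carrier (obj Tp 0). dif Tp 0 (a x) = \<phi> x"
    using fg_projective_lift[OF p0 bc_fd[OF Tp_bounded, of 0] r1 d \<phi> Tp_image[OF \<phi>]] by blast
  show "\<exists>a\<in>mod_hom A (obj Tp 0) (obj Tp 0). \<exists>b\<in>mod_hom A (obj Tp (0 + 1)) (obj Tp (0 + 1)).
      \<forall>x\<in>carrier (obj Tp 0). \<phi> x = dif Tp 0 (a x) \<oplus>\<^bsub>obj Tp (0 + 1)\<^esub> b (dif Tp 0 x)"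
    unfolding add_0
  proof (rule bexI[OF _ a(1)], rule bexI[OF _ mod_hom_zero_map[OF r1]], rule ballI)
    fix x assume x: "x \<in> carrier (obj Tp 0)"
    show "\<phi> x = dif Tp 0 (a x) \<oplus>\<^bsub>obj Tp 1\<^esub> \<zero>\<^bsub>obj Tp 1\<^esub>"
      using a(2) x abelian_monoid.r_zero[OF abelian_group.axioms(1)[OF bc_group[OF Tp_bounded]] mod_hom_closed[OF \<phi> x]] by simp
  qed
next
  note r0 = bc_right[OF Tp_bounded, of 0] and r1 = bc_right[OF Tp_bounded, of 1]
  fix \<phi> y assume "\<phi> \<in> mod_hom A (obj Tp (0 + 1)) (obj Tp 0)"
    and \<phi>0: "\<And>x. x \<in> carrier (obj Tp 0) \<Longrightarrow> \<phi> (dif Tp 0 x) = \<zero>\<^bsub>obj Tp 0\<^esub>"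
    and "y \<in> carrier (obj Tp (0 + 1))"
  then have \<phi>: "\<phi> \<in> mod_hom A (obj Tp 1) (obj Tp 0)" and y: "y \<in> carrier (obj Tp 1)" by simp_all
  let ?p = "\<phi> \<circ> (\<lambda>x. ((undefined, x), undefined))"
  have p: "?p \<in> mod_hom A (P k) (obj Tp 0)" by (rule mod_hom_comp[OF Tp_inject \<phi>])
  \<comment> \<open>A map P_k \<rightarrow> T^0 is determined by the image z of e_k. That it kills
    the image of g means z e = 0 for every arrow e out of k, so \<open>csep\<close> gives z =
    0.\<close>
  define z where "z = ?p (vtx k)"
  have z: "z \<in> carrier (obj Tp 0)" unfolding z_def by (rule mod_hom_closed[OF p vtx_P[OF kv]])
  have "z = \<zero>\<^bsub>obj Tp 0\<^esub>"
  proof (rule csep_Tp[OF c, unfolded csep_def, rule_format, OF _ _ z])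
    show "z \<bullet>\<^bsub>obj Tp 0\<^esub> vtx k = z" using P_hom_eq[OF kv p vtx_P[OF kv]] unfolding z_def by simp
    fix e assume e: "e \<in> Out"
    have aP: "arr e \<in> carrier (P k)" using arr_mult_P[OF Out_facts(1)[OF e], of "\<one>\<^bsub>A\<^esub>"] Out_facts[OF e] by simp
    have vP: "vtx (head Q e) \<in> carrier (P (head Q e))" by (rule vtx_P[OF Out_facts(3)[OF e]])
    have "?p (arr e) = \<phi> (dif Tp 0 ((incl Out (\<lambda>e. P (head Q e)) e (vtx (head Q e)), undefined), \<zero>\<^bsub>S\<^esub>))"
      unfolding Tp_dif_incl(2)[OF e vP] using arr_right[OF Out_facts(1)[OF e]] by simp
    also have "\<dots> = \<zero>\<^bsub>obj Tp 0\<^esub>" by (rule \<phi>0[OF Tp_dif_incl(1)[OF e vP]])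
    finally show "z \<bullet>\<^bsub>obj Tp 0\<^esub> arr e = \<zero>\<^bsub>obj Tp 0\<^esub>" using P_hom_eq[OF kv p aP] by (simp add: z_def)
  qed
  moreover obtain u where u: "u \<in> carrier (P k)" "y = ((undefined, u), undefined)" using y by (auto simp: Tp_obj_1)
  ultimately show "\<phi> y = \<zero>\<^bsub>obj Tp 0\<^esub>"
    using P_hom_eq[OF kv p u(1)] right_module.zero_ract[OF r0 P_incl[OF kv u(1)]] by (simp add: z_def)
qed

lemma Tp_tilting:
  assumes c: "\<And>i. i \<in> verts Q \<Longrightarrow> i \<noteq> k \<Longrightarrow> condp i"
  shows "tilting_complex A Tp"
  unfolding tilting_complex_def
proof (intro conjI allI impI Tp_projective)
  show "generates_per A Tp" by (rule Tp_generates[OF cx_iso_id Tp_bounded])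
  show "Db_Hom_zero A Tp (shift r Tp)" if "r \<noteq> 0" for r
    by (rule Db_Hom_zeroI[OF Tp_projective shift_bounded[OF Tp_bounded] Tp_null[OF c that]])
qed

text \<open>An element x of e_i A e_k killed by all arrows out of k gives, by left multiplication, a
  map P_k \<rightarrow> P_i into a summand of T^0. It is a chain map of degree -1, hence zero, but
  it sends e_k to x.\<close>

lemma Tp_tilting_cond:
  assumes T: "tilting_complex A Tp" and i: "i \<in> verts Q" "i \<noteq> k"
  shows "condp i"
  unfolding condp_def
proof (intro ballI impI)
  have m1: "0 + 1 = (1::int)" by simp
  fix x assume x: "x \<in> carrier (P i)" "x \<otimes>\<^bsub>A\<^esub> vtx k = x" "\<forall>e\<in>Out. x \<otimes>\<^bsub>A\<^esub> arr e = \<zero>\<^bsub>A\<^esub>"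
  have xA: "x \<in> carrier A" by (rule P_incl[OF i(1) x(1)])
  have iS: "i \<in> verts Q - {k}" using i by simp
  have rP: "right_module A (P j)" if "j \<in> verts Q - {k}" for j using P_right that by blast
  note rz = right_module_zero_mod[OF ring_axioms]
  note inc = incl_hom[where M = P and J = "verts Q - {k}" and j = i, OF rP iS]
  define \<psi> :: "(('e \<Rightarrow> ('v,'e,'k) qelt) \<times> ('v,'e,'k) qelt) \<times> ('v \<Rightarrow> ('v,'e,'k) qelt) \<Rightarrow> 'v \<Rightarrow> ('v,'e,'k) qelt" where "\<psi> = incl (verts Q - {k}) P i \<circ> ((\<lambda>p. x \<bullet>\<^bsub>P i\<^esub> p) \<circ> (snd \<circ> fst))"
  define \<phi> :: "(('e \<Rightarrow> ('v,'e,'k) qelt) \<times> ('v,'e,'k) qelt) \<times> ('v \<Rightarrow> ('v,'e,'k) qelt) \<Rightarrow> (('e \<Rightarrow> ('v,'e,'k) qelt) \<times> ('v,'e,'k) qelt) \<times> ('v \<Rightarrow> ('v,'e,'k) qelt)" where "\<phi> = (\<lambda>s. (\<zero>\<^bsub>mod_sum NO zero_mod\<^esub>, s)) \<circ> \<psi>"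
  have xh: "(\<lambda>p. x \<bullet>\<^bsub>P i\<^esub> p) \<in> mod_hom A (P k) (P i)" by (rule P_hom[OF kv P_right[OF i(1)] x(1)])
  have s1: "fst \<in> mod_hom A (obj Tp 1) (mod_sum zero_mod (P k))"
    unfolding Tp_obj_1 by (rule mod_sum_maps(3)[OF right_module_mod_sum[OF rz rights(1)] rz])
  have s2: "snd \<in> mod_hom A (mod_sum zero_mod (P k)) (P k)" by (rule mod_sum_maps(4)[OF rz rights(1)])
  have \<psi>: "\<psi> \<in> mod_hom A (obj Tp 1) S"
    unfolding \<psi>_def by (rule mod_hom_comp[OF mod_hom_comp[OF mod_hom_comp[OF s1 s2] xh] inc])
  have s3: "(\<lambda>s. (\<zero>\<^bsub>mod_sum NO zero_mod\<^esub>, s)) \<in> mod_hom A S (obj Tp 0)"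
    unfolding Tp_obj_0 by (rule mod_sum_maps(2)[OF right_module_mod_sum[OF rights(3) rz] rights(4)])
  have \<phi>: "\<phi> \<in> mod_hom A (obj Tp 1) (obj Tp 0)" unfolding \<phi>_def by (rule mod_hom_comp[OF \<psi> s3])
  have H: "Db_Hom_zero A Tp (shift (- 1) Tp)" using T unfolding tilting_complex_def by simp
  have y: "((undefined, vtx k), undefined) \<in> carrier (obj Tp 1)" (is "?y \<in> _") using vtx_P[OF kv] by (simp add: Tp_obj_1)
  have g0: "g \<zero>\<^bsub>NO\<^esub> = \<zero>\<^bsub>P k\<^esub>" by (rule mod_hom_zero[OF g_hom right_module_group[OF rights(3)] right_module_group[OF rights(1)]])
  \<comment> \<open>Multiplication by x annihilates the image of g, since this image is the sum of
    the right ideals generated by the arrows out of k.\<close>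
  have xg: "x \<otimes>\<^bsub>A\<^esub> g m = \<zero>\<^bsub>A\<^esub>" if m: "m \<in> carrier NO" for m
  proof -
    have c: "left_mult_arrow Q I e (m e) \<in> carrier (P k)" if "e \<in> Out" for e
      using mod_hom_closed[OF arr_hom[OF that], of "m e"] m that by auto
    have z: "x \<otimes>\<^bsub>A\<^esub> left_mult_arrow Q I e (m e) = \<zero>\<^bsub>A\<^esub>" if e: "e \<in> Out" for e
    proof -
      have "m e \<in> carrier (P (head Q e))" using m e by auto
      then have "m e \<in> carrier A" by (rule P_incl[OF Out_facts(3)[OF e]])
      then show ?thesis using x(3) e xA Out_facts(1)[OF e] by (simp add: left_mult_arrow_arr m_assoc[symmetric])
    qed
    interpret Pi: right_module A "P i" by (rule P_right[OF i(1)])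
    have "x \<bullet>\<^bsub>P i\<^esub> g m = (\<Oplus>\<^bsub>P i\<^esub>e\<in>Out. x \<bullet>\<^bsub>P i\<^esub> left_mult_arrow Q I e (m e))"
      by (rule mod_hom_finsum[OF xh right_module_group[OF rights(1)] right_module_group[OF P_right[OF i(1)]] c])
    also have "\<dots> = (\<Oplus>\<^bsub>P i\<^esub>e\<in>Out. \<zero>\<^bsub>P i\<^esub>)"
      by (rule Pi.finsum_cong') (use z abelian_groupE(2)[OF right_module_group[OF P_right[OF i(1)]]] in auto)
    also have "\<dots> = \<zero>\<^bsub>P i\<^esub>" by (rule Pi.finsum_zero)
    finally show ?thesis by simp
  qed
  have "\<phi> ?y = \<zero>\<^bsub>obj Tp 0\<^esub>"
  proof (rule two_degree_Hom_zero[where d = 0 and X = Tp and \<phi> = \<phi> and y = "?y", unfolded m1, OF Tp_bounded _ H \<phi> _ _ y])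
    show "carrier (obj Tp n) = {\<zero>\<^bsub>obj Tp n\<^esub>}" if "n \<noteq> 0" "n \<noteq> 1" for n using Tp_conc that by simp
    show "dif Tp 0 (\<phi> z) = \<zero>\<^bsub>obj Tp 1\<^esub>" if "z \<in> carrier (obj Tp 1)" for z
      using g0 by (simp add: Tp_dif \<phi>_def Tp_obj_1)
    fix z assume "z \<in> carrier (obj Tp 0)"
    then have "fst (fst z) \<in> carrier NO" unfolding Tp_obj_0 by auto
    then have "\<psi> (dif Tp 0 z) = incl (verts Q - {k}) P i \<zero>\<^bsub>P i\<^esub>" using xg by (simp add: Tp_dif \<psi>_def)
    also have "\<dots> = \<zero>\<^bsub>S\<^esub>" by (rule mod_hom_zero[OF inc right_module_group[OF P_right[OF i(1)]] right_module_group[OF rights(4)]])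
    finally show "\<phi> (dif Tp 0 z) = \<zero>\<^bsub>obj Tp 0\<^esub>" by (simp add: \<phi>_def Tp_obj_0)
  qed
  then have "\<psi> ?y = \<zero>\<^bsub>S\<^esub>" by (simp add: \<phi>_def Tp_obj_0)
  from fun_cong[OF this, of i] show "x = \<zero>\<^bsub>A\<^esub>" using iS x(2) by (simp add: \<psi>_def incl_def)
qed

lemma Tp_tilting_iff: "tilting_complex A Tp \<longleftrightarrow> (\<forall>i\<in>verts Q. i \<noteq> k \<longrightarrow> condp i)"
  using Tp_tilting Tp_tilting_cond by blast

subsection \<open>Translation to linear combinations of paths\<close>

lemma path_combs_KQ: "x \<in> path_combs Q i j \<Longrightarrow> x \<in> carrier KQ"
  by (simp add: path_combs_def)

text \<open>Passing to classes turns combinations of paths into all of e_k A e_i and products of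
  paths into products in A; what remains is a contraposition.\<close>

lemma condm_path_combs:
  assumes i: "i \<in> verts Q"
  shows "condm i \<longleftrightarrow> (\<forall>x\<in>path_combs Q k i. nonzero_in Q I x \<longrightarrow> (\<exists>\<alpha>\<in>In. nonzero_in Q I (arrow_elt Q \<alpha> \<otimes>\<^bsub>KQ\<^esub> x)))"
proof -
  have e: "cls (arrow_elt Q \<alpha> \<otimes>\<^bsub>KQ\<^esub> x) = arr \<alpha> \<otimes>\<^bsub>A\<^esub> cls x" if "x \<in> path_combs Q k i" "\<alpha> \<in> In" for x \<alpha>
    unfolding arr_def by (rule cls_mult[symmetric, OF arrow_KQ[OF In_facts(1)[OF that(2)]] path_combs_KQ[OF that(1)]])
  have "condm i \<longleftrightarrow> (\<forall>x\<in>cls ` path_combs Q k i. (\<forall>e\<in>In. arr e \<otimes>\<^bsub>A\<^esub> x = \<zero>\<^bsub>A\<^esub>) \<longrightarrow> x = \<zero>\<^bsub>A\<^esub>)"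
    unfolding condm_def f_zero_iff path_combs_cls[OF kv i] P_carrier[OF kv] by blast
  also have "\<dots> \<longleftrightarrow> (\<forall>x\<in>path_combs Q k i. nonzero_in Q I x \<longrightarrow> (\<exists>\<alpha>\<in>In. nonzero_in Q I (arrow_elt Q \<alpha> \<otimes>\<^bsub>KQ\<^esub> x)))"
    unfolding nonzero_in_iff using e by fastforce
  finally show ?thesis .
qed

lemma condp_path_combs:
  assumes i: "i \<in> verts Q"
  shows "condp i \<longleftrightarrow> (\<forall>x\<in>path_combs Q i k. nonzero_in Q I x \<longrightarrow> (\<exists>\<beta>\<in>Out. nonzero_in Q I (x \<otimes>\<^bsub>KQ\<^esub> arrow_elt Q \<beta>)))"
proof -
  have e: "cls (x \<otimes>\<^bsub>KQ\<^esub> arrow_elt Q \<beta>) = cls x \<otimes>\<^bsub>A\<^esub> arr \<beta>" if "x \<in> path_combs Q i k" "\<beta> \<in> Out" for x \<beta>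
    unfolding arr_def by (rule cls_mult[symmetric, OF path_combs_KQ[OF that(1)] arrow_KQ[OF Out_facts(1)[OF that(2)]]])
  have "condp i \<longleftrightarrow> (\<forall>x\<in>cls ` path_combs Q i k. (\<forall>e\<in>Out. x \<otimes>\<^bsub>A\<^esub> arr e = \<zero>\<^bsub>A\<^esub>) \<longrightarrow> x = \<zero>\<^bsub>A\<^esub>)"
    unfolding condp_def path_combs_cls[OF i kv] P_carrier[OF i] by blast
  also have "\<dots> \<longleftrightarrow> (\<forall>x\<in>path_combs Q i k. nonzero_in Q I x \<longrightarrow> (\<exists>\<beta>\<in>Out. nonzero_in Q I (x \<otimes>\<^bsub>KQ\<^esub> arrow_elt Q \<beta>)))"
    unfolding nonzero_in_iff using e by fastforce
  finally show ?thesis .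
qed

end

theorem proposition2p3:
  fixes Q :: "('v, 'e) pre_digraph"
    and I :: "(('v, 'e) path \<Rightarrow> 'k::field) set"
    and k :: 'v
  assumes "fin_digraph Q"
    and "admissible_ideal Q I"
    and "k \<in> verts Q"
    and "\<forall>e\<in>arcs Q. \<not> (tail Q e = k \<and> head Q e = k)"
  shows
    "(tilting_complex (quiver_algebra Q I) (T_minus Q I k) \<longleftrightarrow>
        (\<forall>i\<in>verts Q. i \<noteq> k \<longrightarrow>
          (\<forall>x\<in>path_combs Q k i. nonzero_in Q I x \<longrightarrow>
            (\<exists>\<alpha>\<in>in_arrows Q k. nonzero_in Q I (arrow_elt Q \<alpha> \<otimes>\<^bsub>path_algebra Q\<^esub> x))))) \<and>
     (iso_to_tilting_module (quiver_algebra Q I) (T_minus Q I k) \<longleftrightarrow>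
        (\<forall>i\<in>verts Q.
          (\<forall>x\<in>path_combs Q k i. nonzero_in Q I x \<longrightarrow>
            (\<exists>\<alpha>\<in>in_arrows Q k. nonzero_in Q I (arrow_elt Q \<alpha> \<otimes>\<^bsub>path_algebra Q\<^esub> x))))) \<and>
     (tilting_complex (quiver_algebra Q I) (T_plus Q I k) \<longleftrightarrow>
        (\<forall>i\<in>verts Q. i \<noteq> k \<longrightarrow>
          (\<forall>x\<in>path_combs Q i k. nonzero_in Q I x \<longrightarrow>
            (\<exists>\<beta>\<in>out_arrows Q k. nonzero_in Q I (x \<otimes>\<^bsub>path_algebra Q\<^esub> arrow_elt Q \<beta>)))))"
proof -
  interpret mutation Q I k
    by (intro mutation.intro bound_quiver.intro mutation_axioms.intro assms)
  show ?thesis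
    unfolding Tm_tilting_iff Tm_module_iff Tp_tilting_iff by (simp add: condm_path_combs condp_path_combs)
qed

end
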